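(* Let $R$ be an uncountably categorical commutative unitary local ring whose maximal ideal $\mathfrak m$ is connected and such that $R=\mathbb F_q\oplus\mathfrak m$. Then the ring $R$ is almost strongly minimal if and only if $\mathfrak m=\mathrm{ann}(\mathfrak m)$.
   Context: Rings are considered as structures in the language of rings; "uncountably categorical" means that the complete theory of $R$ is. Here $q$ is a prime power and $R=\mathbb F_q\oplus\mathfrak m$ means that $R$ contains a copy of the finite field $\mathbb F_q$ as a subring and is the direct sum of $\mathbb F_q$ and $\mathfrak m$ as an additive group. Connected means that the additive group $\mathfrak m$ has no proper definable subgroup of finite index. $\mathrm{ann}(\mathfrak m)=\{r\in\mathfrak m: ra=0\text{ for all }a\in\mathfrak m\}$. **Almost strong minimality.** Work in a saturated model with imaginaries. A definable (interpretable, with parameters) set $X$ over $A$ is almost internal to a definable set $D$ if there is a set of parameters $B\supseteq A$, over which $D$ is defined, such that every element of $X$ is algebraic over $B$ together with finitely many elements of $D$. $X$ is almost strongly minimal if it is almost internal to a strongly minimal set; a structure is almost strongly minimal if its universe is. *)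

theory Defs
  imports
    "HOL-Algebra.QuotRing"
    "HOL-Algebra.Subrings"
    "HOL-Library.Equipollence"
    "HOL-Library.Countable_Set"
    "HOL-Computational_Algebra.Primes"
begin

section \<open>First-order logic in the language of rings\<close>

text \<open>Variables are de Bruijn indices into a list of elements: a quantifier pushes the bound
  element onto the front of the list.\<close>

datatype rterm = Var nat | Zero | One | Minus rterm | Add rterm rterm | Mult rterm rterm

datatype rform = Eq rterm rterm | Neg rform | Conj rform rform | Exists rform

primrec term_vars :: "rterm \<Rightarrow> nat set" where
  "term_vars (Var i) = {i}"
| "term_vars Zero = {}"
| "term_vars One = {}"
| "term_vars (Minus t) = term_vars t"
| "term_vars (Add t u) = term_vars t \<union> term_vars u"
| "term_vars (Mult t u) = term_vars t \<union> term_vars u"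

text \<open>\<open>vars_below \<phi> n\<close>: the free variables of \<open>\<phi>\<close> are among \<open>0, \<dots>, n - 1\<close>.\<close>

primrec vars_below :: "rform \<Rightarrow> nat \<Rightarrow> bool" where
  "vars_below (Eq t u) n \<longleftrightarrow> term_vars t \<union> term_vars u \<subseteq> {..<n}"
| "vars_below (Neg \<phi>) n \<longleftrightarrow> vars_below \<phi> n"
| "vars_below (Conj \<phi> \<psi>) n \<longleftrightarrow> vars_below \<phi> n \<and> vars_below \<psi> n"
| "vars_below (Exists \<phi>) n \<longleftrightarrow> vars_below \<phi> (Suc n)"

primrec tval :: "('a, 'm) ring_scheme \<Rightarrow> 'a list \<Rightarrow> rterm \<Rightarrow> 'a" where
  "tval R xs (Var i) = xs ! i"
| "tval R xs Zero = \<zero>\<^bsub>R\<^esub>"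
| "tval R xs One = \<one>\<^bsub>R\<^esub>"
| "tval R xs (Minus t) = \<ominus>\<^bsub>R\<^esub> tval R xs t"
| "tval R xs (Add t u) = tval R xs t \<oplus>\<^bsub>R\<^esub> tval R xs u"
| "tval R xs (Mult t u) = tval R xs t \<otimes>\<^bsub>R\<^esub> tval R xs u"

primrec sat :: "('a, 'm) ring_scheme \<Rightarrow> rform \<Rightarrow> 'a list \<Rightarrow> bool" where
  "sat R (Eq t u) xs \<longleftrightarrow> tval R xs t = tval R xs u"
| "sat R (Neg \<phi>) xs \<longleftrightarrow> \<not> sat R \<phi> xs"
| "sat R (Conj \<phi> \<psi>) xs \<longleftrightarrow> sat R \<phi> xs \<and> sat R \<psi> xs"
| "sat R (Exists \<phi>) xs \<longleftrightarrow> (\<exists>a\<in>carrier R. sat R \<phi> (a # xs))"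

definition complete_theory :: "('a, 'm) ring_scheme \<Rightarrow> rform set" where
  "complete_theory R = {\<phi>. vars_below \<phi> 0 \<and> sat R \<phi> []}"

text \<open>The theories considered contain the ring axioms, so only rings can be models.\<close>

definition is_model :: "('a, 'm) ring_scheme \<Rightarrow> rform set \<Rightarrow> bool" where
  "is_model M T \<longleftrightarrow> ring M \<and> (\<forall>\<phi>\<in>T. sat M \<phi> [])"

definition elementary_embedding ::
    "('a \<Rightarrow> 'b) \<Rightarrow> ('a, 'm) ring_scheme \<Rightarrow> ('b, 'k) ring_scheme \<Rightarrow> bool" where
  "elementary_embedding h R M \<longleftrightarrow> ring M \<and> h ` carrier R \<subseteq> carrier M \<and>
     (\<forall>\<phi> xs. set xs \<subseteq> carrier R \<and> vars_below \<phi> (length xs) \<longrightarrow>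
        (sat R \<phi> xs \<longleftrightarrow> sat M \<phi> (map h xs)))"

text \<open>The complete theory of \<open>R\<close> has infinite models and is categorical in every uncountable
  cardinal. Since a formula cannot quantify over all types, the models range over subsets of
  \<^typ>\<open>'a set\<close>, that is, over the cardinals up to \<open>2\<close> to the power of the cardinality of
  \<^typ>\<open>'a\<close>. These include an uncountable one, as \<^typ>\<open>'a\<close> is infinite if \<open>R\<close> is. By Morley's
  theorem, categoricity in one uncountable cardinal implies categoricity in all of them, so the
  bound does not matter.\<close>

definition uncountably_categorical :: "('a, 'm) ring_scheme \<Rightarrow> bool" where
  "uncountably_categorical R \<longleftrightarrow> infinite (carrier R) \<and>
     (\<forall>(M :: 'a set ring) (N :: 'a set ring).
        is_model M (complete_theory R) \<and> is_model N (complete_theory R) \<and>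
        uncountable (carrier M) \<and> carrier M \<approx> carrier N \<longrightarrow> M \<simeq> N)"


section \<open>Definable sets and saturation\<close>

definition tuples :: "('a, 'm) ring_scheme \<Rightarrow> nat \<Rightarrow> 'a list set" where
  "tuples M n = {xs. set xs \<subseteq> carrier M \<and> length xs = n}"

text \<open>A set of \<open>n\<close>-tuples definable in \<open>M\<close> with parameters from \<open>A\<close>.\<close>

definition definable :: "('a, 'm) ring_scheme \<Rightarrow> 'a set \<Rightarrow> nat \<Rightarrow> 'a list set \<Rightarrow> bool" where
  "definable M A n X \<longleftrightarrow> (\<exists>\<phi> bs. set bs \<subseteq> A \<and> vars_below \<phi> (n + length bs) \<and>
     X = {xs \<in> tuples M n. sat M \<phi> (xs @ bs)})"

text \<open>A set of formulas in one variable over \<open>A\<close> is given by pairs of a formula, whose variable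
  \<open>0\<close> is the variable of the type, and a list of parameters.\<close>

definition saturated :: "('a, 'm) ring_scheme \<Rightarrow> bool" where
  "saturated M \<longleftrightarrow> infinite (carrier M) \<and>
     (\<forall>A p. A \<subseteq> carrier M \<and> A \<prec> carrier M \<and>
        p \<subseteq> {(\<phi>, bs). set bs \<subseteq> A \<and> vars_below \<phi> (Suc (length bs))} \<and>
        (\<forall>q\<subseteq>p. finite q \<longrightarrow> (\<exists>x\<in>carrier M. \<forall>(\<phi>, bs)\<in>q. sat M \<phi> (x # bs))) \<longrightarrow>
        (\<exists>x\<in>carrier M. \<forall>(\<phi>, bs)\<in>p. sat M \<phi> (x # bs)))"

definition concat_pairs :: "('a list \<times> 'a list) set \<Rightarrow> 'a list set" where
  "concat_pairs E = (\<lambda>(xs, ys). xs @ ys) ` E"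


section \<open>Imaginaries\<close>

text \<open>An imaginary element is a class of a parameter-free definable equivalence relation on
  \<open>n\<close>-tuples. An element \<open>a\<close> of \<open>M\<close> is identified with \<open>{[a]}\<close>.\<close>

definition imaginaries :: "('a, 'm) ring_scheme \<Rightarrow> 'a list set set" where
  "imaginaries M = {c. \<exists>n E. equiv (tuples M n) E \<and> definable M {} (n + n) (concat_pairs E) \<and>
     c \<in> tuples M n // E}"

definition universe :: "('a, 'm) ring_scheme \<Rightarrow> 'a list set set" where
  "universe M = (\<lambda>a. {[a]}) ` carrier M"

text \<open>Definability of a set of \<open>n\<close>-tuples of \<open>M\<close> with imaginary parameters from \<open>C\<close>. A formula of
  the structure with imaginaries refers to a class \<open>c\<close> through its representatives: \<open>\<psi>(x, c)\<close> is
  \<open>\<exists>y. \<pi>(y) = c \<and> \<phi>(x, y)\<close>, where \<open>\<pi>\<close> is the quotient map and \<open>y\<close> is a tuple from \<open>M\<close>.\<close>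

definition definable_eq ::
    "('a, 'm) ring_scheme \<Rightarrow> 'a list set set \<Rightarrow> nat \<Rightarrow> 'a list set \<Rightarrow> bool" where
  "definable_eq M C n X \<longleftrightarrow> (\<exists>\<phi> cs. set cs \<subseteq> C \<and>
     X = {xs \<in> tuples M n. \<exists>yss. list_all2 (\<in>) yss cs \<and>
            vars_below \<phi> (n + length (concat yss)) \<and> sat M \<phi> (xs @ concat yss)})"

text \<open>Interpretable over \<open>C\<close>: the quotient of a \<open>C\<close>-definable set by a \<open>C\<close>-definable equivalence
  relation on it.\<close>

definition interpretable ::
    "('a, 'm) ring_scheme \<Rightarrow> 'a list set set \<Rightarrow> 'a list set set \<Rightarrow> bool" where
  "interpretable M C D \<longleftrightarrow> (\<exists>n X E. definable_eq M C n X \<and> equiv X E \<and>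
     definable_eq M C (n + n) (concat_pairs E) \<and> D = X // E)"

text \<open>\<open>e\<close> lies in a finite set definable over \<open>C\<close> in the structure with imaginaries.\<close>

definition algebraic ::
    "('a, 'm) ring_scheme \<Rightarrow> 'a list set set \<Rightarrow> 'a list set \<Rightarrow> bool" where
  "algebraic M C e \<longleftrightarrow> (\<exists>Z. interpretable M C Z \<and> finite Z \<and> e \<in> Z)"


section \<open>Almost strong minimality\<close>

text \<open>In the following definitions \<open>M\<close> is a saturated model. In particular, for strong minimality
  it suffices to consider the definable subsets in \<open>M\<close> itself. A subset \<open>Y\<close> of a quotient is
  definable iff its preimage \<open>\<Union>Y\<close> is.\<close>

definition strongly_minimal :: "('a, 'm) ring_scheme \<Rightarrow> 'a list set set \<Rightarrow> bool" where
  "strongly_minimal M D \<longleftrightarrow> interpretable M (imaginaries M) D \<and> infinite D \<and>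
     (\<forall>Y\<subseteq>D. (\<exists>n. definable M (carrier M) n (\<Union>Y)) \<longrightarrow> finite Y \<or> finite (D - Y))"

text \<open>As always in a saturated model, parameter sets are small, i.e. of smaller cardinality than
  the model. Without this every set would be almost internal to every other.\<close>

definition almost_internal ::
    "('a, 'm) ring_scheme \<Rightarrow> 'a list set set \<Rightarrow> 'a list set set \<Rightarrow> 'a list set set \<Rightarrow> bool" where
  "almost_internal M A X D \<longleftrightarrow> interpretable M A X \<and>
     (\<exists>B. A \<subseteq> B \<and> B \<subseteq> imaginaries M \<and> B \<prec> carrier M \<and> interpretable M B D \<and>
        (\<forall>e\<in>X. \<exists>F\<subseteq>D. finite F \<and> algebraic M (B \<union> F) e))"

definition almost_strongly_minimal_set ::
    "('a, 'm) ring_scheme \<Rightarrow> 'a list set set \<Rightarrow> 'a list set set \<Rightarrow> bool" where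
  "almost_strongly_minimal_set M A X \<longleftrightarrow> (\<exists>D. strongly_minimal M D \<and> almost_internal M A X D)"

text \<open>The saturated model is an elementary extension of \<open>R\<close> of larger cardinality. If \<open>R\<close> is
  uncountably categorical, its theory has saturated models in all infinite cardinalities, so there
  is such an extension on \<^typ>\<open>'a set\<close>, and the choice of the extension is irrelevant.\<close>

definition almost_strongly_minimal :: "('a, 'm) ring_scheme \<Rightarrow> bool" where
  "almost_strongly_minimal R \<longleftrightarrow> (\<exists>(M :: 'a set ring) h. elementary_embedding h R M \<and>
     saturated M \<and> carrier R \<prec> carrier M \<and> almost_strongly_minimal_set M {} (universe M))"


section \<open>Rings\<close>

definition local_ring_with :: "('a, 'm) ring_scheme \<Rightarrow> 'a set \<Rightarrow> bool" where
  "local_ring_with R \<mm> \<longleftrightarrow> cring R \<and> maximalideal \<mm> R \<and> (\<forall>I. maximalideal I R \<longrightarrow> I = \<mm>)"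

definition annihilator :: "('a, 'm) ring_scheme \<Rightarrow> 'a set \<Rightarrow> 'a set" where
  "annihilator R \<mm> = {r \<in> \<mm>. \<forall>a\<in>\<mm>. r \<otimes>\<^bsub>R\<^esub> a = \<zero>\<^bsub>R\<^esub>}"

text \<open>The subgroups are definable with parameters; finite index in \<open>G\<close> means finitely many cosets
  \<open>H + x\<close> with \<open>x \<in> G\<close>.\<close>

definition connected_subgroup :: "('a, 'm) ring_scheme \<Rightarrow> 'a set \<Rightarrow> bool" where
  "connected_subgroup R G \<longleftrightarrow>
     (\<forall>H. additive_subgroup H R \<and> H \<subseteq> G \<and> definable R (carrier R) 1 ((\<lambda>a. [a]) ` H) \<and>
        finite ((\<lambda>x. H +>\<^bsub>R\<^esub> x) ` G) \<longrightarrow> H = G)"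

definition additive_direct_sum :: "('a, 'm) ring_scheme \<Rightarrow> 'a set \<Rightarrow> 'a set \<Rightarrow> bool" where
  "additive_direct_sum R F G \<longleftrightarrow> additive_subgroup F R \<and> additive_subgroup G R \<and>
     F <+>\<^bsub>R\<^esub> G = carrier R \<and> F \<inter> G = {\<zero>\<^bsub>R\<^esub>}"

end

theory Submission
  imports Defs "HOL-Library.Countable" "HOL-Algebra.Weak_Morphisms"
begin

text \<open>Suppose that the saturated model \<open>M\<close> is almost internal to a strongly minimal set \<open>D\<close>. By
  saturation finitely many definable families, indexed by powers of \<open>D\<close> and with finite members,
  cover \<open>M\<close>, so there are only countably many types over a countable set and definable subgroups
  satisfy the descending chain condition. Hence \<open>\<mm>\<close> is nilpotent. If \<open>\<mm>\<^sup>2 \<noteq> 0\<close>, connectedness yields an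
  infinite group \<open>T = a\<mm>\<close> inside the annihilator, and \<open>\<mm>\<close> has infinite codimension over \<open>\<mm>\<^sup>2 + ann(\<mm>)\<close>.
  So for any finite set of parameters there is a nonzero linear functional \<open>l\<close> on \<open>\<mm>\<close> killing
  \<open>\<mm>\<^sup>2 + ann(\<mm>)\<close> and the parameters, and \<open>x \<mapsto> x + l(x)v\<close> is an automorphism for every \<open>v \<in> T\<close>. These
  automorphisms cannot all fix \<open>D\<close> pointwise, because some element has the infinite orbit \<open>x + T\<close>.
  But if they move \<open>d \<in> D\<close>, then the orbit of \<open>d\<close> is infinite since \<open>T\<close> is connected, hence cofinite in
  \<open>D\<close>, and a second functional, which also kills a representative of \<open>d\<close> and the finitely many other
  points, does fix \<open>D\<close> pointwise.

  Conversely, if \<open>\<mm>\<^sup>2 = 0\<close> then the theory is essentially that of a vector space over a finite field: a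
  back-and-forth between finite subrings shows that a large power of \<open>\<mm>\<close> gives a saturated
  elementary extension in which \<open>\<mm>\<close> is strongly minimal.\<close>

section \<open>Substitution and definable predicates\<close>

text \<open>A functional can be made to kill only finitely many prescribed elements, whereas the
  parameters over which \<open>M\<close> is internal to \<open>D\<close> may be infinite in number.
  Compactness removes this obstacle: a finite cover of \<open>M\<close> by families mentions only
  finitely many of them. The infinite codimension and the group \<open>T\<close> have a common
  source, an element \<open>a\<close> of \<open>\<mm>\<close> that kills
  \<open>\<mm>^2 + ann(\<mm>)\<close> although \<open>a\<mm>\<close> is nonzero. Over the finite
  field, \<open>a\<close> maps the span of \<open>\<mm>^2 + ann(\<mm>)\<close> and finitely many
  further elements onto a finite set, but connectedness makes \<open>a\<mm>\<close> infinite. The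
  second functional \<open>l'\<close> deals with a whole orbit at once because it kills both a
  representative \<open>y\<close> and \<open>T\<close>: on each entry it takes the value
  \<open>l'(y + l(y)w) = 0\<close>, for all \<open>w\<close> in \<open>T\<close> simultaneously. In
  the converse direction, finiteness of the field makes finitely generated subrings finite.
  Back-and-forth therefore needs finite data only, and an element of \<open>\<mm>\<close> outside a
  given finite subring has the same type over that subring as any other such element.\<close>

primrec fval :: "('a, 'm) ring_scheme \<Rightarrow> (nat \<Rightarrow> 'a) \<Rightarrow> rterm \<Rightarrow> 'a" where
  "fval M e (Var i) = e i"
| "fval M e Zero = \<zero>\<^bsub>M\<^esub>"
| "fval M e One = \<one>\<^bsub>M\<^esub>"
| "fval M e (Minus t) = \<ominus>\<^bsub>M\<^esub> fval M e t"
| "fval M e (Add t u) = fval M e t \<oplus>\<^bsub>M\<^esub> fval M e u"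
| "fval M e (Mult t u) = fval M e t \<otimes>\<^bsub>M\<^esub> fval M e u"

text \<open>Assignments are total functions rather than lists: substitution then becomes
  composition, and \<open>sat\<close> is the special case of \<open>(!) xs\<close> without any bound
  on the variables.\<close>

primrec fsat :: "('a, 'm) ring_scheme \<Rightarrow> rform \<Rightarrow> (nat \<Rightarrow> 'a) \<Rightarrow> bool" where
  "fsat M (Eq t u) e \<longleftrightarrow> fval M e t = fval M e u"
| "fsat M (Neg \<phi>) e \<longleftrightarrow> \<not> fsat M \<phi> e"
| "fsat M (Conj \<phi> \<psi>) e \<longleftrightarrow> fsat M \<phi> e \<and> fsat M \<psi> e"
| "fsat M (Exists \<phi>) e \<longleftrightarrow> (\<exists>a\<in>carrier M. fsat M \<phi> (case_nat a e))"

lemma tval_fval: "tval M xs t = fval M ((!) xs) t"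
  by (induction t) auto

lemma nth_Cons_case_nat: "(!) (a # xs) = case_nat a ((!) xs)"
  by (auto simp: fun_eq_iff split: nat.split)

lemma sat_fsat: "sat M \<phi> xs \<longleftrightarrow> fsat M \<phi> ((!) xs)"
  by (induction \<phi> arbitrary: xs) (auto simp: tval_fval nth_Cons_case_nat)

lemma fval_cong: "(\<And>i. i \<in> term_vars t \<Longrightarrow> e i = e' i) \<Longrightarrow> fval M e t = fval M e' t"
  by (induction t) auto

lemma fsat_cong': "vars_below \<phi> n \<Longrightarrow> \<forall>i<n. e i = e' i \<Longrightarrow> fsat M \<phi> e = fsat M \<phi> e'"
proof (induction \<phi> arbitrary: n e e')
  case (Eq t u)
  have "e i = e' i" if "i \<in> term_vars t \<or> i \<in> term_vars u" for i
    using that Eq by (meson UnI1 UnI2 lessThan_iff subsetD vars_below.simps(1))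
  then have "fval M e t = fval M e' t" "fval M e u = fval M e' u"
    by (metis fval_cong)+
  then show ?case by simp
next
  case (Neg \<phi>)
  then show ?case by (metis fsat.simps(2) vars_below.simps(2))
next
  case (Conj \<phi> \<psi>)
  then show ?case by (metis fsat.simps(3) vars_below.simps(3))
next
  case (Exists \<phi>)
  have "fsat M \<phi> (case_nat a e) = fsat M \<phi> (case_nat a e')" for a
  proof (rule Exists.IH[of "Suc n"])
    show "vars_below \<phi> (Suc n)" using Exists.prems(1) by simp
    show "\<forall>i<Suc n. case_nat a e i = case_nat a e' i"
      using Exists.prems(2) by (metis Suc_less_eq nat.case_eq_if not0_implies_Suc old.nat.simps(5))
  qed
  then show ?case by simp
qed

lemma fsat_cong: "vars_below \<phi> n \<Longrightarrow> (\<And>i. i < n \<Longrightarrow> e i = e' i) \<Longrightarrow> fsat M \<phi> e = fsat M \<phi> e'"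
  using fsat_cong' by metis

lemma finite_term_vars: "finite (term_vars t)"
  by (induction t) auto

lemma vars_below_mono: "vars_below \<phi> m \<Longrightarrow> m \<le> n \<Longrightarrow> vars_below \<phi> n"
proof (induction \<phi> arbitrary: m n)
  case (Exists \<phi>)
  then show ?case using Exists.IH[of "Suc m" "Suc n"] by simp
qed (auto simp: subset_iff)

lemma vars_below_ex: "\<exists>n. vars_below \<phi> n"
proof (induction \<phi>)
  case (Eq t u)
  have "finite (term_vars t \<union> term_vars u)" by (simp add: finite_term_vars)
  then obtain n where "term_vars t \<union> term_vars u \<subseteq> {..<n}"
    using finite_nat_iff_bounded by blast
  then show ?case by (intro exI[of _ n]) simp
next
  case (Conj \<phi> \<psi>)
  then obtain m n where "vars_below \<phi> m" "vars_below \<psi> n" by blast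
  then have "vars_below (Conj \<phi> \<psi>) (max m n)"
    by (auto intro: vars_below_mono)
  then show ?case by blast
next
  case (Exists \<phi>)
  then obtain n where "vars_below \<phi> n" by blast
  then have "vars_below (Exists \<phi>) n"
    by (auto intro: vars_below_mono)
  then show ?case by blast
qed auto

section \<open>Simultaneous substitution of terms for variables\<close>

primrec tsub :: "(nat \<Rightarrow> rterm) \<Rightarrow> rterm \<Rightarrow> rterm" where
  "tsub \<tau> (Var i) = \<tau> i"
| "tsub \<tau> Zero = Zero"
| "tsub \<tau> One = One"
| "tsub \<tau> (Minus t) = Minus (tsub \<tau> t)"
| "tsub \<tau> (Add t u) = Add (tsub \<tau> t) (tsub \<tau> u)"
| "tsub \<tau> (Mult t u) = Mult (tsub \<tau> t) (tsub \<tau> u)"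

primrec fsub :: "(nat \<Rightarrow> rterm) \<Rightarrow> rform \<Rightarrow> rform" where
  "fsub \<tau> (Eq t u) = Eq (tsub \<tau> t) (tsub \<tau> u)"
| "fsub \<tau> (Neg \<phi>) = Neg (fsub \<tau> \<phi>)"
| "fsub \<tau> (Conj \<phi> \<psi>) = Conj (fsub \<tau> \<phi>) (fsub \<tau> \<psi>)"
| "fsub \<tau> (Exists \<phi>) = Exists (fsub (case_nat (Var 0) (\<lambda>i. tsub (\<lambda>j. Var (Suc j)) (\<tau> i))) \<phi>)"

lemma fval_tsub [simp]: "fval M e (tsub \<tau> t) = fval M (\<lambda>i. fval M e (\<tau> i)) t"
  by (induction t) auto

lemma fsat_fsub [simp]: "fsat M (fsub \<tau> \<phi>) e = fsat M \<phi> (\<lambda>i. fval M e (\<tau> i))"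
proof (induction \<phi> arbitrary: \<tau> e)
  case (Exists \<phi>)
  have "(\<lambda>i. fval M (case_nat a e) (case_nat (Var 0) (\<lambda>i. tsub (\<lambda>j. Var (Suc j)) (\<tau> i)) i)) =
      case_nat a (\<lambda>i. fval M e (\<tau> i))" for a
    by (auto simp: fun_eq_iff split: nat.split)
  then show ?case by (simp add: Exists.IH)
qed auto

lemma term_vars_tsub: "term_vars (tsub \<tau> t) = (\<Union>i\<in>term_vars t. term_vars (\<tau> i))"
  by (induction t) auto

lemma vars_below_fsub:
  "vars_below \<phi> m \<Longrightarrow> (\<And>i. i < m \<Longrightarrow> term_vars (\<tau> i) \<subseteq> {..<n}) \<Longrightarrow> vars_below (fsub \<tau> \<phi>) n"
proof (induction \<phi> arbitrary: \<tau> m n)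
  case (Eq t u)
  then show ?case by (fastforce simp: term_vars_tsub)
next
  case (Neg \<phi>)
  then show ?case using Neg.IH[of m \<tau> n] by simp
next
  case (Conj \<phi> \<psi>)
  then show ?case using Conj.IH[of m \<tau> n] by simp
next
  case (Exists \<phi>)
  have "term_vars (case_nat (Var 0) (\<lambda>i. tsub (\<lambda>j. Var (Suc j)) (\<tau> i)) i) \<subseteq> {..<Suc n}"
    if "i < Suc m" for i
  proof (cases i)
    case (Suc j)
    then have "term_vars (\<tau> j) \<subseteq> {..<n}" using that Exists.prems(2) by simp
    then show ?thesis using Suc by (auto simp: term_vars_tsub)
  qed simp
  then show ?case using Exists.IH[of "Suc m"] Exists.prems(1) by simp
qed

text \<open>Predicates on assignments: \<open>\<sigma>\<close> says for each variable of the formula whether it stands for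
  an entry of the assignment or for a parameter.\<close>

definition ev :: "(nat \<Rightarrow> nat + 'a) \<Rightarrow> (nat \<Rightarrow> 'a) \<Rightarrow> nat \<Rightarrow> 'a" where
  "ev \<sigma> e i = case_sum e (\<lambda>a. a) (\<sigma> i)"

definition padm :: "'a set \<Rightarrow> (nat \<Rightarrow> nat + 'a) \<Rightarrow> bool" where
  "padm A \<sigma> \<longleftrightarrow> (\<forall>i a. \<sigma> i = Inr a \<longrightarrow> a \<in> A)"

definition asg :: "('a, 'm) ring_scheme \<Rightarrow> (nat \<Rightarrow> 'a) \<Rightarrow> bool" where
  "asg M e \<longleftrightarrow> (\<forall>i. e i \<in> carrier M)"

section \<open>Closure rules for definable terms, predicates and tuples\<close>

definition dterm :: "('a, 'm) ring_scheme \<Rightarrow> 'a set \<Rightarrow> ((nat \<Rightarrow> 'a) \<Rightarrow> 'a) \<Rightarrow> bool" where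
  "dterm M A t \<longleftrightarrow> (\<exists>u \<sigma>. padm A \<sigma> \<and>
     (\<forall>e. asg M e \<longrightarrow> t e \<in> carrier M \<and> t e = fval M (ev \<sigma> e) u))"

text \<open>Definability is handled semantically: the rules below mirror connectives and
  quantifiers, so that a set is shown to be definable without its formula being written down. Only
  assignments into the carrier are compared.\<close>

definition dpred :: "('a, 'm) ring_scheme \<Rightarrow> 'a set \<Rightarrow> ((nat \<Rightarrow> 'a) \<Rightarrow> bool) \<Rightarrow> bool" where
  "dpred M A P \<longleftrightarrow> (\<exists>\<phi> \<sigma>. padm A \<sigma> \<and>
     (\<forall>e. asg M e \<longrightarrow> P e = fsat M \<phi> (ev \<sigma> e)))"

definition dlist :: "('a, 'm) ring_scheme \<Rightarrow> 'a set \<Rightarrow> nat \<Rightarrow> ((nat \<Rightarrow> 'a) \<Rightarrow> 'a list) \<Rightarrow> bool" where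
  "dlist M A n l \<longleftrightarrow> (\<exists>ts. length ts = n \<and> (\<forall>t\<in>set ts. dterm M A t) \<and> l = (\<lambda>e. map (\<lambda>t. t e) ts))"

lemma dterm_carrier: "dterm M A t \<Longrightarrow> asg M e \<Longrightarrow> t e \<in> carrier M"
  by (auto simp: dterm_def)

lemma dlist_tuples: "dlist M A n l \<Longrightarrow> asg M e \<Longrightarrow> l e \<in> tuples M n"
  unfolding dlist_def tuples_def using dterm_carrier[of M A _ e] by auto

lemma dlist_length: "dlist M A n l \<Longrightarrow> length (l e) = n"
  by (auto simp: dlist_def)

lemma dpred_cong:
  "(\<And>e. asg M e \<Longrightarrow> P e = Q e) \<Longrightarrow> dpred M A P = dpred M A Q"
  by (simp add: dpred_def)

lemma dterm_var: "dterm M A (\<lambda>e. e i)"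
  unfolding dterm_def
  by (rule exI[of _ "Var i"], rule exI[of _ Inl]) (simp add: ev_def padm_def asg_def)

lemma dterm_const: "a \<in> A \<Longrightarrow> a \<in> carrier M \<Longrightarrow> dterm M A (\<lambda>e. a)"
  unfolding dterm_def
  by (rule exI[of _ "Var 0"], rule exI[of _ "\<lambda>_. Inr a"]) (simp add: ev_def padm_def)

definition merge :: "(nat \<Rightarrow> nat \<Rightarrow> nat + 'a) \<Rightarrow> nat \<Rightarrow> nat + 'a" where
  "merge \<sigma> k = (case prod_decode k of (i, j) \<Rightarrow> \<sigma> i j)"

lemma ev_merge: "(\<lambda>j. ev (merge \<sigma>) e (prod_encode (i, j))) = ev (\<sigma> i) e"
  by (simp add: fun_eq_iff ev_def merge_def)

lemma padm_merge: "(\<And>i. padm A (\<sigma> i)) \<Longrightarrow> padm A (merge \<sigma>)"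
  unfolding padm_def merge_def by (auto split: prod.split)

text \<open>Each term comes with its own reading of the variables. Renaming variable
  \<open>j\<close> of the \<open>i\<close>-th term to \<open>prod_encode (i, j)\<close> gives the
  terms disjoint blocks, so that a single \<open>\<sigma>\<close> serves the whole family.\<close>

lemma dterm_family:
  assumes "\<And>i::nat. dterm M A (t i)"
  shows "\<exists>u \<sigma>. padm A \<sigma> \<and> (\<forall>i e. asg M e \<longrightarrow> t i e = fval M (ev \<sigma> e) (u i))"
proof -
  have "\<forall>i. \<exists>u \<sigma>. padm A \<sigma> \<and> (\<forall>e. asg M e \<longrightarrow> t i e \<in> carrier M \<and> t i e = fval M (ev \<sigma> e) u)"
    using assms unfolding dterm_def by blast
  then obtain u \<sigma> where *: "\<And>i. padm A (\<sigma> i)"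
    "\<And>i e. asg M e \<Longrightarrow> t i e = fval M (ev (\<sigma> i) e) (u i)"
    by metis
  have "padm A (merge \<sigma>)" by (rule padm_merge) (rule *)
  moreover have "t i e = fval M (ev (merge \<sigma>) e) (tsub (\<lambda>j. Var (prod_encode (i, j))) (u i))"
    if "asg M e" for i e
    by (simp add: *(2)[OF that] ev_merge)
  ultimately show ?thesis
    by (intro exI[of _ "\<lambda>i. tsub (\<lambda>j. Var (prod_encode (i, j))) (u i)"] exI[of _ "merge \<sigma>"]) simp
qed

lemma dpred_fsat:
  assumes "\<And>i::nat. dterm M A (t i)"
  shows "dpred M A (\<lambda>e. fsat M \<phi> (\<lambda>i. t i e))"
proof -
  obtain u \<sigma> where *: "padm A \<sigma>" "\<And>i e. asg M e \<Longrightarrow> t i e = fval M (ev \<sigma> e) (u i)"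
    using dterm_family[of M A t, OF assms] by blast
  have "fsat M \<phi> (\<lambda>i. t i e) = fsat M (fsub u \<phi>) (ev \<sigma> e)" if "asg M e" for e
    by (simp add: *(2)[OF that])
  with *(1) show ?thesis unfolding dpred_def by blast
qed

lemma dterm_fval:
  assumes "\<And>i::nat. dterm M A (t i)" "\<And>e. asg M e \<Longrightarrow> fval M (\<lambda>i. t i e) v \<in> carrier M"
  shows "dterm M A (\<lambda>e. fval M (\<lambda>i. t i e) v)"
proof -
  obtain u \<sigma> where *: "padm A \<sigma>" "\<And>i e. asg M e \<Longrightarrow> t i e = fval M (ev \<sigma> e) (u i)"
    using dterm_family[of M A t, OF assms(1)] by blast
  have "fval M (\<lambda>i. t i e) v = fval M (ev \<sigma> e) (tsub u v)" if "asg M e" for e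
    by (simp add: *(2)[OF that])
  with *(1) assms(2) show ?thesis unfolding dterm_def by blast
qed

lemma dpred_eq:
  assumes "dterm M A t" "dterm M A u" shows "dpred M A (\<lambda>e. t e = u e)"
  using dpred_fsat[of M A "\<lambda>i. if i = 0 then t else u" "Eq (Var 0) (Var 1)"] assms by simp

lemma dpred_not: "dpred M A P \<Longrightarrow> dpred M A (\<lambda>e. \<not> P e)"
  unfolding dpred_def by (metis fsat.simps(2))

lemma dpred_conj:
  assumes "dpred M A P" "dpred M A Q" shows "dpred M A (\<lambda>e. P e \<and> Q e)"
proof -
  obtain \<phi> \<sigma> where P: "padm A \<sigma>" "\<And>e. asg M e \<Longrightarrow> P e = fsat M \<phi> (ev \<sigma> e)"
    using assms(1) unfolding dpred_def by blast
  obtain \<psi> \<rho> where Q: "padm A \<rho>" "\<And>e. asg M e \<Longrightarrow> Q e = fsat M \<psi> (ev \<rho> e)"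
    using assms(2) unfolding dpred_def by blast
  define s where "s = (\<lambda>i::nat. if i = 0 then \<sigma> else \<rho>)"
  define v where "v i j = Var (prod_encode (i, j))" for i j
  have s: "padm A (merge s)" by (rule padm_merge) (simp add: s_def P(1) Q(1))
  have v: "(\<lambda>j. fval M (ev (merge s) e) (v i j)) = ev (s i) e" for i e
    by (simp add: v_def ev_merge)
  have "(P e \<and> Q e) = fsat M (Conj (fsub (v 0) \<phi>) (fsub (v 1) \<psi>)) (ev (merge s) e)" if "asg M e" for e
    unfolding fsat.simps fsat_fsub v using P(2)[OF that] Q(2)[OF that] by (simp add: s_def)
  with s show ?thesis unfolding dpred_def by blast
qed

lemma dpred_disj: "dpred M A P \<Longrightarrow> dpred M A Q \<Longrightarrow> dpred M A (\<lambda>e. P e \<or> Q e)"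
  using dpred_not[OF dpred_conj[OF dpred_not dpred_not]] by simp

lemma dpred_imp:
  assumes "dpred M A P" "dpred M A Q" shows "dpred M A (\<lambda>e. P e \<longrightarrow> Q e)"
  using dpred_disj[OF dpred_not[OF assms(1)] assms(2)] by (simp only: imp_conv_disj)

lemma dpred_True: "dpred M A (\<lambda>e. True)"
  using dpred_eq[OF dterm_var dterm_var, of M A 0 0] by simp

lemma dpred_bool: "dpred M A (\<lambda>e. b)"
  using dpred_True[of M A] dpred_not[OF dpred_True[of M A]] by (cases b) simp_all

text \<open>Entry 0 of the assignment plays the part of the bound variable. Several variables of the
  formula may stand for it, and \<open>\<tau>\<close> identifies them all with the variable of the
  new quantifier.\<close>

lemma dpred_ex:
  assumes "dpred M A (\<lambda>e. Q (e 0) (\<lambda>i. e (Suc i)))"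
  shows "dpred M A (\<lambda>e. \<exists>a\<in>carrier M. Q a e)"
proof -
  obtain \<phi> \<sigma> where *: "padm A \<sigma>"
    "\<And>e. asg M e \<Longrightarrow> Q (e 0) (\<lambda>i. e (Suc i)) = fsat M \<phi> (ev \<sigma> e)"
    using assms unfolding dpred_def by blast
  \<comment> \<open>Where \<open>\<sigma> i = Inl 0\<close> the value is a dummy:
    \<open>\<tau>\<close> sends such an index to the bound variable, so \<open>\<rho>\<close> is not
    read there.\<close>
  define \<rho> where "\<rho> i = (case \<sigma> i of Inl (Suc j) \<Rightarrow> Inl j | s \<Rightarrow> s)" for i
  define \<tau> where "\<tau> i = Var (if \<sigma> i = Inl 0 then 0 else Suc i)" for i
  have \<tau>: "(\<lambda>i. fval M (case_nat a (ev \<rho> e)) (\<tau> i)) = ev \<sigma> (case_nat a e)" for a e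
    by (auto simp: fun_eq_iff \<tau>_def \<rho>_def ev_def split: sum.split nat.split)
  have "padm A \<rho>"
    using *(1) by (auto simp: padm_def \<rho>_def split: sum.splits nat.splits)
  moreover have "(\<exists>a\<in>carrier M. Q a e) = fsat M (Exists (fsub \<tau> \<phi>)) (ev \<rho> e)" if e: "asg M e" for e
  proof -
    have "Q a e = fsat M \<phi> (ev \<sigma> (case_nat a e))" if "a \<in> carrier M" for a
    proof -
      have "asg M (case_nat a e)" using that e by (simp add: asg_def split: nat.split)
      from *(2)[OF this] show ?thesis by simp
    qed
    then show ?thesis by (simp add: \<tau>)
  qed
  ultimately show ?thesis unfolding dpred_def by blast
qed

lemma dpred_all:
  assumes "dpred M A (\<lambda>e. Q (e 0) (\<lambda>i. e (Suc i)))"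
  shows "dpred M A (\<lambda>e. \<forall>a\<in>carrier M. Q a e)"
proof -
  have "dpred M A (\<lambda>e. \<exists>a\<in>carrier M. \<not> Q a e)"
    by (rule dpred_ex) (rule dpred_not[OF assms])
  from dpred_not[OF this] show ?thesis by simp
qed

lemma dterm_shift:
  assumes "dterm M A t"
  shows "dterm M A (\<lambda>e. t (\<lambda>i. e (\<pi> i)))"
proof -
  obtain u \<sigma> where *: "padm A \<sigma>"
    "\<And>e. asg M e \<Longrightarrow> t e \<in> carrier M \<and> t e = fval M (ev \<sigma> e) u"
    using assms unfolding dterm_def by blast
  define \<rho> where "\<rho> i = (case \<sigma> i of Inl j \<Rightarrow> Inl (\<pi> j) | Inr a \<Rightarrow> Inr a)" for i
  have "padm A \<rho>" using *(1) by (auto simp: padm_def \<rho>_def split: sum.splits)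
  moreover have "ev \<sigma> (\<lambda>i. e (\<pi> i)) = ev \<rho> e" for e
    by (auto simp: fun_eq_iff ev_def \<rho>_def split: sum.split)
  moreover have "asg M (\<lambda>i. e (\<pi> i))" if "asg M e" for e :: "nat \<Rightarrow> 'a"
    using that by (simp add: asg_def)
  ultimately show ?thesis using *(2) unfolding dterm_def by metis
qed

lemma dlist_shift: "dlist M A n l \<Longrightarrow> dlist M A n (\<lambda>e. l (\<lambda>i. e (\<pi> i)))"
proof -
  assume "dlist M A n l"
  then obtain ts where "length ts = n" "\<forall>t\<in>set ts. dterm M A t" "l = (\<lambda>e. map (\<lambda>t. t e) ts)"
    unfolding dlist_def by blast
  then show ?thesis unfolding dlist_def
    by (intro exI[of _ "map (\<lambda>t e. t (\<lambda>i. e (\<pi> i))) ts"]) (auto simp: comp_def intro: dterm_shift)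
qed

lemma dlist_Nil: "dlist M A 0 (\<lambda>e. [])"
  by (auto simp: dlist_def)

lemma dlist_Cons: "dterm M A t \<Longrightarrow> dlist M A n l \<Longrightarrow> dlist M A (Suc n) (\<lambda>e. t e # l e)"
  unfolding dlist_def
proof (elim exE conjE)
  fix ts assume "dterm M A t" "length ts = n" "\<forall>t\<in>set ts. dterm M A t" "l = (\<lambda>e. map (\<lambda>t. t e) ts)"
  then show "\<exists>ts. length ts = Suc n \<and> (\<forall>t\<in>set ts. dterm M A t) \<and>
      (\<lambda>e. t e # l e) = (\<lambda>e. map (\<lambda>t. t e) ts)"
    by (intro exI[of _ "t # ts"]) auto
qed

lemma dlist_single: "dterm M A t \<Longrightarrow> dlist M A 1 (\<lambda>e. [t e])"
  using dlist_Cons[OF _ dlist_Nil] by simp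

lemma dlist_append:
  "dlist M A m l \<Longrightarrow> dlist M A n k \<Longrightarrow> dlist M A (m + n) (\<lambda>e. l e @ k e)"
  unfolding dlist_def
proof (elim exE conjE)
  fix ts us assume "length ts = m" "\<forall>t\<in>set ts. dterm M A t" "l = (\<lambda>e. map (\<lambda>t. t e) ts)"
    "length us = n" "\<forall>t\<in>set us. dterm M A t" "k = (\<lambda>e. map (\<lambda>t. t e) us)"
  then show "\<exists>ts. length ts = m + n \<and> (\<forall>t\<in>set ts. dterm M A t) \<and>
      (\<lambda>e. l e @ k e) = (\<lambda>e. map (\<lambda>t. t e) ts)"
    by (intro exI[of _ "ts @ us"]) auto
qed

lemma dlist_map: "(\<And>x. x \<in> set xs \<Longrightarrow> dterm M A (\<lambda>e. t e x)) \<Longrightarrow> dlist M A (length xs) (\<lambda>e. map (t e) xs)"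
  unfolding dlist_def by (intro exI[of _ "map (\<lambda>x e. t e x) xs"]) (auto simp: comp_def)

lemma dlist_vars: "dlist M A n (\<lambda>e. map (\<lambda>i. e (\<pi> i)) [0..<n])"
proof -
  have "dlist M A (length [0..<n]) (\<lambda>e. map (\<lambda>i. e (\<pi> i)) [0..<n])"
    by (rule dlist_map) (rule dterm_var)
  then show ?thesis by (simp only: length_upt diff_zero)
qed

lemma dlist_const:
  assumes "set xs \<subseteq> A" "xs \<in> tuples M n"
  shows "dlist M A n (\<lambda>e. xs)"
proof -
  have "dlist M A (length xs) (\<lambda>e. map (\<lambda>x. x) xs)"
    by (rule dlist_map) (use assms in \<open>auto simp: tuples_def intro: dterm_const\<close>)
  then show ?thesis using assms(2) by (simp add: tuples_def)
qed

lemma dlist_nth: "dlist M A n l \<Longrightarrow> i < n \<Longrightarrow> dterm M A (\<lambda>e. l e ! i)"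
  by (auto simp: dlist_def)

lemma dpred_sat:
  assumes "dlist M A n l" "vars_below \<phi> n"
  shows "dpred M A (\<lambda>e. sat M \<phi> (l e))"
proof -
  let ?t = "\<lambda>i e. if i < n then l e ! i else e 0"
  have "dterm M A (?t i)" for i
    using dlist_nth[OF assms(1)] by (cases "i < n") (auto simp: dterm_var)
  then have "dpred M A (\<lambda>e. fsat M \<phi> (\<lambda>i. ?t i e))" by (rule dpred_fsat)
  moreover have "fsat M \<phi> (\<lambda>i. ?t i e) = sat M \<phi> (l e)" for e
    unfolding sat_fsat by (rule fsat_cong[OF assms(2)]) auto
  ultimately show ?thesis by simp
qed

lemma dpred_mem:
  assumes "definable M A n X" "A \<subseteq> carrier M" "dlist M A n l"
  shows "dpred M A (\<lambda>e. l e \<in> X)"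
proof -
  obtain \<phi> bs where *: "set bs \<subseteq> A" "vars_below \<phi> (n + length bs)"
    "X = {xs \<in> tuples M n. sat M \<phi> (xs @ bs)}"
    using assms(1) unfolding definable_def by blast
  have "dlist M A (length bs) (\<lambda>e. bs)"
    by (rule dlist_const) (use * assms(2) in \<open>auto simp: tuples_def\<close>)
  from dpred_sat[OF dlist_append[OF assms(3) this] *(2)]
  have "dpred M A (\<lambda>e. sat M \<phi> (l e @ bs))" .
  then show ?thesis
    by (rule dpred_cong[THEN iffD1, rotated]) (use dlist_tuples[OF assms(3)] * in auto)
qed

lemma tuples_0: "tuples M 0 = {[]}"
  by (auto simp: tuples_def)

lemma tuples_Suc: "xs \<in> tuples M (Suc m) \<longleftrightarrow> (\<exists>a ys. xs = a # ys \<and> a \<in> carrier M \<and> ys \<in> tuples M m)"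
  by (cases xs) (auto simp: tuples_def)

lemma dpred_exlist:
  "dpred M A (\<lambda>e. Q (map (\<lambda>i. e i) [0..<m]) (\<lambda>i. e (m + i))) \<Longrightarrow>
   dpred M A (\<lambda>e. \<exists>xs\<in>tuples M m. Q xs e)"
proof (induction m arbitrary: Q)
  case 0
  then show ?case by (simp add: tuples_0)
next
  case (Suc m)
  have 1: "(\<exists>xs\<in>tuples M (Suc m). Q xs e) = (\<exists>xs\<in>tuples M m. \<exists>a\<in>carrier M. Q (a # xs) e)" for e
    by (auto simp: tuples_Suc Bex_def)
  have 2: "map (\<lambda>i. e i) [0..<Suc m] = e 0 # map (\<lambda>i. e (Suc i)) [0..<m]" for e :: "nat \<Rightarrow> 'a"
    by (simp add: upt_conv_Cons map_Suc_upt[symmetric] comp_def del: upt_Suc)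
  have "dpred M A (\<lambda>e. Q (e 0 # map (\<lambda>i. e (Suc i)) [0..<m]) (\<lambda>i. e (Suc (m + i))))"
    using Suc.prems unfolding 2 add_Suc .
  then have "dpred M A (\<lambda>e. \<exists>a\<in>carrier M. Q (a # map (\<lambda>i. e i) [0..<m]) (\<lambda>i. e (m + i)))"
    by (rule dpred_ex)
  then show ?case unfolding 1 by (rule Suc.IH)
qed

text \<open>A formula has finitely many variables, so only finitely many of the parameters in
  \<open>\<sigma>\<close> matter and they can be listed behind the tuple. Entries of the assignment
  from \<open>n\<close> on are set to zero, which the term \<open>Zero\<close> matches in the
  formula.\<close>

lemma definable_dpred:
  assumes M: "\<zero>\<^bsub>M\<^esub> \<in> carrier M" and "dpred M A (\<lambda>e. Q (map e [0..<n]))"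
  shows "definable M A n {xs \<in> tuples M n. Q xs}"
proof -
  obtain \<phi> \<sigma> where *: "padm A \<sigma>" "\<And>e. asg M e \<Longrightarrow> Q (map e [0..<n]) = fsat M \<phi> (ev \<sigma> e)"
    using assms(2) unfolding dpred_def by blast
  obtain N where N: "vars_below \<phi> N" using vars_below_ex by blast
  have "finite {a. \<exists>i<N. \<sigma> i = Inr a}"
  proof (rule finite_surj[of "{..<N}" _ "\<lambda>i. projr (\<sigma> i)"])
    show "{a. \<exists>i<N. \<sigma> i = Inr a} \<subseteq> (\<lambda>i. projr (\<sigma> i)) ` {..<N}" by force
  qed simp
  then obtain bs where bs: "set bs = {a. \<exists>i<N. \<sigma> i = Inr a}" using finite_list by blast
  define idx where "idx a = (SOME k. k < length bs \<and> bs ! k = a)" for a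
  have idx: "idx a < length bs \<and> bs ! idx a = a" if "a \<in> set bs" for a
    unfolding idx_def by (rule someI_ex) (use that in \<open>simp add: in_set_conv_nth\<close>)
  define \<tau> where
    "\<tau> i = (case \<sigma> i of Inl j \<Rightarrow> if j < n then Var j else Zero | Inr a \<Rightarrow> Var (n + idx a))" for i
  have "vars_below (fsub \<tau> \<phi>) (n + length bs)"
  proof (rule vars_below_fsub[OF N])
    fix i assume "i < N"
    then show "term_vars (\<tau> i) \<subseteq> {..<n + length bs}"
      using idx bs by (auto simp: \<tau>_def split: sum.split)
  qed
  moreover have "set bs \<subseteq> A" using bs *(1) by (auto simp: padm_def)
  moreover have "Q xs = sat M (fsub \<tau> \<phi>) (xs @ bs)" if xs: "xs \<in> tuples M n" for xs
  proof -
    define e where "e i = (if i < n then xs ! i else \<zero>\<^bsub>M\<^esub>)" for i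
    have len: "length xs = n" using xs by (simp add: tuples_def)
    have "xs ! i \<in> carrier M" if "i < n" for i
      using xs that nth_mem[of i xs] by (auto simp: tuples_def)
    then have "asg M e" using M by (simp add: asg_def e_def)
    moreover have "map e [0..<n] = xs" by (rule nth_equalityI) (auto simp: e_def len)
    ultimately have "Q xs = fsat M \<phi> (ev \<sigma> e)" using *(2)[of e] by simp
    also have "\<dots> = fsat M \<phi> (\<lambda>i. fval M ((!) (xs @ bs)) (\<tau> i))"
    proof (rule fsat_cong[OF N])
      fix i assume i: "i < N"
      show "ev \<sigma> e i = fval M ((!) (xs @ bs)) (\<tau> i)"
      proof (cases "\<sigma> i")
        case (Inl j)
        then show ?thesis by (simp add: ev_def \<tau>_def e_def nth_append len)
      next
        case (Inr a)
        then have "a \<in> set bs" using i bs by auto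
        then show ?thesis using Inr idx[of a] by (simp add: ev_def \<tau>_def nth_append len)
      qed
    qed
    finally show ?thesis by (simp add: sat_fsat)
  qed
  ultimately show ?thesis unfolding definable_def by blast
qed

section \<open>Definable sets and families\<close>

lemma dterm_zero: "ring M \<Longrightarrow> dterm M A (\<lambda>e. \<zero>\<^bsub>M\<^esub>)"
  using dterm_fval[of M A "\<lambda>i e. e 0" Zero] by (simp add: dterm_var ring.ring_simprules(2))

lemma dterm_one: "ring M \<Longrightarrow> dterm M A (\<lambda>e. \<one>\<^bsub>M\<^esub>)"
  using dterm_fval[of M A "\<lambda>i e. e 0" One] by (simp add: dterm_var ring.ring_simprules(6))

lemma dterm_minus:
  assumes "ring M" "dterm M A t" shows "dterm M A (\<lambda>e. \<ominus>\<^bsub>M\<^esub> t e)"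
proof -
  interpret ring M by fact
  show ?thesis using dterm_fval[of M A "\<lambda>i. t" "Minus (Var 0)"] assms(2) dterm_carrier[OF assms(2)]
    by simp
qed

lemma dterm_add:
  assumes "ring M" "dterm M A t" "dterm M A u" shows "dterm M A (\<lambda>e. t e \<oplus>\<^bsub>M\<^esub> u e)"
proof -
  interpret ring M by fact
  show ?thesis using dterm_fval[of M A "\<lambda>i. if i = 0 then t else u" "Add (Var 0) (Var 1)"]
      assms(2,3) dterm_carrier[OF assms(2)] dterm_carrier[OF assms(3)] by simp
qed

lemma dterm_mult:
  assumes "ring M" "dterm M A t" "dterm M A u" shows "dterm M A (\<lambda>e. t e \<otimes>\<^bsub>M\<^esub> u e)"
proof -
  interpret ring M by fact
  show ?thesis using dterm_fval[of M A "\<lambda>i. if i = 0 then t else u" "Mult (Var 0) (Var 1)"]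
      assms(2,3) dterm_carrier[OF assms(2)] dterm_carrier[OF assms(3)] by simp
qed

lemma dterm_diff:
  assumes "ring M" "dterm M A t" "dterm M A u" shows "dterm M A (\<lambda>e. t e \<ominus>\<^bsub>M\<^esub> u e)"
  unfolding a_minus_def by (intro dterm_add dterm_minus assms)

lemmas dring_intros = dterm_zero dterm_one dterm_minus dterm_add dterm_mult dterm_diff

lemma definable_mono: "definable M A n X \<Longrightarrow> A \<subseteq> B \<Longrightarrow> definable M B n X"
  unfolding definable_def by blast

lemma definable_tuples: "definable M A n X \<Longrightarrow> X \<subseteq> tuples M n"
  unfolding definable_def by blast

definition def1 :: "('a, 'm) ring_scheme \<Rightarrow> 'a set \<Rightarrow> 'a set \<Rightarrow> bool" where
  "def1 M A H \<longleftrightarrow> (\<exists>\<phi> bs. set bs \<subseteq> A \<and> vars_below \<phi> (Suc (length bs)) \<and>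
     H = {x \<in> carrier M. sat M \<phi> (x # bs)})"

lemma tuples_1: "tuples M (Suc 0) = (\<lambda>a. [a]) ` carrier M"
  by (auto simp: tuples_Suc tuples_0)

lemma inj_single: "(\<lambda>a. [a]) ` X = (\<lambda>a. [a]) ` Y \<longleftrightarrow> X = Y"
  by (rule inj_image_eq_iff) (simp add: inj_def)

lemma def1_definable: "definable M A 1 ((\<lambda>a. [a]) ` H) \<longleftrightarrow> def1 M A H"
proof -
  have "{xs \<in> tuples M (Suc 0). sat M \<phi> (xs @ bs)} = (\<lambda>a. [a]) ` {x \<in> carrier M. sat M \<phi> (x # bs)}" for \<phi> bs
    by (auto simp: tuples_1)
  then show ?thesis
    by (simp add: definable_def def1_def inj_single)
qed

lemma def1_carrier: "def1 M A H \<Longrightarrow> H \<subseteq> carrier M"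
  unfolding def1_def by blast

lemma def1_mono: "def1 M A X \<Longrightarrow> A \<subseteq> B \<Longrightarrow> def1 M B X"
  unfolding def1_def by blast

lemma definable_def1:
  assumes "definable M A (Suc 0) X" shows "def1 M A {a. [a] \<in> X}"
proof -
  have "X = (\<lambda>a. [a]) ` {a. [a] \<in> X}"
    using definable_tuples[OF assms] by (auto simp: tuples_1)
  then show ?thesis using assms def1_definable[of M A "{a. [a] \<in> X}"] by simp
qed

lemma dpred_def1:
  assumes "ring M" "dpred M A (\<lambda>e. Q (e 0))"
  shows "def1 M A {x \<in> carrier M. Q x}"
proof -
  have "dpred M A (\<lambda>e. Q (hd (map e [0..<Suc 0])))" using assms(2) by simp
  then have "definable M A (Suc 0) {xs \<in> tuples M (Suc 0). Q (hd xs)}"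
    by (rule definable_dpred[OF ring.ring_simprules(2)[OF assms(1)]])
  from definable_def1[OF this] show ?thesis
    by (simp add: tuples_1 image_iff conj_commute)
qed

lemma def1_dpred:
  assumes "def1 M A H" "A \<subseteq> carrier M" "dterm M A t"
  shows "dpred M A (\<lambda>e. t e \<in> H)"
proof -
  have "dpred M A (\<lambda>e. [t e] \<in> (\<lambda>a. [a]) ` H)"
    using dpred_mem[OF def1_definable[THEN iffD2, OF assms(1)] assms(2) dlist_single[OF assms(3)]] .
  then show ?thesis by (simp add: image_iff)
qed

lemma dpred_ex1:
  assumes "def1 M A H" "A \<subseteq> carrier M" "dpred M A (\<lambda>e. Q (e 0) (\<lambda>i. e (Suc i)))"
  shows "dpred M A (\<lambda>e. \<exists>a\<in>H. Q a e)"
proof -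
  have "dpred M A (\<lambda>e. \<exists>a\<in>carrier M. a \<in> H \<and> Q a e)"
    by (rule dpred_ex, rule dpred_conj, rule def1_dpred) (use assms dterm_var in auto)
  moreover have "(\<exists>a\<in>carrier M. a \<in> H \<and> Q a e) = (\<exists>a\<in>H. Q a e)" for e
    using def1_carrier[OF assms(1)] by blast
  ultimately show ?thesis by simp
qed

lemma dpred_all1:
  assumes "def1 M A H" "A \<subseteq> carrier M" "dpred M A (\<lambda>e. Q (e 0) (\<lambda>i. e (Suc i)))"
  shows "dpred M A (\<lambda>e. \<forall>a\<in>H. Q a e)"
proof -
  have "dpred M A (\<lambda>e. \<exists>a\<in>H. \<not> Q a e)"
    by (rule dpred_ex1[OF assms(1,2)]) (rule dpred_not[OF assms(3)])
  from dpred_not[OF this] show ?thesis by simp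
qed

lemma dpred_in_set:
  assumes "dlist M A n l" "dterm M A t" shows "dpred M A (\<lambda>e. t e \<in> set (l e))"
proof -
  obtain ts where ts: "\<forall>u\<in>set ts. dterm M A u" "l = (\<lambda>e. map (\<lambda>u. u e) ts)"
    using assms(1) unfolding dlist_def by blast
  have "dpred M A (\<lambda>e. t e \<in> set (map (\<lambda>u. u e) ts))"
    using ts(1)
  proof (induction ts)
    case Nil
    then show ?case using dpred_bool[of M A False] by simp
  next
    case (Cons u ts)
    then have "dpred M A (\<lambda>e. t e = u e \<or> t e \<in> set (map (\<lambda>u. u e) ts))"
      by (intro dpred_disj dpred_eq assms(2)) auto
    then show ?case by simp
  qed
  then show ?thesis using ts(2) by simp
qed

lemma def1_inter:
  assumes "ring M" "A \<subseteq> carrier M" "def1 M A G" "def1 M A H" shows "def1 M A (G \<inter> H)"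
proof -
  have "def1 M A {x \<in> carrier M. x \<in> G \<and> x \<in> H}"
    by (rule dpred_def1[OF assms(1)], intro dpred_conj def1_dpred dterm_var assms)
  moreover have "{x \<in> carrier M. x \<in> G \<and> x \<in> H} = G \<inter> H" using def1_carrier[OF assms(3)] by blast
  ultimately show ?thesis by simp
qed

lemma def1_all: "ring M \<Longrightarrow> def1 M A (carrier M)"
  using dpred_def1[of M A "\<lambda>_. True"] dpred_True[of M A] by simp

lemma def1_Inter:
  assumes "ring M" "A \<subseteq> carrier M" "finite \<S>" "\<And>S. S \<in> \<S> \<Longrightarrow> def1 M A S"
  shows "def1 M A (carrier M \<inter> \<Inter>\<S>)"
  using assms(3,4)
proof (induction \<S>)
  case empty
  then show ?case using def1_all[OF assms(1)] by simp
next
  case (insert S \<S>)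
  have "def1 M A (S \<inter> (carrier M \<inter> \<Inter>\<S>))"
    by (rule def1_inter[OF assms(1,2)]) (use insert in auto)
  moreover have "S \<inter> (carrier M \<inter> \<Inter>\<S>) = carrier M \<inter> \<Inter>(insert S \<S>)" by blast
  ultimately show ?case by simp
qed

text \<open>Saturation in terms of sets instead of formulas. The type \<open>p\<close> collects
  every formula over \<open>A\<close> that defines a member of \<open>\<S>\<close>, so that a finite
  part of \<open>p\<close> only involves a finite subfamily.\<close>

lemma saturated_Inter:
  assumes "saturated M" "A \<subseteq> carrier M" "A \<prec> carrier M" "\<And>S. S \<in> \<S> \<Longrightarrow> def1 M A S"
    and fin: "\<And>\<Q>. \<Q> \<subseteq> \<S> \<Longrightarrow> finite \<Q> \<Longrightarrow> \<exists>x\<in>carrier M. \<forall>S\<in>\<Q>. x \<in> S"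
  shows "\<exists>x\<in>carrier M. \<forall>S\<in>\<S>. x \<in> S"
proof -
  define f where "f = (\<lambda>(\<phi>, bs). {x \<in> carrier M. sat M \<phi> (x # bs)})"
  define p where "p = {(\<phi>, bs). set bs \<subseteq> A \<and> vars_below \<phi> (Suc (length bs)) \<and> f (\<phi>, bs) \<in> \<S>}"
  have "\<exists>x\<in>carrier M. \<forall>(\<phi>, bs)\<in>q. sat M \<phi> (x # bs)" if q: "q \<subseteq> p" "finite q" for q
  proof -
    have "f ` q \<subseteq> \<S>" "finite (f ` q)" using q by (auto simp: p_def)
    from fin[OF this] obtain x where "x \<in> carrier M" "\<forall>z\<in>q. x \<in> f z" by blast
    then show ?thesis by (fastforce simp: f_def)
  qed
  moreover have "p \<subseteq> {(\<phi>, bs). set bs \<subseteq> A \<and> vars_below \<phi> (Suc (length bs))}"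
    by (auto simp: p_def)
  ultimately obtain x where x: "x \<in> carrier M" "\<forall>(\<phi>, bs)\<in>p. sat M \<phi> (x # bs)"
    using assms(1,2,3) unfolding saturated_def by blast
  have "x \<in> S" if S: "S \<in> \<S>" for S
  proof -
    obtain \<phi> bs where "set bs \<subseteq> A" "vars_below \<phi> (Suc (length bs))" "S = f (\<phi>, bs)"
      using assms(4)[OF S] unfolding def1_def f_def by auto
    moreover from this S have "(\<phi>, bs) \<in> p" by (simp add: p_def)
    ultimately show ?thesis using x by (auto simp: f_def)
  qed
  with x(1) show ?thesis by blast
qed

subsection \<open>Automorphisms\<close>

lemma fval_aut:
  assumes "ring M" "\<sigma> \<in> ring_iso M M" "asg M e"
  shows "fval M e t \<in> carrier M \<and> fval M (\<lambda>i. \<sigma> (e i)) t = \<sigma> (fval M e t)"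
proof -
  interpret ring M by fact
  have hom: "\<sigma> \<in> ring_hom M M" using assms(2) by (simp add: ring_iso_def)
  interpret ring_hom_ring M M \<sigma> by (rule ring_hom_ringI2) (use assms hom in auto)
  show ?thesis
    using assms(3) by (induction t) (auto simp: asg_def)
qed

lemma fsat_aut:
  assumes "ring M" "\<sigma> \<in> ring_iso M M"
  shows "asg M e \<Longrightarrow> fsat M \<phi> (\<lambda>i. \<sigma> (e i)) = fsat M \<phi> e"
proof (induction \<phi> arbitrary: e)
  case (Eq t u)
  have "inj_on \<sigma> (carrier M)" using assms(2) by (simp add: ring_iso_def bij_betw_def)
  then show ?case
    using fval_aut[OF assms Eq, of t] fval_aut[OF assms Eq, of u] by (simp add: inj_on_eq_iff)
next
  case (Exists \<phi>)
  have im: "\<sigma> ` carrier M = carrier M" using assms(2) by (simp add: ring_iso_def bij_betw_def)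
  have *: "fsat M \<phi> (case_nat (\<sigma> a) (\<lambda>i. \<sigma> (e i))) = fsat M \<phi> (case_nat a e)" if "a \<in> carrier M" for a
  proof -
    have "asg M (case_nat a e)" using that Exists.prems by (simp add: asg_def split: nat.split)
    from Exists.IH[OF this] have "fsat M \<phi> (\<lambda>i. \<sigma> (case_nat a e i)) = fsat M \<phi> (case_nat a e)" .
    moreover have "(\<lambda>i. \<sigma> (case_nat a e i)) = case_nat (\<sigma> a) (\<lambda>i. \<sigma> (e i))"
      by (auto simp: fun_eq_iff split: nat.split)
    ultimately show ?thesis by simp
  qed
  have "fsat M (Exists \<phi>) (\<lambda>i. \<sigma> (e i)) \<longleftrightarrow> (\<exists>b\<in>\<sigma> ` carrier M. fsat M \<phi> (case_nat b (\<lambda>i. \<sigma> (e i))))"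
    by (simp add: im)
  also have "\<dots> \<longleftrightarrow> fsat M (Exists \<phi>) e" using * by simp
  finally show ?case .
qed auto

lemma dpred_aut:
  assumes "ring M" "\<sigma> \<in> ring_iso M M" "\<And>a. a \<in> A \<Longrightarrow> \<sigma> a = a" "dpred M A P" "asg M e" "A \<subseteq> carrier M"
  shows "P (\<lambda>i. \<sigma> (e i)) = P e"
proof -
  obtain \<phi> \<rho> where *: "padm A \<rho>" "\<And>e. asg M e \<Longrightarrow> P e = fsat M \<phi> (ev \<rho> e)"
    using assms(4) unfolding dpred_def by blast
  have im: "\<sigma> ` carrier M = carrier M" using assms(2) by (simp add: ring_iso_def bij_betw_def)
  have 1: "asg M (\<lambda>i. \<sigma> (e i))" using assms(5) im by (auto simp: asg_def)
  have 2: "ev \<rho> (\<lambda>i. \<sigma> (e i)) = (\<lambda>i. \<sigma> (ev \<rho> e i))"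
    using *(1) assms(3) by (auto simp: fun_eq_iff ev_def padm_def split: sum.split)
  have 3: "asg M (ev \<rho> e)"
    using *(1) assms(5,6) by (auto simp: asg_def ev_def padm_def split: sum.split)
  show ?thesis using *(2)[OF 1] *(2)[OF assms(5)] fsat_aut[OF assms(1,2) 3, of \<phi>] 2 by simp
qed

lemma definable_aut:
  assumes "ring M" "\<sigma> \<in> ring_iso M M" "\<And>a. a \<in> A \<Longrightarrow> \<sigma> a = a" "A \<subseteq> carrier M"
    and "definable M A n X" "xs \<in> tuples M n"
  shows "map \<sigma> xs \<in> X \<longleftrightarrow> xs \<in> X"
proof -
  have P: "dpred M A (\<lambda>e. map (\<lambda>i. e i) [0..<n] \<in> X)"
    by (rule dpred_mem[OF assms(5,4)]) (rule dlist_vars)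
  interpret ring M by fact
  define e where "e i = (if i < n then xs ! i else \<zero>\<^bsub>M\<^esub>)" for i
  have len: "length xs = n" using assms(6) by (simp add: tuples_def)
  have "xs ! i \<in> carrier M" if "i < n" for i
    using assms(6) that nth_mem[of i xs] by (auto simp: tuples_def)
  then have e: "asg M e" by (simp add: asg_def e_def)
  have 1: "map (\<lambda>i. e i) [0..<n] = xs" by (rule nth_equalityI) (auto simp: e_def len)
  have "map (\<lambda>i. \<sigma> (e i)) [0..<n] = map \<sigma> (map (\<lambda>i. e i) [0..<n])" by simp
  also have "\<dots> = map \<sigma> xs" unfolding 1 ..
  finally show ?thesis using dpred_aut[OF assms(1-3) P e assms(4)] 1 by simp
qed

section \<open>Families indexed by imaginary sorts\<close>

text \<open>A sort \<open>(n, X, E)\<close> stands for the quotient of a set \<open>X\<close> of \<open>n\<close>-tuples by \<open>E\<close>.\<close>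

type_synonym 'a sort = "nat \<times> 'a list set \<times> ('a list \<times> 'a list) set"

definition points :: "'a sort \<Rightarrow> 'a list set set" where
  "points s = quotient (fst (snd s)) (snd (snd s))"

definition sort_over :: "('a, 'm) ring_scheme \<Rightarrow> 'a set \<Rightarrow> 'a sort \<Rightarrow> bool" where
  "sort_over M A s \<longleftrightarrow> equiv (fst (snd s)) (snd (snd s)) \<and> definable M A (fst s) (fst (snd s)) \<and>
     definable M A (fst s + fst s) (concat_pairs (snd (snd s)))"

abbreviation in_sort :: "'a list \<Rightarrow> 'a sort \<Rightarrow> bool" where
  "in_sort y s \<equiv> y \<in> fst (snd s)"

abbreviation cls :: "'a list \<Rightarrow> 'a sort \<Rightarrow> 'a list set" where
  "cls y s \<equiv> snd (snd s) `` {y}"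

lemma sort_over_mono: "sort_over M A s \<Longrightarrow> A \<subseteq> B \<Longrightarrow> sort_over M B s"
  unfolding sort_over_def using definable_mono by blast

lemma in_sort_tuples: "sort_over M A s \<Longrightarrow> in_sort y s \<Longrightarrow> y \<in> tuples M (fst s)"
  unfolding sort_over_def using definable_tuples by blast

lemma in_cls: "sort_over M A s \<Longrightarrow> z \<in> cls y s \<Longrightarrow> in_sort z s \<and> in_sort y s"
  unfolding sort_over_def equiv_def by blast

lemma pointsE:
  assumes "u \<in> points s" obtains y where "in_sort y s" "u = cls y s"
  using assms unfolding points_def quotient_def by blast

lemma pointsI: "in_sort y s \<Longrightarrow> cls y s \<in> points s"
  unfolding points_def by (rule quotientI)

lemma cls_self: "sort_over M A s \<Longrightarrow> in_sort y s \<Longrightarrow> y \<in> cls y s"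
  unfolding sort_over_def using equiv_class_self by fast

lemma cls_eq: "sort_over M A s \<Longrightarrow> z \<in> cls y s \<Longrightarrow> cls z s = cls y s"
  unfolding sort_over_def by (metis Image_singleton_iff equiv_class_eq)

lemma concat_pairs_iff:
  assumes "E \<subseteq> X \<times> X" "X \<subseteq> tuples M n" "length xs = n"
  shows "xs @ ys \<in> concat_pairs E \<longleftrightarrow> (xs, ys) \<in> E"
proof
  assume "xs @ ys \<in> concat_pairs E"
  then obtain xs' ys' where *: "(xs', ys') \<in> E" "xs @ ys = xs' @ ys'" unfolding concat_pairs_def by auto
  then have "xs' \<in> tuples M n" using assms(1,2) by blast
  then have "length xs' = n" by (simp add: tuples_def)
  with * assms(3) show "(xs, ys) \<in> E" by simp
qed (auto simp: concat_pairs_def)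

lemma dpred_cls:
  assumes "sort_over M A s" "A \<subseteq> carrier M" "dlist M A (fst s) y" "dlist M A (fst s) z"
  shows "dpred M A (\<lambda>e. z e \<in> cls (y e) s)"
proof -
  have "dpred M A (\<lambda>e. y e @ z e \<in> concat_pairs (snd (snd s)))"
    by (rule dpred_mem[OF _ assms(2) dlist_append[OF assms(3,4)]])
      (use assms(1) in \<open>simp add: sort_over_def\<close>)
  moreover have "y e @ z e \<in> concat_pairs (snd (snd s)) \<longleftrightarrow> z e \<in> cls (y e) s" for e
  proof -
    have "snd (snd s) \<subseteq> fst (snd s) \<times> fst (snd s)" "fst (snd s) \<subseteq> tuples M (fst s)"
      using assms(1) definable_tuples[of M A "fst s" "fst (snd s)"]
      by (simp_all add: sort_over_def equiv_def)
    from concat_pairs_iff[OF this dlist_length[OF assms(3)]] show ?thesis by simp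
  qed
  ultimately show ?thesis by simp
qed

lemma dpred_in_sort:
  assumes "sort_over M A s" "A \<subseteq> carrier M" "dlist M A (fst s) y"
  shows "dpred M A (\<lambda>e. in_sort (y e) s)"
  by (rule dpred_mem[OF _ assms(2,3)]) (use assms(1) in \<open>simp add: sort_over_def\<close>)

text \<open>\<open>\<Phi>\<close> is a relation between elements of \<open>M\<close> and lists of classes of the given sorts, and
  \<open>family M A srt \<Phi>\<close> says that it is definable over \<open>A\<close> in terms of representatives.\<close>

definition family ::
    "('a, 'm) ring_scheme \<Rightarrow> 'a set \<Rightarrow> 'a sort list \<Rightarrow> ('a \<Rightarrow> 'a list set list \<Rightarrow> bool) \<Rightarrow> bool" where
  "family M A srt \<Phi> \<longleftrightarrow> (\<forall>A' x ys. A \<subseteq> A' \<and> A' \<subseteq> carrier M \<and> dterm M A' x \<and>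
     list_all2 (\<lambda>y s. dlist M A' (fst s) y) ys srt \<longrightarrow>
     dpred M A' (\<lambda>e. list_all2 (\<lambda>y s. in_sort (y e) s) ys srt \<and> \<Phi> (x e) (map2 (\<lambda>y s. cls (y e) s) ys srt)))"

lemma familyD:
  assumes "family M A srt \<Phi>" "A \<subseteq> A'" "A' \<subseteq> carrier M" "dterm M A' x"
    "list_all2 (\<lambda>y s. dlist M A' (fst s) y) ys srt"
  shows "dpred M A' (\<lambda>e. list_all2 (\<lambda>y s. in_sort (y e) s) ys srt \<and> \<Phi> (x e) (map2 (\<lambda>y s. cls (y e) s) ys srt))"
  using assms unfolding family_def by blast

definition in_points :: "'a list set list \<Rightarrow> 'a sort list \<Rightarrow> bool" where
  "in_points us srt \<longleftrightarrow> list_all2 (\<lambda>u s. u \<in> points s) us srt"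

text \<open>The projection of the relation to \<open>M\<close>. When the fibres over lists of points
  are finite, it consists of elements that are algebraic over such points in a uniform way.\<close>

definition shadow ::
    "('a, 'm) ring_scheme \<Rightarrow> 'a sort list \<Rightarrow> ('a \<Rightarrow> 'a list set list \<Rightarrow> bool) \<Rightarrow> 'a set" where
  "shadow M srt \<Phi> = {x \<in> carrier M. \<exists>us. in_points us srt \<and> \<Phi> x us}"

lemma in_points_Nil: "in_points us [] \<longleftrightarrow> us = []"
  by (simp add: in_points_def)

lemma ex_in_points_Cons:
  assumes "sort_over M A s"
  shows "(\<exists>us. in_points us (s # srt) \<and> P us) \<longleftrightarrow>
    (\<exists>y\<in>tuples M (fst s). in_sort y s \<and> (\<exists>us. in_points us srt \<and> P (cls y s # us)))"
proof
  assume "\<exists>us. in_points us (s # srt) \<and> P us"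
  then obtain u us where "u \<in> points s" "in_points us srt" "P (u # us)"
    by (auto simp: in_points_def list_all2_Cons2)
  then show "\<exists>y\<in>tuples M (fst s). in_sort y s \<and> (\<exists>us. in_points us srt \<and> P (cls y s # us))"
    using in_sort_tuples[OF assms] by (metis pointsE)
next
  assume "\<exists>y\<in>tuples M (fst s). in_sort y s \<and> (\<exists>us. in_points us srt \<and> P (cls y s # us))"
  then obtain y us where "in_sort y s" "in_points us srt" "P (cls y s # us)" by blast
  moreover from this have "cls y s \<in> points s" by (intro pointsI)
  ultimately show "\<exists>us. in_points us (s # srt) \<and> P us"
    by (intro exI[of _ "cls y s # us"]) (simp add: in_points_def)
qed

text \<open>The list of sorts is split so that the quantified ones can be removed one at a time: a
  representative for the next sort occupies the first entries of the assignment, and the data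
  already supplied are shifted behind it.\<close>

lemma family_ex_append:
  assumes "family M A (srt1 @ srt2) \<Phi>" "A \<subseteq> A'" "A' \<subseteq> carrier M" "dterm M A' x"
    and "list_all2 (\<lambda>y s. dlist M A' (fst s) y) ys srt1" "\<And>s. s \<in> set srt2 \<Longrightarrow> sort_over M A s"
  shows "dpred M A' (\<lambda>e. list_all2 (\<lambda>y s. in_sort (y e) s) ys srt1 \<and>
    (\<exists>us. in_points us srt2 \<and> \<Phi> (x e) (map2 (\<lambda>y s. cls (y e) s) ys srt1 @ us)))"
  using assms
proof (induction srt2 arbitrary: srt1 ys x)
  case Nil
  have "dpred M A' (\<lambda>e. list_all2 (\<lambda>y s. in_sort (y e) s) ys (srt1 @ []) \<and>
      \<Phi> (x e) (map2 (\<lambda>y s. cls (y e) s) ys (srt1 @ [])))"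
    by (rule familyD[OF Nil.prems(1-4)]) (use Nil.prems(5) in simp)
  then show ?case by (simp add: in_points_Nil)
next
  case (Cons s srt2)
  have s: "sort_over M A s" using Cons.prems by simp
  define Q where "Q y e \<longleftrightarrow> list_all2 (\<lambda>y s. in_sort (y e) s) ys srt1 \<and> in_sort y s \<and>
      (\<exists>us. in_points us srt2 \<and> \<Phi> (x e) (map2 (\<lambda>y s. cls (y e) s) ys srt1 @ cls y s # us))" for y e
  let ?n = "fst s"
  let ?x = "\<lambda>e. x (\<lambda>i. e (?n + i))"
  let ?ys = "map (\<lambda>y e. y (\<lambda>i. e (?n + i))) ys @ [\<lambda>e. map (\<lambda>i. e i) [0..<?n]]"
  have len: "length ys = length srt1" using Cons.prems(5) by (rule list_all2_lengthD)
  have "list_all2 (\<lambda>y s. dlist M A' (fst s) y) ?ys (srt1 @ [s])"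
  proof (rule list_all2_appendI)
    show "list_all2 (\<lambda>y s. dlist M A' (fst s) y) (map (\<lambda>y e. y (\<lambda>i. e (?n + i))) ys) srt1"
      unfolding list_all2_map1
      by (rule list_all2_mono[OF Cons.prems(5)]) (rule dlist_shift)
  qed (simp add: dlist_vars)
  then have "dpred M A' (\<lambda>e. list_all2 (\<lambda>y s. in_sort (y e) s) ?ys (srt1 @ [s]) \<and>
      (\<exists>us. in_points us srt2 \<and> \<Phi> (?x e) (map2 (\<lambda>y s. cls (y e) s) ?ys (srt1 @ [s]) @ us)))"
    by (intro Cons.IH[OF _ Cons.prems(2,3) dterm_shift[OF Cons.prems(4)]]) (use Cons.prems(1,6) in simp_all)
  moreover have "map2 (\<lambda>y s. cls (y e) s) ?ys (srt1 @ [s]) =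
      map2 (\<lambda>y s. cls (y (\<lambda>i. e (?n + i))) s) ys srt1 @ [cls (map (\<lambda>i. e i) [0..<?n]) s]" for e
    using len by (simp add: zip_map1 comp_def case_prod_beta)
  moreover have "list_all2 (\<lambda>y s. in_sort (y e) s) ?ys (srt1 @ [s]) \<longleftrightarrow>
      list_all2 (\<lambda>y s. in_sort (y (\<lambda>i. e (?n + i))) s) ys srt1 \<and> in_sort (map (\<lambda>i. e i) [0..<?n]) s" for e
    using len by (simp add: list_all2_append list_all2_map1)
  ultimately have "dpred M A' (\<lambda>e. Q (map (\<lambda>i. e i) [0..<?n]) (\<lambda>i. e (?n + i)))"
    by (simp add: Q_def)
  then have "dpred M A' (\<lambda>e. \<exists>y\<in>tuples M ?n. Q y e)" by (rule dpred_exlist)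
  moreover have "(\<exists>y\<in>tuples M ?n. Q y e) \<longleftrightarrow> list_all2 (\<lambda>y s. in_sort (y e) s) ys srt1 \<and>
    (\<exists>us. in_points us (s # srt2) \<and> \<Phi> (x e) (map2 (\<lambda>y s. cls (y e) s) ys srt1 @ us))" for e
    unfolding ex_in_points_Cons[OF s] Q_def by blast
  ultimately show ?case by simp
qed

lemma family_shadow:
  assumes "ring M" "family M A srt \<Phi>" "A \<subseteq> carrier M" "\<And>s. s \<in> set srt \<Longrightarrow> sort_over M A s"
  shows "def1 M A (shadow M srt \<Phi>)"
proof -
  have "dpred M A (\<lambda>e. \<exists>us. in_points us srt \<and> \<Phi> (e 0) us)"
    using family_ex_append[of M A "[]" srt \<Phi> A "\<lambda>e. e 0" "[]"] assms dterm_var[of M A 0] by simp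
  from dpred_def1[OF assms(1) this] show ?thesis by (simp add: shadow_def)
qed

text \<open>A point can be substituted as a constant once the entries of one representative are
  available as parameters.\<close>

lemma family_fix:
  assumes "family M A (s # srt) \<Phi>" "sort_over M A s" "in_sort y s" "A \<subseteq> A'" "set y \<subseteq> A'"
  shows "family M A' srt (\<lambda>x us. \<Phi> x (cls y s # us))"
  unfolding family_def
proof (intro allI impI, elim conjE)
  fix B x ys
  assume B: "A' \<subseteq> B" "B \<subseteq> carrier M" "dterm M B x" "list_all2 (\<lambda>y s. dlist M B (fst s) y) ys srt"
  have "dlist M B (fst s) (\<lambda>e. y)"
    by (rule dlist_const) (use assms(5) B(1) in_sort_tuples[OF assms(2,3)] in auto)
  then have "list_all2 (\<lambda>y s. dlist M B (fst s) y) ((\<lambda>e. y) # ys) (s # srt)" using B by simp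
  moreover have "A \<subseteq> B" using assms B by blast
  ultimately have "dpred M B (\<lambda>e. list_all2 (\<lambda>y s. in_sort (y e) s) ((\<lambda>e. y) # ys) (s # srt) \<and>
      \<Phi> (x e) (map2 (\<lambda>y s. cls (y e) s) ((\<lambda>e. y) # ys) (s # srt)))"
    by (intro familyD[OF assms(1)] B)
  then show "dpred M B (\<lambda>e. list_all2 (\<lambda>y s. in_sort (y e) s) ys srt \<and>
      \<Phi> (x e) (cls y s # map2 (\<lambda>y s. cls (y e) s) ys srt))"
    using assms(3) by simp
qed

lemma family_mono: "family M A srt \<Phi> \<Longrightarrow> A \<subseteq> B \<Longrightarrow> family M B srt \<Phi>"
  unfolding family_def by (meson order_trans)

section \<open>Counting types\<close>

text \<open>Types are represented by the definable sets that belong to them, so that passing to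
  fewer parameters is an intersection.\<close>

definition type_over :: "('a, 'm) ring_scheme \<Rightarrow> 'a set \<Rightarrow> 'a \<Rightarrow> 'a set set" where
  "type_over M A x = {S. def1 M A S \<and> x \<in> S}"

text \<open>Finite sorts count as minimal. This lets one-point sorts, which will stand for imaginary
  parameters, be treated on the same footing as the strongly minimal set.\<close>

definition minimal_sort :: "('a, 'm) ring_scheme \<Rightarrow> 'a sort \<Rightarrow> bool" where
  "minimal_sort M s \<longleftrightarrow> (\<forall>Y\<subseteq>points s. definable M (carrier M) (fst s) (\<Union>Y) \<longrightarrow>
     finite Y \<or> finite (points s - Y))"

section \<open>Countability of definable sets and of algebraic points\<close>

instance rterm :: countable by countable_datatype
instance rform :: countable by countable_datatype

lemma countable_definable:
  assumes "countable A" shows "countable {X. definable M A n X}"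
proof -
  let ?f = "\<lambda>z. {xs \<in> tuples M n. sat M (fst z) (xs @ snd z)}"
  have "countable ((UNIV :: rform set) \<times> lists A)"
    by (intro countable_SIGMA countable_lists assms countableI_type)
  then have cnt: "countable (?f ` (UNIV \<times> lists A))" by (rule countable_image)
  have mem: "X \<in> ?f ` (UNIV \<times> lists A)" if X: "definable M A n X" for X
  proof -
    obtain \<phi> bs where *: "set bs \<subseteq> A" "X = {xs \<in> tuples M n. sat M \<phi> (xs @ bs)}"
      using X unfolding definable_def by blast
    show ?thesis
    proof (rule image_eqI[of _ _ "(\<phi>, bs)"])
      show "X = ?f (\<phi>, bs)" unfolding fst_conv snd_conv by (rule *(2))
      show "(\<phi>, bs) \<in> UNIV \<times> lists A" using *(1) by (simp add: lists_eq_set)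
    qed
  qed
  have "{X. definable M A n X} \<subseteq> ?f ` (UNIV \<times> lists A)"
    by (rule subsetI) (rule mem, simp)
  from countable_subset[OF this] show ?thesis using cnt .
qed

definition algebraic_class :: "('a, 'm) ring_scheme \<Rightarrow> 'a set \<Rightarrow> 'a sort \<Rightarrow> 'a list set \<Rightarrow> bool" where
  "algebraic_class M A s u \<longleftrightarrow>
     (\<exists>S. definable M A (fst s) S \<and> finite {c \<in> points s. c \<subseteq> S} \<and> u \<in> points s \<and> u \<subseteq> S)"

lemma countable_algebraic_class:
  assumes "countable A" shows "countable {u. algebraic_class M A s u}"
proof -
  have "{u. algebraic_class M A s u} =
      (\<Union>S\<in>{S. definable M A (fst s) S \<and> finite {c \<in> points s. c \<subseteq> S}}. {c \<in> points s. c \<subseteq> S})"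
    unfolding algebraic_class_def by blast
  moreover have "countable {S. definable M A (fst s) S \<and> finite {c \<in> points s. c \<subseteq> S}}"
    by (rule countable_subset[OF _ countable_definable[OF assms]]) auto
  ultimately show ?thesis by (simp only:) (rule countable_UN, auto intro: countable_finite)
qed

lemma Union_points_subset:
  assumes "sort_over M A s" "Y \<subseteq> points s" "c \<in> points s" "c \<subseteq> \<Union>Y" shows "c \<in> Y"
proof -
  obtain y where y: "in_sort y s" "c = cls y s" using assms(3) by (rule pointsE)
  then have "y \<in> c" using cls_self[OF assms(1)] by blast
  then obtain d where d: "d \<in> Y" "y \<in> d" using assms(4) by blast
  then obtain z where "d = cls z s" using assms(2) pointsE by (metis subsetD)
  then have "d = c" using cls_eq[OF assms(1)] d y by blast
  with d show ?thesis by simp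
qed

text \<open>One of \<open>P\<close> and its negation holds at finitely many points only, and such
  points are algebraic. Both nonalgebraic points therefore lie on the cofinite side.\<close>

lemma generic_transfer:
  assumes M: "ring M" "A \<subseteq> carrier M" "sort_over M A s" "minimal_sort M s"
    and u: "u \<in> points s" "\<not> algebraic_class M A s u" and v: "v \<in> points s" "\<not> algebraic_class M A s v"
    and P: "dpred M A (\<lambda>e. in_sort (map (\<lambda>i. e i) [0..<fst s]) s \<and> P (cls (map (\<lambda>i. e i) [0..<fst s]) s))"
    and "P u"
  shows "P v"
proof (rule ccontr)
  assume nv: "\<not> P v"
  have zero: "\<zero>\<^bsub>M\<^esub> \<in> carrier M" using M(1) by (rule ring.ring_simprules(2))
  define Y where "Y = {c \<in> points s. P c}"
  have pts: "\<Union>{c \<in> points s. R c} = {y \<in> tuples M (fst s). in_sort y s \<and> R (cls y s)}" for R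
  proof (intro subset_antisym subsetI)
    fix y assume "y \<in> \<Union>{c \<in> points s. R c}"
    then obtain c where c: "c \<in> points s" "R c" "y \<in> c" by blast
    obtain z where z: "in_sort z s" "c = cls z s" using c(1) by (rule pointsE)
    then have "in_sort y s" "cls y s = c"
      using in_cls[OF M(3)] cls_eq[OF M(3)] c(3) by blast+
    then show "y \<in> {y \<in> tuples M (fst s). in_sort y s \<and> R (cls y s)}"
      using c(2) in_sort_tuples[OF M(3)] by simp
  next
    fix y assume y: "y \<in> {y \<in> tuples M (fst s). in_sort y s \<and> R (cls y s)}"
    then have "cls y s \<in> points s" "y \<in> cls y s"
      using pointsI cls_self[OF M(3)] by blast+
    with y show "y \<in> \<Union>{c \<in> points s. R c}" by blast
  qed
  have N: "\<Union>(points s - Y) = {y \<in> tuples M (fst s). in_sort y s \<and> \<not> P (cls y s)}"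
  proof -
    have "points s - Y = {c \<in> points s. \<not> P c}" unfolding Y_def by blast
    then show ?thesis by (simp only: pts)
  qed
  have defY: "definable M A (fst s) (\<Union>Y)"
    unfolding Y_def pts by (rule definable_dpred[OF zero]) (rule P)
  have "dpred M A (\<lambda>e. in_sort (map (\<lambda>i. e i) [0..<fst s]) s \<and>
      \<not> (in_sort (map (\<lambda>i. e i) [0..<fst s]) s \<and> P (cls (map (\<lambda>i. e i) [0..<fst s]) s)))"
    by (intro dpred_conj dpred_not P dpred_in_sort M dlist_vars)
  then have defN: "definable M A (fst s) (\<Union>(points s - Y))"
    unfolding N by (intro definable_dpred[OF zero]) (simp cong: conj_cong)
  have sub: "{c \<in> points s. c \<subseteq> \<Union>Z} = Z" if "Z \<subseteq> points s" for Z
    using that Union_points_subset[OF M(3) that] by blast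
  have YP: "Y \<subseteq> points s" by (auto simp: Y_def)
  have "finite Y \<or> finite (points s - Y)"
    using M(4) definable_mono[OF defY M(2)] unfolding minimal_sort_def using YP by blast
  then show False
  proof
    assume "finite Y"
    moreover have "u \<in> Y" using u(1) \<open>P u\<close> by (simp add: Y_def)
    ultimately have "algebraic_class M A s u"
      unfolding algebraic_class_def using defY u(1) sub[of Y] YP by (intro exI[of _ "\<Union>Y"]) auto
    with u show False by simp
  next
    assume "finite (points s - Y)"
    moreover have "v \<in> points s - Y" using v(1) nv by (simp add: Y_def)
    ultimately have "algebraic_class M A s v"
      unfolding algebraic_class_def using defN v(1) sub[of "points s - Y"]
      by (intro exI[of _ "\<Union>(points s - Y)"]) auto
    with v show False by simp
  qed
qed

lemma countable_lesspoll_uncountable: "countable A \<Longrightarrow> uncountable B \<Longrightarrow> A \<prec> B"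
proof -
  assume A: "countable A" and B: "uncountable B"
  have "infinite B" using B countable_finite by blast
  then have "(UNIV :: nat set) \<lesssim> B" by (simp add: infinite_le_lepoll)
  moreover have "A \<lesssim> (UNIV :: nat set)" using A by (auto simp: countable_def lepoll_def)
  ultimately have "A \<lesssim> B" using lepoll_trans by blast
  moreover have "\<not> A \<approx> B"
    using A B unfolding eqpoll_def bij_betw_def by (metis countable_image)
  ultimately show ?thesis by (simp add: lesspoll_def)
qed

lemma type_over_restrict: "A \<subseteq> B \<Longrightarrow> type_over M A x = type_over M B x \<inter> {S. def1 M A S}"
  unfolding type_over_def using def1_mono by blast

lemma def1_compl:
  assumes "ring M" "A \<subseteq> carrier M" "def1 M A S" shows "def1 M A (carrier M - S)"
proof -
  have "def1 M A {x \<in> carrier M. x \<notin> S}"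
    by (rule dpred_def1[OF assms(1)], intro dpred_not def1_dpred dterm_var assms)
  moreover have "{x \<in> carrier M. x \<notin> S} = carrier M - S" by blast
  ultimately show ?thesis by simp
qed

lemma type_over_eqI:
  assumes "ring M" "A \<subseteq> carrier M" "x \<in> carrier M" "y \<in> carrier M" "\<And>S. S \<in> type_over M A x \<Longrightarrow> y \<in> S"
  shows "type_over M A y = type_over M A x"
proof -
  have "x \<in> S" if "def1 M A S" "y \<in> S" for S
    using assms(3) assms(5)[of "carrier M - S"] def1_compl[OF assms(1,2) that(1)] that(2)
    unfolding type_over_def by blast
  with assms(5) show ?thesis unfolding type_over_def by blast
qed

lemma shadow_Cons:
  "shadow M (s # srt) \<Phi> = (\<Union>u\<in>points s. shadow M srt (\<lambda>x us. \<Phi> x (u # us)))"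
  unfolding shadow_def in_points_def list_all2_Cons2 by blast

text \<open>Over a countable set, each minimal sort has countably many algebraic points and one generic
  type, and by saturation any two generic points give rise to the same types.\<close>

lemma countable_types_shadow:
  assumes M: "ring M" "saturated M" "uncountable (carrier M)"
  shows "family M A srt \<Phi> \<Longrightarrow> countable A \<Longrightarrow> A \<subseteq> carrier M \<Longrightarrow>
    (\<And>s. s \<in> set srt \<Longrightarrow> sort_over M A s) \<Longrightarrow> (\<And>s. s \<in> set srt \<Longrightarrow> minimal_sort M s) \<Longrightarrow>
    (\<And>us. finite {x \<in> carrier M. \<Phi> x us}) \<Longrightarrow> countable (type_over M A ` shadow M srt \<Phi>)"
proof (induction srt arbitrary: A \<Phi>)
  case Nil
  have "shadow M [] \<Phi> = {x \<in> carrier M. \<Phi> x []}" by (simp add: shadow_def in_points_Nil)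
  then show ?case using Nil.prems(6)[of "[]"] by (simp add: countable_finite)
next
  case (Cons s srt)
  define W where "W u = shadow M srt (\<lambda>x us. \<Phi> x (u # us))" for u
  have s: "sort_over M A s" "minimal_sort M s" using Cons.prems(4,5) by simp_all
  have srt: "\<And>r. r \<in> set srt \<Longrightarrow> sort_over M A r" using Cons.prems(4) by simp
  \<comment> \<open>Fixing the first point adds the finitely many entries of a representative to the
    parameters, and these remain countable.\<close>
  have rep: "\<exists>B. A \<subseteq> B \<and> B \<subseteq> carrier M \<and> countable B \<and> family M B srt (\<lambda>x us. \<Phi> x (u # us))"
    if u: "u \<in> points s" for u
  proof -
    obtain y where y: "in_sort y s" "u = cls y s" using u by (rule pointsE)
    have "set y \<subseteq> carrier M" using in_sort_tuples[OF s(1) y(1)] by (simp add: tuples_def)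
    moreover have "family M (A \<union> set y) srt (\<lambda>x us. \<Phi> x (u # us))"
      unfolding y(2) by (rule family_fix[OF Cons.prems(1) s(1) y(1)]) auto
    ultimately show ?thesis using Cons.prems(2,3)
      by (intro exI[of _ "A \<union> set y"]) (simp add: countable_finite)
  qed
  have cnt: "countable (type_over M A ` W u)" if u: "u \<in> points s" for u
  proof -
    obtain B where B: "A \<subseteq> B" "B \<subseteq> carrier M" "countable B" "family M B srt (\<lambda>x us. \<Phi> x (u # us))"
      using rep[OF u] by blast
    have "countable (type_over M B ` W u)"
      unfolding W_def
    proof (rule Cons.IH[OF B(4,3,2)])
      show "sort_over M B r" if "r \<in> set srt" for r
        by (rule sort_over_mono[OF srt[OF that] B(1)])
    qed (use Cons.prems(5,6) in simp_all)
    then have "countable ((\<lambda>T. T \<inter> {S. def1 M A S}) ` type_over M B ` W u)" by (rule countable_image)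
    then show ?thesis unfolding image_image type_over_restrict[OF B(1), symmetric] .
  qed
  \<comment> \<open>For a set \<open>S0\<close> in the type of \<open>x\<close>, the condition that
    \<open>S0\<close> meets \<open>W c\<close> is definable over \<open>A\<close> in terms of
    \<open>c\<close>, so it passes from \<open>u\<close> to \<open>v\<close>. Saturation over
    \<open>B\<close>, which suffices to define \<open>W v\<close>, then realises the whole type
    inside \<open>W v\<close>.\<close>
  have gen: "type_over M A ` W u \<subseteq> type_over M A ` W v"
    if u: "u \<in> points s" "\<not> algebraic_class M A s u" and v: "v \<in> points s" "\<not> algebraic_class M A s v" for u v
  proof (intro image_subsetI)
    fix x assume x: "x \<in> W u"
    then have xc: "x \<in> carrier M" by (simp add: W_def shadow_def)
    obtain B where B: "A \<subseteq> B" "B \<subseteq> carrier M" "countable B" "family M B srt (\<lambda>x us. \<Phi> x (v # us))"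
      using rep[OF v(1)] by blast
    have Wv: "def1 M B (W v)"
      unfolding W_def by (rule family_shadow[OF M(1) B(4,2)]) (rule sort_over_mono[OF srt B(1)])
    have "\<exists>z\<in>carrier M. \<forall>S\<in>type_over M A x \<union> {W v}. z \<in> S"
    proof (rule saturated_Inter[OF M(2) B(2) countable_lesspoll_uncountable[OF B(3) M(3)]])
      show "def1 M B S" if "S \<in> type_over M A x \<union> {W v}" for S
        using that Wv def1_mono[OF _ B(1)] by (auto simp: type_over_def)
    next
      fix \<Q> assume Q: "\<Q> \<subseteq> type_over M A x \<union> {W v}" "finite \<Q>"
      define S0 where "S0 = carrier M \<inter> \<Inter>(\<Q> \<inter> type_over M A x)"
      have S0: "def1 M A S0"
        unfolding S0_def by (rule def1_Inter[OF M(1) Cons.prems(3)]) (use Q(2) in \<open>auto simp: type_over_def\<close>)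
      have xS0: "x \<in> S0" using xc by (auto simp: S0_def type_over_def)
      define n where "n = fst s"
      have "dpred M A (\<lambda>e. list_all2 (\<lambda>y s. in_sort (y e) s) [\<lambda>e. map (\<lambda>i. e (Suc i)) [0..<n]] [s] \<and>
          (\<exists>us. in_points us srt \<and>
            \<Phi> (e 0) (map2 (\<lambda>y s. cls (y e) s) [\<lambda>e. map (\<lambda>i. e (Suc i)) [0..<n]] [s] @ us)))"
        by (rule family_ex_append[of M A "[s]" srt \<Phi> A])
          (use Cons.prems(1,3) srt dterm_var dlist_vars in \<open>simp_all add: n_def\<close>)
      then have "dpred M A (\<lambda>e. in_sort (map (\<lambda>i. e (Suc i)) [0..<n]) s \<and>
          (\<exists>us. in_points us srt \<and> \<Phi> (e 0) (cls (map (\<lambda>i. e (Suc i)) [0..<n]) s # us)))"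
        by simp
      then have "dpred M A (\<lambda>e. \<exists>z\<in>S0. in_sort (map (\<lambda>i. e i) [0..<n]) s \<and>
          (\<exists>us. in_points us srt \<and> \<Phi> z (cls (map (\<lambda>i. e i) [0..<n]) s # us)))"
        by (rule dpred_ex1[OF S0 Cons.prems(3)])
      moreover have "(\<exists>z\<in>S0. in_sort (map (\<lambda>i. e i) [0..<n]) s \<and>
          (\<exists>us. in_points us srt \<and> \<Phi> z (cls (map (\<lambda>i. e i) [0..<n]) s # us))) \<longleftrightarrow>
          in_sort (map (\<lambda>i. e i) [0..<n]) s \<and> (\<exists>z\<in>S0. z \<in> W (cls (map (\<lambda>i. e i) [0..<n]) s))" for e
        using def1_carrier[OF S0] unfolding W_def shadow_def by blast
      ultimately have P: "dpred M A (\<lambda>e. in_sort (map (\<lambda>i. e i) [0..<n]) s \<and>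
          (\<exists>z\<in>S0. z \<in> W (cls (map (\<lambda>i. e i) [0..<n]) s)))"
        by (simp only:)
      have "\<exists>z\<in>S0. z \<in> W v"
        by (rule generic_transfer[OF M(1) Cons.prems(3) s u v P[unfolded n_def]]) (use x xS0 in blast)
      then obtain z where z: "z \<in> S0" "z \<in> W v" by blast
      have "z \<in> S" if "S \<in> \<Q>" for S
        using z Q(1) that unfolding S0_def by blast
      then show "\<exists>z\<in>carrier M. \<forall>S\<in>\<Q>. z \<in> S" using z(1) unfolding S0_def by blast
    qed
    then obtain z where z: "z \<in> carrier M" "z \<in> W v" "\<And>S. S \<in> type_over M A x \<Longrightarrow> z \<in> S" by blast
    have "type_over M A z = type_over M A x"
      by (rule type_over_eqI[OF M(1) Cons.prems(3) xc z(1,3)])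
    then show "type_over M A x \<in> type_over M A ` W v" using z(2) by (metis image_eqI)
  qed
  have alg: "countable (\<Union>u\<in>{u. algebraic_class M A s u}. type_over M A ` W u)"
    by (rule countable_UN[OF countable_algebraic_class[OF Cons.prems(2)]])
      (rule cnt, auto simp: algebraic_class_def)
  \<comment> \<open>All generic points contribute the same types, so the countable contribution of a
    single one bounds them all.\<close>
  have "\<exists>K. countable K \<and> (\<forall>u\<in>points s. \<not> algebraic_class M A s u \<longrightarrow> type_over M A ` W u \<subseteq> K)"
  proof (cases "\<exists>v\<in>points s. \<not> algebraic_class M A s v")
    case True
    then obtain v where "v \<in> points s" "\<not> algebraic_class M A s v" by blast
    then show ?thesis using cnt gen by (intro exI[of _ "type_over M A ` W v"]) blast
  next
    case False
    then show ?thesis by (intro exI[of _ "{}"]) blast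
  qed
  then obtain K where "countable K \<and>
      (\<forall>u\<in>points s. \<not> algebraic_class M A s u \<longrightarrow> type_over M A ` W u \<subseteq> K)" ..
  then have K: "countable K"
    "\<And>u. u \<in> points s \<Longrightarrow> \<not> algebraic_class M A s u \<Longrightarrow> type_over M A ` W u \<subseteq> K" by simp_all
  have "type_over M A ` shadow M (s # srt) \<Phi> \<subseteq> (\<Union>u\<in>{u. algebraic_class M A s u}. type_over M A ` W u) \<union> K"
    unfolding shadow_Cons W_def[symmetric] using K(2) by blast
  then show ?case by (rule countable_subset) (intro countable_Un alg K(1))
qed

section \<open>The descending chain condition\<close>

lemma uncountable_nat_set: "uncountable (UNIV :: nat set set)"
proof
  assume "countable (UNIV :: nat set set)"
  then obtain f :: "nat \<Rightarrow> nat set" where "range f = UNIV"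
    by (metis UNIV_not_empty range_from_nat_into uncountable_def)
  then show False using Cantors_theorem[of UNIV] by (metis Pow_UNIV)
qed

text \<open>The coset representative reached at level \<open>n\<close> when the branch
  \<open>S\<close> of the binary tree is followed.\<close>

primrec psum :: "('a, 'm) ring_scheme \<Rightarrow> (nat \<Rightarrow> 'a) \<Rightarrow> nat set \<Rightarrow> nat \<Rightarrow> 'a" where
  "psum M t S 0 = \<zero>\<^bsub>M\<^esub>"
| "psum M t S (Suc n) = psum M t S n \<oplus>\<^bsub>M\<^esub> (if n \<in> S then t n else \<zero>\<^bsub>M\<^esub>)"

lemma psum_cong: "(\<And>i. i < n \<Longrightarrow> i \<in> S \<longleftrightarrow> i \<in> T) \<Longrightarrow> psum M t S n = psum M t T n"
  by (induction n) auto

text \<open>A strictly descending chain of definable subgroups gives a binary tree of cosets, hence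
  \<open>2^\<aleph>\<^sub>0\<close> types over a countable set.\<close>

lemma descending_chain:
  assumes M: "ring M" "saturated M" "uncountable (carrier M)"
    and cnt: "\<And>A. countable A \<Longrightarrow> A0 \<subseteq> A \<Longrightarrow> A \<subseteq> carrier M \<Longrightarrow> countable (type_over M A ` carrier M)"
    and A0: "countable A0" "A0 \<subseteq> carrier M"
    and H: "\<And>n::nat. additive_subgroup (H n) M" "\<And>n. def1 M (carrier M) (H n)"
    and sub: "\<And>n. H (Suc n) \<subset> H n"
  shows False
proof -
  interpret ring M by fact
  have "\<exists>B. finite B \<and> B \<subseteq> carrier M \<and> def1 M B (H n)" for n
  proof -
    obtain \<phi> bs where "set bs \<subseteq> carrier M" "vars_below \<phi> (Suc (length bs))"
      "H n = {x \<in> carrier M. sat M \<phi> (x # bs)}"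
      using H(2)[of n] unfolding def1_def by blast
    then show ?thesis by (intro exI[of _ "set bs"]) (auto simp: def1_def)
  qed
  then obtain B where B: "\<And>n. finite (B n)" "\<And>n. B n \<subseteq> carrier M" "\<And>n. def1 M (B n) (H n)" by metis
  have "\<exists>t. t \<in> H n - H (Suc n)" for n using sub[of n] by blast
  then obtain t where t: "\<And>n. t n \<in> H n - H (Suc n)" by metis
  have Hc: "H n \<subseteq> carrier M" for n using def1_carrier[OF H(2)] .
  have tc: "t n \<in> carrier M" for n using t[of n] Hc[of n] by blast
  define A where "A = A0 \<union> (\<Union>n. B n) \<union> range t"
  have A: "countable A" "A0 \<subseteq> A" "A \<subseteq> carrier M"
    using A0 B(1,2) tc by (auto simp: A_def countable_finite)
  have BA: "B n \<subseteq> A" for n by (auto simp: A_def)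
  \<comment> \<open>The coset of \<open>H n\<close> at level \<open>n\<close> of the branch
    \<open>S\<close>. The parameters of \<open>H n\<close> and the elements \<open>t i\<close> all
    lie in the countable set \<open>A\<close>.\<close>
  define C where "C S n = {x \<in> carrier M. x \<ominus>\<^bsub>M\<^esub> psum M t S n \<in> H n}" for S n
  have pd: "dterm M A (\<lambda>e. psum M t S n)" for S n
  proof (induction n)
    case (Suc n)
    have "dterm M A (\<lambda>e. t n)" by (rule dterm_const) (use tc in \<open>auto simp: A_def\<close>)
    then show ?case using Suc by (auto intro!: dterm_add[OF M(1)] dterm_zero[OF M(1)])
  qed (simp add: dterm_zero[OF M(1)])
  have pc: "psum M t S n \<in> carrier M" for S n by (induction n) (simp_all add: tc)
  have dC: "def1 M A (C S n)" for S n
    unfolding C_def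
    by (rule dpred_def1[OF M(1)])
      (intro def1_dpred[OF def1_mono[OF B(3) BA] A(3)] dterm_diff[OF M(1)] dterm_var pd)
  have Csub: "C S (Suc n) \<subseteq> C S n" for S n
  proof
    fix x assume x: "x \<in> C S (Suc n)"
    define w where "w = (if n \<in> S then t n else \<zero>\<^bsub>M\<^esub>)"
    interpret h: additive_subgroup "H n" M by (rule H)
    have w: "w \<in> H n" using t[of n] h.zero_closed by (simp add: w_def)
    have xc: "x \<in> carrier M" and "x \<ominus>\<^bsub>M\<^esub> psum M t S (Suc n) \<in> H n"
      using x sub[of n] by (auto simp: C_def)
    then have "(x \<ominus>\<^bsub>M\<^esub> (psum M t S n \<oplus>\<^bsub>M\<^esub> w)) \<oplus>\<^bsub>M\<^esub> w \<in> H n"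
      using h.a_closed w by (simp add: w_def)
    moreover have "(x \<ominus>\<^bsub>M\<^esub> (psum M t S n \<oplus>\<^bsub>M\<^esub> w)) \<oplus>\<^bsub>M\<^esub> w = x \<ominus>\<^bsub>M\<^esub> psum M t S n"
    proof -
      have "w \<in> carrier M" using w Hc by blast
      then show ?thesis using xc pc[of S n] by algebra
    qed
    ultimately show "x \<in> C S n" using xc by (simp add: C_def)
  qed
  then have Cmono: "m \<le> n \<Longrightarrow> C S n \<subseteq> C S m" for S m n by (rule lift_Suc_antimono_le)
  have pC: "psum M t S n \<in> C S n" for S n
    using pc additive_subgroup.zero_closed[OF H(1)] by (simp add: C_def r_neg a_minus_def)
  have "\<exists>x\<in>carrier M. \<forall>V\<in>range (C S). x \<in> V" for S
  proof (rule saturated_Inter[OF M(2) A(3) countable_lesspoll_uncountable[OF A(1) M(3)]])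
    show "def1 M A V" if "V \<in> range (C S)" for V using that dC by auto
    fix \<Q> assume "\<Q> \<subseteq> range (C S)" "finite \<Q>"
    then obtain N where N: "finite N" "\<Q> = C S ` N" by (meson finite_subset_image)
    obtain m where m: "\<forall>n\<in>N. n \<le> m" using finite_nat_set_iff_bounded_le N(1) by metis
    have "psum M t S m \<in> V" if V: "V \<in> \<Q>" for V
    proof -
      obtain n where "n \<in> N" "V = C S n" using V N(2) by blast
      then show ?thesis using m Cmono[of n m S] pC[of S m] by blast
    qed
    then show "\<exists>x\<in>carrier M. \<forall>V\<in>\<Q>. x \<in> V" using pc by blast
  qed
  then obtain x where x: "\<And>S. x S \<in> carrier M" "\<And>S n. x S \<in> C S n" by (metis rangeI)
  have half: "S = T"
    if eq: "type_over M A (x S) = type_over M A (x T)" for S T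
  proof (rule ccontr)
    assume "S \<noteq> T"
    then have ex: "\<exists>i. (i \<in> S) \<noteq> (i \<in> T)" by blast
    define i where "i = (LEAST i. (i \<in> S) \<noteq> (i \<in> T))"
    have i: "(i \<in> S) \<noteq> (i \<in> T)" unfolding i_def by (rule LeastI_ex[OF ex])
    have "psum M t S i = psum M t T i"
      by (rule psum_cong) (use not_less_Least in \<open>unfold i_def, blast\<close>)
    \<comment> \<open>Elements of equal type lie in the same cosets definable over \<open>A\<close>.
      Just after the first difference of the branches, however, the two cosets of
      \<open>H (Suc i)\<close> are shifted against each other by \<open>t i\<close>, which is
      outside \<open>H (Suc i)\<close>, so that a common point is impossible.\<close>
    have "x S \<in> C T (Suc i)" "x T \<in> C S (Suc i)"
      using eq x(2) dC unfolding type_over_def by blast+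
    then obtain y where y: "y \<in> C S (Suc i)" "y \<in> C T (Suc i)" using x(2) by blast
    interpret h: additive_subgroup "H (Suc i)" M by (rule H)
    define c where "c = psum M t S i"
    have c: "c \<in> carrier M" "psum M t T i = c"
      using pc \<open>psum M t S i = psum M t T i\<close> by (simp_all add: c_def)
    have yc: "y \<in> carrier M" using y by (simp add: C_def)
    have "y \<ominus>\<^bsub>M\<^esub> (c \<oplus>\<^bsub>M\<^esub> t i) \<in> H (Suc i)" "y \<ominus>\<^bsub>M\<^esub> (c \<oplus>\<^bsub>M\<^esub> \<zero>\<^bsub>M\<^esub>) \<in> H (Suc i)"
      using y i c by (auto simp: C_def c_def[symmetric] split: if_splits)
    then have "(y \<ominus>\<^bsub>M\<^esub> (c \<oplus>\<^bsub>M\<^esub> \<zero>\<^bsub>M\<^esub>)) \<oplus>\<^bsub>M\<^esub> (\<ominus>\<^bsub>M\<^esub> (y \<ominus>\<^bsub>M\<^esub> (c \<oplus>\<^bsub>M\<^esub> t i))) \<in> H (Suc i)"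
      using h.a_closed h.a_inv_closed by blast
    moreover have "(y \<ominus>\<^bsub>M\<^esub> (c \<oplus>\<^bsub>M\<^esub> \<zero>\<^bsub>M\<^esub>)) \<oplus>\<^bsub>M\<^esub> (\<ominus>\<^bsub>M\<^esub> (y \<ominus>\<^bsub>M\<^esub> (c \<oplus>\<^bsub>M\<^esub> t i))) = t i"
      using yc c(1) tc[of i] by algebra
    ultimately show False using t[of i] by simp
  qed
  have "inj (\<lambda>S. type_over M A (x S))" by (rule injI) (rule half)
  moreover have "countable (range (\<lambda>S. type_over M A (x S)))"
    by (rule countable_subset[OF _ cnt[OF A]]) (use x(1) in blast)
  ultimately show False using uncountable_nat_set countable_image_inj_eq by blast
qed

section \<open>Covering an almost internal structure\<close>

text \<open>The one-point sorts beside \<open>s0\<close> stand for imaginary parameters, which a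
  formula reaches only through representatives. An automorphism that fixes \<open>A\<close>
  elementwise preserves such a sort and hence fixes its point.\<close>

definition nice :: "('a, 'm) ring_scheme \<Rightarrow> 'a set \<Rightarrow> 'a sort \<Rightarrow> 'a set \<Rightarrow> bool" where
  "nice M A s0 W \<longleftrightarrow> (\<exists>srt \<Phi>. (\<forall>s\<in>set srt. sort_over M A s \<and> (s = s0 \<or> (\<exists>c. points s = {c}))) \<and>
     family M A srt \<Phi> \<and> (\<forall>us. finite {x \<in> carrier M. \<Phi> x us}) \<and> W = shadow M srt \<Phi>)"

lemma nice_def1: "ring M \<Longrightarrow> A \<subseteq> carrier M \<Longrightarrow> nice M A s0 W \<Longrightarrow> def1 M A W"
  unfolding nice_def by (elim exE conjE) (simp add: family_shadow)

lemma nice_mono: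
  assumes "nice M A s0 W" "A \<subseteq> B" shows "nice M B s0 W"
proof -
  obtain srt \<Phi> where *: "\<forall>s\<in>set srt. sort_over M A s \<and> (s = s0 \<or> (\<exists>c. points s = {c}))"
    "family M A srt \<Phi>" "\<forall>us. finite {x \<in> carrier M. \<Phi> x us}" "W = shadow M srt \<Phi>"
    using assms(1) unfolding nice_def by (elim exE conjE) (rule that)
  have "\<forall>s\<in>set srt. sort_over M B s \<and> (s = s0 \<or> (\<exists>c. points s = {c}))"
    using *(1) sort_over_mono[OF _ assms(2)] by meson
  with family_mono[OF *(2) assms(2)] *(3,4) show ?thesis
    unfolding nice_def by (intro exI conjI)
qed

lemma nice_countable_types:
  assumes "ring M" "saturated M" "uncountable (carrier M)" "minimal_sort M s0"
    and "nice M A s0 W" "countable A" "A \<subseteq> carrier M"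
  shows "countable (type_over M A ` W)"
proof -
  obtain srt \<Phi> where srt: "\<forall>s\<in>set srt. sort_over M A s \<and> (s = s0 \<or> (\<exists>c. points s = {c}))"
    and \<Phi>: "family M A srt \<Phi>" "\<forall>us. finite {x \<in> carrier M. \<Phi> x us}" and W: "W = shadow M srt \<Phi>"
    using assms(5) unfolding nice_def by (elim exE conjE) (rule that)
  have "minimal_sort M s" if "s \<in> set srt" for s
  proof (cases "s = s0")
    case False
    then have "finite (points s)" using srt that by force
    then show ?thesis unfolding minimal_sort_def using finite_subset by blast
  qed (use assms(4) in simp)
  then show ?thesis
    unfolding W using srt \<Phi>(2)
    by (intro countable_types_shadow[OF assms(1-3) \<Phi>(1) assms(6,7)]) auto
qed

section \<open>Imaginary parameters turned into sorts\<close>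

lemma definable_all: "ring M \<Longrightarrow> definable M A n (tuples M n)"
  using definable_dpred[of M A "\<lambda>_. True" n] dpred_True[of M A] by (simp add: ring.ring_simprules(2))

text \<open>An imaginary is the class of any of its representatives \<open>y\<close> under a
  relation definable without parameters. So the set \<open>c\<close>, and with it the sort whose
  only class is \<open>c\<close>, is definable over the entries of \<open>y\<close>.\<close>

lemma imaginary_sort:
  assumes "ring M" "c \<in> imaginaries M"
  shows "\<exists>n. \<forall>y\<in>c. y \<in> tuples M n \<and> sort_over M (set y) (n, c, c \<times> c)"
proof -
  obtain n E where E: "equiv (tuples M n) E" "definable M {} (n + n) (concat_pairs E)" "c \<in> tuples M n // E"
    using assms(2) unfolding imaginaries_def by blast
  have so: "sort_over M {} (n, tuples M n, E)"
    using E definable_all[OF assms(1)] by (simp add: sort_over_def)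
  have zero: "\<zero>\<^bsub>M\<^esub> \<in> carrier M" using assms(1) by (rule ring.ring_simprules(2))
  show ?thesis
  proof (intro exI ballI conjI)
    fix y assume y: "y \<in> c"
    have c: "c = E `` {y}" using E(1,3) y
      by (metis equiv_class_eq_iff quotientE Image_singleton_iff)
    show yt: "y \<in> tuples M n" using E(1) y unfolding c equiv_def by blast
    then have yc: "set y \<subseteq> carrier M" by (simp add: tuples_def)
    have mem: "dpred M (set y) (\<lambda>e. z e \<in> c)" if z: "dlist M (set y) n z" for z
    proof -
      have "dlist M (set y) n (\<lambda>e. y)" by (rule dlist_const[OF order_refl yt])
      then show ?thesis
        using dpred_cls[OF sort_over_mono[OF so, of "set y"] yc, of "\<lambda>e. y" z] z by (simp add: c)
    qed
    have "c \<subseteq> tuples M n" using E(1) unfolding c equiv_def by blast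
    then have 1: "{z \<in> tuples M n. z \<in> c} = c" by blast
    have "dpred M (set y) (\<lambda>e. map (\<lambda>i. e i) [0..<n] \<in> c)" by (intro mem dlist_vars)
    from definable_dpred[OF zero this] have d1: "definable M (set y) n c" unfolding 1 .
    have "dpred M (set y) (\<lambda>e. map (\<lambda>i. e i) [0..<n] \<in> c \<and> map (\<lambda>i. e (n + i)) [0..<n] \<in> c)"
      by (intro dpred_conj mem dlist_vars)
    moreover have "take n (map e [0..<n + n]) = map (\<lambda>i. e i) [0..<n]"
        "drop n (map e [0..<n + n]) = map (\<lambda>i. e (n + i)) [0..<n]" for e :: "nat \<Rightarrow> 'a"
      by (rule nth_equalityI; simp)+
    ultimately have "dpred M (set y) (\<lambda>e. take n (map e [0..<n + n]) \<in> c \<and> drop n (map e [0..<n + n]) \<in> c)"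
      by simp
    from definable_dpred[OF zero this]
    have "definable M (set y) (n + n) {w \<in> tuples M (n + n). take n w \<in> c \<and> drop n w \<in> c}" .
    moreover have "{w \<in> tuples M (n + n). take n w \<in> c \<and> drop n w \<in> c} = concat_pairs (c \<times> c)"
    proof (intro subset_antisym subsetI)
      fix w assume "w \<in> {w \<in> tuples M (n + n). take n w \<in> c \<and> drop n w \<in> c}"
      then show "w \<in> concat_pairs (c \<times> c)" unfolding concat_pairs_def
        by (intro image_eqI[of _ _ "(take n w, drop n w)"]) auto
    next
      fix w assume "w \<in> concat_pairs (c \<times> c)"
      then obtain a b where "a \<in> c" "b \<in> c" "w = a @ b" by (auto simp: concat_pairs_def)
      moreover from this have "a \<in> tuples M n" "b \<in> tuples M n" using \<open>c \<subseteq> tuples M n\<close> by auto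
      ultimately show "w \<in> {w \<in> tuples M (n + n). take n w \<in> c \<and> drop n w \<in> c}"
        by (auto simp: tuples_def)
    qed
    moreover have "equiv c (c \<times> c)" by (auto simp: equiv_def refl_on_def sym_def trans_def)
    ultimately show "sort_over M (set y) (n, c, c \<times> c)"
      using d1 by (simp add: sort_over_def)
  qed
qed

lemma points_Times: "c \<noteq> {} \<Longrightarrow> points (n, c, c \<times> c) = {c}"
  unfolding points_def quotient_def by auto

lemma imaginaries_nonempty: "c \<in> imaginaries M \<Longrightarrow> c \<noteq> {}"
  unfolding imaginaries_def using in_quotient_imp_non_empty by blast

lemma map2_map1: "map2 f (map g xs) ys = map2 (\<lambda>x y. f (g x) y) xs ys"
  by (simp add: zip_map1 case_prod_beta comp_def)

text \<open>The condition has the shape of \<open>definable_eq\<close>, with the imaginary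
  parameters replaced by variable classes. Quantifying over the representatives of one class at a
  time keeps it definable.\<close>

lemma dpred_sorts:
  assumes "list_all2 (\<lambda>y s. dlist M A (fst s) y) ys srt" "\<And>s. s \<in> set srt \<Longrightarrow> sort_over M A s"
    and "A \<subseteq> carrier M" "dlist M A k l" "vars_below \<phi> (k + sum_list (map fst srt))"
  shows "dpred M A (\<lambda>e. \<exists>yss. list_all2 (\<in>) yss (map2 (\<lambda>y s. cls (y e) s) ys srt) \<and>
    sat M \<phi> (l e @ concat yss))"
  using assms
proof (induction srt arbitrary: ys k l rule: list.induct)
  case Nil
  then show ?case using dpred_sat[of M A k l \<phi>] by simp
next
  case (Cons s srt)
  obtain y zs where ys: "ys = y # zs" and y: "dlist M A (fst s) y"
    and zs: "list_all2 (\<lambda>y s. dlist M A (fst s) y) zs srt"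
    using Cons.prems(1) unfolding list_all2_Cons2 by blast
  let ?n = "fst s"
  have s: "sort_over M A s" using Cons.prems(2) by simp
  have zs': "list_all2 (\<lambda>y s. dlist M A (fst s) y) (map (\<lambda>y e. y (\<lambda>i. e (?n + i))) zs) srt"
    unfolding list_all2_map1
    by (rule list_all2_mono[OF zs]) (rule dlist_shift)
  define Q where "Q z e \<longleftrightarrow> z \<in> cls (y e) s \<and> (\<exists>yss. list_all2 (\<in>) yss (map2 (\<lambda>y s. cls (y e) s) zs srt) \<and>
    sat M \<phi> ((l e @ z) @ concat yss))" for z e
  have "dpred M A (\<lambda>e. \<exists>yss. list_all2 (\<in>) yss
      (map2 (\<lambda>y s. cls (y e) s) (map (\<lambda>y e. y (\<lambda>i. e (?n + i))) zs) srt) \<and>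
    sat M \<phi> ((l (\<lambda>i. e (?n + i)) @ map (\<lambda>i. e i) [0..<?n]) @ concat yss))"
    by (rule Cons.IH[OF zs' _ Cons.prems(3) dlist_append[OF dlist_shift[OF Cons.prems(4)] dlist_vars]])
      (use Cons.prems(2,5) in \<open>simp_all add: add.assoc\<close>)
  then have IH: "dpred M A (\<lambda>e. \<exists>yss. list_all2 (\<in>) yss (map2 (\<lambda>y s. cls (y (\<lambda>i. e (?n + i))) s) zs srt) \<and>
    sat M \<phi> ((l (\<lambda>i. e (?n + i)) @ map (\<lambda>i. e i) [0..<?n]) @ concat yss))"
    unfolding map2_map1 .
  have "dpred M A (\<lambda>e. Q (map (\<lambda>i. e i) [0..<?n]) (\<lambda>i. e (?n + i)))"
    unfolding Q_def
    by (rule dpred_conj[OF dpred_cls[OF s Cons.prems(3) dlist_shift[OF y] dlist_vars] IH])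
  then have "dpred M A (\<lambda>e. \<exists>z\<in>tuples M ?n. Q z e)" by (rule dpred_exlist)
  moreover have "(\<exists>z\<in>tuples M ?n. Q z e) \<longleftrightarrow>
    (\<exists>yss. list_all2 (\<in>) yss (map2 (\<lambda>y s. cls (y e) s) (y # zs) (s # srt)) \<and> sat M \<phi> (l e @ concat yss))" for e
  proof
    assume "\<exists>z\<in>tuples M ?n. Q z e"
    then obtain z yss where "z \<in> cls (y e) s" "list_all2 (\<in>) yss (map2 (\<lambda>y s. cls (y e) s) zs srt)"
      "sat M \<phi> ((l e @ z) @ concat yss)" unfolding Q_def by blast
    then show "\<exists>yss. list_all2 (\<in>) yss (map2 (\<lambda>y s. cls (y e) s) (y # zs) (s # srt)) \<and> sat M \<phi> (l e @ concat yss)"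
      by (intro exI[of _ "z # yss"]) simp
  next
    assume "\<exists>yss. list_all2 (\<in>) yss (map2 (\<lambda>y s. cls (y e) s) (y # zs) (s # srt)) \<and> sat M \<phi> (l e @ concat yss)"
    then obtain z yss where *: "z \<in> cls (y e) s" "list_all2 (\<in>) yss (map2 (\<lambda>y s. cls (y e) s) zs srt)"
      "sat M \<phi> (l e @ concat (z # yss))" by (auto simp: list_all2_Cons2)
    have "z \<in> tuples M ?n" using in_sort_tuples[OF s] in_cls[OF s *(1)] by blast
    with * show "\<exists>z\<in>tuples M ?n. Q z e" unfolding Q_def by auto
  qed
  ultimately show ?case unfolding ys by simp
qed

text \<open>The sort is an imaginary, regarded as a sort with one point, or the strongly minimal set.\<close>

definition sorted_params :: "('a, 'm) ring_scheme \<Rightarrow> 'a set \<Rightarrow> 'a list set list \<Rightarrow> 'a sort list \<Rightarrow> bool" where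
  "sorted_params M A cs srt \<longleftrightarrow> in_points cs srt \<and> (\<forall>s\<in>set srt. sort_over M A s)"

text \<open>The total length of the representatives depends on the sorts alone. Hence the bound on
  the variables in \<open>definable_eq\<close> holds for all choices of representatives or for
  none.\<close>

lemma sorted_params_length:
  "sorted_params M A cs srt \<Longrightarrow> list_all2 (\<in>) yss cs \<Longrightarrow> length (concat yss) = sum_list (map fst srt)"
proof (induction srt arbitrary: cs yss)
  case Nil
  then show ?case by (simp add: sorted_params_def in_points_Nil)
next
  case (Cons s srt)
  obtain c cs' where cs: "cs = c # cs'" "c \<in> points s" "in_points cs' srt"
    using Cons.prems(1) by (auto simp: sorted_params_def in_points_def list_all2_Cons2)
  obtain y yss' where yss: "yss = y # yss'" "y \<in> c" "list_all2 (\<in>) yss' cs'"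
    using Cons.prems(2) unfolding cs(1) list_all2_Cons2 by blast
  have s: "sort_over M A s" using Cons.prems(1) by (simp add: sorted_params_def)
  obtain z where "c = cls z s" using cs(2) by (rule pointsE)
  then have "y \<in> tuples M (fst s)" using in_cls[OF s] in_sort_tuples[OF s] yss(2) by blast
  then have "length y = fst s" by (simp add: tuples_def)
  moreover have "sorted_params M A cs' srt" using Cons.prems(1) cs(3) by (simp add: sorted_params_def)
  ultimately show ?case using Cons.IH yss(1,3) by simp
qed

lemma sorted_params_definable:
  assumes "ring M" "sorted_params M A cs srt" "A \<subseteq> carrier M" "\<And>c. c \<in> set cs \<Longrightarrow> \<exists>y\<in>c. set y \<subseteq> A"
    and X: "X = {xs \<in> tuples M n. \<exists>yss. list_all2 (\<in>) yss cs \<and>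
            vars_below \<phi> (n + length (concat yss)) \<and> sat M \<phi> (xs @ concat yss)}"
  shows "definable M A n X"
proof (cases "vars_below \<phi> (n + sum_list (map fst srt))")
  case True
  have "\<forall>c\<in>set cs. \<exists>y. y \<in> c \<and> set y \<subseteq> A" using assms(4) by blast
  then obtain r where r: "\<forall>c\<in>set cs. r c \<in> c \<and> set (r c) \<subseteq> A" by metis
  have *: "list_all2 (\<lambda>y s. dlist M A (fst s) y) (map (\<lambda>c e. r c) cs) srt \<and>
      map2 (\<lambda>y s. cls (y e) s) (map (\<lambda>c e. r c) cs) srt = cs" for e :: "nat \<Rightarrow> 'a"
    using assms(2) r
  proof (induction srt arbitrary: cs)
    case Nil
    then show ?case by (simp add: sorted_params_def in_points_Nil)
  next
    case (Cons s srt)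
    obtain c cs' where cs: "cs = c # cs'" "c \<in> points s" "in_points cs' srt"
      using Cons.prems(1) by (auto simp: sorted_params_def in_points_def list_all2_Cons2)
    have s: "sort_over M A s" using Cons.prems(1) by (simp add: sorted_params_def)
    obtain z where z: "c = cls z s" using cs(2) by (rule pointsE)
    have rc: "r c \<in> c" "set (r c) \<subseteq> A" using Cons.prems(2) cs(1) by simp_all
    then have "r c \<in> tuples M (fst s)" "cls (r c) s = c"
      using in_cls[OF s] in_sort_tuples[OF s] cls_eq[OF s] z by blast+
    moreover have "sorted_params M A cs' srt" using Cons.prems(1) cs(3) by (simp add: sorted_params_def)
    ultimately show ?case using Cons.IH[of cs'] Cons.prems(2) cs(1) rc
      by (simp add: dlist_const)
  qed
  have "dpred M A (\<lambda>e. \<exists>yss. list_all2 (\<in>) yss cs \<and> sat M \<phi> (map (\<lambda>i. e i) [0..<n] @ concat yss))"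
    using dpred_sorts[OF conjunct1[OF *] _ assms(3) dlist_vars True, of "\<lambda>i. i"] assms(2)
    unfolding conjunct2[OF *] sorted_params_def by simp
  from definable_dpred[OF ring.ring_simprules(2)[OF assms(1)] this]
  have "definable M A n {xs \<in> tuples M n. \<exists>yss. list_all2 (\<in>) yss cs \<and> sat M \<phi> (xs @ concat yss)}" .
  moreover have "{xs \<in> tuples M n. \<exists>yss. list_all2 (\<in>) yss cs \<and> sat M \<phi> (xs @ concat yss)} = X"
    unfolding X using sorted_params_length[OF assms(2)] True by (metis (lifting))
  ultimately show ?thesis by simp
next
  case False
  \<comment> \<open>The bound on the variables now fails for every choice of
    representatives.\<close>
  then have "X = {}" unfolding X using sorted_params_length[OF assms(2)] by fastforce
  moreover have "definable M A n {}"
    using definable_dpred[OF ring.ring_simprules(2)[OF assms(1)] dpred_bool[of M A False], of n] by simp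
  ultimately show ?thesis by simp
qed


text \<open>A formula mentions finitely many imaginaries, and each of them can be exchanged for the
  entries of one representative.\<close>

lemma definable_eq_definable:
  assumes M: "ring M" and B: "B \<subseteq> imaginaries M" and X: "definable_eq M B n X"
  shows "\<exists>A. finite A \<and> A \<subseteq> carrier M \<and> definable M A n X"
proof -
  obtain \<phi> cs where cs: "set cs \<subseteq> B" and X: "X = {xs \<in> tuples M n. \<exists>yss. list_all2 (\<in>) yss cs \<and>
            vars_below \<phi> (n + length (concat yss)) \<and> sat M \<phi> (xs @ concat yss)}"
    using X unfolding definable_eq_def by blast
  define r where "r c = (SOME y. y \<in> c)" for c :: "'a list set"
  have r: "r c \<in> c" if "c \<in> set cs" for c
    unfolding r_def using imaginaries_nonempty[of c M] that cs B by (intro some_in_eq[THEN iffD2]) blast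
  have "\<exists>n. \<forall>y\<in>c. y \<in> tuples M n \<and> sort_over M (set y) (n, c, c \<times> c)" if "c \<in> set cs" for c
    using imaginary_sort[OF M] that cs B by blast
  then obtain N where N: "\<And>c y. c \<in> set cs \<Longrightarrow> y \<in> c \<Longrightarrow> y \<in> tuples M (N c) \<and> sort_over M (set y) (N c, c, c \<times> c)"
    by metis
  define A where "A = (\<Union>c\<in>set cs. set (r c))"
  have A: "finite A" "A \<subseteq> carrier M"
    using N r by (auto simp: A_def tuples_def)
  have rA: "set (r c) \<subseteq> A" if "c \<in> set cs" for c using that by (auto simp: A_def)
  have "sorted_params M A cs (map (\<lambda>c. (N c, c, c \<times> c)) cs)"
    unfolding sorted_params_def in_points_def
  proof (intro conjI ballI)
    show "list_all2 (\<lambda>u s. u \<in> points s) cs (map (\<lambda>c. (N c, c, c \<times> c)) cs)"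
      using r points_Times by (auto simp: list_all2_map2 list_all2_same)
    fix s assume "s \<in> set (map (\<lambda>c. (N c, c, c \<times> c)) cs)"
    then obtain c where c: "c \<in> set cs" "s = (N c, c, c \<times> c)" by auto
    show "sort_over M A s" unfolding c(2)
      by (rule sort_over_mono[OF conjunct2[OF N[OF c(1) r[OF c(1)]]] rA[OF c(1)]])
  qed
  from sorted_params_definable[OF M this A(2) _ X] have "definable M A n X" using r rA by blast
  with A show ?thesis by blast
qed

lemma dpred_in_sorts:
  assumes "list_all2 (\<lambda>y s. dlist M A (fst s) y) ys srt" "\<And>s. s \<in> set srt \<Longrightarrow> sort_over M A s"
    and "A \<subseteq> carrier M"
  shows "dpred M A (\<lambda>e. list_all2 (\<lambda>y s. in_sort (y e) s) ys srt)"
  using assms(1,2)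
proof (induction ys srt rule: list_all2_induct)
  case Nil
  show ?case using dpred_True[of M A] by simp
next
  case (Cons y ys s srt)
  have "dpred M A (\<lambda>e. in_sort (y e) s \<and> list_all2 (\<lambda>y s. in_sort (y e) s) ys srt)"
    by (rule dpred_conj[OF dpred_in_sort[OF _ assms(3) Cons.hyps(1)] Cons.IH]) (use Cons.prems in simp_all)
  then show ?case by simp
qed

text \<open>Algebraicity of \<open>x\<close> over \<open>B\<close> and \<open>F\<close> is witnessed
  by a finite quotient \<open>X // E\<close>. Turning the imaginaries that occur in the definitions
  of \<open>X\<close> and \<open>E\<close> into variable points yields a family with
  \<open>x\<close> in its fibre over the actual points; adding a bound on the number of solutions
  makes all its fibres finite.\<close>

lemma nice_cover_point:
  assumes M: "ring M" and B: "B \<subseteq> imaginaries M" and s0: "sort_over M A0 s0" "A0 \<subseteq> carrier M" "finite A0"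
    and F: "F \<subseteq> points s0" "algebraic M (B \<union> F) {[x]}" and x: "x \<in> carrier M"
    and r: "\<And>c. c \<in> B \<Longrightarrow> r c \<in> c"
  shows "\<exists>A W. A \<subseteq> A0 \<union> (\<Union>c\<in>B. set (r c)) \<and> finite A \<and> nice M A s0 W \<and> x \<in> W"
proof -
  have "\<exists>n. \<forall>y\<in>c. y \<in> tuples M n \<and> sort_over M (set y) (n, c, c \<times> c)" if "c \<in> B" for c
    using imaginary_sort[OF M] that B by blast
  then obtain N where N: "\<And>c y. c \<in> B \<Longrightarrow> y \<in> c \<Longrightarrow> y \<in> tuples M (N c) \<and> sort_over M (set y) (N c, c, c \<times> c)"
    by metis
  \<comment> \<open>A parameter from \<open>B\<close> gets a sort of its own, even if it is also a
    point of \<open>s0\<close>; all others range over \<open>s0\<close>.\<close>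
  define sof where "sof c = (if c \<in> B then (N c, c, c \<times> c) else s0)" for c
  obtain Z where Z: "interpretable M (B \<union> F) Z" "finite Z" "{[x]} \<in> Z"
    using F(2) unfolding algebraic_def by blast
  obtain n X E where XE: "definable_eq M (B \<union> F) n X" "equiv X E"
      "definable_eq M (B \<union> F) (n + n) (concat_pairs E)" "Z = X // E"
    using Z(1) unfolding interpretable_def by blast
  obtain \<phi> cs where cs: "set cs \<subseteq> B \<union> F" and X: "X = {xs \<in> tuples M n. \<exists>yss. list_all2 (\<in>) yss cs \<and>
            vars_below \<phi> (n + length (concat yss)) \<and> sat M \<phi> (xs @ concat yss)}"
    using XE(1) unfolding definable_eq_def by blast
  obtain \<psi> ds where ds: "set ds \<subseteq> B \<union> F" and E: "concat_pairs E = {xs \<in> tuples M (n + n). \<exists>yss. list_all2 (\<in>) yss ds \<and>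
            vars_below \<psi> (n + n + length (concat yss)) \<and> sat M \<psi> (xs @ concat yss)}"
    using XE(3) unfolding definable_eq_def by blast
  obtain z where z: "z \<in> X" "{[x]} = E `` {z}" using Z(3) unfolding XE(4) by (rule quotientE)
  then have "z = [x]" using XE(2) equiv_class_self by fastforce
  with z have xX: "[x] \<in> X" "E `` {[x]} = {[x]}" by simp_all
  then have n: "n = 1" unfolding X by (simp add: tuples_def)
  define A where "A = A0 \<union> (\<Union>c\<in>(set cs \<union> set ds) \<inter> B. set (r c))"
  have rB: "set (r c) \<subseteq> carrier M" if "c \<in> B" for c
    using N[OF that r[OF that]] by (simp add: tuples_def)
  have A: "A \<subseteq> A0 \<union> (\<Union>c\<in>B. set (r c))" "finite A" "A \<subseteq> carrier M"
    using s0(2,3) rB by (auto simp: A_def)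
  have so: "c \<in> points (sof c) \<and> sort_over M A (sof c) \<and> (sof c = s0 \<or> (\<exists>d. points (sof c) = {d}))"
    if "c \<in> set cs \<union> set ds" for c
  proof (cases "c \<in> B")
    case True
    have "set (r c) \<subseteq> A" using that True by (auto simp: A_def)
    then have "sort_over M A (N c, c, c \<times> c)"
      using N[OF True r[OF True]] sort_over_mono by blast
    moreover have "points (N c, c, c \<times> c) = {c}" using r[OF True] by (intro points_Times) blast
    ultimately show ?thesis using True by (simp add: sof_def)
  next
    case False
    then have "c \<in> points s0" using that cs ds F(1) by blast
    moreover have "A0 \<subseteq> A" by (auto simp: A_def)
    then have "sort_over M A s0" by (rule sort_over_mono[OF s0(1)])
    ultimately show ?thesis using False by (simp add: sof_def)
  qed
  have sp: "sorted_params M A us (map sof us)" if "set us \<subseteq> set cs \<union> set ds" for us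
    using that so unfolding sorted_params_def in_points_def by (auto simp: list_all2_map2 list_all2_same)
  define m where "m = length cs"
  let ?s1 = "map sof cs" and ?s2 = "map sof ds"
  obtain yss where "list_all2 (\<in>) yss cs" "vars_below \<phi> (1 + length (concat yss))"
    using xX(1) unfolding X n by blast
  then have vb1: "vars_below \<phi> (1 + sum_list (map fst ?s1))"
    using sorted_params_length[OF sp[of cs]] by simp
  have "[x] @ [x] \<in> concat_pairs E"
    using xX(2) unfolding concat_pairs_def by (intro image_eqI[of _ _ "([x], [x])"]) auto
  then obtain yss where "list_all2 (\<in>) yss ds" "vars_below \<psi> (1 + 1 + length (concat yss))"
    unfolding E n by blast
  then have vb2: "vars_below \<psi> (1 + 1 + sum_list (map fst ?s2))"
    using sorted_params_length[OF sp[of ds]] by simp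
  \<comment> \<open>For the actual parameters \<open>cs @ ds\<close> this says that
    \<open>[y]\<close> lies in \<open>X\<close> and is alone in its class. The first
    \<open>m\<close> points are the parameters of \<open>X\<close>, the others those of
    \<open>E\<close>.\<close>
  define G where "G y us \<longleftrightarrow> (\<exists>yss. list_all2 (\<in>) yss (take m us) \<and> sat M \<phi> ([y] @ concat yss)) \<and>
    (\<forall>z\<in>carrier M. (\<exists>yss. list_all2 (\<in>) yss (drop m us) \<and> sat M \<psi> (([y] @ [z]) @ concat yss)) \<longrightarrow> z = y)" for y us
  have srt: "\<And>s. s \<in> set (?s1 @ ?s2) \<Longrightarrow> sort_over M A s" using so by auto
  have dG: "dpred M A' (\<lambda>e. G (t e) (map2 (\<lambda>y s. cls (y e) s) ys (?s1 @ ?s2)))"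
    if A': "A \<subseteq> A'" "A' \<subseteq> carrier M" and t: "dterm M A' t"
      and ys: "list_all2 (\<lambda>y s. dlist M A' (fst s) y) ys (?s1 @ ?s2)" for A' t ys
  proof -
    have "length ys = length (?s1 @ ?s2)" using ys by (rule list_all2_lengthD)
    then have tk: "take m (map2 (\<lambda>y s. cls (y e) s) ys (?s1 @ ?s2)) = map2 (\<lambda>y s. cls (y e) s) (take m ys) ?s1"
      "drop m (map2 (\<lambda>y s. cls (y e) s) ys (?s1 @ ?s2)) = map2 (\<lambda>y s. cls (y e) s) (drop m ys) ?s2" for e
      by (simp_all add: take_map drop_map take_zip drop_zip m_def)
    have ys1: "list_all2 (\<lambda>y s. dlist M A' (fst s) y) (take m ys) ?s1"
      using list_all2_takeI[OF ys, of m] by (simp add: m_def)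
    have "list_all2 (\<lambda>y s. dlist M A' (fst s) y) (drop m ys) ?s2"
      using list_all2_dropI[OF ys, of m] by (simp add: m_def)
    then have ys2: "list_all2 (\<lambda>y s. dlist M A' (fst s) y) (map (\<lambda>y e. y (\<lambda>i. e (Suc i))) (drop m ys)) ?s2"
      unfolding list_all2_map1[of _ "\<lambda>y e. y (\<lambda>i. e (Suc i))"]
      by (rule list_all2_mono) (rule dlist_shift)
    have srt': "sort_over M A' s" if "s \<in> set (?s1 @ ?s2)" for s
      by (rule sort_over_mono[OF srt[OF that] A'(1)])
    have 1: "dpred M A' (\<lambda>e. \<exists>yss. list_all2 (\<in>) yss (map2 (\<lambda>y s. cls (y e) s) (take m ys) ?s1) \<and>
        sat M \<phi> ([t e] @ concat yss))"
      by (rule dpred_sorts[OF ys1 _ A'(2) dlist_single[OF t] vb1]) (rule srt', simp)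
    have "dpred M A' (\<lambda>e. \<exists>yss. list_all2 (\<in>) yss
        (map2 (\<lambda>y s. cls (y e) s) (map (\<lambda>y e. y (\<lambda>i. e (Suc i))) (drop m ys)) ?s2) \<and>
        sat M \<psi> (([t (\<lambda>i. e (Suc i))] @ [e 0]) @ concat yss))"
      by (rule dpred_sorts[OF ys2 _ A'(2) dlist_append[OF dlist_single[OF dterm_shift[OF t]]
        dlist_single[OF dterm_var]] vb2]) (rule srt', simp)
    then have "dpred M A' (\<lambda>e. \<exists>yss. list_all2 (\<in>) yss
        (map2 (\<lambda>y s. cls (y (\<lambda>i. e (Suc i))) s) (drop m ys) ?s2) \<and>
        sat M \<psi> (([t (\<lambda>i. e (Suc i))] @ [e 0]) @ concat yss))"
      unfolding map2_map1 .
    then have "dpred M A' (\<lambda>e. (\<exists>yss. list_all2 (\<in>) yss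
        (map2 (\<lambda>y s. cls (y (\<lambda>i. e (Suc i))) s) (drop m ys) ?s2) \<and>
        sat M \<psi> (([t (\<lambda>i. e (Suc i))] @ [e 0]) @ concat yss)) \<longrightarrow> e 0 = t (\<lambda>i. e (Suc i)))"
      by (rule dpred_imp) (intro dpred_eq dterm_var dterm_shift[OF t])
    then have 2: "dpred M A' (\<lambda>e. \<forall>z\<in>carrier M. (\<exists>yss. list_all2 (\<in>) yss
        (map2 (\<lambda>y s. cls (y e) s) (drop m ys) ?s2) \<and>
        sat M \<psi> (([t e] @ [z]) @ concat yss)) \<longrightarrow> z = t e)"
      by (rule dpred_all)
    show ?thesis unfolding G_def tk by (rule dpred_conj[OF 1 2])
  qed
  have Gx: "{y \<in> carrier M. G y (cs @ ds)} = {y \<in> carrier M. [y] \<in> X \<and> E `` {[y]} = {[y]}}"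
  proof -
    have 1: "(\<exists>yss. list_all2 (\<in>) yss cs \<and> sat M \<phi> ([y] @ concat yss)) \<longleftrightarrow> [y] \<in> X"
      if "y \<in> carrier M" for y
      using vb1 sorted_params_length[OF sp[of cs]] that unfolding X n by (auto simp: tuples_def)
    have 2: "(\<exists>yss. list_all2 (\<in>) yss ds \<and> sat M \<psi> (([y] @ [z]) @ concat yss)) \<longleftrightarrow> ([y], [z]) \<in> E"
      if "y \<in> carrier M" "z \<in> carrier M" for y z
    proof -
      have sub: "E \<subseteq> X \<times> X" "X \<subseteq> tuples M 1" using XE(2) unfolding equiv_def X n by blast+
      have "(\<exists>yss. list_all2 (\<in>) yss ds \<and> sat M \<psi> (([y] @ [z]) @ concat yss)) \<longleftrightarrow> [y] @ [z] \<in> concat_pairs E"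
        using vb2 sorted_params_length[OF sp[of ds]] that unfolding E n by (auto simp: tuples_def)
      also have "\<dots> \<longleftrightarrow> ([y], [z]) \<in> E" by (rule concat_pairs_iff[OF sub]) simp
      finally show ?thesis .
    qed
    have 3: "(\<forall>z\<in>carrier M. ([y], [z]) \<in> E \<longrightarrow> z = y) \<longleftrightarrow> E `` {[y]} = {[y]}" if y: "[y] \<in> X" for y
    proof -
      have "w \<in> (\<lambda>a. [a]) ` carrier M" if "([y], w) \<in> E" for w
        using that XE(2) tuples_1[of M] unfolding equiv_def X n One_nat_def by blast
      moreover have "([y], [y]) \<in> E" using XE(2) y unfolding equiv_def refl_on_def by blast
      ultimately show ?thesis by auto
    qed
    have "G y (cs @ ds) \<longleftrightarrow> [y] \<in> X \<and> E `` {[y]} = {[y]}" if y: "y \<in> carrier M" for y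
      unfolding G_def using 1[OF y] 2[OF y] 3[of y] by (auto simp: m_def)
    then show ?thesis by blast
  qed
  have "(\<lambda>y. {[y]}) ` {y \<in> carrier M. G y (cs @ ds)} \<subseteq> Z"
    unfolding Gx XE(4) by (auto simp: quotient_def)
  then have "finite ((\<lambda>y. {[y]}) ` {y \<in> carrier M. G y (cs @ ds)})" using Z(2) by (rule finite_subset)
  then have "finite {y \<in> carrier M. G y (cs @ ds)}" by (rule finite_imageD) (simp add: inj_on_def)
  then obtain zs where zs: "set zs = {y \<in> carrier M. G y (cs @ ds)}" using finite_list by blast
  \<comment> \<open>Requiring a list of \<open>k\<close> elements that contains all solutions is a
    first-order way to bound every fibre; at \<open>cs @ ds\<close> the list \<open>zs\<close>
    satisfies it.\<close>
  define k where "k = length zs"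
  define \<Phi> where "\<Phi> y us \<longleftrightarrow> G y us \<and> (\<exists>zs\<in>tuples M k. \<forall>z\<in>carrier M. G z us \<longrightarrow> z \<in> set zs)" for y us
  have "family M A (?s1 @ ?s2) \<Phi>"
    unfolding family_def
  proof (intro allI impI, elim conjE)
    fix A' t ys
    assume A': "A \<subseteq> A'" "A' \<subseteq> carrier M" and t: "dterm M A' t"
      and ys: "list_all2 (\<lambda>y s. dlist M A' (fst s) y) ys (?s1 @ ?s2)"
    have "dpred M A' (\<lambda>e. list_all2 (\<lambda>y s. in_sort (y e) s) ys (?s1 @ ?s2))"
      by (rule dpred_in_sorts[OF ys _ A'(2)]) (rule sort_over_mono[OF srt A'(1)])
    moreover have "dpred M A' (\<lambda>e. \<Phi> (t e) (map2 (\<lambda>y s. cls (y e) s) ys (?s1 @ ?s2)))"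
      unfolding \<Phi>_def
    proof (rule dpred_conj[OF dG[OF A' t ys]])
      define ys' where "ys' = map (\<lambda>y e. y (\<lambda>i. e (Suc (k + i)))) ys"
      have "list_all2 (\<lambda>y s. dlist M A' (fst s) y) ys' (?s1 @ ?s2)"
        unfolding ys'_def list_all2_map1[of _ "\<lambda>y e. y (\<lambda>i. e (Suc (k + i)))"]
        by (rule list_all2_mono[OF ys]) (rule dlist_shift)
      from dG[OF A' dterm_var this]
      have "dpred M A' (\<lambda>e. G (e 0) (map2 (\<lambda>y s. cls (y (\<lambda>i. e (Suc (k + i)))) s) ys (?s1 @ ?s2)))"
        unfolding ys'_def map2_map1 .
      then have "dpred M A' (\<lambda>e. G (e 0) (map2 (\<lambda>y s. cls (y (\<lambda>i. e (Suc (k + i)))) s) ys (?s1 @ ?s2)) \<longrightarrow>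
          e 0 \<in> set (map (\<lambda>i. e (Suc i)) [0..<k]))"
        by (rule dpred_imp) (rule dpred_in_set[OF dlist_vars dterm_var])
      then have "dpred M A' (\<lambda>e. \<forall>z\<in>carrier M. G z (map2 (\<lambda>y s. cls (y (\<lambda>i. e (k + i))) s) ys (?s1 @ ?s2)) \<longrightarrow>
          z \<in> set (map (\<lambda>i. e i) [0..<k]))"
        by (rule dpred_all)
      then show "dpred M A' (\<lambda>e. \<exists>zs\<in>tuples M k. \<forall>z\<in>carrier M.
          G z (map2 (\<lambda>y s. cls (y e) s) ys (?s1 @ ?s2)) \<longrightarrow> z \<in> set zs)"
        by (rule dpred_exlist)
    qed
    ultimately show "dpred M A' (\<lambda>e. list_all2 (\<lambda>y s. in_sort (y e) s) ys (?s1 @ ?s2) \<and>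
        \<Phi> (t e) (map2 (\<lambda>y s. cls (y e) s) ys (?s1 @ ?s2)))"
      by (rule dpred_conj)
  qed
  moreover have "finite {y \<in> carrier M. \<Phi> y us}" for us
  proof (cases "\<exists>zs\<in>tuples M k. \<forall>z\<in>carrier M. G z us \<longrightarrow> z \<in> set zs")
    case True
    then obtain zs where "\<forall>z\<in>carrier M. G z us \<longrightarrow> z \<in> set zs" by blast
    then have "{y \<in> carrier M. \<Phi> y us} \<subseteq> set zs" by (auto simp: \<Phi>_def)
    then show ?thesis using finite_subset by blast
  next
    case False
    then have "{y \<in> carrier M. \<Phi> y us} = {}" by (auto simp: \<Phi>_def)
    then show ?thesis by (simp only: finite.emptyI)
  qed
  moreover have "\<forall>s\<in>set (?s1 @ ?s2). sort_over M A s \<and> (s = s0 \<or> (\<exists>c. points s = {c}))"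
  proof
    fix s assume "s \<in> set (?s1 @ ?s2)"
    then obtain c where "c \<in> set cs \<union> set ds" "s = sof c" by auto
    then show "sort_over M A s \<and> (s = s0 \<or> (\<exists>c. points s = {c}))" using so[of c] by simp
  qed
  ultimately have "nice M A s0 (shadow M (?s1 @ ?s2) \<Phi>)"
    unfolding nice_def by (intro exI[of _ "?s1 @ ?s2"] exI[of _ \<Phi>] conjI allI refl)
  moreover have "x \<in> shadow M (?s1 @ ?s2) \<Phi>"
  proof -
    have "in_points (cs @ ds) (?s1 @ ?s2)"
      using sp[of "cs @ ds"] unfolding sorted_params_def by simp
    moreover have "G x (cs @ ds)" using Gx xX x by blast
    moreover have "zs \<in> tuples M k" "\<forall>z\<in>carrier M. G z (cs @ ds) \<longrightarrow> z \<in> set zs"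
      using zs by (auto simp: tuples_def k_def)
    ultimately show ?thesis using x unfolding shadow_def \<Phi>_def by blast
  qed
  ultimately show ?thesis using A by blast
qed

text \<open>For infinite \<open>B\<close> the union is covered by pairs of an element of
  \<open>B\<close> and a position in its list, and \<open>B \<times> nat\<close> is no larger than
  \<open>B\<close>. The finite set \<open>A0\<close> is absorbed by prefixing its elements to each
  list.\<close>

lemma Union_lists_lesspoll:
  assumes "B \<prec> C" "infinite C" "finite A0"
  shows "A0 \<union> (\<Union>c\<in>B. set (r c)) \<prec> C"
proof (cases "finite B")
  case True
  then show ?thesis using assms by (intro finite_lesspoll_infinite) auto
next
  case False
  obtain as where as: "set as = A0" using finite_list[OF assms(3)] by blast
  define r' where "r' c = as @ r c" for c
  have "A0 \<union> (\<Union>c\<in>B. set (r c)) \<subseteq> (\<lambda>(c, i). r' c ! i) ` (B \<times> (UNIV :: nat set))"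
  proof
    fix a assume "a \<in> A0 \<union> (\<Union>c\<in>B. set (r c))"
    moreover have "B \<noteq> {}" using False by auto
    ultimately obtain c where "c \<in> B" "a \<in> set (r' c)" by (auto simp: r'_def as)
    then show "a \<in> (\<lambda>(c, i). r' c ! i) ` (B \<times> (UNIV :: nat set))" by (force simp: in_set_conv_nth)
  qed
  then have "A0 \<union> (\<Union>c\<in>B. set (r c)) \<lesssim> B \<times> (UNIV :: nat set)"
    by (meson image_lepoll lepoll_trans subset_imp_lepoll)
  also have "B \<times> (UNIV :: nat set) \<lesssim> B \<times> B"
    using False by (intro times_lepoll_mono) (simp_all add: infinite_le_lepoll)
  also have "B \<times> B \<lesssim> B"
    using card_of_Times_same_infinite[OF False] by (simp add: lepoll_def card_of_ordIso[symmetric] bij_betw_def) blast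
  finally show ?thesis using assms(1) by (rule lesspoll_trans1)
qed

text \<open>By \<open>nice_cover_point\<close> the nice sets over finite subsets of \<open>C\<close>
  cover \<open>M\<close>. The set \<open>C\<close> of representatives is small because
  \<open>B\<close> is, so saturation applies to the complements and gives a finite subcover, which
  involves finitely many parameters.\<close>

lemma internal_finite_cover:
  assumes M: "ring M" "saturated M" and s0: "sort_over M A0 s0" "A0 \<subseteq> carrier M" "finite A0"
    and B: "B \<subseteq> imaginaries M" "B \<prec> carrier M"
    and alg: "\<And>x. x \<in> carrier M \<Longrightarrow> \<exists>F\<subseteq>points s0. finite F \<and> algebraic M (B \<union> F) {[x]}"
  shows "\<exists>A \<W>. finite A \<and> A0 \<subseteq> A \<and> A \<subseteq> carrier M \<and> finite \<W> \<and> (\<forall>W\<in>\<W>. nice M A s0 W) \<and> carrier M \<subseteq> \<Union>\<W>"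
proof -
  define r where "r c = (SOME y. y \<in> c)" for c :: "'a list set"
  have r: "r c \<in> c" if "c \<in> B" for c
    unfolding r_def using imaginaries_nonempty[of c M] that B by (intro some_in_eq[THEN iffD2]) blast
  have rc: "set (r c) \<subseteq> carrier M" if "c \<in> B" for c
    using imaginary_sort[OF M(1), of c] r[OF that] B(1) that by (auto simp: tuples_def)
  define C where "C = A0 \<union> (\<Union>c\<in>B. set (r c))"
  have inf: "infinite (carrier M)" using M(2) by (simp add: saturated_def)
  have C: "C \<subseteq> carrier M" "C \<prec> carrier M"
    using s0(2) rc Union_lists_lesspoll[OF B(2) inf s0(3)] by (auto simp: C_def)
  define \<S> where "\<S> = {carrier M - W | W. \<exists>A. A \<subseteq> C \<and> finite A \<and> nice M A s0 W}"
  have "\<not> (\<exists>x\<in>carrier M. \<forall>S\<in>\<S>. x \<in> S)"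
  proof
    assume "\<exists>x\<in>carrier M. \<forall>S\<in>\<S>. x \<in> S"
    then obtain x where x: "x \<in> carrier M" "\<And>S. S \<in> \<S> \<Longrightarrow> x \<in> S" by blast
    obtain F where "F \<subseteq> points s0" "algebraic M (B \<union> F) {[x]}" using alg[OF x(1)] by blast
    from nice_cover_point[OF M(1) B(1) s0 this x(1) r]
    obtain A W where "A \<subseteq> C" "finite A" "nice M A s0 W" "x \<in> W" unfolding C_def by blast
    then show False using x(2)[of "carrier M - W"] unfolding \<S>_def by blast
  qed
  moreover have "def1 M C S" if "S \<in> \<S>" for S
    using that nice_def1[OF M(1)] def1_compl[OF M(1) C(1)] nice_mono C(1) unfolding \<S>_def by blast
  ultimately obtain \<Q> where Q: "\<Q> \<subseteq> \<S>" "finite \<Q>" "\<not> (\<exists>x\<in>carrier M. \<forall>S\<in>\<Q>. x \<in> S)"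
    using saturated_Inter[OF M(2) C, of \<S>] by blast
  have "\<forall>S\<in>\<Q>. \<exists>W A. S = carrier M - W \<and> A \<subseteq> C \<and> finite A \<and> nice M A s0 W"
    using Q(1) unfolding \<S>_def by blast
  then obtain W A where WA: "\<And>S. S \<in> \<Q> \<Longrightarrow> S = carrier M - W S \<and> A S \<subseteq> C \<and> finite (A S) \<and> nice M (A S) s0 (W S)"
    by metis
  define A' where "A' = A0 \<union> (\<Union>S\<in>\<Q>. A S)"
  have "finite A'" "A0 \<subseteq> A'" using WA Q(2) s0(3) by (auto simp: A'_def)
  moreover have "A' \<subseteq> carrier M" using WA C(1) s0(2) unfolding A'_def by blast
  moreover have "\<forall>V\<in>W ` \<Q>. nice M A' s0 V"
  proof
    fix V assume "V \<in> W ` \<Q>"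
    then obtain S where S: "S \<in> \<Q>" "V = W S" by blast
    have "A S \<subseteq> A'" using S(1) by (auto simp: A'_def)
    then show "nice M A' s0 V" using WA[OF S(1)] nice_mono S(2) by blast
  qed
  moreover have "carrier M \<subseteq> \<Union>(W ` \<Q>)" using Q(3) WA by blast
  ultimately show ?thesis using Q(2) by blast
qed

lemma internal_countable_types:
  assumes M: "ring M" "saturated M" "uncountable (carrier M)" "minimal_sort M s0"
    and "finite \<W>" "\<And>W. W \<in> \<W> \<Longrightarrow> nice M A0 s0 W" "carrier M \<subseteq> \<Union>\<W>"
    and A: "countable A" "A0 \<subseteq> A" "A \<subseteq> carrier M"
  shows "countable (type_over M A ` carrier M)"
proof -
  have "countable (\<Union>W\<in>\<W>. type_over M A ` W)"
    by (intro countable_UN countable_finite assms(5) nice_countable_types[OF M nice_mono[OF assms(6) A(2)] A(1,3)])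
  then show ?thesis by (rule countable_subset[rotated]) (use assms(7) in blast)
qed

section \<open>Automorphisms acting on sorts and nice sets\<close>

lemma sort_aut:
  assumes "ring M" "\<sigma> \<in> ring_iso M M" "\<And>a. a \<in> A \<Longrightarrow> \<sigma> a = a" "A \<subseteq> carrier M"
    and "sort_over M A s" "in_sort y s"
  shows "in_sort (map \<sigma> y) s"
  using definable_aut[OF assms(1-4), of "fst s" "fst (snd s)" y] in_sort_tuples[OF assms(5,6)] assms(5,6)
  by (simp add: sort_over_def)

text \<open>Such an automorphism fixes every point of every sort involved, so it moves
  \<open>x\<close> within the fibre over the same list of points. That fibre is finite and does not
  depend on the automorphism.\<close>

lemma nice_aut:
  assumes "ring M" "nice M A s0 W" "x \<in> W" "A \<subseteq> carrier M"
  shows "\<exists>Z. finite Z \<and> (\<forall>\<sigma>. \<sigma> \<in> ring_iso M M \<and> (\<forall>a\<in>A. \<sigma> a = a) \<and>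
    (\<forall>y. in_sort y s0 \<longrightarrow> map \<sigma> y \<in> cls y s0) \<longrightarrow> \<sigma> x \<in> Z)"
proof -
  obtain srt \<Phi> where srt: "\<forall>s\<in>set srt. sort_over M A s \<and> (s = s0 \<or> (\<exists>c. points s = {c}))"
    and \<Phi>: "family M A srt \<Phi>" "\<forall>us. finite {x \<in> carrier M. \<Phi> x us}" and W: "W = shadow M srt \<Phi>"
    using assms(2) unfolding nice_def by (elim exE conjE) (rule that)
  obtain us where us: "in_points us srt" "\<Phi> x us" and x: "x \<in> carrier M"
    using assms(3) unfolding W shadow_def by blast
  have "\<sigma> x \<in> {x \<in> carrier M. \<Phi> x us}"
    if \<sigma>: "\<sigma> \<in> ring_iso M M" and inv: "\<And>a. a \<in> A \<Longrightarrow> \<sigma> a = a"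
      and s0: "\<And>y. in_sort y s0 \<Longrightarrow> map \<sigma> y \<in> cls y s0" for \<sigma>
  proof -
    define n where "n = length srt"
    have len: "length us = n" using us(1) unfolding in_points_def n_def by (rule list_all2_lengthD)
    have so: "sort_over M A (srt ! i)" "srt ! i = s0 \<or> (\<exists>c. points (srt ! i) = {c})" if "i < n" for i
      using srt that unfolding n_def by (meson nth_mem)+
    have "\<exists>y. in_sort y (srt ! i) \<and> us ! i = cls y (srt ! i)" if "i < n" for i
    proof -
      have "us ! i \<in> points (srt ! i)"
        using us(1) that len unfolding in_points_def by (simp add: list_all2_conv_all_nth)
      then show ?thesis by (rule pointsE) blast
    qed
    then obtain y where y: "\<And>i. i < n \<Longrightarrow> in_sort (y i) (srt ! i)" "\<And>i. i < n \<Longrightarrow> us ! i = cls (y i) (srt ! i)"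
      by metis
    have yt: "y i \<in> tuples M (fst (srt ! i))" if "i < n" for i
      by (rule in_sort_tuples[OF so(1)[OF that] y(1)[OF that]])
    define t where "t = (\<lambda>e :: nat \<Rightarrow> 'a. e (prod_encode (0, 0)))"
    define b where "b i = (\<lambda>e :: nat \<Rightarrow> 'a. map (\<lambda>j. e (prod_encode (Suc i, j))) [0..<fst (srt ! i)])" for i
    \<comment> \<open>One assignment holds \<open>x\<close> in block 0 and the representative of the
      \<open>i\<close>-th point in block \<open>Suc i\<close>. The default \<open>x\<close> only
      serves to stay in the carrier.\<close>
    define e where "e k = (case prod_decode k of (0, j) \<Rightarrow> x |
      (Suc i, j) \<Rightarrow> if i < n \<and> j < length (y i) then y i ! j else x)" for k
    have e: "asg M e" unfolding asg_def
    proof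
      fix k
      have "y i ! j \<in> carrier M" if "i < n" "j < length (y i)" for i j
        using yt[OF that(1)] nth_mem[OF that(2)] unfolding tuples_def by blast
      then show "e k \<in> carrier M" using x by (auto simp: e_def split: prod.split nat.split)
    qed
    have be: "b i e = y i" if "i < n" for i
    proof -
      have "length (y i) = fst (srt ! i)" using yt[OF that] by (simp add: tuples_def)
      then show ?thesis using that by (intro nth_equalityI) (simp_all add: b_def e_def)
    qed
    have be': "b i (\<lambda>k. \<sigma> (e k)) = map \<sigma> (y i)" if "i < n" for i
      unfolding be[OF that, symmetric] by (simp add: b_def)
    have te: "t e = x" by (simp add: t_def e_def)
    define ys where "ys = map b [0..<n]"
    have "list_all2 (\<lambda>y s. dlist M A (fst s) y) ys srt"
      unfolding list_all2_conv_all_nth ys_def by (auto simp: n_def b_def intro: dlist_vars)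
    then have P: "dpred M A (\<lambda>e. list_all2 (\<lambda>y s. in_sort (y e) s) ys srt \<and>
        \<Phi> (t e) (map2 (\<lambda>y s. cls (y e) s) ys srt))"
      by (intro familyD[OF \<Phi>(1)] order_refl assms(4)) (simp_all add: t_def dterm_var)
    have cl: "cls (map \<sigma> (y i)) (srt ! i) = us ! i \<and> in_sort (map \<sigma> (y i)) (srt ! i)" if i: "i < n" for i
    proof -
      have ins: "in_sort (map \<sigma> (y i)) (srt ! i)"
        by (rule sort_aut[OF assms(1) \<sigma> inv assms(4) so(1)[OF i] y(1)[OF i]])
      show ?thesis
      proof (cases "srt ! i = s0")
        case True
        then have "map \<sigma> (y i) \<in> cls (y i) (srt ! i)" using s0 y(1)[OF i] by simp
        from cls_eq[OF so(1)[OF i] this] show ?thesis using y(2)[OF i] ins by simp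
      next
        case False
        then obtain c where "points (srt ! i) = {c}" using so(2)[OF i] by blast
        then show ?thesis using pointsI[OF ins] pointsI[OF y(1)[OF i]] y(2)[OF i] ins by auto
      qed
    qed
    have 1: "map2 (\<lambda>y s. cls (y e) s) ys srt = us"
      by (rule nth_equalityI) (simp_all add: ys_def n_def[symmetric] len be y(2))
    have 2: "map2 (\<lambda>y s. cls (y (\<lambda>k. \<sigma> (e k))) s) ys srt = us"
      by (rule nth_equalityI) (simp_all add: ys_def n_def[symmetric] len be' cl)
    have "list_all2 (\<lambda>y s. in_sort (y e) s) ys srt"
      unfolding list_all2_conv_all_nth ys_def using y(1) by (simp add: n_def[symmetric] be)
    with 1 te us(2) have "list_all2 (\<lambda>y s. in_sort (y e) s) ys srt \<and>
        \<Phi> (t e) (map2 (\<lambda>y s. cls (y e) s) ys srt)" by simp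
    then have "\<Phi> (t (\<lambda>k. \<sigma> (e k))) (map2 (\<lambda>y s. cls (y (\<lambda>k. \<sigma> (e k))) s) ys srt)"
      using dpred_aut[OF assms(1) \<sigma> inv P e assms(4)] by blast
    moreover have "t (\<lambda>k. \<sigma> (e k)) = \<sigma> x" using te by (simp add: t_def)
    moreover have "\<sigma> x \<in> carrier M" using \<sigma> x by (auto simp: ring_iso_def bij_betw_def)
    ultimately show ?thesis unfolding 2 by simp
  qed
  then show ?thesis using \<Phi>(2) by (intro exI[of _ "{x \<in> carrier M. \<Phi> x us}"]) auto
qed

section \<open>Local rings with the descending chain condition\<close>

primrec loewy :: "('a, 'm) ring_scheme \<Rightarrow> 'a set \<Rightarrow> nat \<Rightarrow> 'a set" where
  "loewy M J 0 = {\<zero>\<^bsub>M\<^esub>}"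
| "loewy M J (Suc k) = {x \<in> carrier M. \<forall>y\<in>J. x \<otimes>\<^bsub>M\<^esub> y \<in> loewy M J k}"

text \<open>This is \<open>J^2\<close> plus the annihilator of \<open>J\<close> within
  \<open>J\<close>. Closure under negatives comes from closure under multiplication by ring
  elements.\<close>

inductive_set decomposable :: "('a, 'm) ring_scheme \<Rightarrow> 'a set \<Rightarrow> 'a set" for M J where
  mult: "x \<in> J \<Longrightarrow> y \<in> J \<Longrightarrow> x \<otimes>\<^bsub>M\<^esub> y \<in> decomposable M J"
| ann: "x \<in> J \<Longrightarrow> x \<in> loewy M J 1 \<Longrightarrow> x \<in> decomposable M J"
| add: "x \<in> decomposable M J \<Longrightarrow> y \<in> decomposable M J \<Longrightarrow> x \<oplus>\<^bsub>M\<^esub> y \<in> decomposable M J"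

text \<open>The span of the list over \<open>F\<close>, enlarged by the decomposable
  elements.\<close>

primrec gen :: "('a, 'm) ring_scheme \<Rightarrow> 'a set \<Rightarrow> 'a set \<Rightarrow> 'a list \<Rightarrow> 'a set" where
  "gen M J F [] = decomposable M J"
| "gen M J F (t # ts) = {u \<oplus>\<^bsub>M\<^esub> c \<otimes>\<^bsub>M\<^esub> t | u c. u \<in> gen M J F ts \<and> c \<in> F}"

lemma (in ring) add_subI:
  assumes "H \<subseteq> carrier R" "\<zero> \<in> H" "\<And>x y. x \<in> H \<Longrightarrow> y \<in> H \<Longrightarrow> x \<oplus> y \<in> H" "\<And>x. x \<in> H \<Longrightarrow> \<ominus> x \<in> H"
  shows "additive_subgroup H R"
  unfolding additive_subgroup_def
  by (rule group.subgroupI[OF a_group]) (use assms in \<open>auto simp: a_inv_def\<close>)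

lemma (in ring) coset_eq:
  assumes "additive_subgroup H R" "x \<in> carrier R" "y \<in> carrier R" "x \<ominus> y \<in> H"
  shows "H +> x = H +> y"
proof -
  interpret h: additive_subgroup H R by fact
  have *: "H +> u \<subseteq> H +> v" if uv: "u \<in> carrier R" "v \<in> carrier R" "u \<ominus> v \<in> H" for u v
  proof
    fix z assume "z \<in> H +> u"
    then obtain w where w: "w \<in> H" "z = w \<oplus> u" unfolding a_r_coset_def' by blast
    have "w \<oplus> (u \<ominus> v) \<in> H" using w(1) uv(3) by simp
    moreover have "z = w \<oplus> (u \<ominus> v) \<oplus> v" using w uv(1,2) h.a_Hcarr by algebra
    ultimately show "z \<in> H +> v" unfolding a_r_coset_def' by blast
  qed
  have "\<ominus> (x \<ominus> y) = y \<ominus> x" using assms(2,3) by algebra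
  then have "y \<ominus> x \<in> H" using h.a_inv_closed[OF assms(4)] by simp
  then show ?thesis using *[of x y] *[of y x] assms by blast
qed

text \<open>This collects what the algebra uses of the saturated model, so that model theory enters
  through \<open>connected\<close> and \<open>dcc\<close> only. The finite field \<open>F\<close>
  represents the residues modulo \<open>J\<close>.\<close>

locale conn_ring = cring M for M (structure) +
  fixes J F :: "'a set"
  assumes J_sub: "additive_subgroup J M"
    and J_mult: "x \<in> carrier M \<Longrightarrow> y \<in> J \<Longrightarrow> x \<otimes> y \<in> J"
    and one_notin_J: "\<one> \<notin> J"
    and unit: "x \<in> carrier M \<Longrightarrow> x \<notin> J \<Longrightarrow> \<exists>y\<in>carrier M. x \<otimes> y = \<one>"
    and J_def: "def1 M (carrier M) J"
    and F_fin: "finite F" and F_carrier: "F \<subseteq> carrier M"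
    and F_zero: "\<zero> \<in> F" and F_one: "\<one> \<in> F"
    and F_add: "x \<in> F \<Longrightarrow> y \<in> F \<Longrightarrow> x \<oplus> y \<in> F"
    and F_neg: "x \<in> F \<Longrightarrow> \<ominus> x \<in> F"
    and F_mult: "x \<in> F \<Longrightarrow> y \<in> F \<Longrightarrow> x \<otimes> y \<in> F"
    and F_inv: "x \<in> F \<Longrightarrow> x \<noteq> \<zero> \<Longrightarrow> \<exists>y\<in>F. x \<otimes> y = \<one>"
    and F_J: "x \<in> F \<Longrightarrow> x \<in> J \<Longrightarrow> x = \<zero>"
    and decomp: "x \<in> carrier M \<Longrightarrow> \<exists>c\<in>F. x \<ominus> c \<in> J"
    and connected: "additive_subgroup H M \<Longrightarrow> H \<subseteq> J \<Longrightarrow> def1 M (carrier M) H \<Longrightarrow>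
      finite ((\<lambda>x. H +> x) ` J) \<Longrightarrow> H = J"
    and dcc: "(\<And>n::nat. additive_subgroup (G n) M) \<Longrightarrow> (\<And>n. def1 M (carrier M) (G n)) \<Longrightarrow>
      (\<And>n. G (Suc n) \<subset> G n) \<Longrightarrow> False"
begin

lemma J_carrier: "J \<subseteq> carrier M"
  using J_sub by (rule additive_subgroup.a_subset)

lemmas J_zero = additive_subgroup.zero_closed[OF J_sub]
  and J_add = additive_subgroup.a_closed[OF J_sub]
  and J_neg = additive_subgroup.a_inv_closed[OF J_sub]

lemma dcc_min:
  assumes "P i0" "\<And>i. P i \<Longrightarrow> additive_subgroup (G i) M" "\<And>i. P i \<Longrightarrow> def1 M (carrier M) (G i)"
  shows "\<exists>i. P i \<and> (\<forall>j. P j \<longrightarrow> \<not> G j \<subset> G i)"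
proof (rule ccontr)
  assume "\<not> ?thesis"
  then have "\<forall>i. \<exists>j. P i \<longrightarrow> P j \<and> G j \<subset> G i" by blast
  then obtain f where f: "\<forall>i. P i \<longrightarrow> P (f i) \<and> G (f i) \<subset> G i" by metis
  define H where "H n = (f ^^ n) i0" for n
  have H: "P (H n)" for n by (induction n) (use assms(1) f in \<open>auto simp: H_def\<close>)
  have "G (H (Suc n)) \<subset> G (H n)" for n using f H[of n] by (simp add: H_def)
  then show False by (intro dcc[of "\<lambda>n. G (H n)"] assms(2,3) H)
qed

lemma def1_mult_image:
  assumes "a \<in> carrier M" "def1 M (carrier M) H"
  shows "def1 M (carrier M) ((\<lambda>y. a \<otimes> y) ` H)"
proof -
  have "dpred M (carrier M) (\<lambda>e. \<exists>y\<in>H. e 0 = a \<otimes> y)"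
    by (rule dpred_ex1[OF assms(2)]) (intro order_refl dpred_eq dring_intros ring_axioms dterm_var dterm_const assms(1))+
  then have "def1 M (carrier M) {x \<in> carrier M. \<exists>y\<in>H. x = a \<otimes> y}"
    by (rule dpred_def1[OF ring_axioms])
  moreover have "{x \<in> carrier M. \<exists>y\<in>H. x = a \<otimes> y} = (\<lambda>y. a \<otimes> y) ` H"
    using assms(1) def1_carrier[OF assms(2)] by auto
  ultimately show ?thesis by simp
qed

lemma mult_image_subgroup:
  assumes a: "a \<in> carrier M" and H: "additive_subgroup H M"
  shows "additive_subgroup ((\<lambda>y. a \<otimes> y) ` H) M"
proof -
  interpret h: additive_subgroup H M by fact
  have c: "u \<in> carrier M" if "u \<in> H" for u using h.a_subset that by blast
  show ?thesis
  proof (rule add_subI)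
    show "(\<lambda>y. a \<otimes> y) ` H \<subseteq> carrier M" using a c by auto
    show "\<zero> \<in> (\<lambda>y. a \<otimes> y) ` H"
      by (rule image_eqI[of _ _ \<zero>]) (use a h.zero_closed in simp_all)
    fix x assume "x \<in> (\<lambda>y. a \<otimes> y) ` H"
    then obtain u where u: "u \<in> H" "x = a \<otimes> u" by blast
    show "\<ominus> x \<in> (\<lambda>y. a \<otimes> y) ` H"
      by (rule image_eqI[of _ _ "\<ominus> u"]) (use a c u h.a_inv_closed in \<open>simp_all add: r_minus\<close>)
    fix y assume "y \<in> (\<lambda>y. a \<otimes> y) ` H"
    then obtain v where v: "v \<in> H" "y = a \<otimes> v" by blast
    show "x \<oplus> y \<in> (\<lambda>y. a \<otimes> y) ` H"
      by (rule image_eqI[of _ _ "u \<oplus> v"]) (use a c u v h.a_closed in \<open>simp_all add: r_distr\<close>)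
  qed
qed

text \<open>The chain of principal ideals of powers of \<open>x\<close> stops, which gives
  \<open>x^n = x^(n+1) r\<close>. As \<open>x r\<close> lies in \<open>J\<close>, the factor
  \<open>1 - x r\<close> is a unit, and it kills \<open>x^n\<close>.\<close>

lemma nil: assumes x: "x \<in> J" shows "\<exists>n. x [^] (n::nat) = \<zero>"
proof -
  have xc: "x \<in> carrier M" using x J_carrier by blast
  define P where "P n = (\<lambda>y. (x [^] (n::nat)) \<otimes> y) ` carrier M" for n
  have "\<exists>n. True \<and> (\<forall>k. True \<longrightarrow> \<not> P k \<subset> P n)"
  proof (rule dcc_min)
    fix n
    have "additive_subgroup (carrier M) M" by (rule add_subI) auto
    then show "additive_subgroup (P n) M" "def1 M (carrier M) (P n)"
      unfolding P_def using xc by (intro mult_image_subgroup def1_mult_image def1_all ring_axioms nat_pow_closed; simp)+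
  qed simp
  then obtain n where n: "\<forall>k. \<not> P k \<subset> P n" by auto
  have "P (Suc n) \<subseteq> P n"
  proof
    fix z assume "z \<in> P (Suc n)"
    then obtain y where "y \<in> carrier M" "z = x [^] Suc n \<otimes> y" unfolding P_def by blast
    then show "z \<in> P n" unfolding P_def using xc
      by (intro image_eqI[of _ _ "x \<otimes> y"]) (simp_all add: m_assoc)
  qed
  with n have "P (Suc n) = P n" by blast
  moreover have "x [^] n \<in> P n" unfolding P_def using xc by (intro image_eqI[of _ _ \<one>]) simp_all
  ultimately obtain r where r: "r \<in> carrier M" "x [^] n = x [^] Suc n \<otimes> r" unfolding P_def by blast
  have xr: "x \<otimes> r \<in> J" using J_mult[OF r(1) x] r(1) xc by (simp add: m_comm)
  have "\<one> \<ominus> x \<otimes> r \<notin> J"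
  proof
    assume "\<one> \<ominus> x \<otimes> r \<in> J"
    then have "(\<one> \<ominus> x \<otimes> r) \<oplus> x \<otimes> r \<in> J" using xr J_add by blast
    moreover have "(\<one> \<ominus> x \<otimes> r) \<oplus> x \<otimes> r = \<one>" using xc r(1) by algebra
    ultimately show False using one_notin_J by simp
  qed
  then obtain u where u: "u \<in> carrier M" "(\<one> \<ominus> x \<otimes> r) \<otimes> u = \<one>" using unit[of "\<one> \<ominus> x \<otimes> r"] xc r(1) by auto
  define w where "w = x [^] n"
  have wc: "w \<in> carrier M" using xc by (simp add: w_def)
  have "w = w \<otimes> x \<otimes> r" using r(2) by (simp add: w_def)
  then have "w \<otimes> (\<one> \<ominus> x \<otimes> r) = \<zero>" using wc xc r(1) by algebra
  then have "w \<otimes> (\<one> \<ominus> x \<otimes> r) \<otimes> u = \<zero>" using u(1) by simp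
  moreover have "w \<otimes> (\<one> \<ominus> x \<otimes> r) \<otimes> u = w \<otimes> ((\<one> \<ominus> x \<otimes> r) \<otimes> u)" using wc u(1) xc r(1) by algebra
  ultimately have "w = \<zero>" using u(2) wc by simp
  then show ?thesis unfolding w_def by blast
qed

section \<open>The annihilator series and nilpotence\<close>

abbreviation L :: "nat \<Rightarrow> 'a set" where "L \<equiv> loewy M J"

lemma L_carrier: "L k \<subseteq> carrier M"
  by (cases k) auto

lemma L_sub: "additive_subgroup (L k) M"
proof (induction k)
  case 0
  show ?case by (rule add_subI) auto
next
  case (Suc k)
  interpret h: additive_subgroup "L k" M by (rule Suc)
  show ?case
  proof (rule add_subI)
    show "\<zero> \<in> L (Suc k)" using J_carrier h.zero_closed by (auto simp: subset_iff)
    show "x \<oplus> y \<in> L (Suc k)" if "x \<in> L (Suc k)" "y \<in> L (Suc k)" for x y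
      using that J_carrier h.a_closed by (auto simp: subset_iff l_distr)
    show "\<ominus> x \<in> L (Suc k)" if "x \<in> L (Suc k)" for x
      using that J_carrier h.a_inv_closed by (auto simp: subset_iff l_minus)
  qed auto
qed

lemma L_def: "def1 M (carrier M) (L k)"
proof (induction k)
  case 0
  have "def1 M (carrier M) {x \<in> carrier M. x = \<zero>}"
    by (rule dpred_def1[OF ring_axioms], intro dpred_eq dterm_var dring_intros ring_axioms)
  moreover have "{x \<in> carrier M. x = \<zero>} = L 0" by auto
  ultimately show ?case by (simp only:)
next
  case (Suc k)
  have "dpred M (carrier M) (\<lambda>e. \<forall>y\<in>J. e 0 \<otimes> y \<in> L k)"
    by (rule dpred_all1[OF J_def]) (intro order_refl def1_dpred[OF Suc] dring_intros ring_axioms dterm_var)+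
  then show ?case unfolding loewy.simps by (rule dpred_def1[OF ring_axioms])
qed

lemma L_mult: "x \<in> L k \<Longrightarrow> r \<in> carrier M \<Longrightarrow> x \<otimes> r \<in> L k"
proof (induction k arbitrary: x)
  case (Suc k)
  have "(x \<otimes> r) \<otimes> y \<in> L k" if "y \<in> J" for y
  proof -
    have "(x \<otimes> r) \<otimes> y = (x \<otimes> y) \<otimes> r"
      using Suc.prems that J_carrier by (auto simp: subset_iff m_ac)
    then show ?thesis using Suc that by simp
  qed
  then show ?case using Suc.prems by simp
qed auto

lemma L_Suc: "L k \<subseteq> L (Suc k)"
proof (induction k)
  case 0
  show ?case using J_carrier by (auto simp: subset_iff)
next
  case (Suc k)
  then show ?case by auto
qed

definition ann :: "'a set \<Rightarrow> 'a set" where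
  "ann S = {z \<in> carrier M. \<forall>x\<in>S. x \<otimes> z = \<zero>}"

lemma ann_sub: "S \<subseteq> carrier M \<Longrightarrow> additive_subgroup (ann S) M"
  by (rule add_subI) (auto simp: ann_def subset_iff r_distr r_minus)

lemma ann_def1:
  assumes "def1 M (carrier M) S" shows "def1 M (carrier M) (ann S)"
proof -
  have "dpred M (carrier M) (\<lambda>e. \<forall>x\<in>S. x \<otimes> e 0 = \<zero>)"
    by (rule dpred_all1[OF assms]) (intro order_refl dpred_eq dring_intros ring_axioms dterm_var)+
  then show ?thesis unfolding ann_def by (rule dpred_def1[OF ring_axioms])
qed

text \<open>Each stage of the series is its own double annihilator, because \<open>y\<close> in
  \<open>J\<close> multiplies \<open>ann (L k)\<close> into \<open>ann (L (Suc k))\<close>. This is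
  what lets a condition on descending chains stop the ascending series.\<close>

lemma ann_ann_L: "x \<in> carrier M \<Longrightarrow> (\<And>z. z \<in> ann (L k) \<Longrightarrow> x \<otimes> z = \<zero>) \<Longrightarrow> x \<in> L k"
proof (induction k arbitrary: x)
  case 0
  have "\<one> \<in> ann (L 0)" by (simp add: ann_def)
  then show ?case using 0 by fastforce
next
  case (Suc k)
  have "x \<otimes> y \<in> L k" if y: "y \<in> J" for y
  proof (rule Suc.IH)
    have yc: "y \<in> carrier M" using y J_carrier by blast
    then show "x \<otimes> y \<in> carrier M" using Suc.prems by simp
    fix z assume z: "z \<in> ann (L k)"
    then have zc: "z \<in> carrier M" by (simp add: ann_def)
    have "w \<otimes> (y \<otimes> z) = \<zero>" if "w \<in> L (Suc k)" for w
    proof -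
      have "w \<otimes> y \<in> L k" using that y by simp
      then have "(w \<otimes> y) \<otimes> z = \<zero>" using z by (simp add: ann_def)
      then show ?thesis using that yc zc by (simp add: m_assoc)
    qed
    then have "y \<otimes> z \<in> ann (L (Suc k))" using yc zc unfolding ann_def by simp
    then have "x \<otimes> (y \<otimes> z) = \<zero>" by (rule Suc.prems(2))
    then show "x \<otimes> y \<otimes> z = \<zero>" using Suc.prems(1) yc zc by (simp add: m_assoc)
  qed
  then show ?case using Suc.prems by simp
qed

text \<open>A nil ideal need not be nilpotent, so the chain condition is used twice more. It makes
  the descending chain \<open>ann (L k)\<close>, and hence \<open>L k\<close>, stationary; and if
  the unit were missing from the last stage, an \<open>a\<close> outside it with minimal double
  annihilator would satisfy \<open>aJ \<subseteq> L k\<close>, which puts \<open>a\<close> into the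
  next stage.\<close>

lemma nilpotent: "\<exists>k. \<one> \<in> L k"
proof -
  have "\<exists>k. True \<and> (\<forall>j. True \<longrightarrow> \<not> ann (L j) \<subset> ann (L k))"
    by (rule dcc_min) (intro ann_sub L_carrier ann_def1 L_def TrueI)+
  then obtain k where k: "\<forall>j. \<not> ann (L j) \<subset> ann (L k)" by auto
  have "ann (L (Suc k)) \<subseteq> ann (L k)" using L_Suc[of k] unfolding ann_def by blast
  with k have eq: "ann (L (Suc k)) = ann (L k)" by blast
  have stab: "x \<in> L k" if "x \<in> L (Suc k)" for x
  proof (rule ann_ann_L)
    show "x \<in> carrier M" using that L_carrier by blast
    fix z assume "z \<in> ann (L k)"
    then have "z \<in> ann (L (Suc k))" by (simp only: eq)
    then have "\<forall>x\<in>L (Suc k). x \<otimes> z = \<zero>" unfolding ann_def by (elim CollectE conjE)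
    then show "x \<otimes> z = \<zero>" using that by (rule bspec)
  qed
  have "\<one> \<in> L k"
  proof (rule ccontr)
    assume one: "\<one> \<notin> L k"
    \<comment> \<open>The double annihilator of \<open>a\<close>, an ideal definable from the single
      parameter \<open>a\<close>.\<close>
    define AA where "AA a = {w \<in> carrier M. \<forall>z\<in>carrier M. a \<otimes> z = \<zero> \<longrightarrow> w \<otimes> z = \<zero>}" for a
    have "\<exists>a. a \<in> carrier M - L k \<and> (\<forall>a'. a' \<in> carrier M - L k \<longrightarrow> \<not> AA a' \<subset> AA a)"
    proof (rule dcc_min)
      show "\<one> \<in> carrier M - L k" using one by simp
      fix a assume a: "a \<in> carrier M - L k"
      then have ac: "a \<in> carrier M" by simp
      have "dpred M (carrier M) (\<lambda>e. \<forall>z\<in>carrier M. a \<otimes> z = \<zero> \<longrightarrow> e 0 \<otimes> z = \<zero>)"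
        by (rule dpred_all) (intro dpred_imp dpred_eq dring_intros ring_axioms dterm_var dterm_const ac)
      then show "def1 M (carrier M) (AA a)" unfolding AA_def by (rule dpred_def1[OF ring_axioms])
      show "additive_subgroup (AA a) M"
        by (rule add_subI) (auto simp: AA_def l_distr l_minus)
    qed
    then obtain a where a: "a \<in> carrier M" "a \<notin> L k"
      and min: "\<forall>a'. a' \<in> carrier M - L k \<longrightarrow> \<not> AA a' \<subset> AA a" by auto
    have "a \<otimes> b \<in> L k" if b: "b \<in> J" for b
    proof (rule ccontr)
      assume ab: "a \<otimes> b \<notin> L k"
      have bc: "b \<in> carrier M" using b J_carrier by blast
      have "a \<otimes> b \<otimes> z = \<zero>" if "z \<in> carrier M" "a \<otimes> z = \<zero>" for z
      proof -
        have "a \<otimes> b \<otimes> z = (a \<otimes> z) \<otimes> b" using a(1) bc that(1) by (simp add: m_ac)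
        then show ?thesis using that bc by simp
      qed
      then have "AA (a \<otimes> b) \<subseteq> AA a" unfolding AA_def by auto
      moreover have "\<not> AA (a \<otimes> b) \<subset> AA a" using min ab a(1) bc by simp
      \<comment> \<open>By minimality \<open>a \<otimes> b\<close> and \<open>a\<close> have the
        same annihilator, so factors \<open>b\<close> can be cancelled one by one from
        \<open>a \<otimes> b^n = 0\<close>, until \<open>a = 0\<close> is left.\<close>
      ultimately have "AA (a \<otimes> b) = AA a" by blast
      moreover have "a \<in> AA a" using a(1) by (simp add: AA_def)
      ultimately have *: "a \<otimes> z = \<zero>" if "z \<in> carrier M" "a \<otimes> b \<otimes> z = \<zero>" for z
        using that unfolding AA_def by blast
      obtain n where n: "b [^] (n::nat) = \<zero>" using nil[OF b] by blast
      have "a \<otimes> b [^] j = \<zero> \<Longrightarrow> a = \<zero>" for j :: nat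
      proof (induction j)
        case (Suc j)
        have "a \<otimes> b \<otimes> (b [^] j) = a \<otimes> b [^] Suc j" using a(1) bc by (simp add: m_ac)
        then have "a \<otimes> b [^] j = \<zero>" using *[of "b [^] j"] Suc.prems bc by simp
        then show ?case by (rule Suc.IH)
      qed (use a(1) in simp)
      from this[of n] have "a = \<zero>" using n a(1) by simp
      then show False using a(2) additive_subgroup.zero_closed[OF L_sub[of k]] by simp
    qed
    then have "a \<in> L (Suc k)" using a(1) by simp
    then show False using stab a(2) by blast
  qed
  then show ?thesis by blast
qed

section \<open>Consequences of connectedness\<close>

lemma finite_cosets:
  assumes "additive_subgroup H M" "G \<subseteq> carrier M" "finite (f ` G)"
    and "\<And>x y. x \<in> G \<Longrightarrow> y \<in> G \<Longrightarrow> f x = f y \<Longrightarrow> x \<ominus> y \<in> H"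
  shows "finite ((\<lambda>x. H +> x) ` G)"
proof -
  define g where "g v = (SOME x. x \<in> G \<and> f x = v)" for v
  have "H +> x = H +> g (f x)" if x: "x \<in> G" for x
  proof (rule coset_eq[OF assms(1)])
    have "g (f x) \<in> G \<and> f (g (f x)) = f x" unfolding g_def by (rule someI[of _ x]) (use x in simp)
    then show "x \<ominus> g (f x) \<in> H" "x \<in> carrier M" "g (f x) \<in> carrier M" using assms(2,4) x by auto
  qed
  then have "(\<lambda>x. H +> x) ` G \<subseteq> (\<lambda>v. H +> g v) ` (f ` G)" by (auto simp: image_iff)
  then show ?thesis using assms(3) by (meson finite_imageI finite_subset)
qed

text \<open>The preimage of \<open>H\<close> under multiplication by \<open>a\<close> is a definable
  subgroup of finite index in \<open>J\<close>, hence all of \<open>J\<close>.\<close>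

lemma connected_image:
  assumes a: "a \<in> carrier M" and H: "additive_subgroup H M" "H \<subseteq> (\<lambda>y. a \<otimes> y) ` J" "def1 M (carrier M) H"
    and fin: "finite ((\<lambda>x. H +> x) ` (\<lambda>y. a \<otimes> y) ` J)"
  shows "H = (\<lambda>y. a \<otimes> y) ` J"
proof -
  interpret h: additive_subgroup H M by fact
  define G where "G = {x \<in> carrier M. x \<in> J \<and> a \<otimes> x \<in> H}"
  have "def1 M (carrier M) G"
    unfolding G_def by (rule dpred_def1[OF ring_axioms])
      (intro dpred_conj def1_dpred[OF J_def] def1_dpred[OF H(3)] order_refl dring_intros ring_axioms dterm_var dterm_const a)
  moreover have sub: "additive_subgroup G M"
    by (rule add_subI) (use a J_carrier J_zero J_add J_neg in \<open>auto simp: G_def r_distr r_minus\<close>)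
  moreover have "finite ((\<lambda>x. G +> x) ` J)"
  proof (rule finite_cosets[OF sub J_carrier])
    show "finite ((\<lambda>x. H +> (a \<otimes> x)) ` J)" using fin by (simp add: image_image)
    fix x y assume xy: "x \<in> J" "y \<in> J" "H +> (a \<otimes> x) = H +> (a \<otimes> y)"
    then have c: "x \<in> carrier M" "y \<in> carrier M" using J_carrier by auto
    have "a \<otimes> x \<in> H +> (a \<otimes> x)" unfolding a_r_coset_def'
      using h.zero_closed a c by (intro UN_I[of \<zero>]) simp_all
    then have "a \<otimes> x \<in> H +> (a \<otimes> y)" by (simp only: xy(3))
    then obtain w where w: "w \<in> H" "a \<otimes> x = w \<oplus> a \<otimes> y" by (auto simp: a_r_coset_def')
    have wc: "w \<in> carrier M" using w(1) h.a_subset by blast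
    have "a \<otimes> (x \<ominus> y) = a \<otimes> x \<ominus> a \<otimes> y" using a c by algebra
    also have "\<dots> = w" unfolding w(2) using a c wc by algebra
    finally have "a \<otimes> (x \<ominus> y) = w" .
    moreover have "x \<ominus> y \<in> J" unfolding a_minus_def using xy J_add J_neg by blast
    ultimately show "x \<ominus> y \<in> G" using w(1) c by (simp add: G_def)
  qed
  ultimately have "G = J" using connected[of G] by (auto simp: G_def)
  then have "(\<lambda>y. a \<otimes> y) ` J \<subseteq> H" by (auto simp: G_def)
  with H(2) show ?thesis by blast
qed

text \<open>In a finite image the zero subgroup has finite index, so \<open>connected_image\<close>
  would make the image zero.\<close>

lemma infinite_image:
  assumes a: "a \<in> carrier M" and "\<exists>y\<in>J. a \<otimes> y \<noteq> \<zero>"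
  shows "infinite ((\<lambda>y. a \<otimes> y) ` J)"
proof
  assume fin: "finite ((\<lambda>y. a \<otimes> y) ` J)"
  have "L 0 = (\<lambda>y. a \<otimes> y) ` J"
  proof (rule connected_image[OF a L_sub _ L_def finite_imageI[OF fin]])
    show "L 0 \<subseteq> (\<lambda>y. a \<otimes> y) ` J" using a J_zero by (auto intro!: image_eqI[of _ _ \<zero>])
  qed
  then show False using assms(2) by auto
qed

end

section \<open>Linear functionals and the automorphisms they define\<close>

context conn_ring
begin

lemma L1_iff: "x \<in> L 1 \<longleftrightarrow> x \<in> carrier M \<and> (\<forall>y\<in>J. x \<otimes> y = \<zero>)"
  by simp

lemma dec_J: "x \<in> decomposable M J \<Longrightarrow> x \<in> J"
proof (induction rule: decomposable.induct)
  case (mult x y)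
  then show ?case using J_carrier by (intro J_mult) blast+
qed (auto intro: J_add)

lemma dec_carrier: "x \<in> decomposable M J \<Longrightarrow> x \<in> carrier M"
  using dec_J J_carrier by blast

lemma dec_smult: "x \<in> decomposable M J \<Longrightarrow> c \<in> carrier M \<Longrightarrow> c \<otimes> x \<in> decomposable M J"
proof (induction rule: decomposable.induct)
  case (mult x y)
  have "(c \<otimes> x) \<otimes> y \<in> decomposable M J"
    using mult by (intro decomposable.mult J_mult)
  moreover have "x \<in> carrier M" "y \<in> carrier M" using mult J_carrier by blast+
  ultimately show ?case using mult(3) by (simp add: m_assoc)
next
  case (ann x)
  have "x \<in> carrier M" using ann J_carrier by blast
  then have "c \<otimes> x = x \<otimes> c" using ann(3) by (rule m_comm[rotated])
  then have "c \<otimes> x \<in> L 1" using L_mult[OF ann(2,3)] by (simp only:)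
  then show ?case by (rule decomposable.ann[OF J_mult[OF ann(3,1)]])
next
  case (add x y)
  have "x \<in> carrier M" "y \<in> carrier M" using add(1,2) dec_carrier by blast+
  then have "c \<otimes> (x \<oplus> y) = c \<otimes> x \<oplus> c \<otimes> y" using add(5) by (simp add: r_distr)
  then show ?case using add decomposable.add by simp
qed

lemma dec_zero: "\<zero> \<in> decomposable M J"
  by (rule decomposable.ann[OF J_zero additive_subgroup.zero_closed[OF L_sub]])

text \<open>Membership in \<open>L 2\<close> disposes of products, and membership in
  \<open>J\<close> of the annihilator.\<close>

lemma dec_L2: "y \<in> decomposable M J \<Longrightarrow> x \<in> L 2 \<Longrightarrow> x \<in> J \<Longrightarrow> x \<otimes> y = \<zero>"
proof (induction rule: decomposable.induct)
  case (mult y z)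
  have c: "x \<in> carrier M" "y \<in> carrier M" "z \<in> carrier M" using mult J_carrier by blast+
  have "x \<otimes> y \<in> L 1" using mult by (simp add: numeral_2_eq_2)
  then have "x \<otimes> y \<otimes> z = \<zero>" using mult(2) unfolding L1_iff by blast
  then show ?case using c by (simp add: m_assoc)
next
  case (ann y)
  then have "y \<otimes> x = \<zero>" unfolding L1_iff by blast
  moreover have "y \<in> carrier M" "x \<in> carrier M" using ann J_carrier by blast+
  ultimately show ?case by (simp add: m_comm)
next
  case (add y z)
  have "x \<in> carrier M" "y \<in> carrier M" "z \<in> carrier M" using add J_carrier dec_carrier by blast+
  then show ?case using add by (simp add: r_distr)
qed

section \<open>Subspaces containing the decomposable elements\<close>

abbreviation K :: "'a list \<Rightarrow> 'a set" where "K \<equiv> gen M J F"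

definition subspace :: "'a set \<Rightarrow> bool" where
  "subspace H \<longleftrightarrow> H \<subseteq> J \<and> decomposable M J \<subseteq> H \<and> (\<forall>x\<in>H. \<forall>y\<in>H. x \<oplus> y \<in> H) \<and>
     (\<forall>c\<in>F. \<forall>x\<in>H. c \<otimes> x \<in> H)"

lemma F_c: "c \<in> F \<Longrightarrow> c \<in> carrier M"
  using F_carrier by blast

lemma subspace_extend:
  assumes H: "subspace H" and t: "t \<in> J"
  shows "subspace {u \<oplus> c \<otimes> t | u c. u \<in> H \<and> c \<in> F}" "H \<subseteq> {u \<oplus> c \<otimes> t | u c. u \<in> H \<and> c \<in> F}"
    "t \<in> {u \<oplus> c \<otimes> t | u c. u \<in> H \<and> c \<in> F}"
proof -
  let ?H = "{u \<oplus> c \<otimes> t | u c. u \<in> H \<and> c \<in> F}"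
  have HJ: "H \<subseteq> J" and dec: "decomposable M J \<subseteq> H" and add: "\<forall>x\<in>H. \<forall>y\<in>H. x \<oplus> y \<in> H"
    and sm: "\<forall>c\<in>F. \<forall>x\<in>H. c \<otimes> x \<in> H" using H unfolding subspace_def by auto
  have tc: "t \<in> carrier M" using t J_carrier by blast
  have Hc: "u \<in> carrier M" if "u \<in> H" for u using that HJ J_carrier by blast
  show sub: "H \<subseteq> ?H"
  proof
    fix u assume u: "u \<in> H"
    then have "u = u \<oplus> \<zero> \<otimes> t" using Hc tc by simp
    then show "u \<in> ?H" using u F_zero by blast
  qed
  show "t \<in> ?H"
  proof -
    have "t = \<zero> \<oplus> \<one> \<otimes> t" using tc by simp
    then show ?thesis using dec dec_zero F_one by blast
  qed
  have p1: "x \<in> J" if "x \<in> ?H" for x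
    using that HJ t J_add J_mult F_c by auto
  have p2: "x \<oplus> y \<in> ?H" if xy: "x \<in> ?H" "y \<in> ?H" for x y
  proof -
    obtain u c v d where *: "u \<in> H" "c \<in> F" "v \<in> H" "d \<in> F" "x = u \<oplus> c \<otimes> t" "y = v \<oplus> d \<otimes> t"
      using xy by blast
    have "u \<in> carrier M" "v \<in> carrier M" "c \<in> carrier M" "d \<in> carrier M" using * Hc F_c by auto
    then have "x \<oplus> y = (u \<oplus> v) \<oplus> (c \<oplus> d) \<otimes> t" unfolding *(5,6) using tc by algebra
    moreover have "u \<oplus> v \<in> H" "c \<oplus> d \<in> F" using * add F_add by auto
    ultimately show ?thesis by blast
  qed
  have p3: "a \<otimes> x \<in> ?H" if ax: "a \<in> F" "x \<in> ?H" for a x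
  proof -
    obtain u c where *: "u \<in> H" "c \<in> F" "x = u \<oplus> c \<otimes> t" using ax by blast
    have "u \<in> carrier M" "c \<in> carrier M" "a \<in> carrier M" using * ax Hc F_c by auto
    then have "a \<otimes> x = (a \<otimes> u) \<oplus> (a \<otimes> c) \<otimes> t" unfolding *(3) using tc by algebra
    moreover have "a \<otimes> u \<in> H" "a \<otimes> c \<in> F" using * ax sm F_mult by auto
    ultimately show ?thesis by blast
  qed
  show "subspace ?H" unfolding subspace_def
  proof (intro conjI ballI)
    show "?H \<subseteq> J" by (rule subsetI) (rule p1)
    show "decomposable M J \<subseteq> ?H" by (rule order_trans[OF dec sub])
  qed (rule p2 p3; assumption)+
qed

lemma subspace_K: "set ts \<subseteq> J \<Longrightarrow> subspace (K ts) \<and> set ts \<subseteq> K ts"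
proof (induction ts)
  case Nil
  have "subspace (decomposable M J)"
    unfolding subspace_def using dec_J dec_smult F_c decomposable.add by auto
  then show ?case by simp
next
  case (Cons t ts)
  then show ?case using subspace_extend[of "K ts" t] by auto
qed

text \<open>Multiplication by \<open>x\<close> kills the decomposable elements, and each further
  generator contributes at most as many multiples as \<open>F\<close> has elements.\<close>

lemma K_mult_finite:
  assumes x: "x \<in> L 2" "x \<in> J"
  shows "set ts \<subseteq> J \<Longrightarrow> finite ((\<lambda>y. x \<otimes> y) ` K ts)"
proof (induction ts)
  case Nil
  have "(\<lambda>y. x \<otimes> y) ` K [] \<subseteq> {\<zero>}" using dec_L2 x by auto
  then show ?case using finite_subset by blast
next
  case (Cons t ts)
  have xc: "x \<in> carrier M" and tc: "t \<in> carrier M" using x Cons.prems J_carrier by auto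
  have ts: "set ts \<subseteq> J" using Cons.prems by simp
  have "(\<lambda>y. x \<otimes> y) ` K (t # ts) \<subseteq> (\<lambda>(w, c). w \<oplus> c \<otimes> (x \<otimes> t)) ` ((\<lambda>y. x \<otimes> y) ` K ts \<times> F)"
  proof
    fix z assume "z \<in> (\<lambda>y. x \<otimes> y) ` K (t # ts)"
    then obtain u c where *: "u \<in> K ts" "c \<in> F" "z = x \<otimes> (u \<oplus> c \<otimes> t)" by auto
    have "u \<in> carrier M" using subspace_K[OF ts] *(1) J_carrier unfolding subspace_def by blast
    moreover have "c \<in> carrier M" using * F_c by blast
    ultimately have "z = x \<otimes> u \<oplus> c \<otimes> (x \<otimes> t)" unfolding *(3) using xc tc by algebra
    then show "z \<in> (\<lambda>(w, c). w \<oplus> c \<otimes> (x \<otimes> t)) ` ((\<lambda>y. x \<otimes> y) ` K ts \<times> F)"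
      using * by (intro image_eqI[of _ _ "(x \<otimes> u, c)"]) auto
  qed
  then show ?case using Cons.IH[OF ts] F_fin by (meson finite_SigmaI finite_imageI finite_subset)
qed

text \<open>If the series, cut down to \<open>J\<close>, does not grow from stage 1 to stage 2, then
  induction keeps every later stage inside stage 1, and nilpotence makes one of them contain
  \<open>J\<close>. Its contrapositive supplies the element \<open>a\<close> of \<open>L 2\<close>
  outside \<open>L 1\<close>.\<close>

lemma L_stable:
  assumes "\<And>x. x \<in> L 2 \<Longrightarrow> x \<in> J \<Longrightarrow> x \<in> L 1"
  shows "J \<subseteq> L 1"
proof -
  have *: "x \<in> L 1" if "x \<in> L k" "x \<in> J" for k x
    using that
  proof (induction k arbitrary: x)
    case 0
    then show ?case using additive_subgroup.zero_closed[OF L_sub[of 1]] by (simp only: loewy.simps singleton_iff)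
  next
    case (Suc k)
    have xc: "x \<in> carrier M" using Suc.prems J_carrier by blast
    have "x \<otimes> y \<in> L 1" if y: "y \<in> J" for y
      using Suc.prems y J_mult[OF xc y] by (intro Suc.IH) auto
    then have "x \<in> L 2" using xc by (simp add: numeral_2_eq_2)
    then show ?case using assms Suc.prems by blast
  qed
  obtain k where k: "\<one> \<in> L k" using nilpotent by blast
  show ?thesis
  proof
    fix x assume x: "x \<in> J"
    then have "x \<in> L k" using L_mult[OF k, of x] J_carrier by auto
    then show "x \<in> L 1" using x by (rule *)
  qed
qed

text \<open>An element of \<open>J\<close> in \<open>L 2\<close> but not in \<open>L 1\<close> has
  infinite image on \<open>J\<close> by connectedness, but finite image on
  \<open>K ts\<close>.\<close>

lemma K_proper:
  assumes "\<not> J \<subseteq> L 1" "set ts \<subseteq> J" shows "\<exists>x0. x0 \<in> J \<and> x0 \<notin> K ts"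
proof (rule ccontr)
  assume "\<not> ?thesis"
  then have J: "J \<subseteq> K ts" by blast
  have "J \<subseteq> L 1"
  proof (rule L_stable, rule ccontr)
    fix x assume x: "x \<in> L 2" "x \<in> J" and "x \<notin> L 1"
    then have xc: "x \<in> carrier M" using J_carrier by blast
    have "\<exists>y\<in>J. x \<otimes> y \<noteq> \<zero>" using \<open>x \<notin> L 1\<close> xc unfolding L1_iff by blast
    from infinite_image[OF xc this] show False
      using finite_subset[OF image_mono[OF J] K_mult_finite[OF x assms(2)]] by blast
  qed
  then show False using assms(1) by blast
qed

text \<open>By Zorn's lemma there is a maximal subspace \<open>H\<close> above \<open>K0\<close>
  that avoids \<open>x0\<close>. Adjoining any further \<open>x\<close> captures \<open>x0\<close>
  as \<open>u + c x\<close> with \<open>c\<close> nonzero, and solving for \<open>x\<close> shows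
  that \<open>H\<close> and \<open>x0\<close> span \<open>J\<close>.\<close>

lemma hyperplane:
  assumes K0: "subspace K0" and x0: "x0 \<in> J" "x0 \<notin> K0"
  shows "\<exists>H. subspace H \<and> K0 \<subseteq> H \<and> x0 \<notin> H \<and> (\<forall>x\<in>J. \<exists>c\<in>F. x \<ominus> c \<otimes> x0 \<in> H)"
proof -
  define \<A> where "\<A> = {H. subspace H \<and> K0 \<subseteq> H \<and> x0 \<notin> H}"
  have "\<exists>H\<in>\<A>. \<forall>X\<in>\<A>. H \<subseteq> X \<longrightarrow> X = H"
  proof (rule subset_Zorn_nonempty)
    show "\<A> \<noteq> {}" using assms by (auto simp: \<A>_def)
    fix \<C> assume ne: "\<C> \<noteq> {}" and ch: "subset.chain \<A> \<C>"
    then have sub: "\<And>H. H \<in> \<C> \<Longrightarrow> subspace H \<and> K0 \<subseteq> H \<and> x0 \<notin> H"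
      unfolding subset.chain_def \<A>_def by blast
    have "subspace (\<Union>\<C>)"
      unfolding subspace_def
    proof (intro conjI ballI)
      show "\<Union>\<C> \<subseteq> J" using sub unfolding subspace_def by blast
      show "decomposable M J \<subseteq> \<Union>\<C>" using sub ne unfolding subspace_def by blast
      show "c \<otimes> x \<in> \<Union>\<C>" if "c \<in> F" "x \<in> \<Union>\<C>" for c x
        using that sub unfolding subspace_def by blast
      fix x y assume "x \<in> \<Union>\<C>" "y \<in> \<Union>\<C>"
      then obtain X Y where XY: "X \<in> \<C>" "Y \<in> \<C>" "x \<in> X" "y \<in> Y" by blast
      then have "X \<subseteq> Y \<or> Y \<subseteq> X" using ch unfolding subset.chain_def by blast
      then show "x \<oplus> y \<in> \<Union>\<C>" using XY sub unfolding subspace_def by blast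
    qed
    then show "\<Union>\<C> \<in> \<A>" using sub ne unfolding \<A>_def by blast
  qed
  then obtain H where HA: "H \<in> \<A>" and maxA: "\<forall>X\<in>\<A>. H \<subseteq> X \<longrightarrow> X = H" ..
  have H: "subspace H" "K0 \<subseteq> H" "x0 \<notin> H" using HA by (simp_all add: \<A>_def)
  have x0c: "x0 \<in> carrier M" using x0 J_carrier by blast
  have "\<exists>c\<in>F. x \<ominus> c \<otimes> x0 \<in> H" if x: "x \<in> J" for x
  proof (cases "x \<in> H")
    case True
    have "x \<ominus> \<zero> \<otimes> x0 = x" using x J_carrier x0c by (auto simp: a_minus_def)
    then show ?thesis using True F_zero by (intro bexI[of _ \<zero>]) simp_all
  next
    case False
    define H' where "H' = {u \<oplus> c \<otimes> x | u c. u \<in> H \<and> c \<in> F}"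
    have H': "subspace H'" "H \<subseteq> H'" "x \<in> H'"
      unfolding H'_def by (rule subspace_extend[OF H(1) x])+
    have "x0 \<in> H'"
    proof (rule ccontr)
      assume "x0 \<notin> H'"
      moreover have "K0 \<subseteq> H'" using H(2) H'(2) by (rule order_trans)
      ultimately have "H' \<in> \<A>" using H'(1) by (simp add: \<A>_def)
      then have "H' = H" using maxA H'(2) by simp
      then show False using H'(3) False by simp
    qed
    then obtain u c where uc: "u \<in> H" "c \<in> F" "x0 = u \<oplus> c \<otimes> x" unfolding H'_def by blast
    have xc: "x \<in> carrier M" using x J_carrier by blast
    have ucc: "u \<in> carrier M" "c \<in> carrier M" using uc H(1) J_carrier F_c unfolding subspace_def by blast+
    have "c \<noteq> \<zero>" using uc H(3) xc ucc by auto
    then obtain d where d: "d \<in> F" "c \<otimes> d = \<one>" using F_inv uc(2) by blast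
    have dc: "d \<in> carrier M" using d F_c by blast
    have "d \<otimes> x0 = d \<otimes> u \<oplus> (c \<otimes> d) \<otimes> x" unfolding uc(3) using xc ucc dc by algebra
    then have "d \<otimes> x0 = d \<otimes> u \<oplus> x" using d(2) xc by simp
    then have "x \<ominus> d \<otimes> x0 = (\<ominus> \<one>) \<otimes> (d \<otimes> u)" using xc dc ucc by algebra
    moreover have "(\<ominus> \<one>) \<otimes> (d \<otimes> u) \<in> H"
      using H(1) uc(1) d(1) F_neg[OF F_one] unfolding subspace_def by blast
    ultimately show ?thesis using d(1) by (intro bexI[of _ d]) simp_all
  qed
  then show ?thesis using H by blast
qed

text \<open>The last clause is a Leibniz rule in which \<open>r\<close> and \<open>s\<close> are the
  residues of \<open>x\<close> and \<open>y\<close>; it is what makes shears multiplicative.\<close>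

definition functional :: "('a \<Rightarrow> 'a) \<Rightarrow> bool" where
  "functional l \<longleftrightarrow> (\<forall>x\<in>carrier M. l x \<in> F) \<and> l \<one> = \<zero> \<and> (\<forall>x\<in>decomposable M J. l x = \<zero>) \<and>
     (\<forall>x\<in>carrier M. \<forall>y\<in>carrier M. l (x \<oplus> y) = l x \<oplus> l y) \<and>
     (\<forall>x\<in>carrier M. \<forall>y\<in>carrier M. \<exists>r\<in>F. \<exists>s\<in>F. x \<ominus> r \<in> J \<and> y \<ominus> s \<in> J \<and>
        l (x \<otimes> y) = r \<otimes> l y \<oplus> s \<otimes> l x)"

text \<open>With a hyperplane \<open>H\<close> of \<open>J\<close> and \<open>x0\<close> outside it,
  the ring decomposes as \<open>F + F x0 + H\<close>, and \<open>l\<close> reads off the coefficient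
  of \<open>x0\<close>. Products of elements of \<open>J\<close> fall into \<open>H\<close>, which
  gives the Leibniz rule.\<close>

lemma functional_exists:
  assumes nz: "\<not> J \<subseteq> L 1" and A: "finite A" "A \<subseteq> carrier M"
  shows "\<exists>l x0. functional l \<and> (\<forall>a\<in>A. l a = \<zero>) \<and> x0 \<in> carrier M \<and> l x0 = \<one>"
proof -
  \<comment> \<open>The residue in \<open>F\<close>. Since the functional will vanish on
    \<open>F\<close>, it suffices to put the differences \<open>a - rs a\<close> into the
    hyperplane.\<close>
  define rs where "rs x = (SOME c. c \<in> F \<and> x \<ominus> c \<in> J)" for x
  have rs: "rs x \<in> F \<and> x \<ominus> rs x \<in> J" if "x \<in> carrier M" for x
    unfolding rs_def by (rule someI_ex) (use decomp[OF that] in blast)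
  have "\<exists>ts. set ts = (\<lambda>a. a \<ominus> rs a) ` A" by (rule finite_list[OF finite_imageI[OF A(1)]])
  then obtain ts where ts: "set ts = (\<lambda>a. a \<ominus> rs a) ` A" ..
  have tsJ: "set ts \<subseteq> J" using ts rs A(2) by auto
  obtain x0 where x0: "x0 \<in> J" "x0 \<notin> K ts" using K_proper[OF nz tsJ] by blast
  obtain H where H: "subspace H" "K ts \<subseteq> H" "x0 \<notin> H" and Hc: "\<forall>x\<in>J. \<exists>c\<in>F. x \<ominus> c \<otimes> x0 \<in> H"
    using hyperplane[OF conjunct1[OF subspace_K[OF tsJ]] x0] by metis
  have HJ: "H \<subseteq> J" and Hdec: "decomposable M J \<subseteq> H" and Hadd: "\<And>x y. x \<in> H \<Longrightarrow> y \<in> H \<Longrightarrow> x \<oplus> y \<in> H"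
    and Hsm: "\<And>c x. c \<in> F \<Longrightarrow> x \<in> H \<Longrightarrow> c \<otimes> x \<in> H" using H(1) unfolding subspace_def by auto
  have Hcar: "x \<in> carrier M" if "x \<in> H" for x using that HJ J_carrier by blast
  have x0c: "x0 \<in> carrier M" using x0 J_carrier by blast
  have H0: "\<zero> \<in> H" using Hdec dec_zero by blast
  define rel where "rel x r c \<longleftrightarrow> r \<in> F \<and> c \<in> F \<and> (\<exists>h\<in>H. x = r \<oplus> c \<otimes> x0 \<oplus> h)" for x r c
  have rel_ex: "\<exists>r c. rel x r c" if x: "x \<in> carrier M" for x
  proof -
    obtain r where r: "r \<in> F" "x \<ominus> r \<in> J" using decomp[OF x] by blast
    then obtain c where c: "c \<in> F" "x \<ominus> r \<ominus> c \<otimes> x0 \<in> H" using Hc by blast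
    have "x = r \<oplus> c \<otimes> x0 \<oplus> (x \<ominus> r \<ominus> c \<otimes> x0)" using x x0c F_c[OF r(1)] F_c[OF c(1)] by algebra
    then show ?thesis using r c unfolding rel_def by blast
  qed
  \<comment> \<open>The difference of the two residues lies in both \<open>F\<close> and
    \<open>J\<close>, so it vanishes. What remains is a multiple of \<open>x0\<close> in
    \<open>H\<close>, and a nonzero coefficient could be inverted to bring \<open>x0\<close> itself
    into \<open>H\<close>.\<close>
  have rel_uniq: "c = c'" if 1: "rel x r c" and 2: "rel x r' c'" for x r c r' c'
  proof (rule ccontr)
    assume ne: "c \<noteq> c'"
    obtain h h' where h: "h \<in> H" "x = r \<oplus> c \<otimes> x0 \<oplus> h" and h': "h' \<in> H" "x = r' \<oplus> c' \<otimes> x0 \<oplus> h'"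
      using 1 2 unfolding rel_def by blast
    have F: "r \<in> F" "c \<in> F" "r' \<in> F" "c' \<in> F" using 1 2 unfolding rel_def by auto
    note car = F_c[OF F(1)] F_c[OF F(2)] F_c[OF F(3)] F_c[OF F(4)] Hcar[OF h(1)] Hcar[OF h'(1)] x0c
    have eq: "r \<oplus> c \<otimes> x0 \<oplus> h = r' \<oplus> c' \<otimes> x0 \<oplus> h'" using h h' by simp
    have rr: "r \<ominus> r' = (c' \<ominus> c) \<otimes> x0 \<oplus> (h' \<oplus> (\<ominus> \<one>) \<otimes> h)"
    proof -
      have "r \<ominus> r' = (r \<oplus> c \<otimes> x0 \<oplus> h) \<ominus> (r' \<oplus> c \<otimes> x0 \<oplus> h)" using car by algebra
      also have "\<dots> = (r' \<oplus> c' \<otimes> x0 \<oplus> h') \<ominus> (r' \<oplus> c \<otimes> x0 \<oplus> h)" by (simp only: eq)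
      also have "\<dots> = (c' \<ominus> c) \<otimes> x0 \<oplus> (h' \<oplus> (\<ominus> \<one>) \<otimes> h)" using car by algebra
      finally show ?thesis .
    qed
    have hh: "h' \<oplus> (\<ominus> \<one>) \<otimes> h \<in> H" using h h' Hadd Hsm F_neg[OF F_one] by blast
    then have "(c' \<ominus> c) \<otimes> x0 \<oplus> (h' \<oplus> (\<ominus> \<one>) \<otimes> h) \<in> J"
      using HJ x0 J_add J_mult[of "c' \<ominus> c" x0] car by auto
    moreover have "r \<ominus> r' \<in> F" unfolding a_minus_def using F F_add F_neg by blast
    ultimately have "r \<ominus> r' = \<zero>" using F_J rr by simp
    then have 0: "(c' \<ominus> c) \<otimes> x0 \<oplus> (h' \<oplus> (\<ominus> \<one>) \<otimes> h) = \<zero>" using rr by simp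
    have dF: "c' \<ominus> c \<in> F" unfolding a_minus_def using F F_add F_neg by blast
    have "c' \<ominus> c \<noteq> \<zero>" using ne car by (metis r_right_minus_eq)
    then obtain d where d: "d \<in> F" "(c' \<ominus> c) \<otimes> d = \<one>" using F_inv dF by blast
    define g where "g = h' \<oplus> (\<ominus> \<one>) \<otimes> h"
    define b where "b = c' \<ominus> c"
    have bg: "b \<in> carrier M" "g \<in> carrier M" "d \<in> carrier M"
      using car hh Hcar F_c d by (auto simp: b_def g_def)
    have "d \<otimes> (b \<otimes> x0 \<oplus> g) = (b \<otimes> d) \<otimes> x0 \<oplus> d \<otimes> g" using bg x0c by algebra
    then have "x0 \<oplus> d \<otimes> g = \<zero>" using 0 d(2) bg x0c by (simp add: b_def[symmetric] g_def[symmetric])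
    then have "x0 = (\<ominus> \<one>) \<otimes> (d \<otimes> g)" using bg x0c by (simp add: l_minus minus_equality)
    moreover have "(\<ominus> \<one>) \<otimes> (d \<otimes> g) \<in> H" using hh d(1) F_neg[OF F_one] Hsm unfolding g_def by blast
    ultimately show False using H(3) by simp
  qed
  define l where "l x = (THE c. \<exists>r. rel x r c)" for x
  have l: "l x = c" if "rel x r c" for x r c
    unfolding l_def using that rel_uniq by blast
  have lrel: "\<exists>r. rel x r (l x)" if "x \<in> carrier M" for x
    using rel_ex[OF that] l by metis
  have relH: "rel x \<zero> \<zero>" if "x \<in> H" for x
    unfolding rel_def using that F_zero Hcar x0c by (intro conjI bexI[of _ x]) simp_all
  have "functional l"
    unfolding functional_def
  proof (intro conjI ballI)
    show "l x \<in> F" if "x \<in> carrier M" for x using lrel[OF that] unfolding rel_def by blast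
    have "rel \<one> \<one> \<zero>" unfolding rel_def using F_zero F_one H0 x0c by (intro conjI bexI[of _ \<zero>]) simp_all
    then show "l \<one> = \<zero>" by (rule l)
    show "l x = \<zero>" if "x \<in> decomposable M J" for x
      using that Hdec by (intro l[OF relH]) blast
    fix x y assume xy: "x \<in> carrier M" "y \<in> carrier M"
    obtain r s where r: "rel x r (l x)" and s: "rel y s (l y)" using lrel xy by blast
    obtain h h' where h: "h \<in> H" "x = r \<oplus> l x \<otimes> x0 \<oplus> h" and h': "h' \<in> H" "y = s \<oplus> l y \<otimes> x0 \<oplus> h'"
      using r s unfolding rel_def by blast
    define c d where "c = l x" and "d = l y"
    have F: "r \<in> F" "c \<in> F" "s \<in> F" "d \<in> F" using r s unfolding rel_def c_def d_def by auto
    note car = F_c[OF F(1)] F_c[OF F(2)] F_c[OF F(3)] F_c[OF F(4)] Hcar[OF h(1)] Hcar[OF h'(1)] x0c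
    have x: "x = r \<oplus> c \<otimes> x0 \<oplus> h" and y: "y = s \<oplus> d \<otimes> x0 \<oplus> h'" using h h' unfolding c_def d_def by simp_all
    have "x \<oplus> y = (r \<oplus> s) \<oplus> (c \<oplus> d) \<otimes> x0 \<oplus> (h \<oplus> h')" unfolding x y using car by algebra
    then have "rel (x \<oplus> y) (r \<oplus> s) (c \<oplus> d)" unfolding rel_def using F F_add Hadd h h' by blast
    then show "l (x \<oplus> y) = l x \<oplus> l y" unfolding c_def d_def by (rule l)
    have J1: "c \<otimes> x0 \<oplus> h \<in> J" "d \<otimes> x0 \<oplus> h' \<in> J"
      by (rule J_add[OF J_mult[OF car(2) x0(1)] subsetD[OF HJ h(1)]],
          rule J_add[OF J_mult[OF car(4) x0(1)] subsetD[OF HJ h'(1)]])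
    have "r \<otimes> h' \<oplus> s \<otimes> h \<oplus> (c \<otimes> x0 \<oplus> h) \<otimes> (d \<otimes> x0 \<oplus> h') \<in> H"
      by (intro Hadd[OF Hadd[OF Hsm[OF F(1) h'(1)] Hsm[OF F(3) h(1)]]]
          subsetD[OF Hdec decomposable.mult[OF J1]])
    moreover have "x \<otimes> y = r \<otimes> s \<oplus> (r \<otimes> d \<oplus> s \<otimes> c) \<otimes> x0 \<oplus>
        (r \<otimes> h' \<oplus> s \<otimes> h \<oplus> (c \<otimes> x0 \<oplus> h) \<otimes> (d \<otimes> x0 \<oplus> h'))"
    proof -
      define p q where "p = c \<otimes> x0 \<oplus> h" and "q = d \<otimes> x0 \<oplus> h'"
      have pq: "p \<in> carrier M" "q \<in> carrier M" using car by (simp_all add: p_def q_def)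
      have "x = r \<oplus> p" "y = s \<oplus> q" unfolding x y p_def q_def using car by (simp_all add: a_assoc)
      then have "x \<otimes> y = r \<otimes> s \<oplus> (r \<otimes> q \<oplus> s \<otimes> p) \<oplus> p \<otimes> q" using car pq by algebra
      moreover have "r \<otimes> q \<oplus> s \<otimes> p = (r \<otimes> d \<oplus> s \<otimes> c) \<otimes> x0 \<oplus> (r \<otimes> h' \<oplus> s \<otimes> h)"
        unfolding p_def q_def using car by algebra
      ultimately show ?thesis unfolding p_def[symmetric] q_def[symmetric] using car pq
        by (simp add: a_assoc)
    qed
    moreover have "r \<otimes> s \<in> F" "r \<otimes> d \<oplus> s \<otimes> c \<in> F" using F F_add F_mult by auto
    ultimately have "rel (x \<otimes> y) (r \<otimes> s) (r \<otimes> d \<oplus> s \<otimes> c)" unfolding rel_def by blast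
    then have "l (x \<otimes> y) = r \<otimes> l y \<oplus> s \<otimes> l x" unfolding c_def d_def by (rule l)
    moreover have "x \<ominus> r = c \<otimes> x0 \<oplus> h" "y \<ominus> s = d \<otimes> x0 \<oplus> h'" unfolding x y using car by algebra+
    ultimately show "\<exists>r\<in>F. \<exists>s\<in>F. x \<ominus> r \<in> J \<and> y \<ominus> s \<in> J \<and> l (x \<otimes> y) = r \<otimes> l y \<oplus> s \<otimes> l x"
      using F J1 by (intro bexI[of _ r] bexI[of _ s]) simp_all
  qed
  moreover have "l a = \<zero>" if a: "a \<in> A" for a
  proof -
    have ac: "a \<in> carrier M" using a A(2) by blast
    have "a \<ominus> rs a \<in> H" using a ts subspace_K[OF tsJ] H(2) by blast
    moreover have "a = rs a \<oplus> \<zero> \<otimes> x0 \<oplus> (a \<ominus> rs a)" using ac x0c F_c[of "rs a"] rs[OF ac] by algebra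
    ultimately have "rel a (rs a) \<zero>" unfolding rel_def using rs[OF ac] F_zero by blast
    then show ?thesis by (rule l)
  qed
  moreover have "l x0 = \<one>"
  proof (rule l)
    show "rel x0 \<zero> \<one>" unfolding rel_def using F_zero F_one H0 x0c by (intro conjI bexI[of _ \<zero>]) simp_all
  qed
  ultimately show ?thesis using x0c by blast
qed

definition shear :: "('a \<Rightarrow> 'a) \<Rightarrow> 'a \<Rightarrow> 'a \<Rightarrow> 'a" where
  "shear l v x = x \<oplus> l x \<otimes> v"

lemma functional_F: "functional l \<Longrightarrow> x \<in> carrier M \<Longrightarrow> l x \<in> carrier M"
  unfolding functional_def using F_c by blast

lemma functional_add: "functional l \<Longrightarrow> x \<in> carrier M \<Longrightarrow> y \<in> carrier M \<Longrightarrow> l (x \<oplus> y) = l x \<oplus> l y"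
  unfolding functional_def by blast

lemma functional_dec: "functional l \<Longrightarrow> x \<in> decomposable M J \<Longrightarrow> l x = \<zero>"
  unfolding functional_def by blast

text \<open>The displacement \<open>l x \<otimes> v\<close> is decomposable, so \<open>l'\<close>
  does not see it and the two displacements simply add up. This also holds for two different
  functionals, which is how the second one later fixes what the first one has moved.\<close>

lemma shear_shear:
  assumes "functional l" "functional l'" "v \<in> J" "v \<in> L 1" "w \<in> J" "x \<in> carrier M"
  shows "shear l' w (shear l v x) = x \<oplus> l x \<otimes> v \<oplus> l' x \<otimes> w"
proof -
  have vc: "v \<in> carrier M" using assms(3) J_carrier by blast
  have "l x \<otimes> v \<in> decomposable M J"
    by (rule dec_smult[OF decomposable.ann[OF assms(3,4)] functional_F[OF assms(1,6)]])
  then have "l' (x \<oplus> l x \<otimes> v) = l' x \<oplus> \<zero>"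
    using functional_add[OF assms(2,6), of "l x \<otimes> v"] functional_dec[OF assms(2)]
      functional_F[OF assms(1,6)] vc by simp
  then show ?thesis unfolding shear_def using functional_F[OF assms(2,6)] by simp
qed

text \<open>Because \<open>v\<close> kills \<open>J\<close>, its product with \<open>x\<close>
  equals its product with the residue of \<open>x\<close>, so the mixed terms of a product are
  exactly those of the Leibniz rule. The inverse is the shear along the negative of
  \<open>v\<close>.\<close>

lemma shear_iso:
  assumes l: "functional l" and v: "v \<in> J" "v \<in> L 1"
  shows "shear l v \<in> ring_iso M M"
proof -
  have vc: "v \<in> carrier M" using v J_carrier by blast
  have vJ: "v \<otimes> y = \<zero>" if "y \<in> J" for y using v(2) that unfolding L1_iff by blast
  have cl: "shear l w x \<in> carrier M" if "x \<in> carrier M" "w \<in> carrier M" for x w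
    using that functional_F[OF l] by (simp add: shear_def)
  have "shear l v \<in> ring_hom M M"
  proof (rule ring_hom_memI)
    show "shear l v x \<in> carrier M" if "x \<in> carrier M" for x using cl that vc by blast
    show "shear l v \<one> = \<one>" using l vc unfolding shear_def functional_def by simp
    fix x y assume x: "x \<in> carrier M" and y: "y \<in> carrier M"
    note lc = functional_F[OF l x] functional_F[OF l y]
    show "shear l v (x \<oplus> y) = shear l v x \<oplus> shear l v y"
      unfolding shear_def functional_add[OF l x y] using x y vc lc by algebra
    obtain r s where rs: "r \<in> F" "s \<in> F" "x \<ominus> r \<in> J" "y \<ominus> s \<in> J" "l (x \<otimes> y) = r \<otimes> l y \<oplus> s \<otimes> l x"
      using l x y unfolding functional_def by blast
    note rc = F_c[OF rs(1)] F_c[OF rs(2)]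
    have "v \<otimes> x = v \<otimes> (x \<ominus> r) \<oplus> v \<otimes> r" "v \<otimes> y = v \<otimes> (y \<ominus> s) \<oplus> v \<otimes> s"
      using x y rc vc by algebra+
    then have vx: "v \<otimes> x = v \<otimes> r" "v \<otimes> y = v \<otimes> s" using vJ rs(3,4) vc rc by simp_all
    have "(x \<oplus> l x \<otimes> v) \<otimes> (y \<oplus> l y \<otimes> v) =
        x \<otimes> y \<oplus> l x \<otimes> (v \<otimes> y) \<oplus> l y \<otimes> (v \<otimes> x) \<oplus> (l x \<otimes> l y) \<otimes> (v \<otimes> v)"
      using x y vc lc by algebra
    also have "\<dots> = x \<otimes> y \<oplus> l x \<otimes> (v \<otimes> s) \<oplus> l y \<otimes> (v \<otimes> r) \<oplus> (l x \<otimes> l y) \<otimes> \<zero>"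
      by (simp only: vx vJ[OF v(1)])
    also have "\<dots> = x \<otimes> y \<oplus> (r \<otimes> l y \<oplus> s \<otimes> l x) \<otimes> v" using x y vc lc rc by algebra
    finally show "shear l v (x \<otimes> y) = shear l v x \<otimes> shear l v y" unfolding shear_def rs(5) by simp
  qed
  moreover have "bij_betw (shear l v) (carrier M) (carrier M)"
  proof (rule bij_betw_byWitness[where f' = "shear l (\<ominus> v)"])
    have nv: "\<ominus> v \<in> J" "\<ominus> v \<in> L 1"
      using v J_neg additive_subgroup.a_inv_closed[OF L_sub] by blast+
    have "shear l (\<ominus> v) (shear l v x) = x \<and> shear l v (shear l (\<ominus> v) x) = x" if x: "x \<in> carrier M" for x
    proof -
      have "x \<oplus> l x \<otimes> v \<oplus> l x \<otimes> (\<ominus> v) = x" "x \<oplus> l x \<otimes> (\<ominus> v) \<oplus> l x \<otimes> v = x"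
        using x functional_F[OF l x] vc by algebra+
      then show ?thesis using shear_shear[OF l l v nv(1) x] shear_shear[OF l l nv v(1) x] by simp
    qed
    then show "\<forall>a\<in>carrier M. shear l (\<ominus> v) (shear l v a) = a"
      "\<forall>a\<in>carrier M. shear l v (shear l (\<ominus> v) a) = a" by blast+
    show "shear l v ` carrier M \<subseteq> carrier M" "shear l (\<ominus> v) ` carrier M \<subseteq> carrier M"
      using cl vc by auto
  qed
  ultimately show ?thesis unfolding ring_iso_def by blast
qed

end

section \<open>Almost strong minimality forces the square of the maximal ideal to vanish\<close>

lemma cls_aut:
  assumes "ring M" "\<sigma> \<in> ring_iso M M" "\<And>a. a \<in> A \<Longrightarrow> \<sigma> a = a" "A \<subseteq> carrier M"
    and s: "sort_over M A s" and z: "z \<in> cls y s"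
  shows "map \<sigma> z \<in> cls (map \<sigma> y) s"
proof -
  have in_s: "in_sort z s" "in_sort y s" using in_cls[OF s z] by auto
  then have t: "z \<in> tuples M (fst s)" "y \<in> tuples M (fst s)" using in_sort_tuples[OF s] by auto
  have sub: "snd (snd s) \<subseteq> fst (snd s) \<times> fst (snd s)" "fst (snd s) \<subseteq> tuples M (fst s)"
    using s definable_tuples[of M A "fst s" "fst (snd s)"] by (simp_all add: sort_over_def equiv_def)
  have "y @ z \<in> concat_pairs (snd (snd s))"
    using z by (auto simp: concat_pairs_def image_iff intro!: bexI[of _ "(y, z)"])
  moreover have "y @ z \<in> tuples M (fst s + fst s)" using t by (auto simp: tuples_def)
  moreover have "definable M A (fst s + fst s) (concat_pairs (snd (snd s)))" using s by (simp add: sort_over_def)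
  ultimately have "map \<sigma> (y @ z) \<in> concat_pairs (snd (snd s))"
    using definable_aut[OF assms(1-4)] by blast
  then have "map \<sigma> y @ map \<sigma> z \<in> concat_pairs (snd (snd s))" by simp
  moreover have "length (map \<sigma> y) = fst s" using t(2) by (simp add: tuples_def)
  ultimately show ?thesis using concat_pairs_iff[OF sub] by simp
qed

context conn_ring
begin

text \<open>As \<open>l x0 = 1\<close>, the shears along \<open>T\<close> move \<open>x0\<close>
  through the infinite set \<open>x0 + T\<close>. If they all fixed every class of
  \<open>s0\<close>, then \<open>nice_aut\<close> would confine this orbit to a finite set.\<close>

lemma finite_orbit_contradiction:
  assumes T: "T \<subseteq> J \<inter> L 1" "infinite T"
    and A0: "A0 \<subseteq> carrier M"
    and cover: "\<forall>W\<in>\<W>. nice M A0 s0 W" "carrier M \<subseteq> \<Union>\<W>"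
    and l: "functional l" "\<forall>a\<in>A0. l a = \<zero>" "x0 \<in> carrier M" "l x0 = \<one>"
  shows "\<exists>v\<in>T. \<exists>y. in_sort y s0 \<and> map (shear l v) y \<notin> cls y s0"
proof (rule ccontr)
  assume neg: "\<not> ?thesis"
  obtain W where W: "W \<in> \<W>" "x0 \<in> W" using cover(2) l(3) by blast
  have "\<exists>Z. finite Z \<and> (\<forall>\<sigma>. \<sigma> \<in> ring_iso M M \<and> (\<forall>a\<in>A0. \<sigma> a = a) \<and>
    (\<forall>y. in_sort y s0 \<longrightarrow> map \<sigma> y \<in> cls y s0) \<longrightarrow> \<sigma> x0 \<in> Z)"
    by (rule nice_aut[OF ring_axioms _ W(2) A0]) (use cover(1) W(1) in blast)
  then obtain Z where Z: "finite Z" and Z': "\<forall>\<sigma>. \<sigma> \<in> ring_iso M M \<and> (\<forall>a\<in>A0. \<sigma> a = a) \<and>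
    (\<forall>y. in_sort y s0 \<longrightarrow> map \<sigma> y \<in> cls y s0) \<longrightarrow> \<sigma> x0 \<in> Z" by (elim exE conjE)
  have Tc: "v \<in> carrier M" if "v \<in> T" for v using that T(1) J_carrier by blast
  have "x0 \<oplus> v \<in> Z" if v: "v \<in> T" for v
  proof -
    have "shear l v \<in> ring_iso M M" using T(1) v by (intro shear_iso[OF l(1)]) blast+
    moreover have "\<forall>a\<in>A0. shear l v a = a"
      using l(2) A0 Tc[OF v] by (auto simp: shear_def)
    moreover have "\<forall>y. in_sort y s0 \<longrightarrow> map (shear l v) y \<in> cls y s0" using neg v by blast
    ultimately have "shear l v x0 \<in> Z" using Z' by simp
    then show ?thesis using l(4) Tc[OF v] by (simp add: shear_def)
  qed
  then have "finite ((\<lambda>v. x0 \<oplus> v) ` T)" using Z by (meson finite_subset image_subsetI)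
  moreover have "inj_on (\<lambda>v. x0 \<oplus> v) T"
    by (rule inj_onI) (use l(3) Tc in simp)
  ultimately show False using T(2) finite_imageD by blast
qed

lemma square_zero:
  assumes s0: "sort_over M A0 s0" "minimal_sort M s0" and A0: "finite A0" "A0 \<subseteq> carrier M"
    and cover: "\<forall>W\<in>\<W>. nice M A0 s0 W" "carrier M \<subseteq> \<Union>\<W>"
  shows "J \<subseteq> L 1"
proof (rule ccontr)
  assume nz: "\<not> J \<subseteq> L 1"
  then have "\<exists>a. a \<in> L 2 \<and> a \<in> J \<and> a \<notin> L 1" using L_stable by blast
  then obtain a where a: "a \<in> L 2" "a \<in> J" "a \<notin> L 1" by (elim exE conjE)
  have ac: "a \<in> carrier M" using a J_carrier by blast
  \<comment> \<open>Products of \<open>a\<close> with \<open>J\<close> lie in \<open>L 1\<close>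
    because \<open>a\<close> is in \<open>L 2\<close>, so that every element of \<open>T\<close>
    gives rise to shears.\<close>
  define T where "T = (\<lambda>y. a \<otimes> y) ` J"
  have "a \<otimes> y \<in> J \<inter> L 1" if "y \<in> J" for y
    using a(1) that J_mult[OF ac that] unfolding numeral_2_eq_2 by simp
  then have TJ: "T \<subseteq> J \<inter> L 1" unfolding T_def by (rule image_subsetI)
  have "\<exists>y\<in>J. a \<otimes> y \<noteq> \<zero>" using a(3) ac unfolding L1_iff by blast
  then have Tinf: "infinite T" unfolding T_def by (rule infinite_image[OF ac])
  have Tdef: "def1 M (carrier M) T" unfolding T_def by (rule def1_mult_image[OF ac J_def])
  have Tsub: "additive_subgroup T M" unfolding T_def by (rule mult_image_subgroup[OF ac J_sub])
  interpret T: additive_subgroup T M by (rule Tsub)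
  have Tc: "v \<in> carrier M" if "v \<in> T" for v using that TJ J_carrier by blast
  note contr = finite_orbit_contradiction[OF TJ Tinf A0(2) cover]
  obtain l x0 where l: "functional l" "\<forall>a\<in>A0. l a = \<zero>" and x0: "x0 \<in> carrier M" "l x0 = \<one>"
    using functional_exists[OF nz A0] by (elim exE conjE)
  obtain v0 y where v0: "v0 \<in> T" and y: "in_sort y s0" and ny: "map (shear l v0) y \<notin> cls y s0"
    using contr[OF l x0] by (elim bexE exE conjE)
  have yt: "y \<in> tuples M (fst s0)" by (rule in_sort_tuples[OF s0(1) y])
  then have yc: "set y \<subseteq> carrier M" "length y = fst s0" by (simp_all add: tuples_def)
  define sg where "sg v = map (shear l v) y" for v
  have iso: "shear l v \<in> ring_iso M M" if "v \<in> T" for v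
    using TJ that by (intro shear_iso[OF l(1)]) blast+
  have fixA: "shear l v a = a" if "a \<in> A0" "v \<in> T" for a v
    using l(2) A0(2) Tc[OF that(2)] that(1) by (auto simp: shear_def)
  note lc = functional_F[OF l(1)]
  have sg_in: "in_sort (sg v) s0" if "v \<in> T" for v
    unfolding sg_def by (rule sort_aut[OF ring_axioms iso[OF that] fixA[OF _ that] A0(2) s0(1) y])
  have comp: "map (shear l w) (sg v) = sg (v \<oplus> w)" if vw: "v \<in> T" "w \<in> T" for v w
  proof -
    have "shear l w (shear l v x) = shear l (v \<oplus> w) x" if x: "x \<in> set y" for x
    proof -
      have xc: "x \<in> carrier M" using x yc by blast
      have "shear l w (shear l v x) = x \<oplus> l x \<otimes> v \<oplus> l x \<otimes> w"
        using TJ vw by (intro shear_shear[OF l(1) l(1) _ _ _ xc]) blast+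
      also have "\<dots> = shear l (v \<oplus> w) x"
        unfolding shear_def using xc lc[OF xc] Tc[OF vw(1)] Tc[OF vw(2)] by algebra
      finally show ?thesis .
    qed
    then show ?thesis by (simp add: sg_def)
  qed
  \<comment> \<open>The stabiliser in \<open>T\<close> of the class of \<open>y\<close>. Elements of
    \<open>T\<close> that move this class to the same place differ by an element of
    \<open>S\<close>, so a finite orbit would mean finite index and, by connectedness,
    \<open>S = T\<close>.\<close>
  define S where "S = {v \<in> carrier M. v \<in> T \<and> sg v \<in> cls y s0}"
  have dsg: "dlist M (carrier M) (fst s0) (\<lambda>e. map (shear l (e j)) y)" for j
  proof -
    have "dlist M (carrier M) (length y) (\<lambda>e. map (\<lambda>x. x \<oplus> l x \<otimes> e j) y)"
      by (rule dlist_map) (intro dring_intros ring_axioms dterm_const dterm_var lc; use yc in blast)+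
    then show ?thesis unfolding yc(2) shear_def .
  qed
  have dy: "dlist M (carrier M) (fst s0) (\<lambda>e. y)" by (rule dlist_const[OF yc(1) yt])
  have s0c: "sort_over M (carrier M) s0" by (rule sort_over_mono[OF s0(1) A0(2)])
  have Sdef: "def1 M (carrier M) S"
    unfolding S_def sg_def
    by (rule dpred_def1[OF ring_axioms])
      (intro dpred_conj def1_dpred[OF Tdef order_refl dterm_var] dpred_cls[OF s0c order_refl dy dsg])
  have cl: "v \<ominus> w \<in> S" if vw: "v \<in> T" "w \<in> T" and eq: "cls (sg v) s0 = cls (sg w) s0" for v w
  proof -
    have nw: "\<ominus> w \<in> T" using vw(2) by (rule T.a_inv_closed)
    have "sg v \<in> cls (sg w) s0" using cls_self[OF s0(1) sg_in[OF vw(1)]] eq by simp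
    from cls_aut[OF ring_axioms iso[OF nw] fixA[OF _ nw] A0(2) s0(1) this]
    have "sg (v \<oplus> \<ominus> w) \<in> cls (sg (w \<oplus> \<ominus> w)) s0" using comp vw nw by simp
    moreover have "sg (w \<oplus> \<ominus> w) = y"
    proof -
      have "shear l \<zero> x = x" if "x \<in> set y" for x
      proof -
        have "x \<in> carrier M" using that yc by blast
        then show ?thesis using lc by (simp add: shear_def)
      qed
      then show ?thesis using Tc[OF vw(2)] by (simp add: sg_def r_neg map_idI)
    qed
    ultimately show ?thesis using T.a_closed[OF vw(1) nw] Tc by (simp add: S_def a_minus_def)
  qed
  have Ssub: "additive_subgroup S M"
  proof -
    have z: "sg \<zero> = y"
      unfolding sg_def by (rule map_idI) (use yc lc in \<open>auto simp: shear_def\<close>)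
    have c0: "cls (sg v) s0 = cls y s0" if "v \<in> S" for v
      using that cls_eq[OF s0(1)] unfolding S_def by blast
    have zT: "\<zero> \<in> T" by (rule T.zero_closed)
    have neg: "\<ominus> v \<in> S" if v: "v \<in> S" for v
    proof -
      have "v \<in> T" "v \<in> carrier M" using v by (simp_all add: S_def)
      moreover have "\<zero> \<ominus> v \<in> S" using cl[OF zT] c0[OF v] \<open>v \<in> T\<close> by (simp add: z)
      ultimately show ?thesis by (simp add: a_minus_def)
    qed
    show ?thesis
    proof (rule add_subI)
      show "S \<subseteq> carrier M" by (auto simp: S_def)
      show "\<zero> \<in> S" using z zT cls_self[OF s0(1) y] by (simp add: S_def)
      show "\<ominus> v \<in> S" if "v \<in> S" for v using neg that by blast
      fix v w assume v: "v \<in> S" and w: "w \<in> S"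
      have nw: "\<ominus> w \<in> S" using neg w by blast
      have "v \<in> T" "\<ominus> w \<in> T" using v nw by (simp_all add: S_def)
      then have "v \<ominus> (\<ominus> w) \<in> S" using cl c0[OF v] c0[OF nw] by simp
      then show "v \<oplus> w \<in> S" using v w by (simp add: S_def a_minus_def)
    qed
  qed
  define Y where "Y = (\<lambda>v. cls (sg v) s0) ` T"
  have "infinite Y"
  proof
    assume "finite Y"
    then have "finite ((\<lambda>v. S +> v) ` T)"
      unfolding Y_def using cl Tc by (intro finite_cosets[OF Ssub _ \<open>finite Y\<close>[unfolded Y_def]]) auto
    then have "S = T" unfolding T_def
      by (intro connected_image[OF ac Ssub _ Sdef]) (auto simp: S_def T_def)
    then show False using v0 ny by (auto simp: S_def sg_def)
  qed
  moreover have YP: "Y \<subseteq> points s0" unfolding Y_def using sg_in by (auto intro: pointsI)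
  moreover have "definable M (carrier M) (fst s0) (\<Union>Y)"
  proof -
    have "dpred M (carrier M) (\<lambda>e. \<exists>v\<in>T. map (\<lambda>i. e i) [0..<fst s0] \<in> cls (map (shear l v) y) s0)"
      by (rule dpred_ex1[OF Tdef order_refl]) (rule dpred_cls[OF s0c order_refl dsg dlist_vars])
    from definable_dpred[OF zero_closed this]
    have "definable M (carrier M) (fst s0) {z \<in> tuples M (fst s0). \<exists>v\<in>T. z \<in> cls (sg v) s0}"
      unfolding sg_def .
    moreover have "{z \<in> tuples M (fst s0). \<exists>v\<in>T. z \<in> cls (sg v) s0} = \<Union>Y"
      unfolding Y_def using in_cls[OF s0(1)] in_sort_tuples[OF s0(1)] by blast
    ultimately show ?thesis by simp
  qed
  ultimately have fin: "finite (points s0 - Y)" using s0(2) unfolding minimal_sort_def by blast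
  define r where "r d = (SOME z. z \<in> d)" for d :: "'a list set"
  have r: "r d \<in> d" "in_sort (r d) s0" "cls (r d) s0 = d" if "d \<in> points s0" for d
  proof -
    obtain z where z: "in_sort z s0" "d = cls z s0" using \<open>d \<in> points s0\<close> by (rule pointsE)
    then have "z \<in> d" using cls_self[OF s0(1)] by blast
    then show "r d \<in> d" unfolding r_def by (rule someI)
    then show "in_sort (r d) s0" "cls (r d) s0 = d"
      unfolding z(2) using in_cls[OF s0(1)] cls_eq[OF s0(1)] by blast+
  qed
  \<comment> \<open>Besides \<open>A0\<close>, the new functional has to kill the entries of
    \<open>y\<close>, from which the whole orbit is obtained, and one representative of each of the
    finitely many classes outside the orbit.\<close>
  define A1 where "A1 = A0 \<union> set y \<union> (\<Union>d\<in>points s0 - Y. set (r d))"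
  have rt: "set (r d) \<subseteq> carrier M" if "d \<in> points s0" for d
    using in_sort_tuples[OF s0(1) r(2)[OF that]] by (simp add: tuples_def)
  have A1: "finite A1" "A1 \<subseteq> carrier M"
    using A0 fin yc rt by (auto simp: A1_def)
  obtain l' x1 where l': "functional l'" "\<forall>a\<in>A1. l' a = \<zero>" and x1: "x1 \<in> carrier M" "l' x1 = \<one>"
    using functional_exists[OF nz A1] by (elim exE conjE)
  have l'A0: "\<forall>a\<in>A0. l' a = \<zero>" using l'(2) by (simp add: A1_def)
  obtain v z where v: "v \<in> T" and z: "in_sort z s0" and nz: "map (shear l' v) z \<notin> cls z s0"
    using contr[OF l'(1) l'A0 x1] by (elim bexE exE conjE)
  have iso': "shear l' v \<in> ring_iso M M"
    using TJ v by (intro shear_iso[OF l'(1)]) blast+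
  have fixA': "shear l' v a = a" if "a \<in> A1" for a
    using l'(2) A1(2) Tc[OF v] that by (auto simp: shear_def)
  have fixA0': "shear l' v a = a" if "a \<in> A0" for a
    using fixA' that by (simp add: A1_def)
  \<comment> \<open>Each class has a representative that the new shear fixes entry by entry: a
    translate \<open>sg w\<close> if the class is in the orbit, the chosen one otherwise. Hence the
    shear fixes the class.\<close>
  have "\<exists>w. in_sort w s0 \<and> z \<in> cls w s0 \<and> map (shear l' v) w = w"
  proof (cases "cls z s0 \<in> Y")
    case True
    then obtain w where w: "w \<in> T" "cls z s0 = cls (sg w) s0" unfolding Y_def by blast
    have "shear l' v (shear l w x) = shear l w x" if x: "x \<in> set y" for x
    proof -
      have xc: "x \<in> carrier M" using x yc by blast
      have "l' x = \<zero>" using l'(2) x by (simp add: A1_def)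
      moreover have "shear l' v (shear l w x) = x \<oplus> l x \<otimes> w \<oplus> l' x \<otimes> v"
        using TJ v w(1) by (intro shear_shear[OF l(1) l'(1) _ _ _ xc]) blast+
      ultimately show ?thesis using xc lc[OF xc] Tc[OF w(1)] Tc[OF v] by (simp add: shear_def)
    qed
    then have "map (shear l' v) (sg w) = sg w" by (simp add: sg_def)
    moreover have "z \<in> cls (sg w) s0" using cls_self[OF s0(1) z] w(2) by simp
    ultimately show ?thesis using sg_in[OF w(1)] by blast
  next
    case False
    define d where "d = cls z s0"
    have d: "d \<in> points s0 - Y" unfolding d_def using False pointsI[OF z] by simp
    have "map (shear l' v) (r d) = r d"
      by (rule map_idI) (use d fixA' in \<open>auto simp: A1_def\<close>)
    moreover have "z \<in> cls (r d) s0" using r(3)[of d] d cls_self[OF s0(1) z] by (simp add: d_def)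
    ultimately show ?thesis using r(2)[of d] d by blast
  qed
  then obtain w where w: "in_sort w s0" "z \<in> cls w s0" "map (shear l' v) w = w" by (elim exE conjE)
  from cls_aut[OF ring_axioms iso' fixA0' A0(2) s0(1) w(2)]
  have "map (shear l' v) z \<in> cls w s0" using w(3) by simp
  also have "cls w s0 = cls z s0" using cls_eq[OF s0(1) w(2)] by simp
  finally show False using nz by simp
qed

end

section \<open>Transfer to the saturated model\<close>

lemma (in cring) proper_ideal_in_maximal:
  assumes I: "ideal I R" "\<one> \<notin> I"
  shows "\<exists>P. maximalideal P R \<and> I \<subseteq> P"
proof -
  define \<A> where "\<A> = {P. ideal P R \<and> I \<subseteq> P \<and> \<one> \<notin> P}"
  have "\<exists>P\<in>\<A>. \<forall>X\<in>\<A>. P \<subseteq> X \<longrightarrow> X = P"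
  proof (rule subset_Zorn_nonempty)
    show "\<A> \<noteq> {}" using I by (auto simp: \<A>_def)
    fix \<C> assume ne: "\<C> \<noteq> {}" and ch: "subset.chain \<A> \<C>"
    then have sub: "ideal P R" "I \<subseteq> P" "\<one> \<notin> P" if "P \<in> \<C>" for P
      using that unfolding subset.chain_def \<A>_def by auto
    have asg: "additive_subgroup P R" if "P \<in> \<C>" for P using ideal.axioms(1)[OF sub(1)[OF that]] .
    have "ideal (\<Union>\<C>) R"
    proof (rule idealI[OF ring_axioms])
      show "subgroup (\<Union>\<C>) (add_monoid R)"
      proof (rule add.subgroupI)
        show "\<Union>\<C> \<subseteq> carrier R"
          using additive_subgroup.a_subset[OF asg] by (intro Union_least)
        obtain P where "P \<in> \<C>" using ne by blast
        then show "\<Union>\<C> \<noteq> {}" using additive_subgroup.zero_closed[OF asg] by auto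
        fix a assume "a \<in> \<Union>\<C>"
        then obtain X where X: "X \<in> \<C>" "a \<in> X" by blast
        show "\<ominus> a \<in> \<Union>\<C>"
          using additive_subgroup.a_inv_closed[OF asg[OF X(1)] X(2)] X(1) by (rule UnionI[rotated])
        fix b assume "b \<in> \<Union>\<C>"
        then obtain Y where Y: "Y \<in> \<C>" "b \<in> Y" by blast
        have "X \<subseteq> Y \<or> Y \<subseteq> X" using ch X(1) Y(1) unfolding subset.chain_def by blast
        then obtain Z where Z: "Z \<in> \<C>" "a \<in> Z" "b \<in> Z" using X Y by blast
        show "a \<oplus> b \<in> \<Union>\<C>"
          using additive_subgroup.a_closed[OF asg[OF Z(1)] Z(2,3)] Z(1) by (rule UnionI[rotated])
      qed
      fix a x assume "a \<in> \<Union>\<C>" and x: "x \<in> carrier R"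
      then obtain X where X: "X \<in> \<C>" "a \<in> X" by blast
      show "x \<otimes> a \<in> \<Union>\<C>" "a \<otimes> x \<in> \<Union>\<C>"
        using ideal.I_l_closed[OF sub(1)[OF X(1)] X(2) x] ideal.I_r_closed[OF sub(1)[OF X(1)] X(2) x] X(1)
        by auto
    qed
    then show "\<Union>\<C> \<in> \<A>" using sub ne unfolding \<A>_def by blast
  qed
  then obtain P where PA: "P \<in> \<A>" and max: "\<forall>X\<in>\<A>. P \<subseteq> X \<longrightarrow> X = P" ..
  have P: "ideal P R" "I \<subseteq> P" "\<one> \<notin> P" using PA by (simp_all add: \<A>_def)
  have "maximalideal P R"
  proof (rule maximalidealI[OF P(1)])
    show "carrier R \<noteq> P" using P(3) by auto
    fix X assume X: "ideal X R" "P \<subseteq> X" "X \<subseteq> carrier R"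
    show "X = P \<or> X = carrier R"
    proof (cases "\<one> \<in> X")
      case True
      then show ?thesis using ideal.one_imp_carrier[OF X(1)] by simp
    next
      case False
      then have "X \<in> \<A>" using X P(2) by (simp add: \<A>_def)
      then show ?thesis using max X(2) by blast
    qed
  qed
  then show ?thesis using P(2) by blast
qed

text \<open>In this form the maximal ideal is defined by a formula without parameters and can be
  followed into an elementary extension.\<close>

definition nonunits :: "('a, 'm) ring_scheme \<Rightarrow> 'a set" where
  "nonunits S = {x \<in> carrier S. \<not> (\<exists>y\<in>carrier S. x \<otimes>\<^bsub>S\<^esub> y = \<one>\<^bsub>S\<^esub>)}"

text \<open>A nonunit generates a proper ideal, and the only maximal ideal above it is
  \<open>J\<close>.\<close>

lemma local_nonunits:
  assumes "local_ring_with R J" shows "J = nonunits R"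
proof -
  interpret cring R using assms by (simp add: local_ring_with_def)
  have max: "maximalideal J R" and uniq: "\<And>I. maximalideal I R \<Longrightarrow> I = J"
    using assms by (simp_all add: local_ring_with_def)
  interpret J: maximalideal J R by (rule max)
  have "x \<in> nonunits R" if x: "x \<in> J" for x
  proof -
    have "x \<otimes>\<^bsub>R\<^esub> y \<noteq> \<one>\<^bsub>R\<^esub>" if "y \<in> carrier R" for y
      using J.I_r_closed[OF x that] J.one_imp_carrier J.I_notcarr by auto
    then show ?thesis using x J.a_subset by (auto simp: nonunits_def)
  qed
  moreover have "x \<in> J" if x: "x \<in> nonunits R" for x
  proof -
    have xc: "x \<in> carrier R" using x by (simp add: nonunits_def)
    have "\<one>\<^bsub>R\<^esub> \<notin> PIdl\<^bsub>R\<^esub> x"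
    proof
      assume "\<one>\<^bsub>R\<^esub> \<in> PIdl\<^bsub>R\<^esub> x"
      then obtain y where "y \<in> carrier R" "\<one>\<^bsub>R\<^esub> = y \<otimes>\<^bsub>R\<^esub> x" unfolding cgenideal_def by blast
      then have "y \<in> carrier R" "x \<otimes>\<^bsub>R\<^esub> y = \<one>\<^bsub>R\<^esub>" using xc m_comm by simp_all
      then show False using x unfolding nonunits_def by blast
    qed
    then obtain P where P: "maximalideal P R" "PIdl\<^bsub>R\<^esub> x \<subseteq> P"
      using proper_ideal_in_maximal[OF cgenideal_ideal[OF xc]] by metis
    have "P = J" by (rule uniq[OF P(1)])
    then show ?thesis using P(2) cgenideal_self[OF xc] by auto
  qed
  ultimately show ?thesis by blast
qed

section \<open>Formulas that express finite index and residues\<close>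

primrec bigconj :: "rform list \<Rightarrow> rform" where
  "bigconj [] = Eq Zero Zero"
| "bigconj (\<phi> # \<phi>s) = Conj \<phi> (bigconj \<phi>s)"

lemma fsat_bigconj [simp]: "fsat M (bigconj \<phi>s) e \<longleftrightarrow> (\<forall>\<phi>\<in>set \<phi>s. fsat M \<phi> e)"
  by (induction \<phi>s) auto

lemma vars_below_bigconj [simp]: "vars_below (bigconj \<phi>s) n \<longleftrightarrow> (\<forall>\<phi>\<in>set \<phi>s. vars_below \<phi> n)"
  by (induction \<phi>s) auto

lemma sat_exists_pow: "sat M ((Exists ^^ n) \<phi>) xs \<longleftrightarrow> (\<exists>as\<in>tuples M n. sat M \<phi> (as @ xs))"
proof (induction n arbitrary: xs)
  case 0
  show ?case by (simp add: tuples_0)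
next
  case (Suc n)
  have "sat M ((Exists ^^ Suc n) \<phi>) xs \<longleftrightarrow> (\<exists>a\<in>carrier M. \<exists>as\<in>tuples M n. sat M \<phi> (as @ a # xs))"
    by (simp add: Suc.IH)
  also have "\<dots> \<longleftrightarrow> (\<exists>as\<in>tuples M (Suc n). sat M \<phi> (as @ xs))"
  proof
    assume "\<exists>a\<in>carrier M. \<exists>as\<in>tuples M n. sat M \<phi> (as @ a # xs)"
    then obtain a as where "a \<in> carrier M" "as \<in> tuples M n" "sat M \<phi> (as @ a # xs)" by blast
    then show "\<exists>as\<in>tuples M (Suc n). sat M \<phi> (as @ xs)"
      \<comment> \<open>The outermost quantifier binds the last entry of the tuple.\<close>
      by (intro bexI[of _ "as @ [a]"]) (auto simp: tuples_def)
  next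
    assume "\<exists>as\<in>tuples M (Suc n). sat M \<phi> (as @ xs)"
    then obtain as where as: "as \<in> tuples M (Suc n)" "sat M \<phi> (as @ xs)" by blast
    then have ne: "as \<noteq> []" by (auto simp: tuples_def)
    have "last as \<in> carrier M" "butlast as \<in> tuples M n"
      using as(1) ne by (auto simp: tuples_def dest: in_set_butlastD)
    moreover have "butlast as @ last as # xs = as @ xs" using ne by simp
    ultimately show "\<exists>a\<in>carrier M. \<exists>as\<in>tuples M n. sat M \<phi> (as @ a # xs)" using as(2) by metis
  qed
  finally show ?case .
qed

lemma vars_below_exists_pow: "vars_below ((Exists ^^ n) \<phi>) m \<longleftrightarrow> vars_below \<phi> (n + m)"
  by (induction n arbitrary: m) auto

text \<open>\<open>\<phi>\<close> with the term \<open>t\<close> for its first variable, inside \<open>k\<close> further quantifiers.\<close>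

definition inst :: "rform \<Rightarrow> rterm \<Rightarrow> nat \<Rightarrow> rform" where
  "inst \<phi> t k = fsub (case_nat t (\<lambda>j. Var (j + k))) \<phi>"

lemma fsat_inst [simp]: "fsat M (inst \<phi> t k) e = fsat M \<phi> (case_nat (fval M e t) (\<lambda>j. e (j + k)))"
proof -
  have "(\<lambda>i. fval M e (case_nat t (\<lambda>j. Var (j + k)) i)) = case_nat (fval M e t) (\<lambda>j. e (j + k))"
    by (auto simp: fun_eq_iff split: nat.split)
  then show ?thesis by (simp add: inst_def)
qed

lemma vars_below_inst:
  "vars_below \<phi> (Suc n) \<Longrightarrow> term_vars t \<subseteq> {..<m} \<Longrightarrow> n + k \<le> m \<Longrightarrow> vars_below (inst \<phi> t k) m"
  unfolding inst_def by (rule vars_below_fsub) (auto split: nat.splits)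

abbreviation imp :: "rform \<Rightarrow> rform \<Rightarrow> rform" where "imp \<phi> \<psi> \<equiv> Neg (Conj \<phi> (Neg \<psi>))"
abbreviation all :: "rform \<Rightarrow> rform" where "all \<phi> \<equiv> Neg (Exists (Neg \<phi>))"
abbreviation unitf :: "rterm \<Rightarrow> rform" where
  "unitf t \<equiv> Exists (Eq (Mult (tsub (\<lambda>i. Var (Suc i)) t) (Var 0)) One)"

text \<open>\<open>proper_cover \<phi> l n\<close> says of parameters \<open>b\<^sub>0, \<dots>, b\<^bsub>l-1\<^esub>, t\<^sub>0, \<dots>, t\<^bsub>n-1\<^esub>\<close> that \<open>\<phi>(x, b)\<close> defines a proper
  subgroup of the group of nonunits, with the cosets of the \<open>t\<^sub>i\<close> covering the latter.\<close>

definition proper_cover :: "rform \<Rightarrow> nat \<Rightarrow> nat \<Rightarrow> rform" where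
  "proper_cover \<phi> l n = bigconj
     [all (imp (inst \<phi> (Var 0) 1) (Neg (unitf (Var 0)))),
      inst \<phi> Zero 0,
      all (all (imp (Conj (inst \<phi> (Var 0) 2) (inst \<phi> (Var 1) 2)) (inst \<phi> (Add (Var 0) (Var 1)) 2))),
      all (imp (inst \<phi> (Var 0) 1) (inst \<phi> (Minus (Var 0)) 1)),
      all (Neg (Conj (Neg (unitf (Var 0)))
        (bigconj (map (\<lambda>i. Neg (inst \<phi> (Add (Var 0) (Minus (Var (Suc (l + i))))) 1)) [0..<n])))),
      Exists (Conj (Neg (unitf (Var 0))) (Neg (inst \<phi> (Var 0) 1)))]"

lemma vars_proper_cover: "vars_below \<phi> (Suc l) \<Longrightarrow> vars_below (proper_cover \<phi> l n) (l + n)"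
  unfolding proper_cover_def
  by (auto intro!: vars_below_inst)

lemma sat_proper_cover:
  assumes "vars_below \<phi> (Suc (length bs))" and S: "S = {x \<in> carrier M. sat M \<phi> (x # bs)}" and M: "ring M"
    and ts: "set ts \<subseteq> carrier M"
  shows "sat M (proper_cover \<phi> (length bs) (length ts)) (bs @ ts) \<longleftrightarrow>
    S \<subseteq> nonunits M \<and> \<zero>\<^bsub>M\<^esub> \<in> S \<and> (\<forall>x\<in>S. \<forall>y\<in>S. x \<oplus>\<^bsub>M\<^esub> y \<in> S) \<and> (\<forall>x\<in>S. \<ominus>\<^bsub>M\<^esub> x \<in> S) \<and>
    (\<forall>x\<in>nonunits M. \<exists>t\<in>set ts. x \<ominus>\<^bsub>M\<^esub> t \<in> S) \<and> \<not> nonunits M \<subseteq> S"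
proof -
  interpret ring M by fact
  have 0: "fsat M \<phi> (case_nat x ((!) (bs @ ts))) \<longleftrightarrow> x \<in> S" if "x \<in> carrier M" for x
  proof -
    have "fsat M \<phi> (case_nat x ((!) (bs @ ts))) = fsat M \<phi> ((!) (x # bs))"
      by (rule fsat_cong[OF assms(1)]) (auto simp: nth_append split: nat.split)
    then show ?thesis using that by (simp add: S sat_fsat)
  qed
  have Sc: "S \<subseteq> carrier M" unfolding S by blast
  have 5: "(\<exists>i\<in>{0..<length ts}. fsat M \<phi> (case_nat (x \<oplus>\<^bsub>M\<^esub> \<ominus>\<^bsub>M\<^esub> ts ! i) ((!) (bs @ ts)))) \<longleftrightarrow>
      (\<exists>t\<in>set ts. x \<oplus>\<^bsub>M\<^esub> \<ominus>\<^bsub>M\<^esub> t \<in> S)" if x: "x \<in> carrier M" for x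
  proof -
    have "(\<exists>i\<in>{0..<length ts}. fsat M \<phi> (case_nat (x \<oplus>\<^bsub>M\<^esub> \<ominus>\<^bsub>M\<^esub> ts ! i) ((!) (bs @ ts)))) \<longleftrightarrow>
      (\<exists>t\<in>set ts. fsat M \<phi> (case_nat (x \<oplus>\<^bsub>M\<^esub> \<ominus>\<^bsub>M\<^esub> t) ((!) (bs @ ts))))"
      by (auto simp: in_set_conv_nth Bex_def)
    also have "\<dots> \<longleftrightarrow> (\<exists>t\<in>set ts. x \<oplus>\<^bsub>M\<^esub> \<ominus>\<^bsub>M\<^esub> t \<in> S)"
      by (rule bex_cong[OF refl], rule 0) (use x ts in auto)
    finally show ?thesis .
  qed
  have *: "sat M (proper_cover \<phi> (length bs) (length ts)) (bs @ ts) \<longleftrightarrow>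
    (\<forall>x\<in>carrier M. x \<in> S \<longrightarrow> \<not> (\<exists>y\<in>carrier M. x \<otimes>\<^bsub>M\<^esub> y = \<one>\<^bsub>M\<^esub>)) \<and> \<zero>\<^bsub>M\<^esub> \<in> S \<and>
    (\<forall>y\<in>carrier M. \<forall>x\<in>carrier M. x \<in> S \<and> y \<in> S \<longrightarrow> x \<oplus>\<^bsub>M\<^esub> y \<in> S) \<and>
    (\<forall>x\<in>carrier M. x \<in> S \<longrightarrow> \<ominus>\<^bsub>M\<^esub> x \<in> S) \<and>
    (\<forall>x\<in>carrier M. \<not> (\<not> (\<exists>y\<in>carrier M. x \<otimes>\<^bsub>M\<^esub> y = \<one>\<^bsub>M\<^esub>) \<and> (\<forall>t\<in>set ts. x \<oplus>\<^bsub>M\<^esub> \<ominus>\<^bsub>M\<^esub> t \<notin> S))) \<and>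
    (\<exists>x\<in>carrier M. \<not> (\<exists>y\<in>carrier M. x \<otimes>\<^bsub>M\<^esub> y = \<one>\<^bsub>M\<^esub>) \<and> x \<notin> S)"
    using ts 0 unfolding sat_fsat proper_cover_def
    by (simp add: 5 subset_iff cong: ball_cong bex_cong) blast
  define U where "U x \<longleftrightarrow> (\<exists>y\<in>carrier M. x \<otimes>\<^bsub>M\<^esub> y = \<one>\<^bsub>M\<^esub>)" for x
  have N: "x \<in> nonunits M \<longleftrightarrow> x \<in> carrier M \<and> \<not> U x" for x by (simp add: nonunits_def U_def)
  have "(\<forall>x\<in>carrier M. x \<in> S \<longrightarrow> \<not> U x) \<longleftrightarrow> S \<subseteq> nonunits M"
    using Sc N by blast
  moreover have "(\<forall>y\<in>carrier M. \<forall>x\<in>carrier M. x \<in> S \<and> y \<in> S \<longrightarrow> x \<oplus>\<^bsub>M\<^esub> y \<in> S) \<longleftrightarrow>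
      (\<forall>x\<in>S. \<forall>y\<in>S. x \<oplus>\<^bsub>M\<^esub> y \<in> S)"
    using Sc by blast
  moreover have "(\<forall>x\<in>carrier M. x \<in> S \<longrightarrow> \<ominus>\<^bsub>M\<^esub> x \<in> S) \<longleftrightarrow> (\<forall>x\<in>S. \<ominus>\<^bsub>M\<^esub> x \<in> S)"
    using Sc by blast
  moreover have "(\<forall>x\<in>carrier M. \<not> (\<not> U x \<and> (\<forall>t\<in>set ts. x \<oplus>\<^bsub>M\<^esub> \<ominus>\<^bsub>M\<^esub> t \<notin> S))) \<longleftrightarrow>
      (\<forall>x\<in>nonunits M. \<exists>t\<in>set ts. x \<ominus>\<^bsub>M\<^esub> t \<in> S)"
    unfolding a_minus_def using N by blast
  moreover have "(\<exists>x\<in>carrier M. \<not> U x \<and> x \<notin> S) \<longleftrightarrow> \<not> nonunits M \<subseteq> S"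
    using N by blast
  ultimately show ?thesis unfolding * U_def[symmetric] by (simp only:)
qed


text \<open>Every element differs from one of the parameters by a nonunit. As \<open>F\<close> is
  finite and can be listed, this puts \<open>R = F + J\<close> into a single formula.\<close>

definition cover :: "nat \<Rightarrow> rform" where
  "cover n = all (Neg (bigconj (map (\<lambda>i. unitf (Add (Var 0) (Minus (Var (Suc i))))) [0..<n])))"

lemma sat_cover:
  "sat S (cover (length gs)) gs \<longleftrightarrow> (\<forall>x\<in>carrier S. \<exists>g\<in>set gs. \<not> (\<exists>y\<in>carrier S.
     (x \<oplus>\<^bsub>S\<^esub> \<ominus>\<^bsub>S\<^esub> g) \<otimes>\<^bsub>S\<^esub> y = \<one>\<^bsub>S\<^esub>))"
proof -
  have "(\<exists>i\<in>{0..<length gs}. P (gs ! i)) \<longleftrightarrow> (\<exists>g\<in>set gs. P g)" for P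
    by (auto simp: in_set_conv_nth Bex_def)
  from this[of "\<lambda>g. \<not> (\<exists>y\<in>carrier S. (x \<oplus>\<^bsub>S\<^esub> \<ominus>\<^bsub>S\<^esub> g) \<otimes>\<^bsub>S\<^esub> y = \<one>\<^bsub>S\<^esub>)" for x]
  show ?thesis unfolding sat_fsat cover_def by simp
qed

lemma elementary_sat:
  "elementary_embedding h R M \<Longrightarrow> set xs \<subseteq> carrier R \<Longrightarrow> vars_below \<phi> (length xs) \<Longrightarrow>
   sat R \<phi> xs = sat M \<phi> (map h xs)"
  unfolding elementary_embedding_def by blast

lemma elementary_sentence:
  "elementary_embedding h R M \<Longrightarrow> vars_below \<phi> 0 \<Longrightarrow> sat R \<phi> [] = sat M \<phi> []"
  using elementary_sat[of h R M "[]" \<phi>] by simp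

lemma elementary_hom:
  assumes "ring R" "elementary_embedding h R M"
  shows "h \<in> ring_hom R M" "inj_on h (carrier R)" "h \<zero>\<^bsub>R\<^esub> = \<zero>\<^bsub>M\<^esub>"
    and "\<And>x. x \<in> carrier R \<Longrightarrow> h (\<ominus>\<^bsub>R\<^esub> x) = \<ominus>\<^bsub>M\<^esub> h x"
proof -
  interpret ring R by fact
  note E = elementary_sat[OF assms(2)]
  show "h \<in> ring_hom R M"
  proof (rule ring_hom_memI)
    show "h x \<in> carrier M" if "x \<in> carrier R" for x
      using assms(2) that unfolding elementary_embedding_def by blast
    show "h \<one>\<^bsub>R\<^esub> = \<one>\<^bsub>M\<^esub>" using E[of "[\<one>\<^bsub>R\<^esub>]" "Eq (Var 0) One"] by simp
    fix x y assume "x \<in> carrier R" "y \<in> carrier R"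
    then show "h (x \<otimes>\<^bsub>R\<^esub> y) = h x \<otimes>\<^bsub>M\<^esub> h y" "h (x \<oplus>\<^bsub>R\<^esub> y) = h x \<oplus>\<^bsub>M\<^esub> h y"
      using E[of "[x, y, x \<otimes>\<^bsub>R\<^esub> y]" "Eq (Var 2) (Mult (Var 0) (Var 1))"]
        E[of "[x, y, x \<oplus>\<^bsub>R\<^esub> y]" "Eq (Var 2) (Add (Var 0) (Var 1))"] by simp_all
  qed
  show "inj_on h (carrier R)"
  proof (rule inj_onI)
    fix x y assume "x \<in> carrier R" "y \<in> carrier R" "h x = h y"
    then show "x = y" using E[of "[x, y]" "Eq (Var 0) (Var 1)"] by simp
  qed
  show "h \<zero>\<^bsub>R\<^esub> = \<zero>\<^bsub>M\<^esub>" using E[of "[\<zero>\<^bsub>R\<^esub>]" "Eq (Var 0) Zero"] by simp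
  show "h (\<ominus>\<^bsub>R\<^esub> x) = \<ominus>\<^bsub>M\<^esub> h x" if "x \<in> carrier R" for x
    using that E[of "[x, \<ominus>\<^bsub>R\<^esub> x]" "Eq (Var 1) (Minus (Var 0))"] by simp
qed

lemma elementary_nonunits:
  assumes "ring R" "elementary_embedding h R M" "x \<in> carrier R"
  shows "h x \<in> nonunits M \<longleftrightarrow> x \<in> nonunits R"
proof -
  have "h x \<in> carrier M" using ring_hom_closed[OF elementary_hom(1)[OF assms(1,2)] assms(3)] .
  moreover have "sat R (unitf (Var 0)) [x] = sat M (unitf (Var 0)) [h x]"
    using elementary_sat[OF assms(2), of "[x]" "unitf (Var 0)"] assms(3) by simp
  ultimately show ?thesis using assms(3) by (auto simp: nonunits_def)
qed

text \<open>Connectedness transfers one formula and one number of cosets at a time. A proper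
  definable subgroup of finite index in \<open>M\<close> makes the existential closure of
  \<open>proper_cover\<close> true there, hence in \<open>R\<close>, where suitable parameters then
  define a subgroup of the same kind and contradict \<open>conn\<close>.\<close>

lemma transfer_conn_ring:
  assumes R: "cring R" and E: "elementary_embedding h R M" and J: "J = nonunits R"
    and conn: "connected_subgroup R J" and F: "subfield F R" "finite F" and ds: "additive_direct_sum R F J"
    and dcc: "\<And>G. (\<And>n::nat. additive_subgroup (G n) M) \<Longrightarrow> (\<And>n. def1 M (carrier M) (G n)) \<Longrightarrow>
      (\<And>n. G (Suc n) \<subset> G n) \<Longrightarrow> False"
  shows "conn_ring M (nonunits M) (h ` F)"
proof -
  interpret R: cring R by fact
  have M: "ring M" using E unfolding elementary_embedding_def by blast
  interpret M: ring M by fact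
  note S = elementary_sat[OF E] and hom = elementary_hom[OF R.ring_axioms E]
  have Jsub: "additive_subgroup J R" and Fsub: "additive_subgroup F R"
    and FJ: "F <+>\<^bsub>R\<^esub> J = carrier R" "F \<inter> J = {\<zero>\<^bsub>R\<^esub>}" using ds unfolding additive_direct_sum_def by auto
  interpret J: additive_subgroup J R by fact
  have sr: "subring F R" using subfieldE(1)[OF F(1)] .
  note Fc = subringE(1)[OF sr]
  have Fc': "f \<in> carrier R" if "f \<in> F" for f using that Fc by blast
  have hc: "h f \<in> carrier M" if "f \<in> F" for f by (rule ring_hom_closed[OF hom(1) Fc'[OF that]])
  have cring: "cring M"
  proof (rule cring.intro[OF M M.monoid_comm_monoidI])
    fix x y assume xy: "x \<in> carrier M" "y \<in> carrier M"
    have "sat R (all (all (Eq (Mult (Var 0) (Var 1)) (Mult (Var 1) (Var 0))))) []"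
      by (simp add: R.m_comm)
    then have "sat M (all (all (Eq (Mult (Var 0) (Var 1)) (Mult (Var 1) (Var 0))))) []"
      by (rule elementary_sentence[OF E, THEN iffD1, rotated]) simp
    then show "x \<otimes>\<^bsub>M\<^esub> y = y \<otimes>\<^bsub>M\<^esub> x" using xy by simp
  qed
  interpret M: cring M by (rule cring)
  have nuM: "nonunits M \<subseteq> carrier M" by (auto simp: nonunits_def)
  have Jadd: "x \<oplus>\<^bsub>M\<^esub> y \<in> nonunits M" if xy: "x \<in> nonunits M" "y \<in> nonunits M" for x y
  proof -
    let ?\<phi> = "all (all (imp (unitf (Add (Var 0) (Var 1))) (Neg (Conj (Neg (unitf (Var 0))) (Neg (unitf (Var 1)))))))"
    have "sat R ?\<phi> []"
    proof -
      have "a \<in> J \<Longrightarrow> b \<in> J \<Longrightarrow> a \<oplus>\<^bsub>R\<^esub> b \<in> J" for a b by (rule J.a_closed)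
      then show ?thesis unfolding J nonunits_def by simp blast
    qed
    then have "sat M ?\<phi> []" by (rule elementary_sentence[OF E, THEN iffD1, rotated]) simp
    then show ?thesis using xy unfolding nonunits_def by simp blast
  qed
  have Jneg: "\<ominus>\<^bsub>M\<^esub> x \<in> nonunits M" if x: "x \<in> nonunits M" for x
  proof -
    have xc: "x \<in> carrier M" using x nuM by blast
    have "x \<otimes>\<^bsub>M\<^esub> (\<ominus>\<^bsub>M\<^esub> y) = \<one>\<^bsub>M\<^esub>" if "y \<in> carrier M" "\<ominus>\<^bsub>M\<^esub> x \<otimes>\<^bsub>M\<^esub> y = \<one>\<^bsub>M\<^esub>" for y
      using that xc by (simp add: M.l_minus M.r_minus)
    then show ?thesis using x xc unfolding nonunits_def using M.a_inv_closed by blast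
  qed
  have J0: "\<zero>\<^bsub>M\<^esub> \<in> nonunits M"
    using elementary_nonunits[OF R.ring_axioms E R.zero_closed] J.zero_closed hom(3) J by simp
  have decR: "\<exists>f\<in>F. x \<ominus>\<^bsub>R\<^esub> f \<in> J" if "x \<in> carrier R" for x
  proof -
    have "x \<in> F <+>\<^bsub>R\<^esub> J" using that FJ(1) by simp
    then obtain f j where fj: "f \<in> F" "j \<in> J" "x = f \<oplus>\<^bsub>R\<^esub> j" by (auto simp: set_add_def')
    have "x \<ominus>\<^bsub>R\<^esub> f = j"
      unfolding fj(3) using Fc'[OF fj(1)] J.a_Hcarr[OF fj(2)] by (simp add: R.minus_eq R.a_comm R.r_neg1 R.a_assoc)
    with fj(2) have "x \<ominus>\<^bsub>R\<^esub> f \<in> J" by (simp only:)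
    with fj(1) show ?thesis by (rule bexI[rotated])
  qed
  show ?thesis
  proof (intro conn_ring.intro conn_ring_axioms.intro cring)
    show "additive_subgroup (nonunits M) M"
      by (rule M.add_subI[OF nuM J0 Jadd Jneg])
    show "x \<otimes>\<^bsub>M\<^esub> y \<in> nonunits M" if "x \<in> carrier M" "y \<in> nonunits M" for x y
    proof -
      have yc: "y \<in> carrier M" using that nuM by blast
      have "y \<otimes>\<^bsub>M\<^esub> (x \<otimes>\<^bsub>M\<^esub> z) = \<one>\<^bsub>M\<^esub>" if "z \<in> carrier M" "x \<otimes>\<^bsub>M\<^esub> y \<otimes>\<^bsub>M\<^esub> z = \<one>\<^bsub>M\<^esub>" for z
        using that \<open>x \<in> carrier M\<close> yc by (simp add: M.m_ac)
      then show ?thesis using that yc unfolding nonunits_def using M.m_closed by blast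
    qed
    show "\<one>\<^bsub>M\<^esub> \<notin> nonunits M" unfolding nonunits_def by (auto intro: bexI[of _ "\<one>\<^bsub>M\<^esub>"])
    show "\<exists>y\<in>carrier M. x \<otimes>\<^bsub>M\<^esub> y = \<one>\<^bsub>M\<^esub>" if "x \<in> carrier M" "x \<notin> nonunits M" for x
      using that unfolding nonunits_def by blast
    show "def1 M (carrier M) (nonunits M)"
      unfolding nonunits_def
      by (rule dpred_def1[OF M], rule dpred_not, rule dpred_ex) (intro dpred_eq dring_intros M dterm_var)
    show "finite (h ` F)" using F(2) by simp
    show "h ` F \<subseteq> carrier M" by (rule image_subsetI) (rule hc)
    show "\<zero>\<^bsub>M\<^esub> \<in> h ` F" using subringE(2)[OF sr] hom(3) by (metis image_eqI)
    show "\<one>\<^bsub>M\<^esub> \<in> h ` F" using subringE(3)[OF sr] ring_hom_one[OF hom(1)] by (metis image_eqI)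
    show "x \<oplus>\<^bsub>M\<^esub> y \<in> h ` F" "x \<otimes>\<^bsub>M\<^esub> y \<in> h ` F" if xy: "x \<in> h ` F" "y \<in> h ` F" for x y
    proof -
      obtain a b where ab: "a \<in> F" "b \<in> F" "x = h a" "y = h b" using xy by blast
      have "x \<oplus>\<^bsub>M\<^esub> y = h (a \<oplus>\<^bsub>R\<^esub> b)" "x \<otimes>\<^bsub>M\<^esub> y = h (a \<otimes>\<^bsub>R\<^esub> b)"
        using ab ring_hom_add[OF hom(1)] ring_hom_mult[OF hom(1)] Fc' by simp_all
      moreover have "a \<oplus>\<^bsub>R\<^esub> b \<in> F" "a \<otimes>\<^bsub>R\<^esub> b \<in> F" using subringE(6,7)[OF sr] ab by blast+
      ultimately show "x \<oplus>\<^bsub>M\<^esub> y \<in> h ` F" "x \<otimes>\<^bsub>M\<^esub> y \<in> h ` F" by simp_all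
    qed
    show "\<ominus>\<^bsub>M\<^esub> x \<in> h ` F" if x: "x \<in> h ` F" for x
    proof -
      obtain a where a: "a \<in> F" "x = h a" using x by blast
      then have "\<ominus>\<^bsub>M\<^esub> x = h (\<ominus>\<^bsub>R\<^esub> a)" using hom(4) Fc' by simp
      then show ?thesis using subringE(5)[OF sr a(1)] by simp
    qed
    show "\<exists>y\<in>h ` F. x \<otimes>\<^bsub>M\<^esub> y = \<one>\<^bsub>M\<^esub>" if x: "x \<in> h ` F" "x \<noteq> \<zero>\<^bsub>M\<^esub>" for x
    proof -
      obtain a where a: "a \<in> F" "x = h a" using x by blast
      then have "a \<in> F - {\<zero>\<^bsub>R\<^esub>}" using x(2) hom(3) by auto
      then have b: "inv\<^bsub>R\<^esub> a \<in> F" "a \<otimes>\<^bsub>R\<^esub> inv\<^bsub>R\<^esub> a = \<one>\<^bsub>R\<^esub>" using R.subfield_m_inv[OF F(1)] by blast+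
      have "x \<otimes>\<^bsub>M\<^esub> h (inv\<^bsub>R\<^esub> a) = \<one>\<^bsub>M\<^esub>"
        unfolding a(2) ring_hom_mult[OF hom(1) Fc'[OF a(1)] Fc'[OF b(1)], symmetric] b(2)
        by (rule ring_hom_one[OF hom(1)])
      then show ?thesis using b(1) by blast
    qed
    show "x = \<zero>\<^bsub>M\<^esub>" if x: "x \<in> h ` F" "x \<in> nonunits M" for x
    proof -
      obtain a where a: "a \<in> F" "x = h a" using x by blast
      then have "a \<in> J" using x(2) elementary_nonunits[OF R.ring_axioms E Fc'] J by simp
      then have "a = \<zero>\<^bsub>R\<^esub>" using FJ(2) a(1) by blast
      then show ?thesis using a(2) hom(3) by simp
    qed
    show "\<exists>c\<in>h ` F. x \<ominus>\<^bsub>M\<^esub> c \<in> nonunits M" if x: "x \<in> carrier M" for x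
    proof -
      obtain fs where fs: "set fs = F" using finite_list[OF F(2)] by blast
      let ?\<phi> = "cover (length fs)"
      note ev = sat_cover
      have "sat R ?\<phi> fs"
        unfolding ev using decR Fc' unfolding fs J nonunits_def a_minus_def by blast
      moreover have "vars_below ?\<phi> (length fs)" by (auto simp: cover_def)
      ultimately have "sat M ?\<phi> (map h fs)" using S[of fs ?\<phi>] fs Fc by simp
      then have "sat M (cover (length (map h fs))) (map h fs)" by simp
      from this[unfolded sat_cover, rule_format, OF x]
      obtain g where g: "g \<in> h ` F" "\<not> (\<exists>y\<in>carrier M. (x \<oplus>\<^bsub>M\<^esub> \<ominus>\<^bsub>M\<^esub> g) \<otimes>\<^bsub>M\<^esub> y = \<one>\<^bsub>M\<^esub>)"
        unfolding set_map fs by (rule bexE) (rule that)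
      moreover have "g \<in> carrier M" using g(1) hc by auto
      ultimately have "x \<ominus>\<^bsub>M\<^esub> g \<in> nonunits M" using x by (simp add: nonunits_def a_minus_def)
      then show ?thesis using g(1) by blast
    qed
    show False if "\<And>n::nat. additive_subgroup (G n) M" "\<And>n. def1 M (carrier M) (G n)"
      "\<And>n. G (Suc n) \<subset> G n" for G
      using that by (rule dcc)
    show "H = nonunits M"
      if H: "additive_subgroup H M" "H \<subseteq> nonunits M" "def1 M (carrier M) H"
        "finite ((\<lambda>x. H +>\<^bsub>M\<^esub> x) ` nonunits M)" for H
    proof (rule ccontr)
      assume "H \<noteq> nonunits M"
      interpret H: additive_subgroup H M by (rule H)
      obtain \<phi> bs where bs: "set bs \<subseteq> carrier M" "vars_below \<phi> (Suc (length bs))"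
        "H = {x \<in> carrier M. sat M \<phi> (x # bs)}" using H(3) unfolding def1_def by blast
      obtain T where T: "T \<subseteq> nonunits M" "finite T" "(\<lambda>x. H +>\<^bsub>M\<^esub> x) ` nonunits M = (\<lambda>x. H +>\<^bsub>M\<^esub> x) ` T"
        using H(4) by (meson finite_subset_image order_refl)
      obtain ts where ts: "set ts = T" using finite_list[OF T(2)] by blast
      have "\<exists>t\<in>T. x \<ominus>\<^bsub>M\<^esub> t \<in> H" if x: "x \<in> nonunits M" for x
      proof -
        obtain t where t: "t \<in> T" "H +>\<^bsub>M\<^esub> x = H +>\<^bsub>M\<^esub> t" using x T(3) by (metis imageE imageI)
        have c: "x \<in> carrier M" "t \<in> carrier M" using x t(1) T(1) nuM by blast+
        have "x \<in> H +>\<^bsub>M\<^esub> x" unfolding a_r_coset_def'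
          using H.zero_closed c by (intro UN_I[of "\<zero>\<^bsub>M\<^esub>"]) simp_all
        then have "x \<in> H +>\<^bsub>M\<^esub> t" by (simp only: t(2))
        then obtain w where w: "w \<in> H" "x = w \<oplus>\<^bsub>M\<^esub> t" by (auto simp: a_r_coset_def')
        then have "x \<ominus>\<^bsub>M\<^esub> t = w" using c(2) H.a_Hcarr[OF w(1)] by (simp add: M.minus_eq M.a_assoc M.r_neg)
        then show ?thesis using t(1) w(1) by blast
      qed
      then have "sat M (proper_cover \<phi> (length bs) (length ts)) (bs @ ts)"
        unfolding sat_proper_cover[OF bs(2,3) M subset_trans[OF eq_refl[OF ts] subset_trans[OF T(1) nuM]]]
        using H(2) \<open>H \<noteq> nonunits M\<close> H.zero_closed H.a_closed H.a_inv_closed ts by blast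
      moreover have "bs @ ts \<in> tuples M (length bs + length ts)"
        using bs(1) ts T(1) nuM by (auto simp: tuples_def)
      ultimately have "sat M ((Exists ^^ (length bs + length ts)) (proper_cover \<phi> (length bs) (length ts))) []"
        unfolding sat_exists_pow append_Nil2 by blast
      moreover have "vars_below ((Exists ^^ (length bs + length ts)) (proper_cover \<phi> (length bs) (length ts))) 0"
        unfolding vars_below_exists_pow using vars_proper_cover[OF bs(2)] by simp
      ultimately have "sat R ((Exists ^^ (length bs + length ts)) (proper_cover \<phi> (length bs) (length ts))) []"
        by (intro elementary_sentence[OF E, THEN iffD2])
      then obtain cs where cs: "cs \<in> tuples R (length bs + length ts)"
        "sat R (proper_cover \<phi> (length bs) (length ts)) cs" unfolding sat_exists_pow append_Nil2 by blast
      define ds us where "ds = take (length bs) cs" and "us = drop (length bs) cs"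
      have du: "cs = ds @ us" "length ds = length bs" "length us = length ts"
        "set ds \<subseteq> carrier R" "set us \<subseteq> carrier R"
        using cs(1) set_take_subset[of "length bs" cs] set_drop_subset[of "length bs" cs]
        by (auto simp: ds_def us_def tuples_def)
      define G where "G = {x \<in> carrier R. sat R \<phi> (x # ds)}"
      have vb: "vars_below \<phi> (Suc (length ds))" using bs(2) du by simp
      have "sat R (proper_cover \<phi> (length ds) (length us)) (ds @ us)" using cs(2) du by simp
      then have G: "G \<subseteq> J" "\<zero>\<^bsub>R\<^esub> \<in> G" "\<forall>x\<in>G. \<forall>y\<in>G. x \<oplus>\<^bsub>R\<^esub> y \<in> G" "\<forall>x\<in>G. \<ominus>\<^bsub>R\<^esub> x \<in> G"
        "\<forall>x\<in>J. \<exists>t\<in>set us. x \<ominus>\<^bsub>R\<^esub> t \<in> G" "\<not> J \<subseteq> G"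
        unfolding sat_proper_cover[OF vb G_def R.ring_axioms du(5)] J by auto
      have Gsub: "additive_subgroup G R"
        by (rule R.add_subI) (use G in \<open>auto simp: G_def\<close>)
      have "(\<lambda>x. G +>\<^bsub>R\<^esub> x) ` J \<subseteq> (\<lambda>x. G +>\<^bsub>R\<^esub> x) ` set us"
      proof (rule image_subsetI)
        fix x assume x: "x \<in> J"
        then obtain t where t: "t \<in> set us" "x \<ominus>\<^bsub>R\<^esub> t \<in> G" using G(5) by blast
        have "G +>\<^bsub>R\<^esub> x = G +>\<^bsub>R\<^esub> t"
          using R.coset_eq[OF Gsub J.a_Hcarr[OF x] _ t(2)] t(1) du(5) by blast
        then show "G +>\<^bsub>R\<^esub> x \<in> (\<lambda>x. G +>\<^bsub>R\<^esub> x) ` set us" using t(1) by simp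
      qed
      then have "finite ((\<lambda>x. G +>\<^bsub>R\<^esub> x) ` J)" using finite_subset by blast
      moreover have "definable R (carrier R) 1 ((\<lambda>a. [a]) ` G)"
        unfolding def1_definable def1_def using vb du(4) by (intro exI[of _ \<phi>] exI[of _ ds]) (simp add: G_def)
      ultimately have "G = J" using conn Gsub G(1) unfolding connected_subgroup_def by blast
      then show False using G(6) by simp
    qed
  qed
qed

lemma almost_strongly_minimal_imp:
  fixes R :: "('a, 'm) ring_scheme"
  assumes inf: "infinite (carrier R)" and loc: "local_ring_with R J"
    and conn: "connected_subgroup R J" and F: "subfield F R" "finite F" and ds: "additive_direct_sum R F J"
    and asm: "almost_strongly_minimal R"
  shows "J = annihilator R J"
proof -
  have R: "cring R" using loc by (simp add: local_ring_with_def)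
  interpret R: cring R by (rule R)
  have J: "J = nonunits R" by (rule local_nonunits[OF loc])
  obtain M :: "'a set ring" and h where E: "elementary_embedding h R M" and sat: "saturated M"
    and less: "carrier R \<prec> carrier M" and asmM: "almost_strongly_minimal_set M {} (universe M)"
    using asm unfolding almost_strongly_minimal_def by (elim exE conjE)
  have M: "ring M" using E unfolding elementary_embedding_def by blast
  \<comment> \<open>\<open>M\<close> is strictly larger than \<open>R\<close>, which is already
    infinite.\<close>
  have unc: "uncountable (carrier M)"
  proof
    assume "countable (carrier M)"
    then have "carrier M \<lesssim> (UNIV :: nat set)" by (auto simp: countable_def lepoll_def)
    also have "(UNIV :: nat set) \<lesssim> carrier R" using inf by (simp add: infinite_le_lepoll)
    finally show False using less lepoll_antisym unfolding lesspoll_def by blast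
  qed
  obtain D where D: "strongly_minimal M D" "almost_internal M {} (universe M) D"
    using asmM unfolding almost_strongly_minimal_set_def by blast
  obtain B where B: "B \<subseteq> imaginaries M" "B \<prec> carrier M" "interpretable M B D"
    and alg: "\<forall>e\<in>universe M. \<exists>F\<subseteq>D. finite F \<and> algebraic M (B \<union> F) e"
    using D(2) unfolding almost_internal_def by blast
  obtain n X Q where X: "definable_eq M B n X" "equiv X Q" "definable_eq M B (n + n) (concat_pairs Q)" "D = X // Q"
    using B(3) unfolding interpretable_def by blast
  \<comment> \<open>The imaginary parameters of \<open>D\<close> are traded for the finitely many
    entries of representatives.\<close>
  obtain A1 A2 where A1: "finite A1" "A1 \<subseteq> carrier M" "definable M A1 n X"
    and A2: "finite A2" "A2 \<subseteq> carrier M" "definable M A2 (n + n) (concat_pairs Q)"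
    using definable_eq_definable[OF M B(1) X(1)] definable_eq_definable[OF M B(1) X(3)] by (elim exE conjE)
  define s0 where "s0 = (n, X, Q)"
  have A0: "finite (A1 \<union> A2)" "A1 \<union> A2 \<subseteq> carrier M" using A1 A2 by auto
  have s0: "sort_over M (A1 \<union> A2) s0"
    using X(2) definable_mono[OF A1(3), of "A1 \<union> A2"] definable_mono[OF A2(3), of "A1 \<union> A2"]
    by (simp add: sort_over_def s0_def)
  have pts: "points s0 = D" by (simp add: s0_def points_def X(4))
  have min: "minimal_sort M s0"
    using D(1) unfolding minimal_sort_def pts strongly_minimal_def by blast
  have algx: "\<exists>F\<subseteq>points s0. finite F \<and> algebraic M (B \<union> F) {[x]}" if "x \<in> carrier M" for x
    using alg that unfolding pts universe_def by simp
  have "\<exists>A \<W>. finite A \<and> A1 \<union> A2 \<subseteq> A \<and> A \<subseteq> carrier M \<and> finite \<W> \<and> (\<forall>W\<in>\<W>. nice M A s0 W) \<and>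
      carrier M \<subseteq> \<Union>\<W>"
    by (rule internal_finite_cover[OF M sat s0 A0(2,1) B(1,2)]) (rule algx)
  then obtain A \<W> where A: "finite A" "A1 \<union> A2 \<subseteq> A" "A \<subseteq> carrier M" and W: "finite \<W>" "\<forall>W\<in>\<W>. nice M A s0 W"
    "carrier M \<subseteq> \<Union>\<W>" by (elim exE conjE)
  have cnt: "countable (type_over M A' ` carrier M)" if "countable A'" "A \<subseteq> A'" "A' \<subseteq> carrier M" for A'
    by (rule internal_countable_types[OF M sat unc min W(1) _ W(3) that]) (use W(2) in blast)
  have dcc: False if "\<And>n::nat. additive_subgroup (G n) M" "\<And>n. def1 M (carrier M) (G n)"
      "\<And>n. G (Suc n) \<subset> G n" for G
    by (rule descending_chain[OF M sat unc _ countable_finite[OF A(1)] A(3)]) (fact cnt that)+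
  interpret C: conn_ring M "nonunits M" "h ` F"
    by (rule transfer_conn_ring[OF R E J conn F ds]) (fact dcc)
  have sq: "nonunits M \<subseteq> C.L 1"
    by (rule C.square_zero[OF sort_over_mono[OF s0 A(2)] min A(1,3) W(2,3)])
  note hom = elementary_hom[OF R.ring_axioms E]
  have Jc: "J \<subseteq> carrier R" unfolding J nonunits_def by blast
  have "x \<otimes>\<^bsub>R\<^esub> y = \<zero>\<^bsub>R\<^esub>" if xy: "x \<in> J" "y \<in> J" for x y
  proof -
    have c: "x \<in> carrier R" "y \<in> carrier R" using xy Jc by auto
    have "h x \<in> nonunits M" "h y \<in> nonunits M"
      using elementary_nonunits[OF R.ring_axioms E] c xy J by simp_all
    then have "h x \<otimes>\<^bsub>M\<^esub> h y = \<zero>\<^bsub>M\<^esub>" using sq unfolding C.L1_iff by auto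
    then have "h (x \<otimes>\<^bsub>R\<^esub> y) = h \<zero>\<^bsub>R\<^esub>" using ring_hom_mult[OF hom(1) c] hom(3) by simp
    then show ?thesis using hom(2) c unfolding inj_on_def by simp
  qed
  then show ?thesis unfolding annihilator_def by blast
qed

section \<open>Local rings whose maximal ideal has square zero\<close>

text \<open>The ring is a finite field plus an infinite vector space with zero multiplication. It is
  stated abstractly because it must be applied to \<open>R\<close>, to a power of \<open>R\<close>
  and to an isomorphic copy of that power.\<close>

locale sqz = cring M for M (structure) +
  fixes J F :: "'a set"
  assumes J_sub: "additive_subgroup J M"
    and J_mult: "x \<in> carrier M \<Longrightarrow> y \<in> J \<Longrightarrow> x \<otimes> y \<in> J"
    and J_sq: "x \<in> J \<Longrightarrow> y \<in> J \<Longrightarrow> x \<otimes> y = \<zero>"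
    and J_inf: "infinite J"
    and F_fin: "finite F" and F_carrier: "F \<subseteq> carrier M"
    and F_one: "\<one> \<in> F" and F_zero: "\<zero> \<in> F"
    and F_add: "x \<in> F \<Longrightarrow> y \<in> F \<Longrightarrow> x \<oplus> y \<in> F"
    and F_neg: "x \<in> F \<Longrightarrow> \<ominus> x \<in> F"
    and F_mult: "x \<in> F \<Longrightarrow> y \<in> F \<Longrightarrow> x \<otimes> y \<in> F"
    and F_inv: "x \<in> F \<Longrightarrow> x \<noteq> \<zero> \<Longrightarrow> \<exists>y\<in>F. x \<otimes> y = \<one>"
    and F_J: "x \<in> F \<Longrightarrow> x \<in> J \<Longrightarrow> x = \<zero>"
    and decomp: "x \<in> carrier M \<Longrightarrow> \<exists>c\<in>F. x \<ominus> c \<in> J"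

text \<open>Finite subrings containing \<open>F\<close>. They are the domains for back-and-forth:
  adjoining an element of \<open>J\<close> adds only its multiples by the finite field.\<close>

definition fin_sub :: "('a, 'm) ring_scheme \<Rightarrow> 'a set \<Rightarrow> 'a set \<Rightarrow> bool" where
  "fin_sub M F G \<longleftrightarrow> finite G \<and> F \<subseteq> G \<and> G \<subseteq> carrier M \<and>
     (\<forall>x\<in>G. \<forall>y\<in>G. x \<oplus>\<^bsub>M\<^esub> y \<in> G \<and> x \<otimes>\<^bsub>M\<^esub> y \<in> G) \<and> (\<forall>x\<in>G. \<ominus>\<^bsub>M\<^esub> x \<in> G)"

context sqz
begin

lemma Jc: "x \<in> J \<Longrightarrow> x \<in> carrier M"
  using additive_subgroup.a_subset[OF J_sub] by blast

lemma Fc: "x \<in> F \<Longrightarrow> x \<in> carrier M"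
  using F_carrier by blast

lemmas J_zero = additive_subgroup.zero_closed[OF J_sub]
  and J_add = additive_subgroup.a_closed[OF J_sub]
  and J_neg = additive_subgroup.a_inv_closed[OF J_sub]

lemma fin_sub_base: "fin_sub M F F"
  unfolding fin_sub_def using F_fin F_carrier F_add F_mult F_neg by blast

text \<open>Two different coefficients would have an invertible difference, and dividing by it would
  express \<open>v\<close> within \<open>G\<close>.\<close>

lemma rep_unique:
  assumes G: "fin_sub M F G" and v: "v \<in> J" "v \<notin> G"
    and g: "g \<in> G" "g' \<in> G" and c: "c \<in> F" "c' \<in> F" and eq: "g \<oplus> c \<otimes> v = g' \<oplus> c' \<otimes> v"
  shows "g = g' \<and> c = c'"
proof -
  have Gc: "x \<in> carrier M" if "x \<in> G" for x using G that unfolding fin_sub_def by blast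
  have FG: "F \<subseteq> G" and Gadd: "\<forall>x\<in>G. \<forall>y\<in>G. x \<oplus> y \<in> G \<and> x \<otimes> y \<in> G" and Gneg: "\<forall>x\<in>G. \<ominus> x \<in> G"
    using G unfolding fin_sub_def by auto
  note car = Gc[OF g(1)] Gc[OF g(2)] Fc[OF c(1)] Fc[OF c(2)] Jc[OF v(1)]
  have *: "(c \<ominus> c') \<otimes> v = g' \<ominus> g"
  proof -
    have "(c \<ominus> c') \<otimes> v = (g \<oplus> c \<otimes> v) \<ominus> (g \<oplus> c' \<otimes> v)" using car by algebra
    also have "\<dots> = (g' \<oplus> c' \<otimes> v) \<ominus> (g \<oplus> c' \<otimes> v)" by (simp only: eq)
    also have "\<dots> = g' \<ominus> g" using car by algebra
    finally show ?thesis .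
  qed
  have cc: "c = c'"
  proof (rule ccontr)
    assume "c \<noteq> c'"
    then have nz: "c \<ominus> c' \<noteq> \<zero>" using car by (metis r_right_minus_eq)
    have "c \<ominus> c' \<in> F" unfolding a_minus_def by (intro F_add F_neg c)
    then obtain d where d: "d \<in> F" "(c \<ominus> c') \<otimes> d = \<one>" using F_inv nz by blast
    have dc: "d \<in> carrier M" by (rule Fc[OF d(1)])
    have "d \<otimes> ((c \<ominus> c') \<otimes> v) = ((c \<ominus> c') \<otimes> d) \<otimes> v" using car dc by algebra
    then have "v = d \<otimes> (g' \<ominus> g)" unfolding d(2) * using car by simp
    moreover have "g' \<oplus> \<ominus> g \<in> G" using g Gadd Gneg by blast
    then have "d \<otimes> (g' \<ominus> g) \<in> G" unfolding a_minus_def using d(1) FG Gadd by blast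
    ultimately show False using v(2) by simp
  qed
  have "g = g'"
    using eq car unfolding cc by simp
  with cc show ?thesis by simp
qed

text \<open>As \<open>J\<close> has square zero, \<open>v\<close> sees only the residues
  \<open>r\<close> and \<open>r'\<close> of its cofactors.\<close>

lemma rep_mult:
  assumes "g \<in> carrier M" "g' \<in> carrier M" "c \<in> F" "c' \<in> F" "r \<in> F" "r' \<in> F" "g \<ominus> r \<in> J" "g' \<ominus> r' \<in> J" "v \<in> J"
  shows "(g \<oplus> c \<otimes> v) \<otimes> (g' \<oplus> c' \<otimes> v) = g \<otimes> g' \<oplus> (r \<otimes> c' \<oplus> r' \<otimes> c) \<otimes> v"
proof -
  note car = assms(1,2) Fc[OF assms(3)] Fc[OF assms(4)] Fc[OF assms(5)] Fc[OF assms(6)] Jc[OF assms(9)]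
  have "g \<otimes> v = (g \<ominus> r) \<otimes> v \<oplus> r \<otimes> v" "g' \<otimes> v = (g' \<ominus> r') \<otimes> v \<oplus> r' \<otimes> v" using car by algebra+
  then have gv: "g \<otimes> v = r \<otimes> v" "g' \<otimes> v = r' \<otimes> v" using J_sq assms(7-9) car by simp_all
  have "(g \<oplus> c \<otimes> v) \<otimes> (g' \<oplus> c' \<otimes> v) = g \<otimes> g' \<oplus> c' \<otimes> (g \<otimes> v) \<oplus> c \<otimes> (g' \<otimes> v) \<oplus> (c \<otimes> c') \<otimes> (v \<otimes> v)"
    using car by algebra
  also have "\<dots> = g \<otimes> g' \<oplus> c' \<otimes> (r \<otimes> v) \<oplus> c \<otimes> (r' \<otimes> v) \<oplus> (c \<otimes> c') \<otimes> \<zero>"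
    by (simp only: gv J_sq[OF assms(9,9)])
  also have "\<dots> = g \<otimes> g' \<oplus> (r \<otimes> c' \<oplus> r' \<otimes> c) \<otimes> v" using car by algebra
  finally show ?thesis .
qed

end

section \<open>Back-and-forth with partial isomorphisms of finite subrings\<close>

definition piso ::
    "('a, 'm) ring_scheme \<Rightarrow> 'a set \<Rightarrow> 'a set \<Rightarrow> ('b, 'n) ring_scheme \<Rightarrow> 'b set \<Rightarrow> 'b set \<Rightarrow>
     'a set \<Rightarrow> ('a \<Rightarrow> 'b) \<Rightarrow> bool" where
  "piso M J F N J' F' G s \<longleftrightarrow> fin_sub M F G \<and> s ` G \<subseteq> carrier N \<and> inj_on s G \<and> s ` F = F' \<and>
     s \<zero>\<^bsub>M\<^esub> = \<zero>\<^bsub>N\<^esub> \<and> s \<one>\<^bsub>M\<^esub> = \<one>\<^bsub>N\<^esub> \<and> (\<forall>x\<in>G. s (\<ominus>\<^bsub>M\<^esub> x) = \<ominus>\<^bsub>N\<^esub> s x) \<and>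
     (\<forall>x\<in>G. \<forall>y\<in>G. s (x \<oplus>\<^bsub>M\<^esub> y) = s x \<oplus>\<^bsub>N\<^esub> s y \<and> s (x \<otimes>\<^bsub>M\<^esub> y) = s x \<otimes>\<^bsub>N\<^esub> s y) \<and>
     (\<forall>x\<in>G. x \<in> J \<longleftrightarrow> s x \<in> J')"

lemma pisoD:
  assumes "piso M J F N J' F' G s"
  shows "fin_sub M F G" "s ` G \<subseteq> carrier N" "inj_on s G" "s ` F = F'" "s \<zero>\<^bsub>M\<^esub> = \<zero>\<^bsub>N\<^esub>" "s \<one>\<^bsub>M\<^esub> = \<one>\<^bsub>N\<^esub>"
    and "\<And>x. x \<in> G \<Longrightarrow> s (\<ominus>\<^bsub>M\<^esub> x) = \<ominus>\<^bsub>N\<^esub> s x"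
    and "\<And>x y. x \<in> G \<Longrightarrow> y \<in> G \<Longrightarrow> s (x \<oplus>\<^bsub>M\<^esub> y) = s x \<oplus>\<^bsub>N\<^esub> s y"
    and "\<And>x y. x \<in> G \<Longrightarrow> y \<in> G \<Longrightarrow> s (x \<otimes>\<^bsub>M\<^esub> y) = s x \<otimes>\<^bsub>N\<^esub> s y"
    and "\<And>x. x \<in> G \<Longrightarrow> x \<in> J \<longleftrightarrow> s x \<in> J'"
  using assms unfolding piso_def by auto

lemma fin_subD:
  assumes "fin_sub M F G"
  shows "finite G" "F \<subseteq> G" "G \<subseteq> carrier M" "\<And>x y. x \<in> G \<Longrightarrow> y \<in> G \<Longrightarrow> x \<oplus>\<^bsub>M\<^esub> y \<in> G"
    "\<And>x y. x \<in> G \<Longrightarrow> y \<in> G \<Longrightarrow> x \<otimes>\<^bsub>M\<^esub> y \<in> G" "\<And>x. x \<in> G \<Longrightarrow> \<ominus>\<^bsub>M\<^esub> x \<in> G"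
  using assms unfolding fin_sub_def by auto

lemma fin_sub_image:
  assumes p: "piso M J F N J' F' G s"
  shows "fin_sub N F' (s ` G)"
proof -
  note P = pisoD[OF p] and G = fin_subD[OF pisoD(1)[OF p]]
  show ?thesis
    unfolding fin_sub_def
  proof (intro conjI ballI)
    show "finite (s ` G)" using G(1) by simp
    show "F' \<subseteq> s ` G" using P(4) G(2) by blast
    show "s ` G \<subseteq> carrier N" by (rule P(2))
    fix x assume "x \<in> s ` G"
    then obtain a where a: "a \<in> G" "x = s a" by blast
    show "\<ominus>\<^bsub>N\<^esub> x \<in> s ` G" unfolding a(2) P(7)[OF a(1), symmetric] using G(6)[OF a(1)] by (rule imageI)
    fix y assume "y \<in> s ` G"
    then obtain b where b: "b \<in> G" "y = s b" by blast
    show "x \<oplus>\<^bsub>N\<^esub> y \<in> s ` G" unfolding a(2) b(2) P(8)[OF a(1) b(1), symmetric] using G(4)[OF a(1) b(1)] by (rule imageI)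
    show "x \<otimes>\<^bsub>N\<^esub> y \<in> s ` G" unfolding a(2) b(2) P(9)[OF a(1) b(1), symmetric] using G(5)[OF a(1) b(1)] by (rule imageI)
  qed
qed

lemma piso_inverse:
  assumes M: "sqz M J F" and p: "piso M J F N J' F' G s"
  shows "piso N J' F' M J F (s ` G) (inv_into G s)"
proof -
  note P = pisoD[OF p] and G = fin_subD[OF pisoD(1)[OF p]]
  have inv: "inv_into G s (s x) = x" if "x \<in> G" for x by (rule inv_into_f_f[OF P(3) that])
  have 0: "\<zero>\<^bsub>M\<^esub> \<in> G" "\<one>\<^bsub>M\<^esub> \<in> G" using sqz.F_zero[OF M] sqz.F_one[OF M] G(2) by auto
  show ?thesis
    unfolding piso_def
  proof (intro conjI ballI)
    show "fin_sub N F' (s ` G)" by (rule fin_sub_image[OF p])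
    show "inv_into G s ` s ` G \<subseteq> carrier M" using G(3) inv by auto
    show "inj_on (inv_into G s) (s ` G)" by (rule inj_on_inv_into) simp
    show "inv_into G s ` F' = F" unfolding P(4)[symmetric] using G(2) inv by (force simp: image_iff)
    show "inv_into G s \<zero>\<^bsub>N\<^esub> = \<zero>\<^bsub>M\<^esub>" using inv[OF 0(1)] P(5) by simp
    show "inv_into G s \<one>\<^bsub>N\<^esub> = \<one>\<^bsub>M\<^esub>" using inv[OF 0(2)] P(6) by simp
    fix x assume "x \<in> s ` G"
    then obtain a where a: "a \<in> G" "x = s a" by blast
    show "inv_into G s (\<ominus>\<^bsub>N\<^esub> x) = \<ominus>\<^bsub>M\<^esub> inv_into G s x"
      unfolding a(2) P(7)[OF a(1), symmetric] inv[OF a(1)] inv[OF G(6)[OF a(1)]] ..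
    show "x \<in> J' \<longleftrightarrow> inv_into G s x \<in> J" unfolding a(2) inv[OF a(1)] using P(10)[OF a(1)] by simp
    fix y assume "y \<in> s ` G"
    then obtain b where b: "b \<in> G" "y = s b" by blast
    show "inv_into G s (x \<oplus>\<^bsub>N\<^esub> y) = inv_into G s x \<oplus>\<^bsub>M\<^esub> inv_into G s y"
      unfolding a(2) b(2) P(8)[OF a(1) b(1), symmetric] inv[OF a(1)] inv[OF b(1)] inv[OF G(4)[OF a(1) b(1)]] ..
    show "inv_into G s (x \<otimes>\<^bsub>N\<^esub> y) = inv_into G s x \<otimes>\<^bsub>M\<^esub> inv_into G s y"
      unfolding a(2) b(2) P(9)[OF a(1) b(1), symmetric] inv[OF a(1)] inv[OF b(1)] inv[OF G(5)[OF a(1) b(1)]] ..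
  qed
qed

text \<open>The elements of \<open>G + Fv\<close> and of \<open>s G + F'w\<close> have unique
  representations, and both sums and products are computed in the same way on the two sides. So any
  \<open>v\<close> and \<open>w\<close> outside the given finite subrings can be matched.\<close>

lemma piso_extend:
  assumes M: "sqz M J F" and N: "sqz N J' F'" and p: "piso M J F N J' F' G s"
    and v: "v \<in> J" "v \<notin> G" and w: "w \<in> J'" "w \<notin> s ` G"
  shows "\<exists>G' s'. piso M J F N J' F' G' s' \<and> G \<subseteq> G' \<and> (\<forall>x\<in>G. s' x = s x) \<and> v \<in> G' \<and> s' v = w"
proof -
  interpret M: sqz M J F by fact
  interpret N: sqz N J' F' by fact
  note P = pisoD[OF p] and G = fin_subD[OF pisoD(1)[OF p]]
  have Gc: "x \<in> carrier M" if "x \<in> G" for x using G(3) that by blast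
  have sc: "s x \<in> carrier N" if "x \<in> G" for x using P(2) that by blast
  have FG: "x \<in> G" if "x \<in> F" for x using G(2) that by blast
  have sF: "s x \<in> F'" if "x \<in> F" for x using P(4) that by blast
  have vc: "v \<in> carrier M" and wc: "w \<in> carrier N" using M.Jc v N.Jc w by auto
  define e where "e g c = g \<oplus>\<^bsub>M\<^esub> c \<otimes>\<^bsub>M\<^esub> v" for g c
  define e' where "e' g c = s g \<oplus>\<^bsub>N\<^esub> s c \<otimes>\<^bsub>N\<^esub> w" for g c
  define G' where "G' = {e g c | g c. g \<in> G \<and> c \<in> F}"
  define s' where "s' x = (THE y. \<exists>g c. g \<in> G \<and> c \<in> F \<and> x = e g c \<and> y = e' g c)" for x
  have uniq: "g = g' \<and> c = c'" if "g \<in> G" "c \<in> F" "g' \<in> G" "c' \<in> F" "e g c = e g' c'" for g c g' c'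
    using M.rep_unique[OF P(1) v that(1,3,2,4)] that(5) unfolding e_def by blast
  have uniq': "g = g' \<and> c = c'" if "g \<in> G" "c \<in> F" "g' \<in> G" "c' \<in> F" "e' g c = e' g' c'" for g c g' c'
  proof -
    have "s g = s g' \<and> s c = s c'"
      using N.rep_unique[OF fin_sub_image[OF p] w imageI[OF that(1)] imageI[OF that(3)] sF[OF that(2)] sF[OF that(4)]]
        that(5) unfolding e'_def by blast
    then show ?thesis using P(3) that FG unfolding inj_on_def by blast
  qed
  have s': "s' (e g c) = e' g c" if "g \<in> G" "c \<in> F" for g c
    unfolding s'_def by (rule the_equality) (use that uniq in blast)+
  have G'I: "e g c \<in> G'" if "g \<in> G" "c \<in> F" for g c using that unfolding G'_def by blast
  have G'E: "\<exists>g c. g \<in> G \<and> c \<in> F \<and> x = e g c" if "x \<in> G'" for x using that unfolding G'_def by blast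
  have 0: "\<zero>\<^bsub>M\<^esub> \<in> G" "\<one>\<^bsub>M\<^esub> \<in> G" using M.F_zero M.F_one FG by auto
  have old: "x \<in> G' \<and> s' x = s x" if x: "x \<in> G" for x
  proof -
    have "e x \<zero>\<^bsub>M\<^esub> = x" "e' x \<zero>\<^bsub>M\<^esub> = s x" unfolding e_def e'_def P(5) using Gc[OF x] sc[OF x] vc wc by simp_all
    then show ?thesis using G'I[OF x M.F_zero] s'[OF x M.F_zero] by simp
  qed
  have new: "v \<in> G' \<and> s' v = w"
  proof -
    have "e \<zero>\<^bsub>M\<^esub> \<one>\<^bsub>M\<^esub> = v" "e' \<zero>\<^bsub>M\<^esub> \<one>\<^bsub>M\<^esub> = w" unfolding e_def e'_def P(5,6) using vc wc by simp_all
    then show ?thesis using G'I[OF 0(1) M.F_one] s'[OF 0(1) M.F_one] by simp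
  qed
  have add: "e g c \<oplus>\<^bsub>M\<^esub> e g' c' = e (g \<oplus>\<^bsub>M\<^esub> g') (c \<oplus>\<^bsub>M\<^esub> c')"
    "e' g c \<oplus>\<^bsub>N\<^esub> e' g' c' = e' (g \<oplus>\<^bsub>M\<^esub> g') (c \<oplus>\<^bsub>M\<^esub> c')"
    if "g \<in> G" "c \<in> F" "g' \<in> G" "c' \<in> F" for g c g' c'
  proof -
    show "e g c \<oplus>\<^bsub>M\<^esub> e g' c' = e (g \<oplus>\<^bsub>M\<^esub> g') (c \<oplus>\<^bsub>M\<^esub> c')"
      unfolding e_def using Gc[OF that(1)] Gc[OF that(3)] M.Fc[OF that(2)] M.Fc[OF that(4)] vc by algebra
    show "e' g c \<oplus>\<^bsub>N\<^esub> e' g' c' = e' (g \<oplus>\<^bsub>M\<^esub> g') (c \<oplus>\<^bsub>M\<^esub> c')"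
      unfolding e'_def P(8)[OF that(1,3)] P(8)[OF FG[OF that(2)] FG[OF that(4)]]
      using sc[OF that(1)] sc[OF that(3)] N.Fc[OF sF[OF that(2)]] N.Fc[OF sF[OF that(4)]] wc by algebra
  qed
  have neg: "\<ominus>\<^bsub>M\<^esub> e g c = e (\<ominus>\<^bsub>M\<^esub> g) (\<ominus>\<^bsub>M\<^esub> c)" "\<ominus>\<^bsub>N\<^esub> e' g c = e' (\<ominus>\<^bsub>M\<^esub> g) (\<ominus>\<^bsub>M\<^esub> c)"
    if "g \<in> G" "c \<in> F" for g c
  proof -
    show "\<ominus>\<^bsub>M\<^esub> e g c = e (\<ominus>\<^bsub>M\<^esub> g) (\<ominus>\<^bsub>M\<^esub> c)"
      unfolding e_def using Gc[OF that(1)] M.Fc[OF that(2)] vc by algebra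
    show "\<ominus>\<^bsub>N\<^esub> e' g c = e' (\<ominus>\<^bsub>M\<^esub> g) (\<ominus>\<^bsub>M\<^esub> c)"
      unfolding e'_def P(7)[OF that(1)] P(7)[OF FG[OF that(2)]]
      using sc[OF that(1)] N.Fc[OF sF[OF that(2)]] wc by algebra
  qed
  have mult: "\<exists>d\<in>F. e g c \<otimes>\<^bsub>M\<^esub> e g' c' = e (g \<otimes>\<^bsub>M\<^esub> g') d \<and> e' g c \<otimes>\<^bsub>N\<^esub> e' g' c' = e' (g \<otimes>\<^bsub>M\<^esub> g') d"
    if "g \<in> G" "c \<in> F" "g' \<in> G" "c' \<in> F" for g c g' c'
  proof -
    note gc = that
    obtain r r' where r: "r \<in> F" "g \<ominus>\<^bsub>M\<^esub> r \<in> J" and r': "r' \<in> F" "g' \<ominus>\<^bsub>M\<^esub> r' \<in> J"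
      using M.decomp[OF Gc[OF gc(1)]] M.decomp[OF Gc[OF gc(3)]] by blast
    have sJ: "s h \<ominus>\<^bsub>N\<^esub> s q \<in> J'" if "h \<in> G" "q \<in> F" "h \<ominus>\<^bsub>M\<^esub> q \<in> J" for h q
    proof -
      have q: "q \<in> G" "\<ominus>\<^bsub>M\<^esub> q \<in> G" using that(2) FG G(6) by blast+
      have "h \<oplus>\<^bsub>M\<^esub> \<ominus>\<^bsub>M\<^esub> q \<in> G" using G(4)[OF that(1) q(2)] .
      then have "s (h \<oplus>\<^bsub>M\<^esub> \<ominus>\<^bsub>M\<^esub> q) \<in> J'" using P(10) that(3) unfolding a_minus_def by blast
      then show ?thesis unfolding a_minus_def P(8)[OF that(1) q(2)] P(7)[OF q(1)] .
    qed
    \<comment> \<open>The coefficient of \<open>v\<close> in the product, by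
      \<open>rep_mult\<close>. Its image serves on the other side because \<open>s\<close> carries
      residues to residues, which is why partial isomorphisms are required to respect
      \<open>J\<close>.\<close>
    define d where "d = r \<otimes>\<^bsub>M\<^esub> c' \<oplus>\<^bsub>M\<^esub> r' \<otimes>\<^bsub>M\<^esub> c"
    have 1: "r \<otimes>\<^bsub>M\<^esub> c' \<in> F" "r' \<otimes>\<^bsub>M\<^esub> c \<in> F" using r r' that M.F_mult by blast+
    then have d: "d \<in> F" unfolding d_def by (rule M.F_add)
    have "e g c \<otimes>\<^bsub>M\<^esub> e g' c' = e (g \<otimes>\<^bsub>M\<^esub> g') d"
      unfolding e_def d_def
      by (rule M.rep_mult[OF Gc[OF that(1)] Gc[OF that(3)] that(2,4) r(1) r'(1) r(2) r'(2) v(1)])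
    moreover have "s d = s r \<otimes>\<^bsub>N\<^esub> s c' \<oplus>\<^bsub>N\<^esub> s r' \<otimes>\<^bsub>N\<^esub> s c"
      unfolding d_def P(8)[OF FG[OF 1(1)] FG[OF 1(2)]] P(9)[OF FG[OF r(1)] FG[OF that(4)]]
        P(9)[OF FG[OF r'(1)] FG[OF that(2)]] ..
    then have "e' g c \<otimes>\<^bsub>N\<^esub> e' g' c' = e' (g \<otimes>\<^bsub>M\<^esub> g') d"
      unfolding e'_def P(9)[OF that(1,3)]
      using N.rep_mult[OF sc[OF that(1)] sc[OF that(3)] sF[OF that(2)] sF[OF that(4)] sF[OF r(1)] sF[OF r'(1)]
        sJ[OF that(1) r] sJ[OF that(3) r'] w(1)] by simp
    ultimately show ?thesis using d by blast
  qed
  have G'c: "e g c \<in> carrier M" "e' g c \<in> carrier N" if "g \<in> G" "c \<in> F" for g c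
    unfolding e_def e'_def using that Gc[OF that(1)] M.Fc[OF that(2)] sc[OF that(1)] N.Fc[OF sF[OF that(2)]] vc wc
    by simp_all
  have Jiff: "e g c \<in> J \<longleftrightarrow> g \<in> J" "e' g c \<in> J' \<longleftrightarrow> s g \<in> J'" if "g \<in> G" "c \<in> F" for g c
  proof -
    have 1: "c \<otimes>\<^bsub>M\<^esub> v \<in> J" "s c \<otimes>\<^bsub>N\<^esub> w \<in> J'"
      using M.J_mult[OF M.Fc[OF that(2)] v(1)] N.J_mult[OF N.Fc[OF sF[OF that(2)]] w(1)] by auto
    have "g = e g c \<oplus>\<^bsub>M\<^esub> \<ominus>\<^bsub>M\<^esub> (c \<otimes>\<^bsub>M\<^esub> v)"
      unfolding e_def using Gc[OF that(1)] M.Fc[OF that(2)] vc by algebra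
    moreover have "s g = e' g c \<oplus>\<^bsub>N\<^esub> \<ominus>\<^bsub>N\<^esub> (s c \<otimes>\<^bsub>N\<^esub> w)"
      unfolding e'_def using sc[OF that(1)] N.Fc[OF sF[OF that(2)]] wc by algebra
    ultimately show "e g c \<in> J \<longleftrightarrow> g \<in> J" "e' g c \<in> J' \<longleftrightarrow> s g \<in> J'"
      using M.J_add[OF _ 1(1)] M.J_add[OF _ M.J_neg[OF 1(1)]] N.J_add[OF _ 1(2)] N.J_add[OF _ N.J_neg[OF 1(2)]]
      unfolding e_def e'_def by metis+
  qed
  have "piso M J F N J' F' G' s'"
    unfolding piso_def fin_sub_def
  proof (intro conjI ballI)
    have "G' = (\<lambda>(g, c). e g c) ` (G \<times> F)" unfolding G'_def by auto
    then show "finite G'" using G(1) M.F_fin by simp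
    show "F \<subseteq> G'" using FG old by blast
    show "G' \<subseteq> carrier M" using G'E G'c(1) by blast
    show "s' ` G' \<subseteq> carrier N" using G'E G'c(2) s' by force
    show "inj_on s' G'"
    proof (rule inj_onI)
      fix x y assume "x \<in> G'" "y \<in> G'" and eq: "s' x = s' y"
      then obtain g c g' c' where *: "g \<in> G" "c \<in> F" "x = e g c" "g' \<in> G" "c' \<in> F" "y = e g' c'"
        using G'E by metis
      then have "g = g' \<and> c = c'" using uniq'[of g c g' c'] eq s' by simp
      then show "x = y" using * by simp
    qed
    show "s' ` F = F'" unfolding P(4)[symmetric] by (rule image_cong[OF refl]) (use FG old in blast)
    show "s' \<zero>\<^bsub>M\<^esub> = \<zero>\<^bsub>N\<^esub>" "s' \<one>\<^bsub>M\<^esub> = \<one>\<^bsub>N\<^esub>" using old 0 P(5,6) by simp_all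
    fix x assume "x \<in> G'"
    then obtain g c where x: "g \<in> G" "c \<in> F" "x = e g c" using G'E by blast
    have ng: "\<ominus>\<^bsub>M\<^esub> g \<in> G" "\<ominus>\<^bsub>M\<^esub> c \<in> F" using G(6) x(1) M.F_neg x(2) by blast+
    show "\<ominus>\<^bsub>M\<^esub> x \<in> G'" unfolding x(3) neg(1)[OF x(1,2)] by (rule G'I[OF ng])
    show "s' (\<ominus>\<^bsub>M\<^esub> x) = \<ominus>\<^bsub>N\<^esub> s' x"
      unfolding x(3) neg(1)[OF x(1,2)] s'[OF x(1,2)] neg(2)[OF x(1,2)] by (rule s'[OF ng])
    show "x \<in> J \<longleftrightarrow> s' x \<in> J'"
      unfolding x(3) s'[OF x(1,2)] Jiff[OF x(1,2)] by (rule P(10)[OF x(1)])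
    fix y assume "y \<in> G'"
    then obtain g' c' where y: "g' \<in> G" "c' \<in> F" "y = e g' c'" using G'E by blast
    have ad: "g \<oplus>\<^bsub>M\<^esub> g' \<in> G" "c \<oplus>\<^bsub>M\<^esub> c' \<in> F" using G(4) x(1) y(1) M.F_add x(2) y(2) by blast+
    show "x \<oplus>\<^bsub>M\<^esub> y \<in> G'" unfolding x(3) y(3) add(1)[OF x(1,2) y(1,2)] by (rule G'I[OF ad])
    show "s' (x \<oplus>\<^bsub>M\<^esub> y) = s' x \<oplus>\<^bsub>N\<^esub> s' y"
      unfolding x(3) y(3) add(1)[OF x(1,2) y(1,2)] s'[OF x(1,2)] s'[OF y(1,2)] add(2)[OF x(1,2) y(1,2)]
      by (rule s'[OF ad])
    obtain d where d: "d \<in> F" "x \<otimes>\<^bsub>M\<^esub> y = e (g \<otimes>\<^bsub>M\<^esub> g') d" "e' g c \<otimes>\<^bsub>N\<^esub> e' g' c' = e' (g \<otimes>\<^bsub>M\<^esub> g') d"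
      using mult[OF x(1,2) y(1,2)] unfolding x(3) y(3) by blast
    have gg: "g \<otimes>\<^bsub>M\<^esub> g' \<in> G" by (rule G(5)[OF x(1) y(1)])
    show "x \<otimes>\<^bsub>M\<^esub> y \<in> G'" unfolding d(2) by (rule G'I[OF gg d(1)])
    show "s' (x \<otimes>\<^bsub>M\<^esub> y) = s' x \<otimes>\<^bsub>N\<^esub> s' y"
      unfolding d(2) s'[OF gg d(1)] unfolding x(3) y(3) s'[OF x(1,2)] s'[OF y(1,2)] d(3) ..
  qed
  then show ?thesis using old new by blast
qed

text \<open>Subtracting the residue, which is already in the domain, leaves an element of
  \<open>J\<close>. If it is new, the infinite \<open>J'\<close> provides a partner outside the
  finite image.\<close>

lemma piso_forth:
  assumes M: "sqz M J F" and N: "sqz N J' F'" and p: "piso M J F N J' F' G s" and a: "a \<in> carrier M"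
  shows "\<exists>G' s'. piso M J F N J' F' G' s' \<and> G \<subseteq> G' \<and> (\<forall>x\<in>G. s' x = s x) \<and> a \<in> G'"
proof -
  interpret M: sqz M J F by fact
  interpret N: sqz N J' F' by fact
  obtain c where c: "c \<in> F" "a \<ominus>\<^bsub>M\<^esub> c \<in> J" using M.decomp[OF a] by blast
  define v where "v = a \<ominus>\<^bsub>M\<^esub> c"
  have av: "a = c \<oplus>\<^bsub>M\<^esub> v" unfolding v_def using a M.Fc[OF c(1)] by algebra
  have "\<exists>G' s'. piso M J F N J' F' G' s' \<and> G \<subseteq> G' \<and> (\<forall>x\<in>G. s' x = s x) \<and> v \<in> G'"
  proof (cases "v \<in> G")
    case True
    then show ?thesis using p by blast
  next
    case False
    have "finite (s ` G)" using fin_subD(1)[OF pisoD(1)[OF p]] by simp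
    then obtain w where "w \<in> J'" "w \<notin> s ` G" using N.J_inf by (meson finite_subset subsetI)
    then show ?thesis using piso_extend[OF M N p c(2)[folded v_def] False] by blast
  qed
  then obtain G' s' where *: "piso M J F N J' F' G' s'" "G \<subseteq> G'" "\<forall>x\<in>G. s' x = s x" "v \<in> G'" by blast
  note G' = fin_subD[OF pisoD(1)[OF *(1)]]
  have "a \<in> G'" unfolding av using G'(2,4) c(1) *(4) by blast
  with * show ?thesis by blast
qed

text \<open>The forth step applied to the inverse, and then inverted again.\<close>

lemma piso_back:
  assumes M: "sqz M J F" and N: "sqz N J' F'" and p: "piso M J F N J' F' G s" and b: "b \<in> carrier N"
  shows "\<exists>G' s' a. piso M J F N J' F' G' s' \<and> G \<subseteq> G' \<and> (\<forall>x\<in>G. s' x = s x) \<and> a \<in> G' \<and> s' a = b"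
proof -
  note pi = piso_inverse[OF M p]
  obtain H t where H: "piso N J' F' M J F H t" "s ` G \<subseteq> H" "\<forall>x\<in>s ` G. t x = inv_into G s x" "b \<in> H"
    using piso_forth[OF N M pi b] by blast
  have inj: "inj_on t H" by (rule pisoD(3)[OF H(1)])
  have tG: "t (s x) = x" if "x \<in> G" for x
    using H(3) that inv_into_f_f[OF pisoD(3)[OF p] that] by simp
  show ?thesis
  proof (intro exI conjI ballI)
    show "piso M J F N J' F' (t ` H) (inv_into H t)" by (rule piso_inverse[OF N H(1)])
    show "G \<subseteq> t ` H"
    proof
      fix x assume x: "x \<in> G"
      then have "s x \<in> H" using H(2) by blast
      then show "x \<in> t ` H" using tG[OF x] by (metis imageI)
    qed
    show "inv_into H t x = s x" if x: "x \<in> G" for x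
    proof -
      have "s x \<in> H" using H(2) x by blast
      from inv_into_f_f[OF inj this] show ?thesis unfolding tG[OF x] .
    qed
    show "t b \<in> t ` H" using H(4) by blast
    show "inv_into H t (t b) = b" by (rule inv_into_f_f[OF inj H(4)])
  qed
qed

lemma piso_fval:
  assumes M: "sqz M J F" and p: "piso M J F N J' F' G s" and e: "\<forall>i\<in>term_vars t. e i \<in> G"
  shows "fval M e t \<in> G \<and> fval N (\<lambda>i. s (e i)) t = s (fval M e t)"
proof -
  note P = pisoD[OF p] and G = fin_subD[OF pisoD(1)[OF p]]
  have 0: "\<zero>\<^bsub>M\<^esub> \<in> G" "\<one>\<^bsub>M\<^esub> \<in> G" using sqz.F_zero[OF M] sqz.F_one[OF M] G(2) by auto
  show ?thesis using e
    by (induction t) (simp_all add: 0 P(5-9) G(4-6))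
qed

lemma piso_sat:
  assumes M: "sqz M J F" and N: "sqz N J' F'"
  shows "piso M J F N J' F' G s \<Longrightarrow> set xs \<subseteq> G \<Longrightarrow> vars_below \<phi> (length xs) \<Longrightarrow>
    sat M \<phi> xs = sat N \<phi> (map s xs)"
proof (induction \<phi> arbitrary: G s xs)
  case (Eq t u)
  note P = pisoD[OF Eq.prems(1)]
  have v: "\<forall>i\<in>term_vars t. xs ! i \<in> G" "\<forall>i\<in>term_vars u. xs ! i \<in> G"
    using Eq.prems(2,3) nth_mem by (auto simp: subset_iff)
  have vals: "fval N ((!) (map s xs)) r = fval N (\<lambda>i. s (xs ! i)) r" if "term_vars r \<subseteq> {..<length xs}" for r
    by (rule fval_cong) (use that in auto)
  have "tval N (map s xs) t = s (tval M xs t)" "tval N (map s xs) u = s (tval M xs u)"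
    "tval M xs t \<in> G" "tval M xs u \<in> G"
    unfolding tval_fval using vals[of t] vals[of u] Eq.prems(3) piso_fval[OF M Eq.prems(1) v(1)]
      piso_fval[OF M Eq.prems(1) v(2)] by simp_all
  then show ?case using P(3) by (simp add: inj_on_eq_iff)
next
  case (Neg \<phi>)
  then show ?case by simp
next
  case (Conj \<phi> \<psi>)
  have "sat M \<phi> xs = sat N \<phi> (map s xs)" "sat M \<psi> xs = sat N \<psi> (map s xs)"
    using Conj.prems(3) Conj.IH(1)[OF Conj.prems(1,2)] Conj.IH(2)[OF Conj.prems(1,2)] by simp_all
  then show ?case by simp
next
  case (Exists \<phi>)
  have vb: "vars_below \<phi> (length (a # xs))" for a :: 'a using Exists.prems(3) by simp
  have step: "sat M \<phi> (a # xs) = sat N \<phi> (s' a # map s xs)"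
    if "piso M J F N J' F' G' s'" "G \<subseteq> G'" "\<forall>x\<in>G. s' x = s x" "a \<in> G'" for G' s' a
  proof -
    have "set (a # xs) \<subseteq> G'" using that Exists.prems(2) by auto
    from Exists.IH[OF that(1) this vb] have "sat M \<phi> (a # xs) = sat N \<phi> (map s' (a # xs))" .
    moreover have "map s' xs = map s xs" using that(3) Exists.prems(2) by auto
    ultimately show ?thesis by simp
  qed
  show ?case
  proof
    assume "sat M (Exists \<phi>) xs"
    then obtain a where a: "a \<in> carrier M" "sat M \<phi> (a # xs)" by auto
    obtain G' s' where *: "piso M J F N J' F' G' s'" "G \<subseteq> G'" "\<forall>x\<in>G. s' x = s x" "a \<in> G'"
      using piso_forth[OF M N Exists.prems(1) a(1)] by blast
    have "s' a \<in> carrier N" using pisoD(2)[OF *(1)] *(4) by blast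
    then show "sat N (Exists \<phi>) (map s xs)" using step[OF *] a(2) by auto
  next
    assume "sat N (Exists \<phi>) (map s xs)"
    then obtain b where b: "b \<in> carrier N" "sat N \<phi> (b # map s xs)" by auto
    obtain G' s' a where *: "piso M J F N J' F' G' s'" "G \<subseteq> G'" "\<forall>x\<in>G. s' x = s x" "a \<in> G'" "s' a = b"
      using piso_back[OF M N Exists.prems(1) b(1)] by blast
    have "a \<in> carrier M" using fin_subD(3)[OF pisoD(1)[OF *(1)]] *(4) by blast
    then show "sat M (Exists \<phi>) xs" using step[OF *(1-4)] b(2) *(5) by auto
  qed
qed

lemma piso_id: "fin_sub M F G \<Longrightarrow> piso M J F M J F G (\<lambda>x. x)"
  unfolding piso_def fin_sub_def by auto

text \<open>Forth steps from \<open>M\<close> to itself, used only for the growing domains that they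
  produce.\<close>

lemma fin_sub_exists:
  assumes M: "sqz M J F" and "set xs \<subseteq> carrier M"
  shows "\<exists>G. fin_sub M F G \<and> set xs \<subseteq> G"
proof -
  have "\<exists>G s. piso M J F M J F G s \<and> set xs \<subseteq> G"
    using assms(2)
  proof (induction xs)
    case Nil
    show ?case using piso_id[OF sqz.fin_sub_base[OF M], of J] by (intro exI conjI) simp_all
  next
    case (Cons a xs)
    then obtain G s where G: "piso M J F M J F G s" "set xs \<subseteq> G" by auto
    obtain G' s' where "piso M J F M J F G' s'" "G \<subseteq> G'" "a \<in> G'"
      using piso_forth[OF M M G(1), of a] Cons.prems by auto
    with G(2) show ?case by (intro exI[of _ G'] exI[of _ s']) auto
  qed
  then show ?thesis using pisoD(1) by blast
qed

text \<open>Sending \<open>v\<close> to \<open>w\<close> extends the identity on \<open>G\<close>,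
  so the two elements have the same type over \<open>G\<close>, also after adding the same
  residue.\<close>

lemma generic_sat:
  assumes M: "sqz M J F" and G: "fin_sub M F G" "set bs \<subseteq> G" and c: "c \<in> F"
    and v: "v \<in> J" "v \<notin> G" and w: "w \<in> J" "w \<notin> G" and vb: "vars_below \<phi> (Suc (length bs))"
  shows "sat M \<phi> ((c \<oplus>\<^bsub>M\<^esub> v) # bs) = sat M \<phi> ((c \<oplus>\<^bsub>M\<^esub> w) # bs)"
proof -
  have "w \<notin> (\<lambda>x. x) ` G" using w(2) by simp
  from piso_extend[OF M M piso_id[OF G(1)] v w(1) this]
  obtain G' s where s: "piso M J F M J F G' s" "G \<subseteq> G'" "\<forall>x\<in>G. s x = x" "v \<in> G'" "s v = w" by blast
  note G' = fin_subD[OF pisoD(1)[OF s(1)]]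
  have c': "c \<in> G'" "s c = c" using c fin_subD(2)[OF G(1)] s(2,3) by blast+
  have "c \<oplus>\<^bsub>M\<^esub> v \<in> G'" by (rule G'(4)[OF c'(1) s(4)])
  then have "set ((c \<oplus>\<^bsub>M\<^esub> v) # bs) \<subseteq> G'" using G(2) s(2) by auto
  from piso_sat[OF M M s(1) this, of \<phi>] vb
  have "sat M \<phi> ((c \<oplus>\<^bsub>M\<^esub> v) # bs) = sat M \<phi> (map s ((c \<oplus>\<^bsub>M\<^esub> v) # bs))" by simp
  moreover have "s (c \<oplus>\<^bsub>M\<^esub> v) = c \<oplus>\<^bsub>M\<^esub> w" using pisoD(8)[OF s(1) c'(1) s(4)] c'(2) s(5) by simp
  moreover have "map s bs = bs" by (rule map_idI) (use G(2) s(3) in blast)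
  ultimately show ?thesis by simp
qed

section \<open>Saturation of uncountable models\<close>

lemma times_self_lepoll:
  assumes "infinite A" shows "A \<times> A \<lesssim> A"
  using card_of_Times_same_infinite[OF assms]
  by (simp add: lepoll_def card_of_ordIso[symmetric] bij_betw_def) blast

lemma lists_lepoll:
  assumes "infinite A" shows "lists A \<lesssim> A"
proof -
  have len: "{xs \<in> lists A. length xs = n} \<lesssim> A" for n
  proof (induction n)
    case 0
    obtain a where "a \<in> A" using assms by (metis finite.emptyI ex_in_conv)
    then show ?case unfolding lepoll_def by (intro exI[of _ "\<lambda>_. a"]) (auto simp: inj_on_def)
  next
    case (Suc n)
    have "{xs \<in> lists A. length xs = Suc n} \<lesssim> A \<times> {xs \<in> lists A. length xs = n}"
      unfolding lepoll_def
    proof (intro exI conjI)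
      show "inj_on (\<lambda>xs. (hd xs, tl xs)) {xs \<in> lists A. length xs = Suc n}"
      proof (rule inj_onI)
        fix xs ys :: "'a list"
        assume *: "xs \<in> {xs \<in> lists A. length xs = Suc n}" "ys \<in> {xs \<in> lists A. length xs = Suc n}"
          "(hd xs, tl xs) = (hd ys, tl ys)"
        then have "xs \<noteq> []" "ys \<noteq> []" by auto
        then show "xs = ys" using *(3) by (simp add: list.expand)
      qed
      show "(\<lambda>xs. (hd xs, tl xs)) ` {xs \<in> lists A. length xs = Suc n} \<subseteq> A \<times> {xs \<in> lists A. length xs = n}"
      proof (rule image_subsetI)
        fix xs assume "xs \<in> {xs \<in> lists A. length xs = Suc n}"
        then show "(hd xs, tl xs) \<in> A \<times> {xs \<in> lists A. length xs = n}" by (cases xs) simp_all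
      qed
    qed
    also have "A \<times> {xs \<in> lists A. length xs = n} \<lesssim> A \<times> A"
      by (rule times_lepoll_mono[OF lepoll_refl Suc])
    also have "A \<times> A \<lesssim> A" by (rule times_self_lepoll[OF assms])
    finally show ?case .
  qed
  then have "\<forall>n. \<exists>f. inj_on f {xs \<in> lists A. length xs = n} \<and> f ` {xs \<in> lists A. length xs = n} \<subseteq> A"
    unfolding lepoll_def by blast
  from choice[OF this] obtain f where "\<forall>n. inj_on (f n) {xs \<in> lists A. length xs = n} \<and>
      f n ` {xs \<in> lists A. length xs = n} \<subseteq> A" by (elim exE)
  then have f: "\<And>n. inj_on (f n) {xs \<in> lists A. length xs = n}"
    "\<And>n. f n ` {xs \<in> lists A. length xs = n} \<subseteq> A" by simp_all
  have "lists A \<lesssim> (UNIV :: nat set) \<times> A"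
    unfolding lepoll_def
  proof (intro exI conjI)
    show "inj_on (\<lambda>xs. (length xs, f (length xs) xs)) (lists A)"
    proof (rule inj_onI)
      fix xs ys assume xy: "xs \<in> lists A" "ys \<in> lists A"
        "(length xs, f (length xs) xs) = (length ys, f (length ys) ys)"
      then have "length xs = length ys" "f (length ys) xs = f (length ys) ys" by auto
      then show "xs = ys" using xy(1,2) by (intro inj_onD[OF f(1)[of "length ys"]]) simp_all
    qed
    show "(\<lambda>xs. (length xs, f (length xs) xs)) ` lists A \<subseteq> UNIV \<times> A" using f(2) by auto
  qed
  also have "(UNIV :: nat set) \<times> A \<lesssim> A \<times> A"
    using assms by (intro times_lepoll_mono) (simp_all add: infinite_le_lepoll)
  also have "A \<times> A \<lesssim> A" by (rule times_self_lepoll[OF assms])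
  finally show ?thesis .
qed

text \<open>A small parameter set leaves an element \<open>v\<close> of \<open>J\<close> outside all
  the finite subrings chosen for its finite lists. If a finitely satisfiable type were realised
  neither by any \<open>c + v\<close> with \<open>c\<close> in \<open>F\<close> nor by an element of
  one suitable finite subring, then finitely many of its formulas would already be
  inconsistent.\<close>

lemma sqz_saturated:
  assumes M: "sqz M J F" and unc: "uncountable (carrier M)"
  shows "saturated M"
  unfolding saturated_def
proof (intro conjI allI impI)
  interpret M: sqz M J F by (rule M)
  show inf: "infinite (carrier M)" using unc countable_finite by blast
  fix A p
  assume "A \<subseteq> carrier M \<and> A \<prec> carrier M \<and> p \<subseteq> {(\<phi>, bs). set bs \<subseteq> A \<and> vars_below \<phi> (Suc (length bs))} \<and>
    (\<forall>q\<subseteq>p. finite q \<longrightarrow> (\<exists>x\<in>carrier M. \<forall>(\<phi>, bs)\<in>q. sat M \<phi> (x # bs)))"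
  then have A: "A \<subseteq> carrier M" "A \<prec> carrier M"
    and sub: "p \<subseteq> {(\<phi>, bs). set bs \<subseteq> A \<and> vars_below \<phi> (Suc (length bs))}"
    and fin: "\<And>q. q \<subseteq> p \<Longrightarrow> finite q \<Longrightarrow> \<exists>x\<in>carrier M. \<forall>z\<in>q. sat M (fst z) (x # snd z)"
    by (simp_all add: case_prod_beta)
  have p: "set (snd z) \<subseteq> A \<and> vars_below (fst z) (Suc (length (snd z)))" if "z \<in> p" for z
    using subsetD[OF sub that] by (simp add: case_prod_beta)
  have "\<forall>bs\<in>lists A. \<exists>G. fin_sub M F G \<and> set bs \<subseteq> G"
  proof
    fix bs assume "bs \<in> lists A"
    then have "set bs \<subseteq> carrier M" using A(1) by auto
    then show "\<exists>G. fin_sub M F G \<and> set bs \<subseteq> G" by (rule fin_sub_exists[OF M])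
  qed
  then obtain G where G: "\<forall>bs\<in>lists A. fin_sub M F (G bs) \<and> set bs \<subseteq> G bs" by metis
  have "\<forall>bs\<in>lists A. \<exists>gs. set gs = G bs" using G fin_subD(1) finite_list by metis
  then obtain gs where gs: "\<forall>bs\<in>lists A. set (gs bs) = G bs" by metis
  have lessl: "lists A \<prec> carrier M"
  proof (cases "finite A")
    case True
    then show ?thesis by (intro countable_lesspoll_uncountable unc countable_lists countable_finite)
  next
    case False
    then show ?thesis using lists_lepoll A(2) lesspoll_trans1 by blast
  qed
  \<comment> \<open>The empty set stands in for \<open>A0\<close>, to match the shape of
    \<open>Union_lists_lesspoll\<close>.\<close>
  define U where "U = {} \<union> (\<Union>bs\<in>lists A. set (gs bs))"
  have U: "U \<prec> carrier M" unfolding U_def by (rule Union_lists_lesspoll[OF lessl inf]) simp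
  have "\<not> J \<subseteq> U"
  proof
    \<comment> \<open>Up to the finitely many residues \<open>J\<close> is as large as
      \<open>M\<close>, so it cannot lie in a set of smaller cardinality.\<close>
    assume "J \<subseteq> U"
    then have JM: "J \<prec> carrier M" using U subset_imp_lepoll lesspoll_trans1 by blast
    have "carrier M \<subseteq> (\<lambda>(c, j). c \<oplus>\<^bsub>M\<^esub> j) ` (F \<times> J)"
    proof
      fix x assume x: "x \<in> carrier M"
      obtain c where c: "c \<in> F" "x \<ominus>\<^bsub>M\<^esub> c \<in> J" using M.decomp[OF x] by blast
      have "x = c \<oplus>\<^bsub>M\<^esub> (x \<ominus>\<^bsub>M\<^esub> c)" using x M.Fc[OF c(1)] by algebra
      then show "x \<in> (\<lambda>(c, j). c \<oplus>\<^bsub>M\<^esub> j) ` (F \<times> J)"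
        using c by (intro image_eqI[of _ _ "(c, x \<ominus>\<^bsub>M\<^esub> c)"]) auto
    qed
    then have "carrier M \<lesssim> F \<times> J" by (meson image_lepoll lepoll_trans subset_imp_lepoll)
    also have "F \<times> J \<lesssim> J \<times> J"
      by (rule times_lepoll_mono[OF finite_lepoll_infinite[OF M.J_inf M.F_fin] lepoll_refl])
    also have "J \<times> J \<lesssim> J" by (rule times_self_lepoll[OF M.J_inf])
    finally show False using JM lepoll_antisym unfolding lesspoll_def by blast
  qed
  then obtain v where v: "v \<in> J" "v \<notin> U" by blast
  have vG: "v \<notin> G bs" if "bs \<in> lists A" for bs
  proof -
    have "G bs \<subseteq> U" using gs that unfolding U_def by blast
    then show ?thesis using v(2) by blast
  qed
  have "\<exists>x\<in>carrier M. \<forall>z\<in>p. sat M (fst z) (x # snd z)"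
  proof (rule ccontr)
    assume "\<not> ?thesis"
    then have "\<forall>x. \<exists>z. x \<in> carrier M \<longrightarrow> z \<in> p \<and> \<not> sat M (fst z) (x # snd z)" by blast
    then obtain Z where Z: "\<forall>x. x \<in> carrier M \<longrightarrow> Z x \<in> p \<and> \<not> sat M (fst (Z x)) (x # snd (Z x))" by metis
    have vc: "c \<oplus>\<^bsub>M\<^esub> v \<in> carrier M" if "c \<in> F" for c using M.Fc[OF that] M.Jc[OF v(1)] by simp
    define z where "z c = Z (c \<oplus>\<^bsub>M\<^esub> v)" for c
    have z: "z c \<in> p \<and> \<not> sat M (fst (z c)) ((c \<oplus>\<^bsub>M\<^esub> v) # snd (z c))" if "c \<in> F" for c
      using Z vc[OF that] unfolding z_def by blast
    obtain cs where cs: "set cs = F" using finite_list[OF M.F_fin] by blast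
    define bs where "bs = concat (map (\<lambda>c. snd (z c)) cs)"
    have sbs: "set (snd (z c)) \<subseteq> set bs" if "c \<in> F" for c using that cs by (auto simp: bs_def)
    have bsA: "bs \<in> lists A"
    proof -
      have "set (snd (z c)) \<subseteq> A" if "c \<in> F" for c using p[of "z c"] z[OF that] by simp
      then show ?thesis using cs by (auto simp: bs_def in_lists_conv_set)
    qed
    define H where "H = G bs"
    have H: "fin_sub M F H" "set bs \<subseteq> H" "v \<notin> H" using G bsA vG[OF bsA] by (auto simp: H_def)
    note Hs = fin_subD[OF H(1)]
    \<comment> \<open>Formulas that fail at the \<open>c + v\<close>, together with formulas that
      fail at the elements of \<open>H\<close>. A realisation with residue \<open>c\<close> is
      either in \<open>H\<close> or of the form \<open>c + w\<close> with \<open>w\<close> generic,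
      and then it behaves like \<open>c + v\<close>; both cases are excluded.\<close>
    define q where "q = z ` F \<union> Z ` H"
    have "q \<subseteq> p" using z Z Hs(3) unfolding q_def by blast
    moreover have "finite q" using M.F_fin Hs(1) by (simp add: q_def)
    ultimately obtain x where x: "x \<in> carrier M" "\<forall>z\<in>q. sat M (fst z) (x # snd z)" using fin by blast
    obtain c where c: "c \<in> F" "x \<ominus>\<^bsub>M\<^esub> c \<in> J" using M.decomp[OF x(1)] by blast
    define w where "w = x \<ominus>\<^bsub>M\<^esub> c"
    have xw: "x = c \<oplus>\<^bsub>M\<^esub> w" unfolding w_def using x(1) M.Fc[OF c(1)] by algebra
    show False
    proof (cases "w \<in> H")
      case True
      then have "x \<in> H" unfolding xw using Hs(2,4) c(1) by blast
      then have "Z x \<in> q" by (simp add: q_def)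
      then show False using x Z by blast
    next
      case False
      have "set (snd (z c)) \<subseteq> H" using sbs[OF c(1)] H(2) by blast
      moreover have "vars_below (fst (z c)) (Suc (length (snd (z c))))" using p z[OF c(1)] by blast
      ultimately have "sat M (fst (z c)) ((c \<oplus>\<^bsub>M\<^esub> v) # snd (z c)) = sat M (fst (z c)) ((c \<oplus>\<^bsub>M\<^esub> w) # snd (z c))"
        by (intro generic_sat[OF M H(1) _ c(1) v(1) H(3) c(2)[folded w_def] False])
      moreover have "z c \<in> q" using c(1) by (simp add: q_def)
      ultimately show False using z[OF c(1)] x(2) xw by auto
    qed
  qed
  then show "\<exists>x\<in>carrier M. \<forall>(\<phi>, bs)\<in>p. sat M \<phi> (x # bs)" by (simp add: case_prod_beta)
qed

section \<open>Strong minimality of the maximal ideal\<close>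

lemma definable_eqI:
  assumes "set cs \<subseteq> C" "\<And>yss. list_all2 (\<in>) yss cs \<Longrightarrow> vars_below \<phi> (n + length (concat yss))"
    and "\<And>xs. xs \<in> tuples M n \<Longrightarrow> xs \<in> X \<longleftrightarrow> (\<exists>yss. list_all2 (\<in>) yss cs \<and> sat M \<phi> (xs @ concat yss))"
    and "X \<subseteq> tuples M n"
  shows "definable_eq M C n X"
  unfolding definable_eq_def
proof (intro exI conjI)
  show "set cs \<subseteq> C" by (rule assms(1))
  show "X = {xs \<in> tuples M n. \<exists>yss. list_all2 (\<in>) yss cs \<and>
      vars_below \<phi> (n + length (concat yss)) \<and> sat M \<phi> (xs @ concat yss)}"
    using assms(2-4) by blast
qed

lemma Id_on_quotient: "quotient X (Id_on X) = (\<lambda>x. {x}) ` X"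
  unfolding quotient_def by auto

lemma equiv_Id_on: "equiv X (Id_on X)"
  unfolding equiv_def refl_on_def sym_def trans_def by auto

lemma concat_pairs_Id_on: "concat_pairs (Id_on ((\<lambda>a. [a]) ` X)) = (\<lambda>a. [a, a]) ` X"
  unfolding concat_pairs_def Id_on_def by force

text \<open>Elements of \<open>M\<close> are imaginaries via the quotient by equality, so the
  equivalence relation is defined by the formula for the set together with
  \<open>x = y\<close>.\<close>

lemma interpretable_elements:
  assumes "set cs \<subseteq> C" "\<And>yss. list_all2 (\<in>) yss cs \<Longrightarrow> length (concat yss) = m"
    and vb: "vars_below \<phi> (Suc m)" and X: "X \<subseteq> carrier M"
    and mem: "\<And>x. x \<in> carrier M \<Longrightarrow> x \<in> X \<longleftrightarrow> (\<exists>yss. list_all2 (\<in>) yss cs \<and> sat M \<phi> (x # concat yss))"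
  shows "interpretable M C ((\<lambda>a. {[a]}) ` X)"
  unfolding interpretable_def
proof (intro exI conjI)
  let ?X = "(\<lambda>a. [a]) ` X"
  show "definable_eq M C 1 ?X"
  proof (rule definable_eqI[OF assms(1)])
    show "vars_below \<phi> (1 + length (concat yss))" if "list_all2 (\<in>) yss cs" for yss
      using vb assms(2)[OF that] by simp
    fix xs assume "xs \<in> tuples M 1"
    then obtain x where "x \<in> carrier M" "xs = [x]" by (auto simp: tuples_1)
    then show "xs \<in> ?X \<longleftrightarrow> (\<exists>yss. list_all2 (\<in>) yss cs \<and> sat M \<phi> (xs @ concat yss))"
      using mem by (simp add: image_iff)
  qed (use X in \<open>auto simp: tuples_def\<close>)
  show "equiv ?X (Id_on ?X)" by (rule equiv_Id_on)
  let ?\<psi> = "Conj (inst \<phi> (Var 0) 2) (Eq (Var 0) (Var 1))"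
  show "definable_eq M C (1 + 1) (concat_pairs (Id_on ?X))"
  proof (rule definable_eqI[OF assms(1)])
    show "vars_below ?\<psi> (1 + 1 + length (concat yss))" if "list_all2 (\<in>) yss cs" for yss
      using vars_below_inst[OF vb, of "Var 0" "2 + m" 2] assms(2)[OF that] by simp
    fix xs assume "xs \<in> tuples M (1 + 1)"
    then obtain x y where xy: "x \<in> carrier M" "y \<in> carrier M" "xs = [x, y]"
      by (auto simp: tuples_Suc tuples_0)
    have "sat M ?\<psi> (xs @ concat yss) \<longleftrightarrow> sat M \<phi> (x # concat yss) \<and> x = y" for yss
      unfolding xy(3) sat_fsat by (simp add: nth_Cons_case_nat[symmetric])
    then show "xs \<in> concat_pairs (Id_on ?X) \<longleftrightarrow> (\<exists>yss. list_all2 (\<in>) yss cs \<and> sat M ?\<psi> (xs @ concat yss))"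
      using mem[OF xy(1)] xy unfolding concat_pairs_Id_on by auto
  qed (use X in \<open>auto simp: concat_pairs_Id_on tuples_def\<close>)
  show "(\<lambda>a. {[a]}) ` X = ?X // Id_on ?X" by (simp add: Id_on_quotient image_image)
qed


lemma single_imaginary:
  assumes "ring M" "a \<in> carrier M" shows "{[a]} \<in> imaginaries M"
proof -
  interpret ring M by fact
  have "{xs \<in> tuples M (1 + 1). sat M (Eq (Var 0) (Var 1)) xs} = concat_pairs (Id_on (tuples M 1))"
    unfolding One_nat_def tuples_1 concat_pairs_Id_on by (auto simp: tuples_Suc tuples_0)
  then have "definable M {} (1 + 1) (concat_pairs (Id_on (tuples M 1)))"
    unfolding definable_def by (intro exI[of _ "Eq (Var 0) (Var 1)"] exI[of _ "[]"]) auto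
  moreover have "{[a]} \<in> quotient (tuples M 1) (Id_on (tuples M 1))"
    unfolding Id_on_quotient using assms(2) by (simp add: tuples_1)
  ultimately show ?thesis unfolding imaginaries_def using equiv_Id_on by blast
qed

text \<open>The maximal ideal serves as the strongly minimal set. Every element is the sum of its
  residue and an element of \<open>J\<close>, so it is definable from that element once the finite
  field is among the parameters.\<close>

lemma sqz_almost_strongly_minimal_set:
  assumes M: "sqz M J F"
  shows "almost_strongly_minimal_set M {} (universe M)"
proof -
  interpret M: sqz M J F by (rule M)
  define D where "D = (\<lambda>a. {[a]}) ` J"
  \<comment> \<open>This defines \<open>J\<close> without parameters. An element whose square is
    zero has a residue with square zero, which vanishes because \<open>F\<close> is a field.\<close>
  have Jiff: "x \<in> J \<longleftrightarrow> x \<otimes>\<^bsub>M\<^esub> x = \<zero>\<^bsub>M\<^esub>" if x: "x \<in> carrier M" for x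
  proof
    assume sq: "x \<otimes>\<^bsub>M\<^esub> x = \<zero>\<^bsub>M\<^esub>"
    obtain c where c: "c \<in> F" "x \<ominus>\<^bsub>M\<^esub> c \<in> J" using M.decomp[OF x] by blast
    have cc: "c \<in> carrier M" by (rule M.Fc[OF c(1)])
    have "c = \<zero>\<^bsub>M\<^esub>"
    proof (rule ccontr)
      assume "c \<noteq> \<zero>\<^bsub>M\<^esub>"
      then obtain d where d: "d \<in> F" "c \<otimes>\<^bsub>M\<^esub> d = \<one>\<^bsub>M\<^esub>" using M.F_inv c(1) by blast
      have dc: "d \<in> carrier M" by (rule M.Fc[OF d(1)])
      have "c \<otimes>\<^bsub>M\<^esub> c = x \<otimes>\<^bsub>M\<^esub> x \<ominus>\<^bsub>M\<^esub> (x \<oplus>\<^bsub>M\<^esub> c) \<otimes>\<^bsub>M\<^esub> (x \<ominus>\<^bsub>M\<^esub> c)" using x cc by algebra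
      also have "\<dots> = \<ominus>\<^bsub>M\<^esub> ((x \<oplus>\<^bsub>M\<^esub> c) \<otimes>\<^bsub>M\<^esub> (x \<ominus>\<^bsub>M\<^esub> c))" using x cc by (simp add: sq a_minus_def)
      finally have "c \<otimes>\<^bsub>M\<^esub> c \<in> J" using M.J_neg[OF M.J_mult[OF _ c(2), of "x \<oplus>\<^bsub>M\<^esub> c"]] x cc by simp
      then have "c \<otimes>\<^bsub>M\<^esub> c = \<zero>\<^bsub>M\<^esub>" by (rule M.F_J[OF M.F_mult[OF c(1) c(1)]])
      then have "(c \<otimes>\<^bsub>M\<^esub> c) \<otimes>\<^bsub>M\<^esub> (d \<otimes>\<^bsub>M\<^esub> d) = \<zero>\<^bsub>M\<^esub>" using dc by simp
      moreover have "(c \<otimes>\<^bsub>M\<^esub> c) \<otimes>\<^bsub>M\<^esub> (d \<otimes>\<^bsub>M\<^esub> d) = (c \<otimes>\<^bsub>M\<^esub> d) \<otimes>\<^bsub>M\<^esub> (c \<otimes>\<^bsub>M\<^esub> d)" using cc dc by algebra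
      ultimately have 10: "\<one>\<^bsub>M\<^esub> = \<zero>\<^bsub>M\<^esub>" unfolding d(2) by simp
      have "c = c \<otimes>\<^bsub>M\<^esub> \<one>\<^bsub>M\<^esub>" using cc by simp
      then have "c = \<zero>\<^bsub>M\<^esub>" unfolding 10 using cc by simp
      with \<open>c \<noteq> \<zero>\<^bsub>M\<^esub>\<close> show False ..
    qed
    then show "x \<in> J" using c(2) x by (simp add: a_minus_def)
  qed (rule M.J_sq)
  have Dint: "interpretable M C D" for C
    unfolding D_def
    by (rule interpretable_elements[of "[]" _ 0 "Eq (Mult (Var 0) (Var 0)) Zero"])
      (use Jiff M.Jc in auto)
  have Dinf: "infinite D"
    unfolding D_def using M.J_inf by (auto simp: finite_image_iff inj_on_def)
  have "finite Y \<or> finite (D - Y)" if Y: "Y \<subseteq> D" "definable M (carrier M) n (\<Union>Y)" for Y n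
  proof -
    obtain \<phi> bs where bs: "set bs \<subseteq> carrier M" "vars_below \<phi> (n + length bs)"
      "\<Union>Y = {xs \<in> tuples M n. sat M \<phi> (xs @ bs)}" using Y(2) unfolding definable_def by blast
    obtain G where G: "fin_sub M F G" "set bs \<subseteq> G" using fin_sub_exists[OF M bs(1)] by blast
    have fin: "finite ((\<lambda>a. {[a]}) ` G)" using fin_subD(1)[OF G(1)] by simp
    have mem: "{[a]} \<in> Y \<longleftrightarrow> [a] \<in> \<Union>Y" for a
      using Y(1) unfolding D_def by auto
    show ?thesis
    proof (cases "Y = {}")
      case False
      then obtain a where a: "a \<in> J" "{[a]} \<in> Y" using Y(1) unfolding D_def by blast
      then have "[a] \<in> tuples M n" using mem bs(3) by blast
      then have n: "n = 1" by (simp add: tuples_def)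
      have vb: "vars_below \<phi> (Suc (length bs))" using bs(2) n by simp
      have sat: "{[v]} \<in> Y \<longleftrightarrow> sat M \<phi> (v # bs)" if "v \<in> J" for v
        unfolding mem bs(3) n using M.Jc[OF that] by (simp add: tuples_def)
      \<comment> \<open>The elements of \<open>J\<close> outside a finite subring containing the
        parameters are indistinguishable, so \<open>Y\<close> contains all of them or none; the
        residue in \<open>generic_sat\<close> is zero here.\<close>
      have same: "{[v]} \<in> Y \<longleftrightarrow> {[w]} \<in> Y" if "v \<in> J - G" "w \<in> J - G" for v w
        using generic_sat[OF M G M.F_zero _ _ _ _ vb, of v w] that sat M.Jc by simp
      show ?thesis
      proof (cases "\<exists>v\<in>J - G. {[v]} \<in> Y")
        case True
        then have "\<forall>w\<in>J - G. {[w]} \<in> Y" using same by blast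
        then have "D - Y \<subseteq> (\<lambda>a. {[a]}) ` G" unfolding D_def by blast
        then show ?thesis using fin finite_subset by blast
      next
        case False
        then have "Y \<subseteq> (\<lambda>a. {[a]}) ` G" using Y(1) unfolding D_def by blast
        then show ?thesis using fin finite_subset by blast
      qed
    qed simp
  qed
  then have sm: "strongly_minimal M D"
    unfolding strongly_minimal_def using Dint Dinf by blast
  define B where "B = (\<lambda>a. {[a]}) ` F"
  have "interpretable M {} (universe M)"
    unfolding universe_def
    by (rule interpretable_elements[of "[]" _ 0 "Eq Zero Zero"]) auto
  moreover have "B \<subseteq> imaginaries M"
    unfolding B_def using single_imaginary[OF M.ring_axioms] M.Fc by auto
  moreover have "B \<prec> carrier M"
  proof (rule finite_lesspoll_infinite)
    show "infinite (carrier M)" using M.J_inf M.Jc by (meson finite_subset subsetI)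
    show "finite B" using M.F_fin by (simp add: B_def)
  qed
  moreover have "\<exists>Q\<subseteq>D. finite Q \<and> algebraic M (B \<union> Q) e" if e: "e \<in> universe M" for e
  proof -
    obtain x where x: "x \<in> carrier M" "e = {[x]}" using e unfolding universe_def by blast
    obtain c where c: "c \<in> F" "x \<ominus>\<^bsub>M\<^esub> c \<in> J" using M.decomp[OF x(1)] by blast
    define v where "v = x \<ominus>\<^bsub>M\<^esub> c"
    have xv: "x = c \<oplus>\<^bsub>M\<^esub> v" unfolding v_def using x(1) M.Fc[OF c(1)] by algebra
    have yss: "list_all2 (\<in>) yss [{[c]}, {[v]}] \<longleftrightarrow> yss = [[c], [v]]" for yss
      by (auto simp: list_all2_Cons2)
    have "interpretable M (B \<union> {{[v]}}) ((\<lambda>a. {[a]}) ` {x})"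
    proof (rule interpretable_elements[of "[{[c]}, {[v]}]" _ 2 "Eq (Var 0) (Add (Var 1) (Var 2))"])
      show "set [{[c]}, {[v]}] \<subseteq> B \<union> {{[v]}}" using c(1) by (simp add: B_def)
    qed (use x(1) xv yss in auto)
    then have "algebraic M (B \<union> {{[v]}}) e"
      unfolding algebraic_def x(2) by (intro exI[of _ "(\<lambda>a. {[a]}) ` {x}"]) simp
    moreover have "{{[v]}} \<subseteq> D" unfolding D_def using c(2) by (simp add: v_def)
    ultimately show ?thesis by (intro exI[of _ "{{[v]}}"]) simp
  qed
  ultimately have "almost_internal M {} (universe M) D"
    unfolding almost_internal_def using Dint by (intro conjI exI[of _ B]) blast+
  then show ?thesis unfolding almost_strongly_minimal_set_def using sm by blast
qed

section \<open>A large power of the ring\<close>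

definition pow_ring :: "('a, 'm) ring_scheme \<Rightarrow> 'a set \<Rightarrow> 'a set \<Rightarrow> 'i set \<Rightarrow> ('i \<Rightarrow> 'a) ring" where
  "pow_ring R J F I = \<lparr>carrier = {f \<in> I \<rightarrow>\<^sub>E carrier R. \<exists>c\<in>F. \<forall>i\<in>I. f i \<ominus>\<^bsub>R\<^esub> c \<in> J},
     monoid.mult = (\<lambda>f g. \<lambda>i\<in>I. f i \<otimes>\<^bsub>R\<^esub> g i), one = (\<lambda>i\<in>I. \<one>\<^bsub>R\<^esub>),
     zero = (\<lambda>i\<in>I. \<zero>\<^bsub>R\<^esub>), add = (\<lambda>f g. \<lambda>i\<in>I. f i \<oplus>\<^bsub>R\<^esub> g i)\<rparr>"

lemma pow_ring_simps:
  "f \<in> carrier (pow_ring R J F I) \<longleftrightarrow> f \<in> I \<rightarrow>\<^sub>E carrier R \<and> (\<exists>c\<in>F. \<forall>i\<in>I. f i \<ominus>\<^bsub>R\<^esub> c \<in> J)"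
  "f \<otimes>\<^bsub>pow_ring R J F I\<^esub> g = (\<lambda>i\<in>I. f i \<otimes>\<^bsub>R\<^esub> g i)" "\<one>\<^bsub>pow_ring R J F I\<^esub> = (\<lambda>i\<in>I. \<one>\<^bsub>R\<^esub>)"
  "f \<oplus>\<^bsub>pow_ring R J F I\<^esub> g = (\<lambda>i\<in>I. f i \<oplus>\<^bsub>R\<^esub> g i)" "\<zero>\<^bsub>pow_ring R J F I\<^esub> = (\<lambda>i\<in>I. \<zero>\<^bsub>R\<^esub>)"
  by (simp_all add: pow_ring_def)

context sqz
begin

context
  fixes I :: "'i set"
begin

abbreviation Q :: "('i \<Rightarrow> 'a) ring" where "Q \<equiv> pow_ring M J F I"

lemma Q_val: "f \<in> carrier Q \<Longrightarrow> i \<in> I \<Longrightarrow> f i \<in> carrier M"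
  unfolding pow_ring_simps by (blast dest: PiE_mem)

lemma Q_ext:
  assumes "f \<in> carrier Q" "g \<in> carrier Q" "\<And>i. i \<in> I \<Longrightarrow> f i = g i" shows "f = g"
  by (rule PiE_ext[of f I "\<lambda>_. carrier M" g]) (use assms in \<open>simp_all add: pow_ring_simps\<close>)

lemma Q_memI:
  assumes "\<And>i. i \<in> I \<Longrightarrow> t i \<in> carrier M" "c \<in> F" "\<And>i. i \<in> I \<Longrightarrow> t i \<ominus> c \<in> J"
  shows "(\<lambda>i\<in>I. t i) \<in> carrier Q"
  unfolding pow_ring_simps using assms by auto

lemma Q_const: "c \<in> F \<Longrightarrow> (\<lambda>i\<in>I. c) \<in> carrier Q"
  using Fc J_zero by (intro Q_memI[of _ c]) (simp_all add: a_minus_def r_neg)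

lemma Q_const':
  assumes "x \<in> carrier M" shows "(\<lambda>i\<in>I. x) \<in> carrier Q"
proof -
  obtain c where c: "c \<in> F" "x \<ominus> c \<in> J" using decomp[OF assms] by blast
  show ?thesis by (rule Q_memI[OF assms c])
qed

lemma Q_add: "f \<in> carrier Q \<Longrightarrow> g \<in> carrier Q \<Longrightarrow> f \<oplus>\<^bsub>Q\<^esub> g \<in> carrier Q"
proof -
  assume f: "f \<in> carrier Q" and g: "g \<in> carrier Q"
  obtain c where c: "c \<in> F" "\<forall>i\<in>I. f i \<ominus> c \<in> J" using f unfolding pow_ring_simps by blast
  obtain d where d: "d \<in> F" "\<forall>i\<in>I. g i \<ominus> d \<in> J" using g unfolding pow_ring_simps by blast
  show ?thesis unfolding pow_ring_simps(4)
  proof (rule Q_memI[OF _ F_add[OF c(1) d(1)]])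
    fix i assume i: "i \<in> I"
    show "f i \<oplus> g i \<in> carrier M" using Q_val[OF f i] Q_val[OF g i] by simp
    have "f i \<oplus> g i \<ominus> (c \<oplus> d) = (f i \<ominus> c) \<oplus> (g i \<ominus> d)"
      using Q_val[OF f i] Q_val[OF g i] Fc[OF c(1)] Fc[OF d(1)] by algebra
    then show "f i \<oplus> g i \<ominus> (c \<oplus> d) \<in> J" using J_add c(2) d(2) i by simp
  qed
qed

lemma Q_mult: "f \<in> carrier Q \<Longrightarrow> g \<in> carrier Q \<Longrightarrow> f \<otimes>\<^bsub>Q\<^esub> g \<in> carrier Q"
proof -
  assume f: "f \<in> carrier Q" and g: "g \<in> carrier Q"
  obtain c where c: "c \<in> F" "\<forall>i\<in>I. f i \<ominus> c \<in> J" using f unfolding pow_ring_simps by blast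
  obtain d where d: "d \<in> F" "\<forall>i\<in>I. g i \<ominus> d \<in> J" using g unfolding pow_ring_simps by blast
  show ?thesis unfolding pow_ring_simps(2)
  proof (rule Q_memI[OF _ F_mult[OF c(1) d(1)]])
    fix i assume i: "i \<in> I"
    note car = Q_val[OF f i] Q_val[OF g i] Fc[OF c(1)] Fc[OF d(1)]
    show "f i \<otimes> g i \<in> carrier M" using car by simp
    have "f i \<otimes> g i \<ominus> c \<otimes> d = g i \<otimes> (f i \<ominus> c) \<oplus> c \<otimes> (g i \<ominus> d)"
      using car by algebra
    then show "f i \<otimes> g i \<ominus> c \<otimes> d \<in> J" using J_add J_mult car c(2) d(2) i by simp
  qed
qed

lemma Q_neg:
  assumes f: "f \<in> carrier Q"
  shows "(\<lambda>i\<in>I. \<ominus> f i) \<in> carrier Q" "(\<lambda>i\<in>I. \<ominus> f i) \<oplus>\<^bsub>Q\<^esub> f = \<zero>\<^bsub>Q\<^esub>"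
proof -
  obtain c where c: "c \<in> F" "\<forall>i\<in>I. f i \<ominus> c \<in> J" using f unfolding pow_ring_simps by blast
  show "(\<lambda>i\<in>I. \<ominus> f i) \<in> carrier Q"
  proof (rule Q_memI[OF _ F_neg[OF c(1)]])
    fix i assume i: "i \<in> I"
    show "\<ominus> f i \<in> carrier M" using Q_val[OF f i] by simp
    have "\<ominus> f i \<ominus> \<ominus> c = \<ominus> (f i \<ominus> c)" using Q_val[OF f i] Fc[OF c(1)] by algebra
    then show "\<ominus> f i \<ominus> \<ominus> c \<in> J" using J_neg c(2) i by simp
  qed
  show "(\<lambda>i\<in>I. \<ominus> f i) \<oplus>\<^bsub>Q\<^esub> f = \<zero>\<^bsub>Q\<^esub>"
    unfolding pow_ring_simps by (rule restrict_ext) (use Q_val[OF f] in \<open>simp add: l_neg\<close>)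
qed

lemma Q_cring: "cring Q"
proof (rule cringI)
  show "abelian_group Q"
  proof (rule abelian_groupI)
    show "\<zero>\<^bsub>Q\<^esub> \<in> carrier Q" unfolding pow_ring_simps(5) by (rule Q_const[OF F_zero])
    fix x assume x: "x \<in> carrier Q"
    show "\<exists>y\<in>carrier Q. y \<oplus>\<^bsub>Q\<^esub> x = \<zero>\<^bsub>Q\<^esub>" using Q_neg[OF x] by blast
    show "\<zero>\<^bsub>Q\<^esub> \<oplus>\<^bsub>Q\<^esub> x = x"
      by (rule Q_ext[OF Q_add[OF _ x] x])
        (use Q_const[OF F_zero] Q_val[OF x] in \<open>simp_all add: pow_ring_simps(4,5)\<close>)
    fix y assume y: "y \<in> carrier Q"
    show "x \<oplus>\<^bsub>Q\<^esub> y \<in> carrier Q" by (rule Q_add[OF x y])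
    show "x \<oplus>\<^bsub>Q\<^esub> y = y \<oplus>\<^bsub>Q\<^esub> x"
      unfolding pow_ring_simps by (rule restrict_ext) (use Q_val[OF x] Q_val[OF y] in \<open>simp add: a_comm\<close>)
    fix z assume z: "z \<in> carrier Q"
    show "x \<oplus>\<^bsub>Q\<^esub> y \<oplus>\<^bsub>Q\<^esub> z = x \<oplus>\<^bsub>Q\<^esub> (y \<oplus>\<^bsub>Q\<^esub> z)"
      unfolding pow_ring_simps
      by (rule restrict_ext) (use Q_val[OF x] Q_val[OF y] Q_val[OF z] in \<open>simp add: a_assoc\<close>)
  qed
  show "comm_monoid Q"
  proof (rule comm_monoidI)
    show "\<one>\<^bsub>Q\<^esub> \<in> carrier Q" unfolding pow_ring_simps(3) by (rule Q_const[OF F_one])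
    fix x assume x: "x \<in> carrier Q"
    show "\<one>\<^bsub>Q\<^esub> \<otimes>\<^bsub>Q\<^esub> x = x"
      by (rule Q_ext[OF Q_mult[OF _ x] x])
        (use Q_const[OF F_one] Q_val[OF x] in \<open>simp_all add: pow_ring_simps(2,3)\<close>)
    fix y assume y: "y \<in> carrier Q"
    show "x \<otimes>\<^bsub>Q\<^esub> y \<in> carrier Q" by (rule Q_mult[OF x y])
    show "x \<otimes>\<^bsub>Q\<^esub> y = y \<otimes>\<^bsub>Q\<^esub> x"
      unfolding pow_ring_simps by (rule restrict_ext) (use Q_val[OF x] Q_val[OF y] in \<open>simp add: m_comm\<close>)
    fix z assume z: "z \<in> carrier Q"
    show "x \<otimes>\<^bsub>Q\<^esub> y \<otimes>\<^bsub>Q\<^esub> z = x \<otimes>\<^bsub>Q\<^esub> (y \<otimes>\<^bsub>Q\<^esub> z)"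
      unfolding pow_ring_simps
      by (rule restrict_ext) (use Q_val[OF x] Q_val[OF y] Q_val[OF z] in \<open>simp add: m_assoc\<close>)
  qed
  fix x y z assume x: "x \<in> carrier Q" and y: "y \<in> carrier Q" and z: "z \<in> carrier Q"
  show "(x \<oplus>\<^bsub>Q\<^esub> y) \<otimes>\<^bsub>Q\<^esub> z = x \<otimes>\<^bsub>Q\<^esub> z \<oplus>\<^bsub>Q\<^esub> y \<otimes>\<^bsub>Q\<^esub> z"
    unfolding pow_ring_simps
    by (rule restrict_ext) (use Q_val[OF x] Q_val[OF y] Q_val[OF z] in \<open>simp add: l_distr\<close>)
qed

lemma Q_a_inv: "f \<in> carrier Q \<Longrightarrow> \<ominus>\<^bsub>Q\<^esub> f = (\<lambda>i\<in>I. \<ominus> f i)"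
proof -
  assume f: "f \<in> carrier Q"
  interpret Q: cring Q by (rule Q_cring)
  show ?thesis by (rule Q.minus_equality[OF Q_neg(2)[OF f] f Q_neg(1)[OF f]])
qed

lemma sqz_pow:
  assumes I: "I \<noteq> {}"
  shows "sqz Q {f \<in> carrier Q. \<forall>i\<in>I. f i \<in> J} ((\<lambda>c. \<lambda>i\<in>I. c) ` F)"
proof -
  interpret Q: cring Q by (rule Q_cring)
  let ?J = "{f \<in> carrier Q. \<forall>i\<in>I. f i \<in> J}" and ?k = "\<lambda>c. \<lambda>i\<in>I. c"
  obtain i0 where i0: "i0 \<in> I" using I by blast
  have kinj: "inj ?k"
  proof (rule injI)
    fix x y assume "?k x = ?k y"
    then have "?k x i0 = ?k y i0" by simp
    then show "x = y" using i0 by simp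
  qed
  show ?thesis
  proof (intro sqz.intro sqz_axioms.intro Q_cring)
    show "additive_subgroup ?J Q"
    proof (rule Q.add_subI)
      show "\<zero>\<^bsub>Q\<^esub> \<in> ?J" using Q.zero_closed J_zero by (simp add: pow_ring_simps(5))
      show "x \<oplus>\<^bsub>Q\<^esub> y \<in> ?J" if "x \<in> ?J" "y \<in> ?J" for x y
        using that Q_add J_add by (simp add: pow_ring_simps(4))
      show "\<ominus>\<^bsub>Q\<^esub> x \<in> ?J" if "x \<in> ?J" for x
        using that Q.a_inv_closed[of x] J_neg by (simp add: Q_a_inv)
    qed auto
    show "x \<otimes>\<^bsub>Q\<^esub> y \<in> ?J" if "x \<in> carrier Q" "y \<in> ?J" for x y
      using that Q_mult[of x y] J_mult Q_val[OF that(1)] by (simp add: pow_ring_simps(2))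
    show "x \<otimes>\<^bsub>Q\<^esub> y = \<zero>\<^bsub>Q\<^esub>" if "x \<in> ?J" "y \<in> ?J" for x y
      unfolding pow_ring_simps by (rule restrict_ext) (use that J_sq in simp)
    have "?k ` J \<subseteq> ?J" using Q_const' Jc by auto
    moreover have "infinite (?k ` J)"
      using J_inf finite_imageD[OF _ inj_on_subset[OF kinj subset_UNIV]] by blast
    ultimately show "infinite ?J" using finite_subset by blast
    show "finite (?k ` F)" using F_fin by simp
    show "?k ` F \<subseteq> carrier Q" using Q_const by blast
    show "\<one>\<^bsub>Q\<^esub> \<in> ?k ` F" "\<zero>\<^bsub>Q\<^esub> \<in> ?k ` F" using F_one F_zero by (auto simp: pow_ring_simps(3,5))
    fix x assume "x \<in> ?k ` F"
    then obtain a where a: "a \<in> F" "x = ?k a" by blast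
    show "\<ominus>\<^bsub>Q\<^esub> x \<in> ?k ` F"
    proof -
      have "\<ominus>\<^bsub>Q\<^esub> x = ?k (\<ominus> a)" unfolding a(2) Q_a_inv[OF Q_const[OF a(1)]] by (rule restrict_ext) simp
      then show ?thesis using F_neg[OF a(1)] by blast
    qed
    show "\<exists>y\<in>?k ` F. x \<otimes>\<^bsub>Q\<^esub> y = \<one>\<^bsub>Q\<^esub>" if "x \<noteq> \<zero>\<^bsub>Q\<^esub>"
    proof -
      have "a \<noteq> \<zero>" using that unfolding a(2) pow_ring_simps by auto
      then obtain b where b: "b \<in> F" "a \<otimes> b = \<one>" using F_inv a(1) by blast
      have "x \<otimes>\<^bsub>Q\<^esub> ?k b = \<one>\<^bsub>Q\<^esub>" unfolding pow_ring_simps a(2) by (rule restrict_ext) (simp add: b(2))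
      then show ?thesis using b(1) by blast
    qed
    show "x = \<zero>\<^bsub>Q\<^esub>" if "x \<in> ?J"
    proof -
      have "a \<in> J" using that i0 unfolding a(2) by auto
      then have "a = \<zero>" by (rule F_J[OF a(1)])
      then show ?thesis unfolding a(2) pow_ring_simps by simp
    qed
    fix y assume "y \<in> ?k ` F"
    then obtain b where b: "b \<in> F" "y = ?k b" by blast
    have "x \<oplus>\<^bsub>Q\<^esub> y = ?k (a \<oplus> b)" "x \<otimes>\<^bsub>Q\<^esub> y = ?k (a \<otimes> b)"
      unfolding pow_ring_simps a(2) b(2) by (rule restrict_ext; simp)+
    then show "x \<oplus>\<^bsub>Q\<^esub> y \<in> ?k ` F" "x \<otimes>\<^bsub>Q\<^esub> y \<in> ?k ` F" using F_add F_mult a(1) b(1) by blast+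
  next
    fix x assume x: "x \<in> carrier Q"
    then obtain c where c: "c \<in> F" "\<forall>i\<in>I. x i \<ominus> c \<in> J" unfolding pow_ring_simps by blast
    have k: "?k c \<in> carrier Q" by (rule Q_const[OF c(1)])
    have "x \<ominus>\<^bsub>Q\<^esub> ?k c \<in> carrier Q" using x k by simp
    moreover have "(x \<ominus>\<^bsub>Q\<^esub> ?k c) i \<in> J" if "i \<in> I" for i
      using c(2) that unfolding a_minus_def Q_a_inv[OF k] pow_ring_simps(4) by simp
    ultimately show "\<exists>c\<in>?k ` F. x \<ominus>\<^bsub>Q\<^esub> c \<in> ?J" using c(1) by blast
  qed
qed

text \<open>A nonzero \<open>j\<close> in \<open>J\<close> and zero have the same residue, so the
  functions with these two values encode the subsets of \<open>I\<close>.\<close>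

lemma Pow_lepoll_pow:
  shows "Pow I \<lesssim> carrier Q"
proof -
  obtain j where j: "j \<in> J" "j \<noteq> \<zero>" using J_inf by (metis finite.emptyI finite.insertI finite_subset singletonI subsetI insertCI)
  define f where "f S = (\<lambda>i\<in>I. if i \<in> S then j else \<zero>)" for S
  have "f S \<in> carrier Q" for S
    unfolding f_def
    by (rule Q_memI[OF _ F_zero]) (use j Jc[OF j(1)] J_zero in \<open>auto simp: a_minus_def\<close>)
  moreover have "inj_on f (Pow I)"
  proof (rule inj_onI)
    fix S T assume ST: "S \<in> Pow I" "T \<in> Pow I" "f S = f T"
    have "i \<in> S \<longleftrightarrow> i \<in> T" if "i \<in> I" for i
      using fun_cong[OF ST(3), of i] that j(2) by (auto simp: f_def split: if_splits)
    then show "S = T" using ST(1,2) by blast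
  qed
  ultimately show ?thesis unfolding lepoll_def by blast
qed

end

end

text \<open>The power consists of functions, whereas the saturated model must have its elements in
  \<open>'a set\<close>, so the structure is transported along an encoding.\<close>

lemma sqz_iso:
  assumes M: "sqz M J F" and f: "f \<in> ring_iso M N" and N: "ring N"
  shows "sqz N (f ` J) (f ` F)"
proof -
  interpret M: sqz M J F by (rule M)
  interpret N: ring N by (rule N)
  have hom: "f \<in> ring_hom M N" and bij: "bij_betw f (carrier M) (carrier N)" using f by (auto simp: ring_iso_def)
  interpret f: ring_hom_ring M N f by (rule ring_hom_ringI2[OF M.ring_axioms N hom])
  have inj: "inj_on f (carrier M)" and surj: "carrier N = f ` carrier M" using bij by (auto simp: bij_betw_def)
  have fJ: "f x \<in> f ` J \<longleftrightarrow> x \<in> J" if "x \<in> carrier M" for x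
    using inj that M.Jc by (auto simp: inj_on_def)
  show ?thesis
  proof (intro sqz.intro sqz_axioms.intro)
    show "cring N"
    proof (rule cring.intro[OF N N.monoid_comm_monoidI])
      fix x y assume "x \<in> carrier N" "y \<in> carrier N"
      then obtain a b where "a \<in> carrier M" "b \<in> carrier M" "x = f a" "y = f b" unfolding surj by blast
      then show "x \<otimes>\<^bsub>N\<^esub> y = y \<otimes>\<^bsub>N\<^esub> x" using M.m_comm[of a b] f.hom_mult[of a b] f.hom_mult[of b a] by simp
    qed
    show "additive_subgroup (f ` J) N"
    proof (rule N.add_subI)
      show "f ` J \<subseteq> carrier N" using M.Jc by auto
      show "\<zero>\<^bsub>N\<^esub> \<in> f ` J" by (rule image_eqI[of _ _ "\<zero>\<^bsub>M\<^esub>"]) (simp_all add: M.J_zero)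
      fix x assume "x \<in> f ` J"
      then obtain a where a: "a \<in> J" "x = f a" by blast
      show "\<ominus>\<^bsub>N\<^esub> x \<in> f ` J"
        by (rule image_eqI[of _ _ "\<ominus>\<^bsub>M\<^esub> a"]) (use a M.Jc M.J_neg in simp_all)
      fix y assume "y \<in> f ` J"
      then obtain b where b: "b \<in> J" "y = f b" by blast
      show "x \<oplus>\<^bsub>N\<^esub> y \<in> f ` J"
        by (rule image_eqI[of _ _ "a \<oplus>\<^bsub>M\<^esub> b"]) (use a b M.Jc M.J_add in simp_all)
    qed
    show "x \<otimes>\<^bsub>N\<^esub> y \<in> f ` J" if xy: "x \<in> carrier N" "y \<in> f ` J" for x y
    proof -
      obtain a b where ab: "a \<in> carrier M" "x = f a" "b \<in> J" "y = f b" using xy unfolding surj by blast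
      show ?thesis by (rule image_eqI[of _ _ "a \<otimes>\<^bsub>M\<^esub> b"]) (use ab M.Jc M.J_mult in simp_all)
    qed
    show "x \<otimes>\<^bsub>N\<^esub> y = \<zero>\<^bsub>N\<^esub>" if xy: "x \<in> f ` J" "y \<in> f ` J" for x y
    proof -
      obtain a b where ab: "a \<in> J" "x = f a" "b \<in> J" "y = f b" using xy by blast
      have "f (a \<otimes>\<^bsub>M\<^esub> b) = \<zero>\<^bsub>N\<^esub>" using M.J_sq[OF ab(1,3)] by simp
      then show ?thesis using ab M.Jc by simp
    qed
    show "infinite (f ` J)"
      using M.J_inf finite_imageD[OF _ inj_on_subset[OF inj]] M.Jc by blast
    show "finite (f ` F)" using M.F_fin by simp
    show "f ` F \<subseteq> carrier N" using M.Fc by auto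
    show "\<one>\<^bsub>N\<^esub> \<in> f ` F" by (rule image_eqI[of _ _ "\<one>\<^bsub>M\<^esub>"]) (simp_all add: M.F_one)
    show "\<zero>\<^bsub>N\<^esub> \<in> f ` F" by (rule image_eqI[of _ _ "\<zero>\<^bsub>M\<^esub>"]) (simp_all add: M.F_zero)
    fix x assume "x \<in> f ` F"
    then obtain a where a: "a \<in> F" "x = f a" by blast
    note ac = M.Fc[OF a(1)]
    show "\<ominus>\<^bsub>N\<^esub> x \<in> f ` F"
      by (rule image_eqI[of _ _ "\<ominus>\<^bsub>M\<^esub> a"]) (use a ac M.F_neg in simp_all)
    show "\<exists>y\<in>f ` F. x \<otimes>\<^bsub>N\<^esub> y = \<one>\<^bsub>N\<^esub>" if "x \<noteq> \<zero>\<^bsub>N\<^esub>"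
    proof -
      have "a \<noteq> \<zero>\<^bsub>M\<^esub>" using that a(2) by auto
      then obtain b where b: "b \<in> F" "a \<otimes>\<^bsub>M\<^esub> b = \<one>\<^bsub>M\<^esub>" using M.F_inv a(1) by blast
      have "f (a \<otimes>\<^bsub>M\<^esub> b) = \<one>\<^bsub>N\<^esub>" unfolding b(2) by simp
      then have "x \<otimes>\<^bsub>N\<^esub> f b = \<one>\<^bsub>N\<^esub>" using a(2) ac M.Fc[OF b(1)] by simp
      then show ?thesis using b(1) by blast
    qed
    show "x = \<zero>\<^bsub>N\<^esub>" if "x \<in> f ` J"
    proof -
      have "a \<in> J" using that fJ[OF ac] unfolding a(2) by simp
      then show ?thesis using M.F_J[OF a(1)] a(2) by simp
    qed
    fix y assume "y \<in> f ` F"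
    then obtain b where b: "b \<in> F" "y = f b" by blast
    show "x \<oplus>\<^bsub>N\<^esub> y \<in> f ` F"
      by (rule image_eqI[of _ _ "a \<oplus>\<^bsub>M\<^esub> b"]) (use a b M.Fc M.F_add in simp_all)
    show "x \<otimes>\<^bsub>N\<^esub> y \<in> f ` F"
      by (rule image_eqI[of _ _ "a \<otimes>\<^bsub>M\<^esub> b"]) (use a b M.Fc M.F_mult in simp_all)
  next
    fix x assume "x \<in> carrier N"
    then obtain a where a: "a \<in> carrier M" "x = f a" unfolding surj by blast
    obtain c where c: "c \<in> F" "a \<ominus>\<^bsub>M\<^esub> c \<in> J" using M.decomp[OF a(1)] by blast
    have "f (a \<ominus>\<^bsub>M\<^esub> c) = x \<ominus>\<^bsub>N\<^esub> f c" using a M.Fc[OF c(1)] by (simp add: a_minus_def)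
    then have "x \<ominus>\<^bsub>N\<^esub> f c \<in> f ` J" using c(2) by (metis imageI)
    then show "\<exists>c\<in>f ` F. x \<ominus>\<^bsub>N\<^esub> c \<in> f ` J" using c(1) by blast
  qed
qed

lemma square_zero_imp_almost_strongly_minimal:
  fixes R :: "('a, 'm) ring_scheme"
  assumes inf: "infinite (carrier R)" and loc: "local_ring_with R J"
    and F: "subfield F R" "finite F" and ds: "additive_direct_sum R F J"
    and ann: "J = annihilator R J"
  shows "almost_strongly_minimal R"
proof -
  have R: "cring R" and Jmax: "maximalideal J R" using loc by (simp_all add: local_ring_with_def)
  interpret R: cring R by (rule R)
  interpret J: maximalideal J R by (rule Jmax)
  have FJ: "F <+>\<^bsub>R\<^esub> J = carrier R" "F \<inter> J = {\<zero>\<^bsub>R\<^esub>}" using ds unfolding additive_direct_sum_def by auto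
  have sr: "subring F R" using subfieldE(1)[OF F(1)] .
  have Fc: "c \<in> carrier R" if "c \<in> F" for c using subringE(1)[OF sr] that by blast
  have dec: "\<exists>c\<in>F. x \<ominus>\<^bsub>R\<^esub> c \<in> J" if "x \<in> carrier R" for x
  proof -
    have "x \<in> F <+>\<^bsub>R\<^esub> J" using that FJ(1) by simp
    then obtain f j where fj: "f \<in> F" "j \<in> J" "x = f \<oplus>\<^bsub>R\<^esub> j" by (auto simp: set_add_def')
    have "x \<ominus>\<^bsub>R\<^esub> f = j"
      unfolding fj(3) using Fc[OF fj(1)] J.a_Hcarr[OF fj(2)] by (simp add: R.minus_eq R.a_comm R.r_neg1 R.a_assoc)
    with fj(2) have "x \<ominus>\<^bsub>R\<^esub> f \<in> J" by (simp only:)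
    with fj(1) show ?thesis by (rule bexI[rotated])
  qed
  have Jinf: "infinite J"
  proof
    assume fin: "finite J"
    have "carrier R \<subseteq> (\<lambda>(c, j). c \<oplus>\<^bsub>R\<^esub> j) ` (F \<times> J)"
      unfolding FJ(1)[symmetric] by (auto simp: set_add_def')
    then show False using inf F(2) fin by (meson finite_SigmaI finite_imageI finite_subset)
  qed
  have sq: "sqz R J F"
  proof (intro sqz.intro sqz_axioms.intro R)
    show "additive_subgroup J R" by (rule J.additive_subgroup_axioms)
    show "x \<otimes>\<^bsub>R\<^esub> y \<in> J" if "x \<in> carrier R" "y \<in> J" for x y by (rule J.I_l_closed[OF that(2,1)])
    show "x \<otimes>\<^bsub>R\<^esub> y = \<zero>\<^bsub>R\<^esub>" if "x \<in> J" "y \<in> J" for x y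
      using that ann unfolding annihilator_def by blast
    show "infinite J" by (rule Jinf)
    show "finite F" by (rule F(2))
    show "F \<subseteq> carrier R" "\<one>\<^bsub>R\<^esub> \<in> F" "\<zero>\<^bsub>R\<^esub> \<in> F" using subringE(1-3)[OF sr] by auto
    show "x \<oplus>\<^bsub>R\<^esub> y \<in> F" "x \<otimes>\<^bsub>R\<^esub> y \<in> F" if "x \<in> F" "y \<in> F" for x y
      using subringE(6,7)[OF sr that] by auto
    show "\<ominus>\<^bsub>R\<^esub> x \<in> F" if "x \<in> F" for x by (rule subringE(5)[OF sr that])
    show "\<exists>y\<in>F. x \<otimes>\<^bsub>R\<^esub> y = \<one>\<^bsub>R\<^esub>" if "x \<in> F" "x \<noteq> \<zero>\<^bsub>R\<^esub>" for x
      using R.subfield_m_inv[OF F(1), of x] that by blast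
    show "x = \<zero>\<^bsub>R\<^esub>" if "x \<in> F" "x \<in> J" for x using FJ(2) that by blast
    show "\<exists>c\<in>F. x \<ominus>\<^bsub>R\<^esub> c \<in> J" if "x \<in> carrier R" for x by (rule dec[OF that])
  qed
  interpret S: sqz R J F by (rule sq)
  \<comment> \<open>With as many factors as \<open>R\<close> has elements, the power contains a copy
    of the power set of \<open>R\<close> and so is strictly larger than \<open>R\<close>.\<close>
  define I where "I = carrier R"
  have I: "I \<noteq> {}" using inf by (auto simp: I_def)
  let ?Q = "pow_ring R J F I"
  obtain pr :: "'a \<times> 'a \<Rightarrow> 'a" where pr: "inj_on pr (I \<times> I)"
    using times_self_lepoll[OF inf] unfolding lepoll_def I_def by blast
  \<comment> \<open>A function is coded by its graph, which the pairing \<open>pr\<close> turns into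
    a set of elements of \<open>R\<close>.\<close>
  define enc where "enc f = (\<lambda>x. pr (x, f x)) ` I" for f
  have enc: "inj_on enc (carrier ?Q)"
  proof (rule inj_onI)
    fix f g assume f: "f \<in> carrier ?Q" and g: "g \<in> carrier ?Q" and eq: "enc f = enc g"
    show "f = g"
    proof (rule S.Q_ext[OF f g])
      fix x assume x: "x \<in> I"
      then have "pr (x, f x) \<in> enc f" unfolding enc_def by blast
      then have "pr (x, f x) \<in> enc g" by (simp only: eq)
      then obtain y where y: "y \<in> I" "pr (x, f x) = pr (y, g y)" unfolding enc_def by blast
      then have "(x, f x) = (y, g y)"
        using x S.Q_val[OF f x] S.Q_val[OF g y(1)] by (intro inj_onD[OF pr]) (simp_all add: I_def)
      then show "f x = g x" by auto
    qed
  qed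
  define N where "N = image_ring enc ?Q"
  have iso: "enc \<in> ring_iso ?Q N" unfolding N_def by (rule inj_imp_image_ring_iso[OF enc])
  have sqQ: "sqz ?Q {f \<in> carrier ?Q. \<forall>i\<in>I. f i \<in> J} ((\<lambda>c. \<lambda>i\<in>I. c) ` F)" by (rule S.sqz_pow[OF I])
  interpret Q: sqz ?Q "{f \<in> carrier ?Q. \<forall>i\<in>I. f i \<in> J}" "(\<lambda>c. \<lambda>i\<in>I. c) ` F" by (rule sqQ)
  have N: "ring N" unfolding N_def by (rule Q.inj_imp_image_ring_is_ring[OF enc])
  define J' F' where "J' = enc ` {f \<in> carrier ?Q. \<forall>i\<in>I. f i \<in> J}" and "F' = enc ` (\<lambda>c. \<lambda>i\<in>I. c) ` F"
  have sqN: "sqz N J' F'" unfolding J'_def F'_def by (rule sqz_iso[OF sqQ iso N])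
  define k where "k x = (\<lambda>i\<in>I. x)" for x :: 'a
  define h where "h x = enc (k x)" for x
  have kQ: "k x \<in> carrier ?Q" if "x \<in> carrier R" for x unfolding k_def by (rule S.Q_const'[OF that])
  have kinj: "x = y" if "k x = k y" for x y
  proof -
    obtain i where "i \<in> I" using I by blast
    then show ?thesis using fun_cong[OF that, of i] by (simp add: k_def)
  qed
  have hom: "enc \<in> ring_hom ?Q N" and bij: "bij_betw enc (carrier ?Q) (carrier N)"
    using iso by (auto simp: ring_iso_def)
  interpret f: ring_hom_ring ?Q N enc by (rule ring_hom_ringI2[OF Q.ring_axioms N hom])
  \<comment> \<open>The embedding by constant functions restricts to a partial isomorphism on every
    finite subring. As each finite list lies in such a subring, it is elementary by
    \<open>piso_sat\<close>.\<close>
  have piso: "piso R J F N J' F' G h" if G: "fin_sub R F G" for G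
    unfolding piso_def
  proof (intro conjI ballI G)
    note GD = fin_subD[OF G]
    have Gc: "x \<in> carrier R" if "x \<in> G" for x using GD(3) that by blast
    show "h ` G \<subseteq> carrier N" using kQ Gc by (auto simp: h_def)
    show "inj_on h G"
      by (rule inj_onI) (use kinj inj_onD[OF enc] kQ Gc in \<open>simp add: h_def\<close>)
    show "h ` F = F'" by (simp add: F'_def h_def k_def image_image)
    show "h \<zero>\<^bsub>R\<^esub> = \<zero>\<^bsub>N\<^esub>" "h \<one>\<^bsub>R\<^esub> = \<one>\<^bsub>N\<^esub>"
      using f.hom_zero f.hom_one by (simp_all add: h_def k_def pow_ring_simps(3,5))
    fix x assume x: "x \<in> G"
    have "k (\<ominus>\<^bsub>R\<^esub> x) = \<ominus>\<^bsub>?Q\<^esub> k x"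
      unfolding S.Q_a_inv[OF kQ[OF Gc[OF x]]] unfolding k_def by (rule restrict_ext) simp
    then show "h (\<ominus>\<^bsub>R\<^esub> x) = \<ominus>\<^bsub>N\<^esub> h x" using f.hom_a_inv[OF kQ[OF Gc[OF x]]] by (simp add: h_def)
    show "x \<in> J \<longleftrightarrow> h x \<in> J'"
    proof -
      have "h x \<in> J' \<longleftrightarrow> k x \<in> {f \<in> carrier ?Q. \<forall>i\<in>I. f i \<in> J}"
        unfolding J'_def h_def by (rule inj_on_image_mem_iff[OF enc kQ[OF Gc[OF x]]]) auto
      then show ?thesis using kQ[OF Gc[OF x]] I by (auto simp: k_def)
    qed
    fix y assume y: "y \<in> G"
    have "k (x \<oplus>\<^bsub>R\<^esub> y) = k x \<oplus>\<^bsub>?Q\<^esub> k y" "k (x \<otimes>\<^bsub>R\<^esub> y) = k x \<otimes>\<^bsub>?Q\<^esub> k y"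
      unfolding pow_ring_simps k_def by (rule restrict_ext; simp)+
    then show "h (x \<oplus>\<^bsub>R\<^esub> y) = h x \<oplus>\<^bsub>N\<^esub> h y" "h (x \<otimes>\<^bsub>R\<^esub> y) = h x \<otimes>\<^bsub>N\<^esub> h y"
      using f.hom_add[OF kQ[OF Gc[OF x]] kQ[OF Gc[OF y]]] f.hom_mult[OF kQ[OF Gc[OF x]] kQ[OF Gc[OF y]]]
      by (simp_all add: h_def)
  qed
  have "elementary_embedding h R N"
    unfolding elementary_embedding_def
  proof (intro conjI allI impI N)
    show "h ` carrier R \<subseteq> carrier N" using kQ by (auto simp: h_def)
    fix \<phi> xs assume *: "set xs \<subseteq> carrier R \<and> vars_below \<phi> (length xs)"
    obtain G where "fin_sub R F G" "set xs \<subseteq> G" using fin_sub_exists[OF sq] * by blast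
    then show "sat R \<phi> xs = sat N \<phi> (map h xs)" using piso_sat[OF sq sqN piso] * by blast
  qed
  moreover have less: "carrier R \<prec> carrier N"
  proof -
    have "carrier R \<prec> Pow (carrier R)" by (rule lesspoll_Pow_self)
    also have "Pow (carrier R) \<lesssim> carrier ?Q" using S.Pow_lepoll_pow[of I] by (simp add: I_def)
    also have "carrier ?Q \<lesssim> carrier N" using bij by (auto simp: lepoll_def bij_betw_def)
    finally show ?thesis .
  qed
  moreover have "saturated N"
  proof (rule sqz_saturated[OF sqN])
    show "uncountable (carrier N)"
    proof
      assume "countable (carrier N)"
      then have "carrier N \<lesssim> (UNIV :: nat set)" by (auto simp: countable_def lepoll_def)
      also have "(UNIV :: nat set) \<lesssim> carrier R" using inf by (simp add: infinite_le_lepoll)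
      finally show False using less lepoll_antisym unfolding lesspoll_def by blast
    qed
  qed
  ultimately show ?thesis
    unfolding almost_strongly_minimal_def using sqz_almost_strongly_minimal_set[OF sqN] by blast
qed

theorem proposition6p17:
  fixes R :: "('a, 'm) ring_scheme" and \<mm> F :: "'a set" and p k :: nat
  assumes "uncountably_categorical R"
    and "local_ring_with R \<mm>"
    and "connected_subgroup R \<mm>"
    and "prime p" and "k > 0"
    and "subfield F R" and "card F = p ^ k"
    and "additive_direct_sum R F \<mm>"
  shows "almost_strongly_minimal R \<longleftrightarrow> \<mm> = annihilator R \<mm>"
proof -
  have inf: "infinite (carrier R)" using assms(1) by (simp add: uncountably_categorical_def)
  have "card F > 0" using assms(4,7) by (simp add: prime_gt_0_nat)
  then have fin: "finite F" by (rule card_ge_0_finite)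
  show ?thesis
    using almost_strongly_minimal_imp[OF inf assms(2,3,6) fin assms(8)]
      square_zero_imp_almost_strongly_minimal[OF inf assms(2,6) fin assms(8)] by blast
qed

end
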